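(* Let $[\sigma]$ and $[\sigma^{-}]$ be the filtered Rouquier complexes of the positive and negative elementary two-strand braids, and let $I$ be the two-strand identity bimodule. Then the complexes of both two-crossing braid words $\sigma\sigma^{-}$ and $\sigma^{-}\sigma$ are homotopy equivalent to $I$ in the category $\mathrm{Ch}(\mathbf D_2)$ of bounded complexes over the filtered derived category: $$[\sigma]\circ[\sigma^{-}]\sim I,\qquad [\sigma^{-}]\circ[\sigma]\sim I .$$
   Context: Categories. For $n\ge1$ let $\mathbf x=(x_1,\dots,x_n)$, $\mathbf y=(y_1,\dots,y_n)$; $\mathbb Q[\mathbf x,\mathbf y]$ is graded by $q$-degree with $\deg x_i=\deg y_i=2$. $\mathbf D_n$ is the derived category of $q$-graded $\mathbb Q[\mathbf x,\mathbf y]$-modules with a decreasing filtration $F^\bullet$: objects are represented by filtered $q$-graded complexes, filtered quasi-isomorphisms (those inducing quasi-isomorphisms on all associated graded pieces) are inverted, and morphisms preserve $q$-degree and filtration. Its homological degree is called $a$-degree; differentials lower it by $1$. Shift functors: $\mathbf q$ ($q$-degree), $\mathbf a$ ($a$-degree), $\mathbf s$ (filtration, $F^i(\mathbf sA)=F^{i-1}A$). $\mathrm{Ch}(\mathbf D_n)$ is the category of bounded chain complexes over the additive category $\mathbf D_n$ ("outer" complexes, written in square brackets); the outer degree is the $t$-degree with shift $\mathbf t$, outer differentials lower $t$-degree by $1$, and $a$-degree records total homological degree, so passing to one higher outer position is the shift $\mathbf t_a=\mathbf t\mathbf a$. Half-integer $t$- and $s$-shifts are allowed. Put $\mathbf a_q=\mathbf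 a\mathbf q^2$, $\mathbf s_q=\mathbf s\mathbf q^2$, $\mathbf t_s=(\mathbf t\mathbf s)^{1/2}$. Homotopy equivalence in $\mathrm{Ch}(\mathbf D_n)$ means the usual chain homotopy equivalence, with all maps and homotopies made of morphisms of $\mathbf D_n$ (hence filtered). Composition: for bimodules (or complexes of them), $M\circ N=M(\mathbf z,\mathbf y)\otimes_{\mathbb Q[\mathbf y]}N(\mathbf y,\mathbf x)$ with the tensor product filtration (total outer complex in the case of complexes); the result is regarded as a $\mathbb Q[\mathbf x,\mathbf z]$-module. All bimodules used are free over each side compatibly with filtration. Two-strand bimodules ($n=2$). Put $x_\pm=x_2\pm x_1$, $y_\pm=y_2\pm y_1$. Let $I=\mathbb Q[\mathbf x,\mathbf y]/(y_1-x_1,y_2-x_2)$ and $V=\mathbb Q[\mathbf x,\mathbf y]/(y_2-x_1,y_1-x_2)$ with trivial filtration ($F^0$ everything, $F^1=0$). Let $M=\mathbb Q[\mathbf x,\mathbf y]/(y_+-x_+,(y_-+x_-)(y_--x_-))$. The black blob bimodule $B$ is $M$ with $F^0=M$, $F^1=(y_--x_-)M\cong\mathbf q^2V$, $F^2=0$ (so $F^0/F^1\cong I$); the gray blob bimodule $G$ is $M$ with $F^0=M$, $F^1=(y_-+x_-)M\cong\mathbf q^2I$, $F^2=0$ (so $F^0/F^1\cong V$). Let $\chi_+:\mathbf s_qI\to G$ be the inclusion of $F^1$ (multiplication by $y_-+x_-$) and $\chi_-:B\to I$ the projection onto $F^0/F^1$. Filtered Rouquier complexes: $$[\sigma]=\mathbf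 t_s\mathbf a_q\bigl[\,I\xrightarrow{\chi_+}\mathbf t_a^{-1}\mathbf s_q^{-1}G\,\bigr],\qquad [\sigma^{-}]=(\mathbf t_s\mathbf a_q)^{-1}\bigl[\,\mathbf t_aB\xrightarrow{\chi_-}I\,\bigr].$$ *)

theory Defs
  imports
    "HOL-Library.Poly_Mapping"
    "HOL-Library.Numeral_Type"
    "HOL-Algebra.Module"
    "HOL-Algebra.QuotRing"
    "HOL-Algebra.Generated_Groups"
    "HOL-Algebra.Free_Abelian_Groups"
    "HOL-Algebra.Algebraic_Closure_Type"
begin

section \<open>The polynomial ring \<open>\<rat>[x, y]\<close>\<close>

text \<open>
  The strands are indexed by a finite type \<open>'n\<close>, so that \<open>n = CARD('n)\<close>; two strands are the
  numeral type \<open>2\<close>.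
\<close>

datatype 'n bvar = Xv 'n | Yv 'n

type_synonym 'v mpoly = "('v \<Rightarrow>\<^sub>0 nat) \<Rightarrow>\<^sub>0 rat"
type_synonym 'n bpoly = "'n bvar mpoly"

abbreviation PR :: "'v mpoly ring" where
  "PR \<equiv> ring_of_type_algebra"

definition mvar :: "'v \<Rightarrow> 'v mpoly" where
  "mvar v = Poly_Mapping.single (Poly_Mapping.single v 1) 1"

definition homog :: "int \<Rightarrow> 'v mpoly \<Rightarrow> bool" where
  "homog d p \<longleftrightarrow> (\<forall>\<mu>\<in>Poly_Mapping.keys p.
     2 * (\<Sum>v\<in>Poly_Mapping.keys \<mu>. int (Poly_Mapping.lookup \<mu> v)) = d)"

definition mpoly_subst :: "('v \<Rightarrow> 'w mpoly) \<Rightarrow> 'v mpoly \<Rightarrow> 'w mpoly" where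
  "mpoly_subst f p = (\<Sum>\<mu>\<in>Poly_Mapping.keys p.
     Poly_Mapping.single 0 (Poly_Mapping.lookup p \<mu>) *
     (\<Prod>v\<in>Poly_Mapping.keys \<mu>. f v ^ Poly_Mapping.lookup \<mu> v))"


section \<open>Filtered \<open>q\<close>-graded modules\<close>

text \<open>
  \<^bold>\<open>Half-integers.\<close> Half-integer shifts of the filtration and of the \<open>t\<close>-degree occur, so both
  are indexed by integers in half units: \<open>fil M k\<close> is \<open>F\<^sup>k\<^sup>/\<^sup>2 M\<close>, and an outer position
  \<open>j\<close> has \<open>t\<close>-degree \<open>j / 2\<close>. A filtration indexed by integers is extended by
  \<open>F\<^sup>r = F\<^sup>i\<close> for \<open>i = \<lceil>r\<rceil>\<close>. The \<open>q\<close>- and \<open>a\<close>-degrees are plain integers.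

  The ring multiplication that the library's module record inherits from the ring record
  plays no role.
\<close>

record ('r, 'a) gfmod = "('r, 'a) module" +
  qpart :: "int \<Rightarrow> 'a set"
  fil :: "int \<Rightarrow> 'a set"

definition hcomponents :: "('r, 'a) gfmod \<Rightarrow> 'a \<Rightarrow> (int \<Rightarrow> 'a) \<Rightarrow> bool" where
  "hcomponents M m c \<longleftrightarrow>
     (\<forall>q. c q \<in> qpart M q) \<and> finite {q. c q \<noteq> \<zero>\<^bsub>M\<^esub>} \<and>
     m = finsum M c {q. c q \<noteq> \<zero>\<^bsub>M\<^esub>}"

definition gfmodule :: "('n bpoly, 'a) gfmod \<Rightarrow> bool" where
  "gfmodule M \<longleftrightarrow>
     module PR M \<and>
     (\<forall>q. additive_subgroup (qpart M q) M) \<and>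
     (\<forall>m\<in>carrier M. \<exists>!c. hcomponents M m c) \<and>
     (\<forall>d q p. homog d p \<longrightarrow> (\<forall>m\<in>qpart M q. p \<odot>\<^bsub>M\<^esub> m \<in> qpart M (q + d))) \<and>
     (\<forall>k. submodule (fil M k) PR M) \<and>
     (\<forall>k m c. m \<in> fil M k \<and> hcomponents M m c \<longrightarrow> (\<forall>q. c q \<in> fil M k)) \<and>
     (\<forall>k. fil M (k + 1) \<subseteq> fil M k)"

definition gfhom :: "('n bpoly, 'a) gfmod \<Rightarrow> ('n bpoly, 'b) gfmod \<Rightarrow> ('a \<Rightarrow> 'b) \<Rightarrow> bool" where
  "gfhom M N f \<longleftrightarrow>
     f \<in> carrier M \<rightarrow> carrier N \<and>
     (\<forall>x\<in>carrier M. \<forall>y\<in>carrier M. f (x \<oplus>\<^bsub>M\<^esub> y) = f x \<oplus>\<^bsub>N\<^esub> f y) \<and>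
     (\<forall>p. \<forall>x\<in>carrier M. f (p \<odot>\<^bsub>M\<^esub> x) = p \<odot>\<^bsub>N\<^esub> f x) \<and>
     (\<forall>q. f ` qpart M q \<subseteq> qpart N q) \<and>
     (\<forall>k. f ` fil M k \<subseteq> fil N k)"

definition gf_triv :: "'a \<Rightarrow> ('n bpoly, 'a) gfmod" where
  "gf_triv z = \<lparr>carrier = {z}, monoid.mult = \<lambda>_ _. z, one = z, zero = z, add = \<lambda>_ _. z,
     module.smult = \<lambda>_ _. z, qpart = \<lambda>_. {z}, fil = \<lambda>_. {z}\<rparr>"

definition q_mod :: "int \<Rightarrow> ('r, 'a) gfmod \<Rightarrow> ('r, 'a) gfmod" where
  "q_mod r M = M\<lparr>qpart := \<lambda>q. qpart M (q - r)\<rparr>"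

text \<open>\<open>s_mod k\<close> is the shift by \<open>k / 2\<close>.\<close>

definition s_mod :: "int \<Rightarrow> ('r, 'a) gfmod \<Rightarrow> ('r, 'a) gfmod" where
  "s_mod k M = M\<lparr>fil := \<lambda>i. fil M (i - k)\<rparr>"


section \<open>The filtered derived category\<close>

record ('n, 'a) fcx =
  cpart :: "int \<Rightarrow> ('n bpoly, 'a) gfmod"
  cdif :: "int \<Rightarrow> 'a \<Rightarrow> 'a"

definition fcomplex :: "('n, 'a) fcx \<Rightarrow> bool" where
  "fcomplex C \<longleftrightarrow>
     (\<forall>k. gfmodule (cpart C k) \<and> gfhom (cpart C k) (cpart C (k - 1)) (cdif C k) \<and>
       (\<forall>x\<in>carrier (cpart C k). cdif C (k - 1) (cdif C k x) = \<zero>\<^bsub>cpart C (k - 2)\<^esub>))"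

definition chmap :: "('n, 'a) fcx \<Rightarrow> ('n, 'b) fcx \<Rightarrow> (int \<Rightarrow> 'a \<Rightarrow> 'b) \<Rightarrow> bool" where
  "chmap C D f \<longleftrightarrow>
     (\<forall>k. gfhom (cpart C k) (cpart D k) (f k) \<and>
       (\<forall>x\<in>carrier (cpart C k). cdif D k (f k x) = f (k - 1) (cdif C k x)))"

definition fhomotopic ::
  "('n, 'a) fcx \<Rightarrow> ('n, 'b) fcx \<Rightarrow> (int \<Rightarrow> 'a \<Rightarrow> 'b) \<Rightarrow> (int \<Rightarrow> 'a \<Rightarrow> 'b) \<Rightarrow> bool" where
  "fhomotopic C D f g \<longleftrightarrow>
     (\<exists>h. \<forall>k. gfhom (cpart C k) (cpart D (k + 1)) (h k) \<and>
       (\<forall>x\<in>carrier (cpart C k).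
          f k x = g k x \<oplus>\<^bsub>cpart D k\<^esub>
            (cdif D (k + 1) (h k x) \<oplus>\<^bsub>cpart D k\<^esub> h (k - 1) (cdif C k x))))"

text \<open>
  Cycles and boundaries of the associated graded complex \<open>F\<^sup>i C / F\<^sup>i\<^sup>+\<^sup>1 C\<close> (one step being a half
  unit), lifted to \<open>F\<^sup>i C\<close>: both contain \<open>F\<^sup>i\<^sup>+\<^sup>1 C\<close>, so the homology of the graded piece is the
  quotient of the lifted cycles by the lifted boundaries.
\<close>

definition gr_cycles :: "('n, 'a) fcx \<Rightarrow> int \<Rightarrow> int \<Rightarrow> 'a set" where
  "gr_cycles C i k = {x \<in> fil (cpart C k) i. cdif C k x \<in> fil (cpart C (k - 1)) (i + 1)}"

definition gr_boundaries :: "('n, 'a) fcx \<Rightarrow> int \<Rightarrow> int \<Rightarrow> 'a set" where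
  "gr_boundaries C i k =
     {cdif C (k + 1) y \<oplus>\<^bsub>cpart C k\<^esub> w | y w.
        y \<in> fil (cpart C (k + 1)) i \<and> w \<in> fil (cpart C k) (i + 1)}"

definition gr_homology :: "('n, 'a) fcx \<Rightarrow> int \<Rightarrow> int \<Rightarrow> 'a set set" where
  "gr_homology C i k = (\<lambda>z. gr_boundaries C i k +>\<^bsub>cpart C k\<^esub> z) ` gr_cycles C i k"

definition fqis :: "('n, 'a) fcx \<Rightarrow> ('n, 'b) fcx \<Rightarrow> (int \<Rightarrow> 'a \<Rightarrow> 'b) \<Rightarrow> bool" where
  "fqis C D f \<longleftrightarrow> chmap C D f \<and>
     (\<forall>i k. bij_betw (\<lambda>Z. gr_boundaries D i k <+>\<^bsub>cpart D k\<^esub> f k ` Z)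
        (gr_homology C i k) (gr_homology D i k))"

text \<open>
  The localization at the filtered quasi-isomorphisms is formed by the calculus of right
  fractions in the homotopy category of filtered complexes: a morphism from \<open>A\<close> to \<open>B\<close> is a
  class of roofs \<open>A \<leftarrow> C \<rightarrow> B\<close> whose left leg is a filtered quasi-isomorphism.

  Since HOL does not quantify over types inside a formula, the category is formed relative to a
  universe type \<open>'u\<close>: the apexes of roofs have their elements in \<open>'u\<close>, and an object may have any
  element type as long as its modules have at most as many elements as \<open>'u\<close>
  (equivalently, it is isomorphic to a complex with elements in \<open>'u\<close>). For infinite \<open>'u\<close> this is
  the derived category of the modules of cardinality at most that of \<open>'u\<close>.
\<close>

definition dobj :: "'u itself \<Rightarrow> ('n, 'a) fcx \<Rightarrow> bool" where
  "dobj _ A \<longleftrightarrow> fcomplex A \<and> (\<forall>k. \<exists>g :: 'a \<Rightarrow> 'u. inj_on g (carrier (cpart A k)))"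

type_synonym ('n, 'u, 'a, 'b) roof =
  "('n, 'u) fcx \<times> (int \<Rightarrow> 'u \<Rightarrow> 'a) \<times> (int \<Rightarrow> 'u \<Rightarrow> 'b)"

type_synonym ('n, 'u, 'a, 'b) dmor = "('n, 'u, 'a, 'b) roof set"

definition is_roof :: "('n, 'a) fcx \<Rightarrow> ('n, 'b) fcx \<Rightarrow> ('n, 'u, 'a, 'b) roof \<Rightarrow> bool" where
  "is_roof A B = (\<lambda>(C, s, f). fcomplex C \<and> fqis C A s \<and> chmap C B f)"

definition roof_equiv ::
  "('n, 'a) fcx \<Rightarrow> ('n, 'b) fcx \<Rightarrow> ('n, 'u, 'a, 'b) roof \<Rightarrow> ('n, 'u, 'a, 'b) roof \<Rightarrow> bool" where
  "roof_equiv A B = (\<lambda>(C, s, f) (C', s', f').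
     \<exists>(E :: ('n, 'u) fcx) u v. fcomplex E \<and> chmap E C u \<and> chmap E C' v \<and>
       fqis E A (\<lambda>k. s k \<circ> u k) \<and>
       fhomotopic E A (\<lambda>k. s k \<circ> u k) (\<lambda>k. s' k \<circ> v k) \<and>
       fhomotopic E B (\<lambda>k. f k \<circ> u k) (\<lambda>k. f' k \<circ> v k))"

definition roof_class ::
  "('n, 'a) fcx \<Rightarrow> ('n, 'b) fcx \<Rightarrow> ('n, 'u, 'a, 'b) roof \<Rightarrow> ('n, 'u, 'a, 'b) dmor" where
  "roof_class A B r = {r'. is_roof A B r' \<and> roof_equiv A B r r'}"

definition dhom :: "('n, 'a) fcx \<Rightarrow> ('n, 'b) fcx \<Rightarrow> ('n, 'u, 'a, 'b) dmor set" where
  "dhom A B = {roof_class A B r | r. is_roof A B r}"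

text \<open>
  Each of the following unions is over all choices of representatives and of common denominators,
  all of which give the same class. \<open>dmap A B g\<close> is the image of a chain map \<open>g\<close> under the
  localization functor.
\<close>

definition dmap ::
  "('n, 'a) fcx \<Rightarrow> ('n, 'b) fcx \<Rightarrow> (int \<Rightarrow> 'a \<Rightarrow> 'b) \<Rightarrow> ('n, 'u, 'a, 'b) dmor" where
  "dmap A B g = \<Union> {roof_class A B (C, s, \<lambda>k. g k \<circ> s k) | C s. fcomplex C \<and> fqis C A s}"

definition did :: "('n, 'a) fcx \<Rightarrow> ('n, 'u, 'a, 'a) dmor" where
  "did A = dmap A A (\<lambda>k x. x)"

definition dzero :: "('n, 'a) fcx \<Rightarrow> ('n, 'b) fcx \<Rightarrow> ('n, 'u, 'a, 'b) dmor" where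
  "dzero A B = dmap A B (\<lambda>k x. \<zero>\<^bsub>cpart B k\<^esub>)"

definition dadd ::
  "('n, 'a) fcx \<Rightarrow> ('n, 'b) fcx \<Rightarrow> ('n, 'u, 'a, 'b) dmor \<Rightarrow> ('n, 'u, 'a, 'b) dmor
    \<Rightarrow> ('n, 'u, 'a, 'b) dmor" where
  "dadd A B \<phi> \<psi> = \<Union> {roof_class A B (C, s, \<lambda>k x. f k x \<oplus>\<^bsub>cpart B k\<^esub> g k x) | C s f g.
     (C, s, f) \<in> \<phi> \<and> (C, s, g) \<in> \<psi>}"

definition dcomp ::
  "('n, 'a) fcx \<Rightarrow> ('n, 'b) fcx \<Rightarrow> ('n, 'c) fcx \<Rightarrow> ('n, 'u, 'b, 'c) dmor \<Rightarrow> ('n, 'u, 'a, 'b) dmor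
    \<Rightarrow> ('n, 'u, 'a, 'c) dmor" where
  "dcomp A B D \<psi> \<phi> = \<Union> {roof_class A D (E, \<lambda>k. s k \<circ> u k, \<lambda>k. g k \<circ> v k) | E u v C s f C' s' g.
     (C, s, f) \<in> \<phi> \<and> (C', s', g) \<in> \<psi> \<and>
     fcomplex E \<and> fqis E C u \<and> chmap E C' v \<and>
     fhomotopic E B (\<lambda>k. f k \<circ> u k) (\<lambda>k. s' k \<circ> v k)}"


section \<open>Bounded complexes over the filtered derived category\<close>

record ('n, 'u, 'a) dch =
  dterm :: "int \<Rightarrow> ('n, 'a) fcx"
  ddif :: "int \<Rightarrow> ('n, 'u, 'a, 'a) dmor"

text \<open>Positions are in half units, so the outer differential lowers the position by \<open>2\<close>.\<close>

definition is_Ch :: "('n, 'u, 'a) dch \<Rightarrow> bool" where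
  "is_Ch Z \<longleftrightarrow>
     (\<forall>t. dobj TYPE('u) (dterm Z t) \<and> ddif Z t \<in> dhom (dterm Z t) (dterm Z (t - 2)) \<and>
       dcomp (dterm Z t) (dterm Z (t - 2)) (dterm Z (t - 4)) (ddif Z (t - 2)) (ddif Z t)
         = dzero (dterm Z t) (dterm Z (t - 4))) \<and>
     finite {t. \<exists>k. carrier (cpart (dterm Z t) k) \<noteq> {\<zero>\<^bsub>cpart (dterm Z t) k\<^esub>}}"

definition Ch_map ::
  "('n, 'u, 'a) dch \<Rightarrow> ('n, 'u, 'b) dch \<Rightarrow> (int \<Rightarrow> ('n, 'u, 'a, 'b) dmor) \<Rightarrow> bool" where
  "Ch_map Z Y f \<longleftrightarrow>
     (\<forall>t. f t \<in> dhom (dterm Z t) (dterm Y t) \<and>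
       dcomp (dterm Z t) (dterm Y t) (dterm Y (t - 2)) (ddif Y t) (f t)
         = dcomp (dterm Z t) (dterm Z (t - 2)) (dterm Y (t - 2)) (f (t - 2)) (ddif Z t))"

definition Ch_homotopic ::
  "('n, 'u, 'a) dch \<Rightarrow> ('n, 'u, 'b) dch \<Rightarrow> (int \<Rightarrow> ('n, 'u, 'a, 'b) dmor)
    \<Rightarrow> (int \<Rightarrow> ('n, 'u, 'a, 'b) dmor) \<Rightarrow> bool" where
  "Ch_homotopic Z Y f g \<longleftrightarrow>
     (\<exists>h. \<forall>t. h t \<in> dhom (dterm Z t) (dterm Y (t + 2)) \<and>
       f t = dadd (dterm Z t) (dterm Y t) (g t)
         (dadd (dterm Z t) (dterm Y t)
           (dcomp (dterm Z t) (dterm Y (t + 2)) (dterm Y t) (ddif Y (t + 2)) (h t))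
           (dcomp (dterm Z t) (dterm Z (t - 2)) (dterm Y t) (h (t - 2)) (ddif Z t))))"

definition Ch_equiv :: "('n, 'u, 'a) dch \<Rightarrow> ('n, 'u, 'b) dch \<Rightarrow> bool" where
  "Ch_equiv Z Y \<longleftrightarrow> is_Ch Z \<and> is_Ch Y \<and>
     (\<exists>f g. Ch_map Z Y f \<and> Ch_map Y Z g \<and>
       Ch_homotopic Z Z (\<lambda>t. dcomp (dterm Z t) (dterm Y t) (dterm Z t) (g t) (f t))
         (\<lambda>t. did (dterm Z t)) \<and>
       Ch_homotopic Y Y (\<lambda>t. dcomp (dterm Y t) (dterm Z t) (dterm Y t) (f t) (g t))
         (\<lambda>t. did (dterm Y t)))"


section \<open>Complexes of bimodules\<close>

text \<open>
  \<open>bterm M t a\<close> is the summand of position \<open>t\<close> (half units) and \<open>a\<close>-degree \<open>a\<close>. The \<open>a\<close>-degree is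
  the total homological degree, so the differential lowers it along with the \<open>t\<close>-degree.
\<close>

record ('n, 'a) bcx =
  bterm :: "int \<Rightarrow> int \<Rightarrow> ('n bpoly, 'a) gfmod"
  bdif :: "int \<Rightarrow> int \<Rightarrow> 'a \<Rightarrow> 'a"

definition t_shift :: "int \<Rightarrow> ('n, 'a) bcx \<Rightarrow> ('n, 'a) bcx" where
  "t_shift k M = \<lparr>bterm = \<lambda>t a. bterm M (t - k) a, bdif = \<lambda>t a. bdif M (t - k) a\<rparr>"

definition a_shift :: "int \<Rightarrow> ('n, 'a) bcx \<Rightarrow> ('n, 'a) bcx" where
  "a_shift k M = \<lparr>bterm = \<lambda>t a. bterm M t (a - k), bdif = \<lambda>t a. bdif M t (a - k)\<rparr>"

definition q_shift :: "int \<Rightarrow> ('n, 'a) bcx \<Rightarrow> ('n, 'a) bcx" where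
  "q_shift k M = M\<lparr>bterm := \<lambda>t a. q_mod k (bterm M t a)\<rparr>"

definition s_shift :: "int \<Rightarrow> ('n, 'a) bcx \<Rightarrow> ('n, 'a) bcx" where
  "s_shift k M = M\<lparr>bterm := \<lambda>t a. s_mod k (bterm M t a)\<rparr>"

text \<open>
  \<open>bracket p M N f\<close> is \<open>[t\<^sub>a\<^sup>p M \<rightarrow> t\<^sub>a\<^sup>p\<^sup>-\<^sup>1 N]\<close>; the shift \<open>t\<^sub>a\<close> moves the position by two half units and
  the \<open>a\<close>-degree by one.
\<close>

definition bracket ::
  "int \<Rightarrow> ('n bpoly, 'a) gfmod \<Rightarrow> ('n bpoly, 'a) gfmod \<Rightarrow> ('a \<Rightarrow> 'a) \<Rightarrow> ('n, 'a) bcx" where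
  "bracket p M N f = (let T = (\<lambda>t a.
       if t = 2 * p \<and> a = p then M
       else if t = 2 * (p - 1) \<and> a = p - 1 then N
       else gf_triv \<zero>\<^bsub>M\<^esub>)
     in \<lparr>bterm = T,
         bdif = \<lambda>t a. if t = 2 * p \<and> a = p then f else (\<lambda>_. \<zero>\<^bsub>T (t - 2) (a - 1)\<^esub>)\<rparr>)"

definition single_bcx :: "('n bpoly, 'a) gfmod \<Rightarrow> ('n, 'a) bcx" where
  "single_bcx M = (let T = (\<lambda>t a. if t = 0 \<and> a = 0 then M else gf_triv \<zero>\<^bsub>M\<^esub>)
     in \<lparr>bterm = T, bdif = \<lambda>t a _. \<zero>\<^bsub>T (t - 2) (a - 1)\<^esub>\<rparr>)"

text \<open>
  Passage to complexes over the derived category. An outer position one unit higher accounts for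
  one unit of \<open>a\<close>-degree, so the inner homological degree at \<open>t\<close>-degree \<open>t\<close> is \<open>a - t\<close>, which makes
  the outer differentials morphisms of the derived category. At half-integral \<open>t\<close> it is normalized
  to the integer \<open>a - \<lfloor>t\<rfloor>\<close>.
\<close>

definition bcx_complex :: "('n, 'a) bcx \<Rightarrow> int \<Rightarrow> ('n, 'a) fcx" where
  "bcx_complex M t = \<lparr>cpart = \<lambda>k. bterm M t (k + t div 2),
     cdif = \<lambda>k _. \<zero>\<^bsub>bterm M t (k - 1 + t div 2)\<^esub>\<rparr>"

definition to_Ch :: "'u itself \<Rightarrow> ('n, 'a) bcx \<Rightarrow> ('n, 'u, 'a) dch" where
  "to_Ch _ M = \<lparr>dterm = bcx_complex M,
     ddif = \<lambda>t. dmap (bcx_complex M t) (bcx_complex M (t - 2)) (\<lambda>k. bdif M t (k + t div 2))\<rparr>"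


section \<open>Composition of bimodules\<close>

text \<open>
  \<open>M \<circ> N = M(z, y) \<otimes> N(y, x)\<close> over \<open>\<rat>[y]\<close>: the \<open>x\<close>-variables of \<open>M\<close> are identified with the
  \<open>y\<close>-variables of \<open>N\<close>. In the result the \<open>y\<close>-variables (the \<open>z\<close> of the formula) act on \<open>M\<close> and the
  \<open>x\<close>-variables act on \<open>N\<close>.
\<close>

definition tens_free ::
  "('r, 'a) gfmod \<Rightarrow> ('r, 'b) gfmod \<Rightarrow> (('a \<times> 'b) \<Rightarrow>\<^sub>0 int) monoid" where
  "tens_free M N = free_Abelian_group (carrier M \<times> carrier N)"

definition tens_rel ::
  "('n bpoly, 'a) gfmod \<Rightarrow> ('n bpoly, 'b) gfmod \<Rightarrow> (('a \<times> 'b) \<Rightarrow>\<^sub>0 int) set" where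
  "tens_rel M N = generate (tens_free M N)
    ({frag_of (m \<oplus>\<^bsub>M\<^esub> m', n) - frag_of (m, n) - frag_of (m', n) | m m' n.
        m \<in> carrier M \<and> m' \<in> carrier M \<and> n \<in> carrier N} \<union>
     {frag_of (m, n \<oplus>\<^bsub>N\<^esub> n') - frag_of (m, n) - frag_of (m, n') | m n n'.
        m \<in> carrier M \<and> n \<in> carrier N \<and> n' \<in> carrier N} \<union>
     {frag_of (mpoly_subst (\<lambda>i. mvar (Xv i)) p \<odot>\<^bsub>M\<^esub> m, n)
        - frag_of (m, mpoly_subst (\<lambda>i. mvar (Yv i)) p \<odot>\<^bsub>N\<^esub> n) | (p :: 'n mpoly) m n.
        m \<in> carrier M \<and> n \<in> carrier N})"

definition tens_class ::
  "('n bpoly, 'a) gfmod \<Rightarrow> ('n bpoly, 'b) gfmod \<Rightarrow> (('a \<times> 'b) \<Rightarrow>\<^sub>0 int)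
    \<Rightarrow> (('a \<times> 'b) \<Rightarrow>\<^sub>0 int) set" where
  "tens_class M N c = tens_rel M N #>\<^bsub>tens_free M N\<^esub> c"

definition x_monom :: "('n::finite bvar \<Rightarrow>\<^sub>0 nat) \<Rightarrow> 'n bpoly" where
  "x_monom \<mu> = (\<Prod>i\<in>UNIV. mvar (Xv i) ^ Poly_Mapping.lookup \<mu> (Xv i))"

definition y_monom :: "('n::finite bvar \<Rightarrow>\<^sub>0 nat) \<Rightarrow> 'n bpoly" where
  "y_monom \<mu> = (\<Prod>i\<in>UNIV. mvar (Yv i) ^ Poly_Mapping.lookup \<mu> (Yv i))"

definition tens_act ::
  "('n::finite bpoly, 'a) gfmod \<Rightarrow> ('n bpoly, 'b) gfmod \<Rightarrow> 'n bpoly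
    \<Rightarrow> (('a \<times> 'b) \<Rightarrow>\<^sub>0 int) \<Rightarrow> (('a \<times> 'b) \<Rightarrow>\<^sub>0 int)" where
  "tens_act M N p = frag_extend (\<lambda>(m, n). \<Sum>\<mu>\<in>Poly_Mapping.keys p.
     frag_of ((Poly_Mapping.single 0 (Poly_Mapping.lookup p \<mu>) * y_monom \<mu>) \<odot>\<^bsub>M\<^esub> m,
              x_monom \<mu> \<odot>\<^bsub>N\<^esub> n))"

definition tens ::
  "('n::finite bpoly, 'a) gfmod \<Rightarrow> ('n bpoly, 'b) gfmod
    \<Rightarrow> ('n bpoly, (('a \<times> 'b) \<Rightarrow>\<^sub>0 int) set) gfmod" where
  "tens M N = (let Q = tens_free M N Mod tens_rel M N in
     \<lparr>carrier = carrier Q, monoid.mult = undefined, one = undefined,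
      zero = \<one>\<^bsub>Q\<^esub>, add = monoid.mult Q,
      module.smult = \<lambda>p Z. \<Union>c\<in>Z. tens_class M N (tens_act M N p c),
      qpart = \<lambda>q. generate Q
        {tens_class M N (frag_of (m, n)) | m n i. m \<in> qpart M i \<and> n \<in> qpart N (q - i)},
      fil = \<lambda>k. generate Q
        {tens_class M N (frag_of (m, n)) | m n i. m \<in> fil M i \<and> n \<in> fil N (k - i)}\<rparr>)"

definition tens_map ::
  "('n bpoly, 'c) gfmod \<Rightarrow> ('n bpoly, 'd) gfmod
    \<Rightarrow> ('a \<Rightarrow> 'c) \<Rightarrow> ('b \<Rightarrow> 'd) \<Rightarrow> (('a \<times> 'b) \<Rightarrow>\<^sub>0 int) set \<Rightarrow> (('c \<times> 'd) \<Rightarrow>\<^sub>0 int) set" where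
  "tens_map M' N' f g Z =
     (\<Union>c\<in>Z. tens_class M' N' (frag_extend (\<lambda>(m, n). frag_of (f m, g n)) c))"

definition gf_dsum :: "('i \<Rightarrow> ('r, 'a) gfmod) \<Rightarrow> ('r, 'i \<Rightarrow> 'a) gfmod" where
  "gf_dsum T = (let S = {c. (\<forall>i. c i \<in> carrier (T i)) \<and> finite {i. c i \<noteq> \<zero>\<^bsub>T i\<^esub>}} in
     \<lparr>carrier = S, monoid.mult = undefined, one = undefined,
      zero = \<lambda>i. \<zero>\<^bsub>T i\<^esub>, add = \<lambda>c c' i. c i \<oplus>\<^bsub>T i\<^esub> c' i,
      module.smult = \<lambda>p c i. p \<odot>\<^bsub>T i\<^esub> c i,
      qpart = \<lambda>q. {c \<in> S. \<forall>i. c i \<in> qpart (T i) q},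
      fil = \<lambda>k. {c \<in> S. \<forall>i. c i \<in> fil (T i) k}\<rparr>)"

text \<open>
  The total complex, with differential \<open>d(m \<otimes> n) = dm \<otimes> n + (-1)\<^sup>a m \<otimes> dn\<close> where \<open>a\<close> is the \<open>a\<close>-degree
  of \<open>m\<close>. The Koszul sign is governed by the \<open>a\<close>-degree because that is the total homological degree
  (the \<open>t\<close>-degree need not be an integer). An element is a family indexed by the degrees
  \<open>(i, b)\<close> of the left factor.
\<close>

definition bcx_summand ::
  "('n::finite, 'a) bcx \<Rightarrow> ('n, 'b) bcx \<Rightarrow> int \<Rightarrow> int \<Rightarrow> int \<times> int
    \<Rightarrow> ('n bpoly, (('a \<times> 'b) \<Rightarrow>\<^sub>0 int) set) gfmod" where
  "bcx_summand M N t a = (\<lambda>(i, b). tens (bterm M i b) (bterm N (t - i) (a - b)))"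

definition bcx_comp ::
  "('n::finite, 'a) bcx \<Rightarrow> ('n, 'b) bcx \<Rightarrow> ('n, int \<times> int \<Rightarrow> (('a \<times> 'b) \<Rightarrow>\<^sub>0 int) set) bcx"
    (infixl \<open>\<circ>\<^sub>b\<close> 70) where
  "M \<circ>\<^sub>b N =
     \<lparr>bterm = \<lambda>t a. gf_dsum (bcx_summand M N t a),
      bdif = \<lambda>t a c (i, b).
        (let T = bcx_summand M N (t - 2) (a - 1) (i, b);
             l = tens_map (bterm M i b) (bterm N (t - 2 - i) (a - 1 - b))
                   (bdif M (i + 2) (b + 1)) (\<lambda>n. n) (c (i + 2, b + 1));
             r = tens_map (bterm M i b) (bterm N (t - 2 - i) (a - 1 - b))
                   (\<lambda>m. m) (bdif N (t - i) (a - b)) (c (i, b))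
         in l \<oplus>\<^bsub>T\<^esub> (if even b then r else \<ominus>\<^bsub>T\<^esub> r))\<rparr>"


section \<open>The two-strand bimodules and the Rouquier complexes\<close>

definition quot_gf ::
  "'n bpoly set \<Rightarrow> (int \<Rightarrow> 'n bpoly set set) \<Rightarrow> ('n bpoly, 'n bpoly set) gfmod" where
  "quot_gf J F = (let Q = PR Quot J in
     \<lparr>carrier = carrier Q, monoid.mult = monoid.mult Q, one = \<one>\<^bsub>Q\<^esub>, zero = \<zero>\<^bsub>Q\<^esub>, add = add Q,
      module.smult = \<lambda>p Z. (J +>\<^bsub>PR\<^esub> p) \<otimes>\<^bsub>Q\<^esub> Z,
      qpart = \<lambda>q. {J +>\<^bsub>PR\<^esub> p | p. homog q p},
      fil = F\<rparr>)"

text \<open>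
  \<open>step_fil J c\<close> is the filtration of the quotient by \<open>J\<close> with \<open>F\<^sup>0\<close> everything, \<open>F\<^sup>1\<close> the submodule
  generated by \<open>c\<close>, and \<open>F\<^sup>2 = 0\<close>; indices are in half units. For \<open>c = 0\<close> it is the trivial filtration.
\<close>

definition step_fil :: "'n bpoly set \<Rightarrow> 'n bpoly \<Rightarrow> int \<Rightarrow> 'n bpoly set set" where
  "step_fil J c k =
     (if k \<le> 0 then {J +>\<^bsub>PR\<^esub> p | p. True}
      else if k \<le> 2 then {J +>\<^bsub>PR\<^esub> (c * p) | p. True}
      else {J})"

definition x_plus :: "2 bpoly" where "x_plus = mvar (Xv 2) + mvar (Xv 1)"
definition x_minus :: "2 bpoly" where "x_minus = mvar (Xv 2) - mvar (Xv 1)"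
definition y_plus :: "2 bpoly" where "y_plus = mvar (Yv 2) + mvar (Yv 1)"
definition y_minus :: "2 bpoly" where "y_minus = mvar (Yv 2) - mvar (Yv 1)"

definition ideal_I :: "2 bpoly set" where
  "ideal_I = Idl\<^bsub>PR\<^esub> {mvar (Yv 1) - mvar (Xv 1), mvar (Yv 2) - mvar (Xv 2)}"

definition ideal_M :: "2 bpoly set" where
  "ideal_M = Idl\<^bsub>PR\<^esub> {y_plus - x_plus, (y_minus + x_minus) * (y_minus - x_minus)}"

definition bimod_I :: "(2 bpoly, 2 bpoly set) gfmod" where
  "bimod_I = quot_gf ideal_I (step_fil ideal_I 0)"

definition black_blob :: "(2 bpoly, 2 bpoly set) gfmod" where
  "black_blob = quot_gf ideal_M (step_fil ideal_M (y_minus - x_minus))"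

definition gray_blob :: "(2 bpoly, 2 bpoly set) gfmod" where
  "gray_blob = quot_gf ideal_M (step_fil ideal_M (y_minus + x_minus))"

text \<open>The map of quotient modules induced by multiplication by \<open>c\<close>, into the quotient by \<open>J'\<close>.\<close>

definition quot_mult :: "'n bpoly set \<Rightarrow> 'n bpoly \<Rightarrow> 'n bpoly set \<Rightarrow> 'n bpoly set" where
  "quot_mult J' c Z = (\<Union>p\<in>Z. J' +>\<^bsub>PR\<^esub> (c * p))"

definition chi_plus :: "2 bpoly set \<Rightarrow> 2 bpoly set" where
  "chi_plus = quot_mult ideal_M (y_minus + x_minus)"

definition chi_minus :: "2 bpoly set \<Rightarrow> 2 bpoly set" where
  "chi_minus = quot_mult ideal_I 1"

text \<open>
  The prefactors are \<open>t\<^sub>s a\<^sub>q = t\<^sup>1\<^sup>/\<^sup>2 s\<^sup>1\<^sup>/\<^sup>2 a q\<^sup>2\<close> and its inverse, and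
  \<open>s\<^sub>q\<^sup>-\<^sup>1 = s\<^sup>-\<^sup>1 q\<^sup>-\<^sup>2\<close>; the arguments of the \<open>t\<close>- and \<open>s\<close>-shifts are in half units.
\<close>

definition sigma_pos :: "(2, 2 bpoly set) bcx" where
  "sigma_pos = t_shift 1 (s_shift 1 (a_shift 1 (q_shift 2
     (bracket 0 bimod_I (s_mod (-2) (q_mod (-2) gray_blob)) chi_plus))))"

definition sigma_neg :: "(2, 2 bpoly set) bcx" where
  "sigma_neg = t_shift (-1) (s_shift (-1) (a_shift (-1) (q_shift (-2)
     (bracket 1 black_blob bimod_I chi_minus))))"

end

theory Submission
  imports Defs
begin

text \<open>
  All terms are filtered modules placed in a single inner degree, and the localization functor
  preserves composition and addition, so it suffices to contract both complexes strictly, at the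
  level of filtered graded bimodules. There both have the form
  \<open>T\<^sub>2 \<rightarrow> T\<^sub>0 \<oplus> L \<rightarrow> M\<^sub>2\<close> with \<open>T\<^sub>0 = I \<otimes> I\<close> and \<open>L\<close> the product of the two blobs. The trace
  over the middle variables, \<open>f(z\<^sub>1, z\<^sub>2) \<mapsto> (f(z\<^sub>1, z\<^sub>2) - f(z\<^sub>2, z\<^sub>1)) / (z\<^sub>2 - z\<^sub>1)\<close> up to normalization, retracts
  \<open>L\<close> onto \<open>T\<^sub>2\<close>, and \<open>1 \<mapsto> 1 \<otimes> 1\<close> splits \<open>L \<rightarrow> M\<^sub>2\<close>. Both maps respect the filtrations because the two
  blobs carry opposite ones: \<open>(y\<^sub>- + x\<^sub>-)(1 \<otimes> 1)\<close> is a combination of \<open>(y\<^sub>- + x\<^sub>-) \<otimes> 1\<close> and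
  \<open>1 \<otimes> (y\<^sub>- - x\<^sub>-)\<close>, of filtration degree 1 in \<open>G \<otimes> B\<close>, and likewise in \<open>B \<otimes> G\<close>. Cancelling
  \<open>T\<^sub>2\<close> and \<open>M\<^sub>2\<close> against \<open>L\<close> leaves \<open>I \<otimes> I \<cong> I\<close>.
\<close>

text \<open>The derived category enters through one statement about roofs: images of chain maps
  compose and add as the maps do. It rests on the Ore condition inside the universe type
  \<open>'u\<close>. A homotopy pullback consists of triples of elements of \<open>'u\<close>, so
  \<open>'u\<close> is taken infinite to contain a copy of it; all bimodules here are countable, so
  they fit as well.

  The cancellation is more than a splitting of L. As the differential squares to zero, \<Xi> A = -
  \<open>D2 D1\<close>, so A r + j \<Xi> alone need not be the identity of L and the correction j
  \<open>D2 D1\<close> r joins it. Such identities are tested on generators: over the outer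
  variables M \<otimes> M is generated by 1 \<otimes> 1 and \<epsilon> (1 \<otimes> 1), with
  \<epsilon> the difference of the middle variables, and 1 \<otimes> 1 suffices once a factor is I.

  The trace lowers the filtration by one step, which the shift \<open>s_q^{-1}\<close> on L absorbs.
  The critical case is F^2 of L; for G \<otimes> B the relation \<epsilon>^2 = y_-^2 gives (y_- +
  \<epsilon>)(\<epsilon> - x_-) = (y_- - x_-)(\<epsilon> + y_-).\<close>

lemma PR_simps [simp]:
  "carrier (ring_of_type_algebra :: 'a::comm_ring_1 ring) = UNIV"
  "x \<otimes>\<^bsub>(ring_of_type_algebra :: 'a::comm_ring_1 ring)\<^esub> y = x * y"
  "\<one>\<^bsub>(ring_of_type_algebra :: 'a::comm_ring_1 ring)\<^esub> = 1"
  "\<zero>\<^bsub>(ring_of_type_algebra :: 'a::comm_ring_1 ring)\<^esub> = 0"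
  "x \<oplus>\<^bsub>(ring_of_type_algebra :: 'a::comm_ring_1 ring)\<^esub> y = x + y"
  by (simp_all add: ring_of_type_algebra_def)

lemma cring_PR: "cring (ring_of_type_algebra :: 'a::comm_ring_1 ring)" by (rule cring_from_type_algebra)

lemma PR_a_inv [simp]: "\<ominus>\<^bsub>(ring_of_type_algebra :: 'a::comm_ring_1 ring)\<^esub> x = - x"
proof -
  interpret cring "ring_of_type_algebra :: 'a::comm_ring_1 ring" by (rule cring_PR)
  show ?thesis by (rule minus_equality) simp_all
qed

lemma PR_a_minus [simp]: "x \<ominus>\<^bsub>(ring_of_type_algebra :: 'a::comm_ring_1 ring)\<^esub> y = x - y"
  by (simp add: a_minus_def)

section \<open>Grading, filtration and morphisms of bimodules\<close>

section \<open>Filtered graded modules\<close>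

text \<open>
  Simplification with the following equations moves all negative terms of an equation to the other
  side, so that an identity of abelian groups becomes one up to associativity and commutativity.
\<close>

context abelian_group
begin

lemma minus_eq_iff:
  assumes "x \<in> carrier G" "y \<in> carrier G" "z \<in> carrier G"
  shows "x \<ominus> y = z \<longleftrightarrow> x = z \<oplus> y" "z = x \<ominus> y \<longleftrightarrow> z \<oplus> y = x"
  using assms by (auto simp: a_minus_def a_assoc l_neg r_neg)

lemma a_inv_eq_iff:
  assumes "x \<in> carrier G" "z \<in> carrier G"
  shows "\<ominus> x = z \<longleftrightarrow> \<zero> = z \<oplus> x" "z = \<ominus> x \<longleftrightarrow> z \<oplus> x = \<zero>"
  using minus_eq_iff[of \<zero> x z] assms by (auto simp: a_minus_def)

lemma minus_rearrange0:
  assumes "x \<in> carrier G"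
  shows "x \<ominus> \<zero> = x" "\<zero> \<ominus> x = \<ominus> x"
  using assms minus_equality[of \<zero> \<zero>] by (auto simp: a_minus_def)

lemma minus_zero: "\<ominus> \<zero> = \<zero>" using minus_equality[of \<zero> \<zero>] by simp

lemma minus_rearrange:
  assumes "x \<in> carrier G" "y \<in> carrier G"
  shows "x \<oplus> \<ominus> y = x \<ominus> y" "\<ominus> x \<oplus> y = y \<ominus> x" "\<ominus> x \<ominus> y = \<ominus> (x \<oplus> y)" "x \<ominus> \<ominus> y = x \<oplus> y"
    "\<ominus> (x \<ominus> y) = y \<ominus> x" using assms by (auto simp: a_minus_def minus_add a_comm)

lemma minus_rearrange3:
  assumes "x \<in> carrier G" "y \<in> carrier G" "z \<in> carrier G"
  shows "(x \<ominus> y) \<oplus> z = (x \<oplus> z) \<ominus> y" "x \<oplus> (y \<ominus> z) = (x \<oplus> y) \<ominus> z"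
    "(x \<ominus> y) \<ominus> z = x \<ominus> (y \<oplus> z)" "x \<ominus> (y \<ominus> z) = (x \<oplus> z) \<ominus> y"
  using assms by (auto simp: a_minus_def minus_add a_ac)

lemmas group_simps = minus_eq_iff a_inv_eq_iff minus_rearrange0 minus_zero minus_rearrange minus_rearrange3 a_ac

end

lemma gfmodule_module: "gfmodule M \<Longrightarrow> module PR M" by (simp add: gfmodule_def)

lemma gfmodule_abelian_group: "gfmodule M \<Longrightarrow> abelian_group M"
  using gfmodule_module module.axioms(2) by blast

lemma gfmodule_qpart: "gfmodule M \<Longrightarrow> additive_subgroup (qpart M q) M" by (simp add: gfmodule_def)

lemma gfmodule_fil: "gfmodule M \<Longrightarrow> submodule (fil M k) PR M" by (simp add: gfmodule_def)

lemma gfmodule_fil_additive: "gfmodule M \<Longrightarrow> additive_subgroup (fil M k) M"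
  using gfmodule_fil submodule.axioms(1) additive_subgroup.intro by blast

lemma gfmodule_fil_carrier: "gfmodule M \<Longrightarrow> x \<in> fil M k \<Longrightarrow> x \<in> carrier M"
  using additive_subgroup.a_subset gfmodule_fil_additive by blast

lemma gfmodule_qpart_carrier: "gfmodule M \<Longrightarrow> x \<in> qpart M k \<Longrightarrow> x \<in> carrier M"
  using additive_subgroup.a_subset gfmodule_qpart by blast

lemma gfmodule_fil_mono:
  assumes "gfmodule M" "i \<le> j"
  shows "fil M j \<subseteq> fil M i" using assms(2)
proof (induction rule: int_ge_induct)
  case (step i)
  then show ?case using assms(1) unfolding gfmodule_def by blast
qed simp

lemma gfmodule_smult_qpart:
  "gfmodule M \<Longrightarrow> homog d p \<Longrightarrow> m \<in> qpart M q \<Longrightarrow> p \<odot>\<^bsub>M\<^esub> m \<in> qpart M (q + d)"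
  by (simp add: gfmodule_def)

lemma additive_subgroupI:
  assumes "abelian_group M" "S \<subseteq> carrier M" "\<zero>\<^bsub>M\<^esub> \<in> S"
    "\<And>x y. x \<in> S \<Longrightarrow> y \<in> S \<Longrightarrow> x \<oplus>\<^bsub>M\<^esub> y \<in> S" "\<And>x. x \<in> S \<Longrightarrow> \<ominus>\<^bsub>M\<^esub> x \<in> S"
  shows "additive_subgroup S M"
  using assms by (auto intro!: additive_subgroup.intro subgroup.intro simp: a_inv_def[symmetric])

lemma additive_subgroupD:
  assumes "abelian_group M" "additive_subgroup S M"
  shows "S \<subseteq> carrier M" "\<zero>\<^bsub>M\<^esub> \<in> S"
    "x \<in> S \<Longrightarrow> y \<in> S \<Longrightarrow> x \<oplus>\<^bsub>M\<^esub> y \<in> S" "x \<in> S \<Longrightarrow> \<ominus>\<^bsub>M\<^esub> x \<in> S"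
    "x \<in> S \<Longrightarrow> y \<in> S \<Longrightarrow> x \<ominus>\<^bsub>M\<^esub> y \<in> S"
proof -
  interpret abelian_group M by fact
  interpret S: additive_subgroup S M by fact
  show "S \<subseteq> carrier M" "\<zero>\<^bsub>M\<^esub> \<in> S" "x \<in> S \<Longrightarrow> y \<in> S \<Longrightarrow> x \<oplus>\<^bsub>M\<^esub> y \<in> S"
    by auto
  show 1: "\<ominus>\<^bsub>M\<^esub> x \<in> S" if "x \<in> S" for x
    using that S.a_inv_closed abelian_group_axioms by (simp add: a_inv_def subgroup.m_inv_closed S.a_subgroup)
  show "x \<in> S \<Longrightarrow> y \<in> S \<Longrightarrow> x \<ominus>\<^bsub>M\<^esub> y \<in> S"  using 1 by (simp add: a_minus_def)
qed

lemma submodulePRI: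
  fixes M :: "('n bpoly, 'a) gfmod"
  assumes "module PR M" "additive_subgroup S M"
    "\<And>p x. x \<in> S \<Longrightarrow> p \<odot>\<^bsub>M\<^esub> x \<in> S"
  shows "submodule S PR M"
  using assms by (auto intro!: submodule.intro submodule_axioms.intro dest: additive_subgroup.a_subgroup)

lemma gf_fil_closed:
  assumes "gfmodule M"
  shows "\<zero>\<^bsub>M\<^esub> \<in> fil M k" "x \<in> fil M k \<Longrightarrow> y \<in> fil M k \<Longrightarrow> x \<oplus>\<^bsub>M\<^esub> y \<in> fil M k"
    "x \<in> fil M k \<Longrightarrow> \<ominus>\<^bsub>M\<^esub> x \<in> fil M k"
    "x \<in> fil M k \<Longrightarrow> y \<in> fil M k \<Longrightarrow> x \<ominus>\<^bsub>M\<^esub> y \<in> fil M k"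
    "x \<in> fil M k \<Longrightarrow> p \<odot>\<^bsub>M\<^esub> x \<in> fil M k"
  using additive_subgroupD[OF gfmodule_abelian_group[OF assms] gfmodule_fil_additive[OF assms]]
    submodule.smult_closed[OF gfmodule_fil[OF assms]] by auto

lemma gf_qpart_closed:
  assumes "gfmodule M"
  shows "\<zero>\<^bsub>M\<^esub> \<in> qpart M k" "x \<in> qpart M k \<Longrightarrow> y \<in> qpart M k \<Longrightarrow> x \<oplus>\<^bsub>M\<^esub> y \<in> qpart M k"
    "x \<in> qpart M k \<Longrightarrow> \<ominus>\<^bsub>M\<^esub> x \<in> qpart M k"
  using additive_subgroupD[OF gfmodule_abelian_group[OF assms] gfmodule_qpart[OF assms]] by auto

subsection \<open>Homogeneous components\<close>

lemma hcomponents_finsum: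
  assumes "abelian_group M" "hcomponents M m c" "finite S" "{q. c q \<noteq> \<zero>\<^bsub>M\<^esub>} \<subseteq> S" "\<And>q. c q \<in> carrier M"
  shows "m = finsum M c S"
proof -
  interpret abelian_group M by fact
  have "finsum M c {q. c q \<noteq> \<zero>\<^bsub>M\<^esub>} = finsum M c S"
    using assms(3-5) by (intro add.finprod_mono_neutral_cong_left) auto
  then show ?thesis using assms(2) unfolding hcomponents_def by simp
qed

text \<open>Unique decompositions are awkward to verify directly, whereas orthogonal additive
  projections are easy to write down. Applying \<pi> q to a finite decomposition leaves its
  component of degree q, which gives uniqueness; \<open>dec\<close> gives existence. Transported
  modules, direct sums, tensor products and quotients all get their grading this way.\<close>

lemma hcomponents_by_projections:
  fixes M :: "('r, 'a) gfmod"
  assumes ab: "abelian_group M" and sub: "\<And>q. additive_subgroup (qpart M q) M"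
    and cl: "\<And>q m. m \<in> carrier M \<Longrightarrow> \<pi> q m \<in> qpart M q"
    and add: "\<And>q m m'. m \<in> carrier M \<Longrightarrow> m' \<in> carrier M \<Longrightarrow> \<pi> q (m \<oplus>\<^bsub>M\<^esub> m') = \<pi> q m \<oplus>\<^bsub>M\<^esub> \<pi> q m'"
    and id: "\<And>q m. m \<in> qpart M q \<Longrightarrow> \<pi> q m = m"
    and orth: "\<And>q q' m. m \<in> qpart M q \<Longrightarrow> q' \<noteq> q \<Longrightarrow> \<pi> q' m = \<zero>\<^bsub>M\<^esub>"
    and dec: "\<And>m. m \<in> carrier M \<Longrightarrow>
       \<exists>S. finite S \<and> (\<forall>q. q \<notin> S \<longrightarrow> \<pi> q m = \<zero>\<^bsub>M\<^esub>) \<and> m = finsum M (\<lambda>q. \<pi> q m) S"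
    and m: "m \<in> carrier M"
  shows "hcomponents M m c \<longleftrightarrow> c = (\<lambda>q. \<pi> q m)"
proof -
  interpret abelian_group M by fact
  have subC: "x \<in> qpart M q \<Longrightarrow> x \<in> carrier M" for x q
    using additive_subgroupD(1)[OF ab sub] by blast
  have zin: "\<zero>\<^bsub>M\<^esub> \<in> qpart M q" for q using additive_subgroupD(2)[OF ab sub] by blast
  have \<pi>C: "\<pi> q x \<in> carrier M" if "x \<in> carrier M" for q x using subC cl that by blast
  show ?thesis
  proof
    assume h: "hcomponents M m c"
    then have cq: "\<And>q. c q \<in> qpart M q" and fin: "finite {q. c q \<noteq> \<zero>\<^bsub>M\<^esub>}"
      and ms: "m = finsum M c {q. c q \<noteq> \<zero>\<^bsub>M\<^esub>}" by (auto simp: hcomponents_def)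
    have "\<pi> q (finsum M c S) = (if q \<in> S then c q else \<zero>\<^bsub>M\<^esub>)" if "finite S" for S q
      using that
    proof (induction S)
      case empty
      show ?case using id[OF zin] by simp
    next
      case (insert x F)
      have "\<pi> q (c x) = \<zero>\<^bsub>M\<^esub>" if "x \<noteq> q" using orth[OF cq] that by metis
      moreover have "\<pi> q (finsum M c (insert x F)) = \<pi> q (c x) \<oplus>\<^bsub>M\<^esub> \<pi> q (finsum M c F)"
        using insert subC[OF cq] by (simp add: add Pi_def)
      ultimately show ?case using insert id[OF cq] subC[OF cq] by (cases "x = q") (auto simp: Pi_def)
    qed
    from this[OF fin] ms show "c = (\<lambda>q. \<pi> q m)" by (auto simp: fun_eq_iff)
  next
    assume c: "c = (\<lambda>q. \<pi> q m)"
    obtain S where S: "finite S" "\<And>q. q \<notin> S \<Longrightarrow> \<pi> q m = \<zero>\<^bsub>M\<^esub>" "m = finsum M (\<lambda>q. \<pi> q m) S"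
      using dec[OF m] by blast
    have sS: "{q. \<pi> q m \<noteq> \<zero>\<^bsub>M\<^esub>} \<subseteq> S" using S(2) by blast
    have "finsum M (\<lambda>q. \<pi> q m) {q. \<pi> q m \<noteq> \<zero>\<^bsub>M\<^esub>} = finsum M (\<lambda>q. \<pi> q m) S"
      using S(1) sS \<pi>C[OF m] by (intro add.finprod_mono_neutral_cong_left) auto
    then show "hcomponents M m c" using S sS c cl[OF m] finite_subset[OF sS S(1)] by (simp add: hcomponents_def)
  qed
qed

text \<open>The description denotes by the uniqueness clause of \<open>gfmodule\<close>, so facts
  about it assume \<open>gfmodule M\<close> and an element of the module.\<close>

definition hproj :: "('r, 'a) gfmod \<Rightarrow> int \<Rightarrow> 'a \<Rightarrow> 'a" where
  "hproj M q m = (THE c. hcomponents M m c) q"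

lemma hproj_eqI:
  assumes "gfmodule M" "m \<in> carrier M" "hcomponents M m c"
  shows "hproj M q m = c q" using assms unfolding hproj_def gfmodule_def by (metis the_equality)

lemma hcomponents_hproj:
  assumes "gfmodule M" "m \<in> carrier M"
  shows "hcomponents M m (\<lambda>q. hproj M q m)"
proof -
  obtain c where "hcomponents M m c" using assms unfolding gfmodule_def by blast
  moreover from this have "(\<lambda>q. hproj M q m) = c" using hproj_eqI[OF assms] by auto
  ultimately show ?thesis by simp
qed

lemma hcomponentsD:
  assumes "hcomponents M m c"
  shows "c q \<in> qpart M q" "finite {q. c q \<noteq> \<zero>\<^bsub>M\<^esub>}"
  using assms by (simp_all only: hcomponents_def)

lemma hproj_qpart: "gfmodule M \<Longrightarrow> m \<in> carrier M \<Longrightarrow> hproj M q m \<in> qpart M q"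
  using hcomponentsD(1)[OF hcomponents_hproj] .

lemma hproj_carrier: "gfmodule M \<Longrightarrow> m \<in> carrier M \<Longrightarrow> hproj M q m \<in> carrier M"
  by (rule gfmodule_qpart_carrier[OF _ hproj_qpart])

lemma hproj_finite: "gfmodule M \<Longrightarrow> m \<in> carrier M \<Longrightarrow> finite {q. hproj M q m \<noteq> \<zero>\<^bsub>M\<^esub>}"
  using hcomponentsD(2)[OF hcomponents_hproj] .

lemma hproj_sum:
  assumes "gfmodule M" "m \<in> carrier M" "finite S" "{q. hproj M q m \<noteq> \<zero>\<^bsub>M\<^esub>} \<subseteq> S"
  shows "finsum M (\<lambda>q. hproj M q m) S = m"
  using hcomponents_finsum[OF gfmodule_abelian_group hcomponents_hproj, OF assms(1) assms(1-4)]
    hproj_carrier[OF assms(1,2)] by simp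

lemma hproj_fil: "gfmodule M \<Longrightarrow> m \<in> fil M k \<Longrightarrow> hproj M q m \<in> fil M k"
  using hcomponents_hproj[of M m] gfmodule_fil_carrier[of M m k] unfolding gfmodule_def by blast

lemma hcomponents_add:
  assumes "gfmodule M" "m \<in> carrier M" "m' \<in> carrier M" "hcomponents M m c" "hcomponents M m' c'"
  shows "hcomponents M (m \<oplus>\<^bsub>M\<^esub> m') (\<lambda>q. c q \<oplus>\<^bsub>M\<^esub> c' q)"
proof -
  interpret abelian_group M using assms(1) by (rule gfmodule_abelian_group)
  have c: "\<And>q. c q \<in> qpart M q" "\<And>q. c' q \<in> qpart M q"
    and f: "finite {q. c q \<noteq> \<zero>\<^bsub>M\<^esub>}" "finite {q. c' q \<noteq> \<zero>\<^bsub>M\<^esub>}"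
    by (rule hcomponentsD[OF assms(4)] hcomponentsD[OF assms(5)])+
  let ?S = "{q. c q \<noteq> \<zero>\<^bsub>M\<^esub>} \<union> {q. c' q \<noteq> \<zero>\<^bsub>M\<^esub>}"
  have cC: "\<And>q. c q \<in> carrier M" "\<And>q. c' q \<in> carrier M"
    using c gfmodule_qpart_carrier[OF assms(1)] by auto
  have sub: "{q. c q \<oplus>\<^bsub>M\<^esub> c' q \<noteq> \<zero>\<^bsub>M\<^esub>} \<subseteq> ?S" by auto
  have "m = finsum M c ?S" "m' = finsum M c' ?S"
    by (rule hcomponents_finsum[OF abelian_group_axioms assms(4)] hcomponents_finsum[OF abelian_group_axioms assms(5)];
      use f cC in auto)+
  then have "m \<oplus>\<^bsub>M\<^esub> m' = finsum M (\<lambda>q. c q \<oplus>\<^bsub>M\<^esub> c' q) ?S"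
    using cC f by (simp add: finsum_addf Pi_def)
  also have "\<dots> = finsum M (\<lambda>q. c q \<oplus>\<^bsub>M\<^esub> c' q) {q. c q \<oplus>\<^bsub>M\<^esub> c' q \<noteq> \<zero>\<^bsub>M\<^esub>}"
    using f cC sub by (intro add.finprod_mono_neutral_cong_right) auto
  finally show ?thesis unfolding hcomponents_def using c f sub gf_qpart_closed[OF assms(1)]
    by (auto dest: finite_subset)
qed

lemma hproj_add:
  assumes "gfmodule M" "m \<in> carrier M" "m' \<in> carrier M"
  shows "hproj M q (m \<oplus>\<^bsub>M\<^esub> m') = hproj M q m \<oplus>\<^bsub>M\<^esub> hproj M q m'"
proof -
  interpret abelian_group M using assms(1) by (rule gfmodule_abelian_group)
  show ?thesis
    using hproj_eqI[OF assms(1) _ hcomponents_add[OF assms hcomponents_hproj hcomponents_hproj]] assms by simp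
qed

lemma hproj_id:
  assumes "gfmodule M" "m \<in> qpart M q"
  shows "hproj M q' m = (if q' = q then m else \<zero>\<^bsub>M\<^esub>)"
proof -
  interpret abelian_group M using assms(1) by (rule gfmodule_abelian_group)
  have m: "m \<in> carrier M" by (rule gfmodule_qpart_carrier[OF assms])
  have "hcomponents M m (\<lambda>q'. if q' = q then m else \<zero>\<^bsub>M\<^esub>)"
  proof -
    have "finsum M (\<lambda>q'. if q' = q then m else \<zero>\<^bsub>M\<^esub>) {q'. (if q' = q then m else \<zero>\<^bsub>M\<^esub>) \<noteq> \<zero>\<^bsub>M\<^esub>} = m"
    proof (cases "m = \<zero>\<^bsub>M\<^esub>")
      case False
      then have "{q'. (if q' = q then m else \<zero>\<^bsub>M\<^esub>) \<noteq> \<zero>\<^bsub>M\<^esub>} = {q}" by auto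
      then show ?thesis using m by simp
    qed simp
    then show ?thesis using assms gf_qpart_closed(1)[OF assms(1)] unfolding hcomponents_def by auto
  qed
  from hproj_eqI[OF assms(1) m this] show ?thesis by simp
qed

lemma hproj_zero: "gfmodule M \<Longrightarrow> hproj M q \<zero>\<^bsub>M\<^esub> = \<zero>\<^bsub>M\<^esub>"
  using hproj_id[of M "\<zero>\<^bsub>M\<^esub>" 0 q] gf_qpart_closed(1)[of M 0] by auto

lemma additive_finsum:
  assumes "abelian_group M" "abelian_group N" "f \<in> carrier M \<rightarrow> carrier N"
    "\<And>x y. x \<in> carrier M \<Longrightarrow> y \<in> carrier M \<Longrightarrow> f (x \<oplus>\<^bsub>M\<^esub> y) = f x \<oplus>\<^bsub>N\<^esub> f y"
    "finite S" "\<And>i. i \<in> S \<Longrightarrow> g i \<in> carrier M"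
  shows "f (finsum M g S) = finsum N (\<lambda>i. f (g i)) S"
proof -
  interpret M: abelian_group M by fact
  interpret N: abelian_group N by fact
  have z: "f \<zero>\<^bsub>M\<^esub> = \<zero>\<^bsub>N\<^esub>"
    using assms(4)[of "\<zero>\<^bsub>M\<^esub>" "\<zero>\<^bsub>M\<^esub>"] N.add.r_cancel_one'[of "f \<zero>\<^bsub>M\<^esub>" "f \<zero>\<^bsub>M\<^esub>"]
      funcset_mem[OF assms(3)] by simp
  show ?thesis using assms(5,6)
  proof (induction S)
    case (insert x F)
    then show ?case using assms(3,4) by (auto simp: Pi_def)
  qed (simp add: z)
qed

lemma additive_zero_inv:
  assumes "abelian_group M" "abelian_group N" "f \<in> carrier M \<rightarrow> carrier N"
    "\<And>x y. x \<in> carrier M \<Longrightarrow> y \<in> carrier M \<Longrightarrow> f (x \<oplus>\<^bsub>M\<^esub> y) = f x \<oplus>\<^bsub>N\<^esub> f y"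
  shows "f \<zero>\<^bsub>M\<^esub> = \<zero>\<^bsub>N\<^esub>" "x \<in> carrier M \<Longrightarrow> f (\<ominus>\<^bsub>M\<^esub> x) = \<ominus>\<^bsub>N\<^esub> f x"
    "x \<in> carrier M \<Longrightarrow> y \<in> carrier M \<Longrightarrow> f (x \<ominus>\<^bsub>M\<^esub> y) = f x \<ominus>\<^bsub>N\<^esub> f y"
proof -
  interpret M: abelian_group M by fact
  interpret N: abelian_group N by fact
  show z: "f \<zero>\<^bsub>M\<^esub> = \<zero>\<^bsub>N\<^esub>"
    using assms(4)[of "\<zero>\<^bsub>M\<^esub>" "\<zero>\<^bsub>M\<^esub>"] N.add.r_cancel_one'[of "f \<zero>\<^bsub>M\<^esub>" "f \<zero>\<^bsub>M\<^esub>"]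
      funcset_mem[OF assms(3)] by simp
  show inv: "f (\<ominus>\<^bsub>M\<^esub> x) = \<ominus>\<^bsub>N\<^esub> f x" if "x \<in> carrier M" for x
  proof -
    have "f (\<ominus>\<^bsub>M\<^esub> x) \<oplus>\<^bsub>N\<^esub> f x = \<zero>\<^bsub>N\<^esub>"
      using assms(4)[of "\<ominus>\<^bsub>M\<^esub> x" x] that z by (simp add: M.l_neg)
    then show ?thesis using assms(3) that by (intro N.minus_equality[symmetric]) auto
  qed
  show "x \<in> carrier M \<Longrightarrow> y \<in> carrier M \<Longrightarrow> f (x \<ominus>\<^bsub>M\<^esub> y) = f x \<ominus>\<^bsub>N\<^esub> f y"
    by (simp add: a_minus_def assms(4) inv)
qed

subsection \<open>Transport of structure\<close>

text \<open>A linear bijection transports all axioms, and grading and filtration may be reindexed by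
  a and b on the way. With a = b = 0 this moves a module to another element type; with the identity
  for r it gives the shift functors.\<close>

lemma gfmodule_iso:
  fixes M :: "('n bpoly, 'a) gfmod" and N :: "('n bpoly, 'b) gfmod"
  assumes M: "gfmodule M" and bij: "bij_betw r (carrier M) (carrier N)"
    and add: "\<And>x y. x \<in> carrier M \<Longrightarrow> y \<in> carrier M \<Longrightarrow> r (x \<oplus>\<^bsub>M\<^esub> y) = r x \<oplus>\<^bsub>N\<^esub> r y"
    and smult: "\<And>p x. x \<in> carrier M \<Longrightarrow> r (p \<odot>\<^bsub>M\<^esub> x) = p \<odot>\<^bsub>N\<^esub> r x"
    and zero: "r \<zero>\<^bsub>M\<^esub> = \<zero>\<^bsub>N\<^esub>"
    and qp: "\<And>q. qpart N q = r ` qpart M (q - a)" and fl: "\<And>k. fil N k = r ` fil M (k - b)"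
  shows "gfmodule N"
proof -
  interpret M: module PR M using M by (rule gfmodule_module)
  have abM: "abelian_group M" using M by (rule gfmodule_abelian_group)
  have car: "carrier N = r ` carrier M" and inj: "inj_on r (carrier M)" using bij by (auto simp: bij_betw_def)
  have abN: "abelian_group N"
  proof (rule abelian_groupI)
    fix x y z assume "x \<in> carrier N" "y \<in> carrier N" "z \<in> carrier N"
    then obtain a b c where *: "a \<in> carrier M" "b \<in> carrier M" "c \<in> carrier M" "x = r a" "y = r b" "z = r c"
      unfolding car by blast
    show "x \<oplus>\<^bsub>N\<^esub> y \<in> carrier N" "x \<oplus>\<^bsub>N\<^esub> y = y \<oplus>\<^bsub>N\<^esub> x" "x \<oplus>\<^bsub>N\<^esub> y \<oplus>\<^bsub>N\<^esub> z = x \<oplus>\<^bsub>N\<^esub> (y \<oplus>\<^bsub>N\<^esub> z)"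
      "\<zero>\<^bsub>N\<^esub> \<oplus>\<^bsub>N\<^esub> x = x"
      using * by (auto simp: add[symmetric] car M.a_ac zero[symmetric])
    show "\<exists>y\<in>carrier N. y \<oplus>\<^bsub>N\<^esub> x = \<zero>\<^bsub>N\<^esub>"
      using * by (intro bexI[of _ "r (\<ominus>\<^bsub>M\<^esub> a)"]) (auto simp: add[symmetric] car zero[symmetric] M.l_neg)
  next
    show "\<zero>\<^bsub>N\<^esub> \<in> carrier N" unfolding car zero[symmetric] by simp
  qed
  interpret N: abelian_group N by fact
  have rC: "r \<in> carrier M \<rightarrow> carrier N" unfolding car by blast
  note inv = additive_zero_inv[OF abM abN rC add]
  have modN: "module PR N" by (rule moduleI[OF cring_PR abN])
      (auto simp: car smult[symmetric] add[symmetric] M.smult_l_distr[simplified] M.smult_r_distr[simplified]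
        M.smult_assoc1[simplified] M.smult_one[simplified] M.smult_closed[simplified])
  have sub: "additive_subgroup (r ` S) N" if "additive_subgroup S M" for S
  proof (rule additive_subgroupI[OF abN])
    note S = additive_subgroupD[OF abM that]
    show "r ` S \<subseteq> carrier N" using S(1) rC by auto
    show "\<zero>\<^bsub>N\<^esub> \<in> r ` S" using S(2) zero[symmetric] by simp
    fix x y assume x: "x \<in> r ` S"
    then obtain a where a: "a \<in> S" "a \<in> carrier M" "x = r a" using S(1) by blast
    then show "\<ominus>\<^bsub>N\<^esub> x \<in> r ` S" using S(4) inv(2) by force
    assume "y \<in> r ` S"
    then obtain b where b: "b \<in> S" "b \<in> carrier M" "y = r b" using S(1) by blast
    then show "x \<oplus>\<^bsub>N\<^esub> y \<in> r ` S" using S(3)[OF a(1) b(1)] a b add by force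
  qed
  define r' where "r' = inv_into (carrier M) r"
  have r': "r' (r x) = x" if "x \<in> carrier M" for x using that inj by (simp add: r'_def)
  have r'C: "r' y \<in> carrier M" "r (r' y) = y" if "y \<in> carrier N" for y
    using that unfolding car r'_def by (simp_all add: inv_into_into f_inv_into_f)
  have qpM: "x \<in> carrier M" if "x \<in> qpart M q" for x q using that gfmodule_qpart_carrier[OF M] by blast
  have hc: "hcomponents N m c \<longleftrightarrow> c = (\<lambda>q. r (hproj M (q - a) (r' m)))" if m: "m \<in> carrier N" for m c
  proof (rule hcomponents_by_projections[OF abN])
    show "additive_subgroup (qpart N q) N" for q unfolding qp by (rule sub) (rule gfmodule_qpart[OF M])
    show "r (hproj M (q - a) (r' m)) \<in> qpart N q" if "m \<in> carrier N" for m q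
      using that r'C hproj_qpart[OF M] qp by blast
    show "r (hproj M (q - a) (r' (m \<oplus>\<^bsub>N\<^esub> m'))) = r (hproj M (q - a) (r' m)) \<oplus>\<^bsub>N\<^esub> r (hproj M (q - a) (r' m'))"
      if "m \<in> carrier N" "m' \<in> carrier N" for q m m'
    proof -
      have "r' (m \<oplus>\<^bsub>N\<^esub> m') = r' m \<oplus>\<^bsub>M\<^esub> r' m'"
        by (metis M.add.m_closed add r' r'C that)
      then show ?thesis using that r'C hproj_add[OF M] hproj_carrier[OF M] add by auto
    qed
    show "r (hproj M (q - a) (r' m)) = m" if "m \<in> qpart N q" for m q
    proof -
      obtain x where "x \<in> qpart M (q - a)" "m = r x" using \<open>m \<in> qpart N q\<close> unfolding qp by blast
      then show ?thesis using r'[OF qpM] hproj_id[OF M] by auto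
    qed
    show "r (hproj M (q' - a) (r' m)) = \<zero>\<^bsub>N\<^esub>" if "m \<in> qpart N q" "q' \<noteq> q" for m q q'
    proof -
      obtain x where "x \<in> qpart M (q - a)" "m = r x" using \<open>m \<in> qpart N q\<close> unfolding qp by blast
      then show ?thesis using r'[OF qpM] hproj_id[OF M] zero \<open>q' \<noteq> q\<close> by auto
    qed
    show "\<exists>S. finite S \<and> (\<forall>q. q \<notin> S \<longrightarrow> r (hproj M (q - a) (r' m)) = \<zero>\<^bsub>N\<^esub>) \<and>
             m = finsum N (\<lambda>q. r (hproj M (q - a) (r' m))) S" if "m \<in> carrier N" for m
    proof (intro exI conjI)
      let ?Z = "{q. hproj M q (r' m) \<noteq> \<zero>\<^bsub>M\<^esub>}" and ?S = "{q. hproj M (q - a) (r' m) \<noteq> \<zero>\<^bsub>M\<^esub>}"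
      \<comment> \<open>The degrees that occur are translated by \<open>a\<close>, so the sum over
        them is reindexed.\<close>
      have S: "?S = (\<lambda>q. q + a) ` ?Z"
      proof (intro Set.set_eqI iffI)
        fix q assume "q \<in> ?S" then show "q \<in> (\<lambda>q. q + a) ` ?Z" by (intro image_eqI[of _ _ "q - a"]) auto
      qed auto
      have fin0: "finite ?Z" using that r'C hproj_finite[OF M] by blast
      show fin: "finite ?S" unfolding S using fin0 by simp
      have "finsum M (\<lambda>q. hproj M (q - a) (r' m)) ?S = finsum M (\<lambda>q. hproj M (q + a - a) (r' m)) ?Z"
        unfolding S by (rule M.add.finprod_reindex)
          (use that r'C hproj_carrier[OF M] in \<open>auto simp: inj_on_def\<close>)
      then have sm: "finsum M (\<lambda>q. hproj M (q - a) (r' m)) ?S = r' m"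
        using hproj_sum[OF M _ fin0] that r'C by simp
      show "\<forall>q. q \<notin> ?S \<longrightarrow> r (hproj M (q - a) (r' m)) = \<zero>\<^bsub>N\<^esub>" using zero by auto
      have "r (finsum M (\<lambda>q. hproj M (q - a) (r' m)) ?S) = finsum N (\<lambda>q. r (hproj M (q - a) (r' m))) ?S"
        by (rule additive_finsum[OF abM abN rC add fin]) (use that r'C hproj_carrier[OF M] in auto)
      then show "m = finsum N (\<lambda>q. r (hproj M (q - a) (r' m))) ?S" using sm that r'C by auto
    qed
  qed fact
  show ?thesis unfolding gfmodule_def
  proof (intro conjI allI ballI impI)
    show "module PR N" by fact
    show "additive_subgroup (qpart N q) N" for q unfolding qp by (rule sub) (rule gfmodule_qpart[OF M])
    show "\<exists>!c. hcomponents N m c" if "m \<in> carrier N" for m using hc[OF that] by auto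
    show "p \<odot>\<^bsub>N\<^esub> m \<in> qpart N (q + d)" if "homog d p" "m \<in> qpart N q" for d q p m
    proof -
      obtain x where x: "x \<in> qpart M (q - a)" "m = r x" using \<open>m \<in> qpart N q\<close> unfolding qp by blast
      have "p \<odot>\<^bsub>M\<^esub> x \<in> qpart M (q + d - a)" using gfmodule_smult_qpart[OF M that(1) x(1)] by (simp add: algebra_simps)
      then show ?thesis unfolding qp x(2) using smult[OF qpM[OF x(1)]] by (metis imageI)
    qed
    show "submodule (fil N k) PR N" for k
    proof (rule submodulePRI[OF modN])
      show "additive_subgroup (fil N k) N" unfolding fl by (rule sub) (rule gfmodule_fil_additive[OF M])
      show "p \<odot>\<^bsub>N\<^esub> x \<in> fil N k" if "x \<in> fil N k" for p x
      proof -
        obtain y where y: "y \<in> fil M (k - b)" "x = r y" using \<open>x \<in> fil N k\<close> unfolding fl by blast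
        show ?thesis unfolding fl y(2) smult[OF gfmodule_fil_carrier[OF M y(1)], symmetric]
          using gf_fil_closed(5)[OF M y(1)] by blast
      qed
    qed
    show "c q \<in> fil N k" if m: "m \<in> fil N k \<and> hcomponents N m c" for k m c q
    proof -
      obtain x where x: "x \<in> fil M (k - b)" "m = r x" using m fl by auto
      then have "c = (\<lambda>q. r (hproj M (q - a) x))"
        using hc[of m c] that gfmodule_fil_carrier[OF M x(1)] r' rC by auto
      then show ?thesis using hproj_fil[OF M x(1)] fl by auto
    qed
    show "fil N (k + 1) \<subseteq> fil N k" for k unfolding fl using gfmodule_fil_mono[OF M, of "k - b" "k+1-b"] by auto
  qed
qed

text \<open>The image of a module under an injection, used to place objects of any element type
  inside the universe type in which the apexes of roofs live.\<close>

definition gf_copy :: "('a \<Rightarrow> 'b) \<Rightarrow> ('r, 'a) gfmod \<Rightarrow> ('r, 'b) gfmod" where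
  "gf_copy g M = (let g' = inv_into (carrier M) g in
     \<lparr>carrier = g ` carrier M, monoid.mult = undefined, one = undefined, zero = g \<zero>\<^bsub>M\<^esub>,
      add = \<lambda>x y. g (g' x \<oplus>\<^bsub>M\<^esub> g' y), module.smult = \<lambda>p x. g (p \<odot>\<^bsub>M\<^esub> g' x),
      qpart = \<lambda>q. g ` qpart M q, fil = \<lambda>k. g ` fil M k\<rparr>)"

lemma gfmodule_gf_copy:
  fixes M :: "('n bpoly, 'a) gfmod"
  assumes "gfmodule M" "inj_on g (carrier M)"
  shows "gfmodule (gf_copy g M)"
  by (rule gfmodule_iso[OF assms(1), of g _ 0 0]) (use assms(2) in \<open>auto simp: gf_copy_def Let_def bij_betw_def\<close>)

subsection \<open>Filtered graded homomorphisms\<close>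

lemma gfhomD:
  assumes "gfhom M N f"
  shows "x \<in> carrier M \<Longrightarrow> f x \<in> carrier N"
    "x \<in> carrier M \<Longrightarrow> y \<in> carrier M \<Longrightarrow> f (x \<oplus>\<^bsub>M\<^esub> y) = f x \<oplus>\<^bsub>N\<^esub> f y"
    "x \<in> carrier M \<Longrightarrow> f (p \<odot>\<^bsub>M\<^esub> x) = p \<odot>\<^bsub>N\<^esub> f x"
    "x \<in> qpart M q \<Longrightarrow> f x \<in> qpart N q" "x \<in> fil M k \<Longrightarrow> f x \<in> fil N k"
  using assms by (auto simp: gfhom_def image_subset_iff)

lemma gfhomD0:
  assumes "gfmodule M" "gfmodule N" "gfhom M N f"
  shows "f \<zero>\<^bsub>M\<^esub> = \<zero>\<^bsub>N\<^esub>" "x \<in> carrier M \<Longrightarrow> f (\<ominus>\<^bsub>M\<^esub> x) = \<ominus>\<^bsub>N\<^esub> f x"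
    "x \<in> carrier M \<Longrightarrow> y \<in> carrier M \<Longrightarrow> f (x \<ominus>\<^bsub>M\<^esub> y) = f x \<ominus>\<^bsub>N\<^esub> f y"
  using additive_zero_inv[OF gfmodule_abelian_group[OF assms(1)] gfmodule_abelian_group[OF assms(2)], of f]
    gfhomD(1,2)[OF assms(3)] by auto

lemma gfhom_id: "gfhom M M (\<lambda>x. x)" by (auto simp: gfhom_def)

lemma gfhom_comp: "gfhom M N f \<Longrightarrow> gfhom N P g \<Longrightarrow> gfhom M P (\<lambda>x. g (f x))"
  unfolding gfhom_def by (auto simp: image_subset_iff Pi_iff)

text \<open>Morphisms are total functions of HOL whose values off the carrier are arbitrary. All
  conditions in \<open>gfhom\<close> read values on the carrier, since the graded and filtered
  pieces are contained in it.\<close>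

lemma gfhom_cong:
  assumes "gfmodule M" "gfhom M N f" "\<And>x. x \<in> carrier M \<Longrightarrow> f x = g x"
  shows "gfhom M N g"
proof -
  interpret module PR M using assms(1) by (rule gfmodule_module)
  have "x \<in> qpart M q \<Longrightarrow> x \<in> carrier M" "x \<in> fil M q \<Longrightarrow> x \<in> carrier M" for x q
    using gfmodule_qpart_carrier[OF assms(1)] gfmodule_fil_carrier[OF assms(1)] by auto
  then show ?thesis using assms(2,3) smult_closed unfolding gfhom_def by (simp add: image_subset_iff Pi_iff)
qed

lemma gfhom_zero:
  assumes "gfmodule M" "gfmodule N"
  shows "gfhom M N (\<lambda>_. \<zero>\<^bsub>N\<^esub>)"
proof -
  interpret N: module PR N using assms(2) by (rule gfmodule_module)
  show ?thesis using gf_fil_closed(1)[OF assms(2)] gf_qpart_closed(1)[OF assms(2)] N.smult_r_null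
    by (auto simp: gfhom_def)
qed

lemma gfhom_add:
  assumes "gfmodule M" "gfmodule N" "gfhom M N f" "gfhom M N g"
  shows "gfhom M N (\<lambda>x. f x \<oplus>\<^bsub>N\<^esub> g x)"
proof -
  interpret N: module PR N using assms(2) by (rule gfmodule_module)
  note f = gfhomD[OF assms(3)] and g = gfhomD[OF assms(4)]
  have "f x \<oplus>\<^bsub>N\<^esub> f y \<oplus>\<^bsub>N\<^esub> (g x \<oplus>\<^bsub>N\<^esub> g y) = f x \<oplus>\<^bsub>N\<^esub> g x \<oplus>\<^bsub>N\<^esub> (f y \<oplus>\<^bsub>N\<^esub> g y)"
    if "x \<in> carrier M" "y \<in> carrier M" for x y using that f g by (simp add: N.a_ac N.add.m_closed)
  then show ?thesis using f g N.smult_r_distr gf_fil_closed(2)[OF assms(2)] gf_qpart_closed(2)[OF assms(2)]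
    unfolding gfhom_def by (auto simp: N.add.m_closed)
qed

lemma gfhom_minus:
  assumes "gfmodule M" "gfmodule N" "gfhom M N f"
  shows "gfhom M N (\<lambda>x. \<ominus>\<^bsub>N\<^esub> f x)"
proof -
  interpret N: module PR N using assms(2) by (rule gfmodule_module)
  note f = gfhomD[OF assms(3)]
  show ?thesis using f N.smult_r_minus gf_fil_closed(3)[OF assms(2)] gf_qpart_closed(3)[OF assms(2)]
    unfolding gfhom_def by (auto simp: N.a_inv_closed N.minus_add)
qed

subsection \<open>Shifts, trivial modules and direct sums\<close>

lemma gfmodule_gf_triv: "gfmodule (gf_triv z :: ('n bpoly, 'a) gfmod)"
proof -
  have ab: "abelian_group (gf_triv z :: ('n bpoly, 'a) gfmod)" by (rule abelian_groupI) (auto simp: gf_triv_def)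
  interpret abelian_group "gf_triv z :: ('n bpoly, 'a) gfmod" by fact
  have md: "module PR (gf_triv z :: ('n bpoly, 'a) gfmod)" by (rule moduleI[OF cring_PR ab]) (auto simp: gf_triv_def)
  have sub: "additive_subgroup {z} (gf_triv z :: ('n bpoly, 'a) gfmod)"
    using a_inv_closed by (intro additive_subgroupI[OF ab]) (auto simp: gf_triv_def)
  have fs: "finsum (gf_triv z :: ('n bpoly, 'a) gfmod) c {} = z" for c :: "int \<Rightarrow> 'a"
    using finsum_empty by (simp add: gf_triv_def)
  have hc: "hcomponents (gf_triv z :: ('n bpoly, 'a) gfmod) m c \<longleftrightarrow> c = (\<lambda>_. z)" if "m = z" for m c
    unfolding hcomponents_def using fs that by (auto simp: gf_triv_def)
  show ?thesis unfolding gfmodule_def using md sub hc submodulePRI[OF md sub] by (auto simp: gf_triv_def)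
qed

lemma gfmodule_q_mod:
  fixes M :: "('n bpoly, 'a) gfmod"
  shows "gfmodule M \<Longrightarrow> gfmodule (q_mod r M)"
  by (rule gfmodule_iso[of M "\<lambda>x. x" _ r 0]) (auto simp: q_mod_def bij_betw_def)

lemma gfmodule_s_mod:
  fixes M :: "('n bpoly, 'a) gfmod"
  shows "gfmodule M \<Longrightarrow> gfmodule (s_mod r M)"
  by (rule gfmodule_iso[of M "\<lambda>x. x" _ 0 r]) (auto simp: s_mod_def bij_betw_def)

definition dsupp :: "('i \<Rightarrow> ('r, 'a) gfmod) \<Rightarrow> ('i \<Rightarrow> 'a) \<Rightarrow> 'i set" where
  "dsupp T c = {i. c i \<noteq> \<zero>\<^bsub>T i\<^esub>}"

lemma gf_dsum_simps:
  "c \<in> carrier (gf_dsum T) \<longleftrightarrow> (\<forall>i. c i \<in> carrier (T i)) \<and> finite (dsupp T c)"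
  "\<zero>\<^bsub>gf_dsum T\<^esub> = (\<lambda>i. \<zero>\<^bsub>T i\<^esub>)"
  "c \<oplus>\<^bsub>gf_dsum T\<^esub> c' = (\<lambda>i. c i \<oplus>\<^bsub>T i\<^esub> c' i)"
  "p \<odot>\<^bsub>gf_dsum T\<^esub> c = (\<lambda>i. p \<odot>\<^bsub>T i\<^esub> c i)"
  "c \<in> qpart (gf_dsum T) q \<longleftrightarrow> c \<in> carrier (gf_dsum T) \<and> (\<forall>i. c i \<in> qpart (T i) q)"
  "c \<in> fil (gf_dsum T) k \<longleftrightarrow> c \<in> carrier (gf_dsum T) \<and> (\<forall>i. c i \<in> fil (T i) k)"
  by (auto simp: gf_dsum_def Let_def dsupp_def)

text \<open>All axioms hold componentwise; what needs care is finiteness of supports. Negation is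
  not a field of the record but is derived from addition, so its componentwise form is recorded as a
  second conclusion.\<close>

lemma gfmodule_gf_dsum:
  fixes T :: "'i \<Rightarrow> ('n bpoly, 'a) gfmod"
  assumes T: "\<And>i. gfmodule (T i)"
  shows "gfmodule (gf_dsum T)"
    and "\<And>c i. c \<in> carrier (gf_dsum T) \<Longrightarrow> (\<ominus>\<^bsub>gf_dsum T\<^esub> c) i = \<ominus>\<^bsub>T i\<^esub> c i"
proof -
  let ?D = "gf_dsum T"
  note simps = gf_dsum_simps[where T=T]
  have Tm: "module PR (T i)" for i by (rule gfmodule_module[OF T])
  have Tab: "abelian_group (T i)" for i by (rule gfmodule_abelian_group[OF T])
  have supp_add: "finite (dsupp T (\<lambda>i. c i \<oplus>\<^bsub>T i\<^esub> c' i))" if "finite (dsupp T c)" "finite (dsupp T c')" for c c'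
  proof (rule finite_subset)
    show "dsupp T (\<lambda>i. c i \<oplus>\<^bsub>T i\<^esub> c' i) \<subseteq> dsupp T c \<union> dsupp T c'"
      using abelian_group.axioms(1)[OF Tab] abelian_monoid.l_zero abelian_monoid.zero_closed by (fastforce simp: dsupp_def)
  qed (use that in simp)
  have supp_map: "finite (dsupp T (\<lambda>i. f i (c i)))" if "finite (dsupp T c)" "\<And>i. f i \<zero>\<^bsub>T i\<^esub> = \<zero>\<^bsub>T i\<^esub>" for c f
    by (rule finite_subset[OF _ that(1)]) (use that(2) in \<open>auto simp: dsupp_def\<close>)
  have neg0: "\<ominus>\<^bsub>T i\<^esub> \<zero>\<^bsub>T i\<^esub> = \<zero>\<^bsub>T i\<^esub>" for i
    using abelian_group.minus_equality[OF Tab[of i]] abelian_monoid.zero_closed[OF abelian_group.axioms(1)[OF Tab]]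
      abelian_monoid.l_zero[OF abelian_group.axioms(1)[OF Tab]] by blast
  have negC: "(\<lambda>i. \<ominus>\<^bsub>T i\<^esub> c i) \<in> carrier ?D" if "c \<in> carrier ?D" for c
    using that supp_map[of c "\<lambda>i. a_inv (T i)", OF _ neg0] abelian_group.a_inv_closed[OF Tab] by (auto simp: simps)
  have neg: "c \<in> carrier ?D \<Longrightarrow> (\<lambda>i. \<ominus>\<^bsub>T i\<^esub> c i) \<oplus>\<^bsub>?D\<^esub> c = \<zero>\<^bsub>?D\<^esub>" for c
    using abelian_group.l_neg[OF Tab] by (auto simp: simps)
  have ab: "abelian_group ?D"
  proof (rule abelian_groupI)
    fix x y z assume x: "x \<in> carrier ?D" and y: "y \<in> carrier ?D" and z: "z \<in> carrier ?D"
    show "x \<oplus>\<^bsub>?D\<^esub> y \<in> carrier ?D" using x y supp_add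
      by (auto simp: simps intro: abelian_monoid.a_closed[OF abelian_group.axioms(1)[OF Tab]])
    show "x \<oplus>\<^bsub>?D\<^esub> y \<oplus>\<^bsub>?D\<^esub> z = x \<oplus>\<^bsub>?D\<^esub> (y \<oplus>\<^bsub>?D\<^esub> z)" using x y z
      by (auto simp: simps abelian_monoid.a_assoc[OF abelian_group.axioms(1)[OF Tab]])
    show "x \<oplus>\<^bsub>?D\<^esub> y = y \<oplus>\<^bsub>?D\<^esub> x" using x y
      by (auto simp: simps abelian_monoid.a_comm[OF abelian_group.axioms(1)[OF Tab]])
    show "\<zero>\<^bsub>?D\<^esub> \<oplus>\<^bsub>?D\<^esub> x = x" using x
      by (auto simp: simps abelian_monoid.l_zero[OF abelian_group.axioms(1)[OF Tab]])
    show "\<exists>y\<in>carrier ?D. y \<oplus>\<^bsub>?D\<^esub> x = \<zero>\<^bsub>?D\<^esub>" using negC[OF x] neg[OF x] by blast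
  next
    show "\<zero>\<^bsub>?D\<^esub> \<in> carrier ?D"
      by (auto simp: simps dsupp_def abelian_monoid.zero_closed[OF abelian_group.axioms(1)[OF Tab]])
  qed
  interpret D: abelian_group ?D by fact
  have inv: "\<ominus>\<^bsub>?D\<^esub> c = (\<lambda>i. \<ominus>\<^bsub>T i\<^esub> c i)" if "c \<in> carrier ?D" for c
    using D.minus_equality[OF neg[OF that] that negC[OF that]] .
  then show "\<And>c i. c \<in> carrier (gf_dsum T) \<Longrightarrow> (\<ominus>\<^bsub>gf_dsum T\<^esub> c) i = \<ominus>\<^bsub>T i\<^esub> c i" by simp
  have md: "module PR ?D"
  proof (rule moduleI[OF cring_PR ab])
    fix p q and x y assume x: "x \<in> carrier ?D"
    show "p \<odot>\<^bsub>?D\<^esub> x \<in> carrier ?D" using x supp_map[of x "\<lambda>i. module.smult (T i) p"]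
      module.smult_closed[OF Tm] module.smult_r_null[OF Tm] by (auto simp: simps)
    show "(p \<oplus>\<^bsub>PR\<^esub> q) \<odot>\<^bsub>?D\<^esub> x = p \<odot>\<^bsub>?D\<^esub> x \<oplus>\<^bsub>?D\<^esub> q \<odot>\<^bsub>?D\<^esub> x"
      using x module.smult_l_distr[OF Tm] by (auto simp: simps)
    show "(p \<otimes>\<^bsub>PR\<^esub> q) \<odot>\<^bsub>?D\<^esub> x = p \<odot>\<^bsub>?D\<^esub> (q \<odot>\<^bsub>?D\<^esub> x)"
      using x module.smult_assoc1[OF Tm] by (auto simp: simps)
    show "\<one>\<^bsub>PR\<^esub> \<odot>\<^bsub>?D\<^esub> x = x" using x module.smult_one[OF Tm] by (auto simp: simps)
    assume y: "y \<in> carrier ?D"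
    show "p \<odot>\<^bsub>?D\<^esub> (x \<oplus>\<^bsub>?D\<^esub> y) = p \<odot>\<^bsub>?D\<^esub> x \<oplus>\<^bsub>?D\<^esub> p \<odot>\<^bsub>?D\<^esub> y"
      using x y module.smult_r_distr[OF Tm] by (auto simp: simps)
  qed
  have sub: "additive_subgroup {c \<in> carrier ?D. \<forall>i. c i \<in> S i} ?D" if "\<And>i. additive_subgroup (S i) (T i)" for S
  proof (rule additive_subgroupI[OF ab])
    note S = additive_subgroupD[OF Tab that]
    show "\<zero>\<^bsub>?D\<^esub> \<in> {c \<in> carrier ?D. \<forall>i. c i \<in> S i}" using S(2) by (auto simp: simps(2)) (simp add: simps(2)[symmetric])
    show "x \<oplus>\<^bsub>?D\<^esub> y \<in> {c \<in> carrier ?D. \<forall>i. c i \<in> S i}"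
      if "x \<in> {c \<in> carrier ?D. \<forall>i. c i \<in> S i}" "y \<in> {c \<in> carrier ?D. \<forall>i. c i \<in> S i}" for x y
      using that S(3) D.a_closed[of x y] by (auto simp: gf_dsum_simps(3))
    show "\<ominus>\<^bsub>?D\<^esub> x \<in> {c \<in> carrier ?D. \<forall>i. c i \<in> S i}"
      if "x \<in> {c \<in> carrier ?D. \<forall>i. c i \<in> S i}" for x
      using that S(4) D.a_inv_closed[of x] by (auto simp: inv)
  qed auto
  have qp: "qpart ?D q = {c \<in> carrier ?D. \<forall>i. c i \<in> qpart (T i) q}"
    and fl: "fil ?D q = {c \<in> carrier ?D. \<forall>i. c i \<in> fil (T i) q}" for q by (auto simp: simps(5,6))
  have subq: "additive_subgroup (qpart ?D q) ?D" for q unfolding qp by (rule sub) (rule gfmodule_qpart[OF T])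
  have subf: "additive_subgroup (fil ?D q) ?D" for q unfolding fl by (rule sub) (rule gfmodule_fil_additive[OF T])
  define \<pi> where "\<pi> = (\<lambda>q c i. hproj (T i) q (c i))"
  have comp: "c i \<in> carrier (T i)" if "c \<in> carrier ?D" for c i using that by (simp add: simps)
  have pC: "\<pi> q c \<in> carrier ?D" if "c \<in> carrier ?D" for q c
    using that supp_map[of c "\<lambda>i. hproj (T i) q"] hproj_zero[OF T] hproj_carrier[OF T] by (auto simp: simps \<pi>_def)
  have fs: "finsum ?D f A i = finsum (T i) (\<lambda>q. f q i) A"
    if "finite A" "\<And>q. q \<in> A \<Longrightarrow> f q \<in> carrier ?D" for f :: "int \<Rightarrow> 'i \<Rightarrow> 'a" and A i
    by (rule additive_finsum[OF ab Tab]) (use that in \<open>auto simp: simps\<close>)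
  have hc: "hcomponents ?D m c \<longleftrightarrow> c = (\<lambda>q. \<pi> q m)" if m: "m \<in> carrier ?D" for m c
  proof (rule hcomponents_by_projections[OF ab subq _ _ _ _ _ m])
    show "\<pi> q m \<in> qpart ?D q" if "m \<in> carrier ?D" for q m
      using that pC[of m q] hproj_qpart[OF T comp] by (auto simp: qp \<pi>_def)
    show "\<pi> q (m \<oplus>\<^bsub>?D\<^esub> m') = \<pi> q m \<oplus>\<^bsub>?D\<^esub> \<pi> q m'" if "m \<in> carrier ?D" "m' \<in> carrier ?D" for q m m'
      using that hproj_add[OF T comp comp] by (auto simp: simps \<pi>_def)
    show "\<pi> q m = m" if "m \<in> qpart ?D q" for q m
    proof (rule ext)
      fix i have "m i \<in> qpart (T i) q" using that by (simp add: qp)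
      then show "\<pi> q m i = m i" using hproj_id[OF T] by (simp add: \<pi>_def)
    qed
    show "\<pi> q' m = \<zero>\<^bsub>?D\<^esub>" if "m \<in> qpart ?D q" "q' \<noteq> q" for q q' m
    proof (rule ext)
      fix i have "m i \<in> qpart (T i) q" using that by (simp add: qp)
      then show "\<pi> q' m i = \<zero>\<^bsub>?D\<^esub> i" using hproj_id[OF T] that(2) by (simp add: \<pi>_def gf_dsum_simps(2))
    qed
    show "\<exists>S. finite S \<and> (\<forall>q. q \<notin> S \<longrightarrow> \<pi> q m = \<zero>\<^bsub>?D\<^esub>) \<and> m = finsum ?D (\<lambda>q. \<pi> q m) S"
      if m: "m \<in> carrier ?D" for m
    proof (intro exI conjI)
      \<comment> \<open>Finitely many entries are nonzero and each has finitely many nonzero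
        components, so finitely many degrees occur in the whole family.\<close>
      let ?S = "\<Union>i\<in>dsupp T m. {q. hproj (T i) q (m i) \<noteq> \<zero>\<^bsub>T i\<^esub>}"
      show fin: "finite ?S" using m hproj_finite[OF T comp[OF m]] by (auto simp: simps)
      have z: "hproj (T i) q (m i) = \<zero>\<^bsub>T i\<^esub>" if "q \<notin> ?S" for q i
        using that hproj_zero[OF T] by (cases "i \<in> dsupp T m") (auto simp: dsupp_def)
      then show "\<forall>q. q \<notin> ?S \<longrightarrow> \<pi> q m = \<zero>\<^bsub>?D\<^esub>" by (auto simp: \<pi>_def simps)
      show "m = finsum ?D (\<lambda>q. \<pi> q m) ?S"
      proof (rule ext)
        fix i
        have "finsum (T i) (\<lambda>q. hproj (T i) q (m i)) ?S = m i"
          by (rule hproj_sum[OF T comp[OF m] fin]) (use z in blast)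
        then show "m i = finsum ?D (\<lambda>q. \<pi> q m) ?S i"
          using fs[OF fin, of "\<lambda>q. \<pi> q m"] pC[OF m] by (simp add: \<pi>_def)
      qed
    qed
  qed
  show "gfmodule ?D" unfolding gfmodule_def
  proof (intro conjI allI ballI impI)
    show "module PR ?D" by fact
    show "additive_subgroup (qpart ?D q) ?D" for q by (rule subq)
    show "\<exists>!c. hcomponents ?D m c" if "m \<in> carrier ?D" for m using hc[OF that] by auto
    show "p \<odot>\<^bsub>?D\<^esub> m \<in> qpart ?D (q + d)" if "homog d p" "m \<in> qpart ?D q" for d q p m
      using that gfmodule_smult_qpart[OF T] module.smult_closed[OF md, of p m] by (auto simp: gf_dsum_simps(4,5))
    show "submodule (fil ?D k) PR ?D" for k by (rule submodulePRI[OF md subf])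
        (use gf_fil_closed(5)[OF T] module.smult_closed[OF md] in \<open>auto simp: gf_dsum_simps(4,6)\<close>)
    show "c q \<in> fil ?D k" if "m \<in> fil ?D k \<and> hcomponents ?D m c" for k m c q
    proof -
      have "m \<in> carrier ?D" using that by (simp add: gf_dsum_simps(6))
      then have "c = (\<lambda>q. \<pi> q m)" using hc that by blast
      then show ?thesis using that pC hproj_fil[OF T] by (auto simp: gf_dsum_simps(6) \<pi>_def)
    qed
    show "fil ?D (k + 1) \<subseteq> fil ?D k" for k
      using subsetD[OF gfmodule_fil_mono[OF T, of k "k+1"]] by (auto simp: gf_dsum_simps(6))
  qed
qed

section \<open>The homotopy category of filtered complexes and its calculus of right
  fractions\<close>

section \<open>Filtered complexes\<close>

lemma fcomplexD:
  assumes "fcomplex C"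
  shows "gfmodule (cpart C k)" "gfhom (cpart C k) (cpart C (k - 1)) (cdif C k)"
    "x \<in> carrier (cpart C k) \<Longrightarrow> cdif C (k - 1) (cdif C k x) = \<zero>\<^bsub>cpart C (k - 2)\<^esub>"
  using assms by (auto simp: fcomplex_def)

text \<open>The differential indexed by its target. Homotopies and boundaries use it in this form,
  with \<open>k + 1 - 1\<close> already simplified.\<close>

lemma fcomplexD1:
  assumes "fcomplex C"
  shows "gfhom (cpart C (k + 1)) (cpart C k) (cdif C (k + 1))"
    "x \<in> carrier (cpart C (k + 1)) \<Longrightarrow> cdif C k (cdif C (k + 1) x) = \<zero>\<^bsub>cpart C (k - 1)\<^esub>"
  using fcomplexD(2)[OF assms, of "k + 1"] fcomplexD(3)[OF assms, of x "k + 1"] by (auto simp: algebra_simps)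

lemma fcomplex_ab: "fcomplex C \<Longrightarrow> abelian_group (cpart C k)"
  by (rule gfmodule_abelian_group[OF fcomplexD(1)])

lemma chmapD:
  assumes "chmap C D f"
  shows "gfhom (cpart C k) (cpart D k) (f k)"
    "x \<in> carrier (cpart C k) \<Longrightarrow> cdif D k (f k x) = f (k - 1) (cdif C k x)"
  using assms by (auto simp: chmap_def)

lemma chmapD1:
  assumes "chmap C D f" "x \<in> carrier (cpart C (k + 1))"
  shows "cdif D (k + 1) (f (k + 1) x) = f k (cdif C (k + 1) x)" using chmapD(2)[OF assms] by simp

lemma chmap_id: "chmap C C (\<lambda>k x. x)" by (simp add: chmap_def gfhom_id)

lemma chmap_comp:
  assumes f: "chmap C D f" and g: "chmap D E g"
  shows "chmap C E (\<lambda>k. g k \<circ> f k)" unfolding chmap_def comp_def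
  using gfhom_comp[OF chmapD(1)[OF f] chmapD(1)[OF g]] chmapD(2)[OF f]
    chmapD(2)[OF g gfhomD(1)[OF chmapD(1)[OF f]]] by simp

lemma chmap_zero:
  assumes "fcomplex C" "fcomplex D"
  shows "chmap C D (\<lambda>k x. \<zero>\<^bsub>cpart D k\<^esub>)"
  using gfhom_zero fcomplexD(1)[OF assms(1)] fcomplexD(1)[OF assms(2)]
    gfhomD0(1)[OF fcomplexD(1)[OF assms(2)] fcomplexD(1)[OF assms(2)] fcomplexD(2)[OF assms(2)]]
  by (auto simp: chmap_def)

lemma chmap_add:
  assumes "fcomplex C" "fcomplex D" "chmap C D f" "chmap C D g"
  shows "chmap C D (\<lambda>k x. f k x \<oplus>\<^bsub>cpart D k\<^esub> g k x)" unfolding chmap_def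
proof (intro allI conjI ballI)
  fix k
  show "gfhom (cpart C k) (cpart D k) (\<lambda>x. f k x \<oplus>\<^bsub>cpart D k\<^esub> g k x)"
    by (intro gfhom_add fcomplexD(1) chmapD(1) assms)
  fix x assume x: "x \<in> carrier (cpart C k)"
  show "cdif D k (f k x \<oplus>\<^bsub>cpart D k\<^esub> g k x) = f (k - 1) (cdif C k x) \<oplus>\<^bsub>cpart D (k - 1)\<^esub> g (k - 1) (cdif C k x)"
    by (simp only: gfhomD(2)[OF fcomplexD(2)[OF assms(2)] gfhomD(1)[OF chmapD(1)[OF assms(3)] x]
        gfhomD(1)[OF chmapD(1)[OF assms(4)] x]] chmapD(2)[OF assms(3) x] chmapD(2)[OF assms(4) x])
qed

lemma chmap_cong:
  assumes "fcomplex C" "chmap C D f" "\<And>k x. x \<in> carrier (cpart C k) \<Longrightarrow> f k x = g k x"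
  shows "chmap C D g" unfolding chmap_def
proof (intro allI conjI ballI)
  fix k
  show "gfhom (cpart C k) (cpart D k) (g k)"
    by (rule gfhom_cong[OF fcomplexD(1)[OF assms(1)] chmapD(1)[OF assms(2)] assms(3)])
  fix x assume x: "x \<in> carrier (cpart C k)"
  then have "cdif C k x \<in> carrier (cpart C (k - 1))" using gfhomD(1)[OF fcomplexD(2)[OF assms(1)]] by blast
  then show "cdif D k (g k x) = g (k - 1) (cdif C k x)" using chmapD(2)[OF assms(2) x] assms(3) x by simp
qed

subsection \<open>Homotopies\<close>

lemma fhomotopicI:
  assumes "\<And>k. gfhom (cpart C k) (cpart D (k + 1)) (h k)"
    "\<And>k x. x \<in> carrier (cpart C k) \<Longrightarrow>
       f k x = g k x \<oplus>\<^bsub>cpart D k\<^esub> (cdif D (k + 1) (h k x) \<oplus>\<^bsub>cpart D k\<^esub> h (k - 1) (cdif C k x))"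
  shows "fhomotopic C D f g" using assms unfolding fhomotopic_def by blast

lemma fhomotopicE:
  assumes "fhomotopic C D f g"
  obtains h where "\<And>k. gfhom (cpart C k) (cpart D (k + 1)) (h k)"
    "\<And>k x. x \<in> carrier (cpart C k) \<Longrightarrow>
       f k x = g k x \<oplus>\<^bsub>cpart D k\<^esub> (cdif D (k + 1) (h k x) \<oplus>\<^bsub>cpart D k\<^esub> h (k - 1) (cdif C k x))"
  using assms unfolding fhomotopic_def by blast

lemma homotopy_closed:
  assumes "fcomplex C" "fcomplex D" "\<And>k. gfhom (cpart C k) (cpart D (k + 1)) (h k)"
    "x \<in> carrier (cpart C k)"
  shows "h k x \<in> carrier (cpart D (k + 1))" "cdif D (k + 1) (h k x) \<in> carrier (cpart D k)"
    "cdif C k x \<in> carrier (cpart C (k - 1))" "h (k - 1) (cdif C k x) \<in> carrier (cpart D k)"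
proof -
  show 1: "h k x \<in> carrier (cpart D (k + 1))" by (rule gfhomD(1)[OF assms(3,4)])
  show "cdif D (k + 1) (h k x) \<in> carrier (cpart D k)" by (rule gfhomD(1)[OF fcomplexD1(1)[OF assms(2)] 1])
  show 2: "cdif C k x \<in> carrier (cpart C (k - 1))" by (rule gfhomD(1)[OF fcomplexD(2)[OF assms(1)] assms(4)])
  show "h (k - 1) (cdif C k x) \<in> carrier (cpart D k)" using gfhomD(1)[OF assms(3) 2] by simp
qed

text \<open>The zero homotopy. It turns equality on carriers, the natural equality of chain maps
  here, into the relation by which roofs are compared.\<close>

lemma fhomotopic_eqI:
  assumes "fcomplex C" "fcomplex D" "chmap C D f" "\<And>k x. x \<in> carrier (cpart C k) \<Longrightarrow> f k x = g k x"
  shows "fhomotopic C D f g"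
proof (rule fhomotopicI[where h = "\<lambda>k x. \<zero>\<^bsub>cpart D (k + 1)\<^esub>"])
  show "gfhom (cpart C k) (cpart D (k + 1)) (\<lambda>x. \<zero>\<^bsub>cpart D (k + 1)\<^esub>)" for k
    by (intro gfhom_zero fcomplexD(1) assms)
  fix k x assume x: "x \<in> carrier (cpart C k)"
  interpret D: abelian_group "cpart D k" by (rule fcomplex_ab[OF assms(2)])
  have "cdif D (k + 1) \<zero>\<^bsub>cpart D (k + 1)\<^esub> = \<zero>\<^bsub>cpart D k\<^esub>"
    by (rule gfhomD0(1)[OF fcomplexD(1)[OF assms(2)] fcomplexD(1)[OF assms(2)] fcomplexD1(1)[OF assms(2)]])
  then show "f k x = g k x \<oplus>\<^bsub>cpart D k\<^esub> (cdif D (k + 1) \<zero>\<^bsub>cpart D (k + 1)\<^esub> \<oplus>\<^bsub>cpart D k\<^esub> \<zero>\<^bsub>cpart D (k - 1 + 1)\<^esub>)"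
    using gfhomD(1)[OF chmapD(1)[OF assms(3)] x] assms(4)[OF x] by simp
qed

lemma fhomotopic_refl: "fcomplex C \<Longrightarrow> fcomplex D \<Longrightarrow> chmap C D f \<Longrightarrow> fhomotopic C D f f"
  by (rule fhomotopic_eqI) auto

lemma fhomotopic_sym:
  assumes "fcomplex C" "fcomplex D" "chmap C D g" "fhomotopic C D f g"
  shows "fhomotopic C D g f"
proof -
  obtain h where h: "\<And>k. gfhom (cpart C k) (cpart D (k + 1)) (h k)"
    "\<And>k x. x \<in> carrier (cpart C k) \<Longrightarrow>
       f k x = g k x \<oplus>\<^bsub>cpart D k\<^esub> (cdif D (k + 1) (h k x) \<oplus>\<^bsub>cpart D k\<^esub> h (k - 1) (cdif C k x))"
    using fhomotopicE[OF assms(4)] by blast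
  show ?thesis
  proof (rule fhomotopicI[where h = "\<lambda>k x. \<ominus>\<^bsub>cpart D (k + 1)\<^esub> h k x"])
    show "gfhom (cpart C k) (cpart D (k + 1)) (\<lambda>x. \<ominus>\<^bsub>cpart D (k + 1)\<^esub> h k x)" for k
      by (intro gfhom_minus fcomplexD(1) assms h)
    fix k x assume x: "x \<in> carrier (cpart C k)"
    interpret D: abelian_group "cpart D k" by (rule fcomplex_ab[OF assms(2)])
    note cl = homotopy_closed[OF assms(1,2) h(1) x] gfhomD(1)[OF chmapD(1)[OF assms(3)] x]
    have "cdif D (k + 1) (\<ominus>\<^bsub>cpart D (k + 1)\<^esub> h k x) = \<ominus>\<^bsub>cpart D k\<^esub> cdif D (k + 1) (h k x)"
      by (rule gfhomD0(2)[OF fcomplexD(1)[OF assms(2)] fcomplexD(1)[OF assms(2)] fcomplexD1(1)[OF assms(2)] cl(1)])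
    then show "g k x = f k x \<oplus>\<^bsub>cpart D k\<^esub> (cdif D (k + 1) (\<ominus>\<^bsub>cpart D (k + 1)\<^esub> h k x) \<oplus>\<^bsub>cpart D k\<^esub>
       \<ominus>\<^bsub>cpart D (k - 1 + 1)\<^esub> h (k - 1) (cdif C k x))"
      unfolding h(2)[OF x] using cl by (simp add: D.group_simps)
  qed
qed

lemma fhomotopic_trans:
  assumes "fcomplex C" "fcomplex D" "chmap C D l" "fhomotopic C D f g" "fhomotopic C D g l"
  shows "fhomotopic C D f l"
proof -
  obtain h where h: "\<And>k. gfhom (cpart C k) (cpart D (k + 1)) (h k)"
    "\<And>k x. x \<in> carrier (cpart C k) \<Longrightarrow>
       f k x = g k x \<oplus>\<^bsub>cpart D k\<^esub> (cdif D (k + 1) (h k x) \<oplus>\<^bsub>cpart D k\<^esub> h (k - 1) (cdif C k x))"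
    using fhomotopicE[OF assms(4)] by blast
  obtain h' where h': "\<And>k. gfhom (cpart C k) (cpart D (k + 1)) (h' k)"
    "\<And>k x. x \<in> carrier (cpart C k) \<Longrightarrow>
       g k x = l k x \<oplus>\<^bsub>cpart D k\<^esub> (cdif D (k + 1) (h' k x) \<oplus>\<^bsub>cpart D k\<^esub> h' (k - 1) (cdif C k x))"
    using fhomotopicE[OF assms(5)] by blast
  show ?thesis
  proof (rule fhomotopicI[where h = "\<lambda>k x. h k x \<oplus>\<^bsub>cpart D (k + 1)\<^esub> h' k x"])
    show "gfhom (cpart C k) (cpart D (k + 1)) (\<lambda>x. h k x \<oplus>\<^bsub>cpart D (k + 1)\<^esub> h' k x)" for k
      by (intro gfhom_add fcomplexD(1) assms h h')
    fix k x assume x: "x \<in> carrier (cpart C k)"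
    interpret D: abelian_group "cpart D k" by (rule fcomplex_ab[OF assms(2)])
    note cl = homotopy_closed[OF assms(1,2) h(1) x] homotopy_closed[OF assms(1,2) h'(1) x]
      gfhomD(1)[OF chmapD(1)[OF assms(3)] x]
    have "cdif D (k + 1) (h k x \<oplus>\<^bsub>cpart D (k + 1)\<^esub> h' k x)
        = cdif D (k + 1) (h k x) \<oplus>\<^bsub>cpart D k\<^esub> cdif D (k + 1) (h' k x)"
      by (rule gfhomD(2)[OF fcomplexD1(1)[OF assms(2)] cl(1) cl(5)])
    then show "f k x = l k x \<oplus>\<^bsub>cpart D k\<^esub> (cdif D (k + 1) (h k x \<oplus>\<^bsub>cpart D (k + 1)\<^esub> h' k x) \<oplus>\<^bsub>cpart D k\<^esub>
       (h (k - 1) (cdif C k x) \<oplus>\<^bsub>cpart D (k - 1 + 1)\<^esub> h' (k - 1) (cdif C k x)))"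
      unfolding h(2)[OF x] h'(2)[OF x] using cl by (simp add: D.a_ac)
  qed
qed

lemma fhomotopic_comp_left:
  assumes "fcomplex C" "fcomplex D" "fcomplex E" "chmap C D g" "chmap D E p" "fhomotopic C D f g"
  shows "fhomotopic C E (\<lambda>k. p k \<circ> f k) (\<lambda>k. p k \<circ> g k)"
proof -
  obtain h where h: "\<And>k. gfhom (cpart C k) (cpart D (k + 1)) (h k)"
    "\<And>k x. x \<in> carrier (cpart C k) \<Longrightarrow>
       f k x = g k x \<oplus>\<^bsub>cpart D k\<^esub> (cdif D (k + 1) (h k x) \<oplus>\<^bsub>cpart D k\<^esub> h (k - 1) (cdif C k x))"
    using fhomotopicE[OF assms(6)] by blast
  show ?thesis
  proof (rule fhomotopicI[where h = "\<lambda>k x. p (k + 1) (h k x)"])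
    show "gfhom (cpart C k) (cpart E (k + 1)) (\<lambda>x. p (k + 1) (h k x))" for k
      by (rule gfhom_comp[OF h(1) chmapD(1)[OF assms(5)]])
    fix k x assume x: "x \<in> carrier (cpart C k)"
    interpret D: abelian_group "cpart D k" by (rule fcomplex_ab[OF assms(2)])
    note cl = homotopy_closed[OF assms(1,2) h(1) x] gfhomD(1)[OF chmapD(1)[OF assms(4)] x]
    have "cdif E (k + 1) (p (k + 1) (h k x)) = p k (cdif D (k + 1) (h k x))" by (rule chmapD1[OF assms(5) cl(1)])
    then show "(p k \<circ> f k) x = (p k \<circ> g k) x \<oplus>\<^bsub>cpart E k\<^esub>
       (cdif E (k + 1) (p (k + 1) (h k x)) \<oplus>\<^bsub>cpart E k\<^esub> p (k - 1 + 1) (h (k - 1) (cdif C k x)))"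
      using cl gfhomD(2)[OF chmapD(1)[OF assms(5)]] by (simp add: h(2)[OF x])
  qed
qed

lemma fhomotopic_comp_right:
  assumes "chmap B C u" "fhomotopic C D f g"
  shows "fhomotopic B D (\<lambda>k. f k \<circ> u k) (\<lambda>k. g k \<circ> u k)"
proof -
  obtain h where h: "\<And>k. gfhom (cpart C k) (cpart D (k + 1)) (h k)"
    "\<And>k x. x \<in> carrier (cpart C k) \<Longrightarrow>
       f k x = g k x \<oplus>\<^bsub>cpart D k\<^esub> (cdif D (k + 1) (h k x) \<oplus>\<^bsub>cpart D k\<^esub> h (k - 1) (cdif C k x))"
    using fhomotopicE[OF assms(2)] by blast
  show ?thesis
  proof (rule fhomotopicI[where h = "\<lambda>k x. h k (u k x)"])
    show "gfhom (cpart B k) (cpart D (k + 1)) (\<lambda>x. h k (u k x))" for k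
      by (rule gfhom_comp[OF chmapD(1)[OF assms(1)] h(1)])
    fix k x assume x: "x \<in> carrier (cpart B k)"
    show "(f k \<circ> u k) x = (g k \<circ> u k) x \<oplus>\<^bsub>cpart D k\<^esub>
       (cdif D (k + 1) (h k (u k x)) \<oplus>\<^bsub>cpart D k\<^esub> h (k - 1) (u (k - 1) (cdif B k x)))"
      using h(2)[OF gfhomD(1)[OF chmapD(1)[OF assms(1)] x]] chmapD(2)[OF assms(1) x] by simp
  qed
qed

lemma fhomotopic_add:
  assumes "fcomplex C" "fcomplex D" "chmap C D g" "chmap C D g'" "fhomotopic C D f g" "fhomotopic C D f' g'"
  shows "fhomotopic C D (\<lambda>k x. f k x \<oplus>\<^bsub>cpart D k\<^esub> f' k x) (\<lambda>k x. g k x \<oplus>\<^bsub>cpart D k\<^esub> g' k x)"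
proof -
  obtain h where h: "\<And>k. gfhom (cpart C k) (cpart D (k + 1)) (h k)"
    "\<And>k x. x \<in> carrier (cpart C k) \<Longrightarrow>
       f k x = g k x \<oplus>\<^bsub>cpart D k\<^esub> (cdif D (k + 1) (h k x) \<oplus>\<^bsub>cpart D k\<^esub> h (k - 1) (cdif C k x))"
    using fhomotopicE[OF assms(5)] by blast
  obtain h' where h': "\<And>k. gfhom (cpart C k) (cpart D (k + 1)) (h' k)"
    "\<And>k x. x \<in> carrier (cpart C k) \<Longrightarrow>
       f' k x = g' k x \<oplus>\<^bsub>cpart D k\<^esub> (cdif D (k + 1) (h' k x) \<oplus>\<^bsub>cpart D k\<^esub> h' (k - 1) (cdif C k x))"
    using fhomotopicE[OF assms(6)] by blast
  show ?thesis
  proof (rule fhomotopicI[where h = "\<lambda>k x. h k x \<oplus>\<^bsub>cpart D (k + 1)\<^esub> h' k x"])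
    show "gfhom (cpart C k) (cpart D (k + 1)) (\<lambda>x. h k x \<oplus>\<^bsub>cpart D (k + 1)\<^esub> h' k x)" for k
      by (intro gfhom_add fcomplexD(1) assms h h')
    fix k x assume x: "x \<in> carrier (cpart C k)"
    interpret D: abelian_group "cpart D k" by (rule fcomplex_ab[OF assms(2)])
    note cl = homotopy_closed[OF assms(1,2) h(1) x] homotopy_closed[OF assms(1,2) h'(1) x]
      gfhomD(1)[OF chmapD(1)[OF assms(3)] x] gfhomD(1)[OF chmapD(1)[OF assms(4)] x]
    have "cdif D (k + 1) (h k x \<oplus>\<^bsub>cpart D (k + 1)\<^esub> h' k x)
        = cdif D (k + 1) (h k x) \<oplus>\<^bsub>cpart D k\<^esub> cdif D (k + 1) (h' k x)"
      by (rule gfhomD(2)[OF fcomplexD1(1)[OF assms(2)] cl(1) cl(5)])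
    then show "f k x \<oplus>\<^bsub>cpart D k\<^esub> f' k x = g k x \<oplus>\<^bsub>cpart D k\<^esub> g' k x \<oplus>\<^bsub>cpart D k\<^esub>
       (cdif D (k + 1) (h k x \<oplus>\<^bsub>cpart D (k + 1)\<^esub> h' k x) \<oplus>\<^bsub>cpart D k\<^esub>
       (h (k - 1) (cdif C k x) \<oplus>\<^bsub>cpart D (k - 1 + 1)\<^esub> h' (k - 1) (cdif C k x)))"
      unfolding h(2)[OF x] h'(2)[OF x] using cl by (simp add: D.a_ac)
  qed
qed

subsection \<open>Filtered quasi-isomorphisms\<close>

lemma gr_cyclesD:
  assumes "x \<in> gr_cycles C i k"
  shows "x \<in> fil (cpart C k) i" "cdif C k x \<in> fil (cpart C (k - 1)) (i + 1)"
  using assms by (auto simp: gr_cycles_def)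

text \<open>Solving for the summand in F^{i+1} removes one existential: a lifted boundary is an
  element that agrees with some d y, for y in F^i, up to F^{i+1}.\<close>

lemma gr_boundaries_iff:
  assumes C: "fcomplex C"
  shows "x \<in> gr_boundaries C i k \<longleftrightarrow> x \<in> carrier (cpart C k) \<and>
    (\<exists>y\<in>fil (cpart C (k + 1)) i. x \<ominus>\<^bsub>cpart C k\<^esub> cdif C (k + 1) y \<in> fil (cpart C k) (i + 1))"
proof -
  interpret M: abelian_group "cpart C k" by (rule fcomplex_ab[OF C])
  note fc = gfmodule_fil_carrier[OF fcomplexD(1)[OF C]]
  have dc: "cdif C (k + 1) y \<in> carrier (cpart C k)" if "y \<in> fil (cpart C (k + 1)) i" for y
    using gfhomD(1)[OF fcomplexD1(1)[OF C]] fc[OF that] by blast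
  show ?thesis
  proof safe
    assume "x \<in> gr_boundaries C i k"
    then obtain y w where yw: "x = cdif C (k + 1) y \<oplus>\<^bsub>cpart C k\<^esub> w" "y \<in> fil (cpart C (k + 1)) i"
      "w \<in> fil (cpart C k) (i + 1)" by (auto simp: gr_boundaries_def)
    show "x \<in> carrier (cpart C k)" using yw dc fc by auto
    have "x \<ominus>\<^bsub>cpart C k\<^esub> cdif C (k + 1) y = w"
      unfolding yw(1) using dc[OF yw(2)] fc[OF yw(3)] by (simp add: M.group_simps)
    then show "\<exists>y\<in>fil (cpart C (k + 1)) i. x \<ominus>\<^bsub>cpart C k\<^esub> cdif C (k + 1) y \<in> fil (cpart C k) (i + 1)"
      using yw(2,3) by (intro bexI[OF _ yw(2)]) simp
  next
    fix y assume x: "x \<in> carrier (cpart C k)" and y: "y \<in> fil (cpart C (k + 1)) i"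
      and w: "x \<ominus>\<^bsub>cpart C k\<^esub> cdif C (k + 1) y \<in> fil (cpart C k) (i + 1)"
    have "x = cdif C (k + 1) y \<oplus>\<^bsub>cpart C k\<^esub> (x \<ominus>\<^bsub>cpart C k\<^esub> cdif C (k + 1) y)"
      using x dc[OF y] by (simp add: M.group_simps)
    then show "x \<in> gr_boundaries C i k" using y w unfolding gr_boundaries_def by blast
  qed
qed

lemma gr_cycles_subgroup:
  assumes C: "fcomplex C"
  shows "additive_subgroup (gr_cycles C i k) (cpart C k)"
proof (rule additive_subgroupI[OF fcomplex_ab[OF C]])
  note C1 = fcomplexD(1)[OF C] and d = fcomplexD(2)[OF C]
  note fc = gfmodule_fil_carrier[OF C1]
  show "gr_cycles C i k \<subseteq> carrier (cpart C k)" using fc by (auto simp: gr_cycles_def)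
  show "\<zero>\<^bsub>cpart C k\<^esub> \<in> gr_cycles C i k"
    using gf_fil_closed(1)[OF C1] gfhomD0(1)[OF C1 C1 d] by (auto simp: gr_cycles_def)
  show "x \<oplus>\<^bsub>cpart C k\<^esub> y \<in> gr_cycles C i k" if "x \<in> gr_cycles C i k" "y \<in> gr_cycles C i k" for x y
    using that gf_fil_closed(2)[OF C1] gfhomD(2)[OF d fc fc] by (auto simp: gr_cycles_def)
  show "\<ominus>\<^bsub>cpart C k\<^esub> x \<in> gr_cycles C i k" if "x \<in> gr_cycles C i k" for x
    using that gf_fil_closed(3)[OF C1] gfhomD0(2)[OF C1 C1 d fc] by (auto simp: gr_cycles_def)
qed

lemma gr_boundaries_subgroup:
  assumes C: "fcomplex C"
  shows "additive_subgroup (gr_boundaries C i k) (cpart C k)"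
proof (rule additive_subgroupI[OF fcomplex_ab[OF C]])
  note C1 = fcomplexD(1)[OF C] and d = fcomplexD1(1)[OF C]
  note fc = gfmodule_fil_carrier[OF C1]
  interpret M: abelian_group "cpart C k" by (rule fcomplex_ab[OF C])
  show "gr_boundaries C i k \<subseteq> carrier (cpart C k)" using gr_boundaries_iff[OF C] by blast
  show "\<zero>\<^bsub>cpart C k\<^esub> \<in> gr_boundaries C i k"
    unfolding gr_boundaries_iff[OF C] using gf_fil_closed(1)[OF C1] gfhomD0(1)[OF C1 C1 d]
    by (auto intro!: bexI[of _ "\<zero>\<^bsub>cpart C (k + 1)\<^esub>"] simp: M.group_simps)
  show "x \<oplus>\<^bsub>cpart C k\<^esub> y \<in> gr_boundaries C i k" if xy: "x \<in> gr_boundaries C i k" "y \<in> gr_boundaries C i k" for x y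
  proof -
    obtain x' u where x: "x = cdif C (k + 1) x' \<oplus>\<^bsub>cpart C k\<^esub> u" "x' \<in> fil (cpart C (k + 1)) i"
      "u \<in> fil (cpart C k) (i + 1)" using xy by (auto simp: gr_boundaries_def)
    obtain y' w where y: "y = cdif C (k + 1) y' \<oplus>\<^bsub>cpart C k\<^esub> w" "y' \<in> fil (cpart C (k + 1)) i"
      "w \<in> fil (cpart C k) (i + 1)" using xy by (auto simp: gr_boundaries_def)
    have "x \<oplus>\<^bsub>cpart C k\<^esub> y = cdif C (k + 1) (x' \<oplus>\<^bsub>cpart C (k + 1)\<^esub> y') \<oplus>\<^bsub>cpart C k\<^esub> (u \<oplus>\<^bsub>cpart C k\<^esub> w)"
      unfolding gfhomD(2)[OF d fc[OF x(2)] fc[OF y(2)]] x(1) y(1)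
      using fc[OF x(3)] fc[OF y(3)] gfhomD(1)[OF d fc[OF x(2)]] gfhomD(1)[OF d fc[OF y(2)]] by (simp add: M.a_ac)
    then show ?thesis unfolding gr_boundaries_def
      using gf_fil_closed(2)[OF C1 x(2) y(2)] gf_fil_closed(2)[OF C1 x(3) y(3)] by blast
  qed
  show "\<ominus>\<^bsub>cpart C k\<^esub> x \<in> gr_boundaries C i k" if xy: "x \<in> gr_boundaries C i k" for x
  proof -
    obtain x' u where x: "x = cdif C (k + 1) x' \<oplus>\<^bsub>cpart C k\<^esub> u" "x' \<in> fil (cpart C (k + 1)) i"
      "u \<in> fil (cpart C k) (i + 1)" using xy by (auto simp: gr_boundaries_def)
    have "\<ominus>\<^bsub>cpart C k\<^esub> x = cdif C (k + 1) (\<ominus>\<^bsub>cpart C (k + 1)\<^esub> x') \<oplus>\<^bsub>cpart C k\<^esub> (\<ominus>\<^bsub>cpart C k\<^esub> u)"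
      unfolding gfhomD0(2)[OF C1 C1 d fc[OF x(2)]] x(1)
      using fc[OF x(3)] gfhomD(1)[OF d fc[OF x(2)]] by (simp add: M.minus_add)
    then show ?thesis unfolding gr_boundaries_def
      using gf_fil_closed(3)[OF C1 x(2)] gf_fil_closed(3)[OF C1 x(3)] by blast
  qed
qed

lemma coset_eq_iff:
  assumes "abelian_group M" "additive_subgroup B M" "x \<in> carrier M" "y \<in> carrier M"
  shows "B +>\<^bsub>M\<^esub> x = B +>\<^bsub>M\<^esub> y \<longleftrightarrow> x \<ominus>\<^bsub>M\<^esub> y \<in> B"
proof -
  interpret M: abelian_group M by fact
  note B = additive_subgroupD[OF assms(1,2)]
  show ?thesis
  proof
    assume "B +>\<^bsub>M\<^esub> x = B +>\<^bsub>M\<^esub> y"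
    moreover have "x \<in> B +>\<^bsub>M\<^esub> x" using B(2) assms(3) by (force simp: a_r_coset_def')
    ultimately obtain b where b: "b \<in> B" "x = b \<oplus>\<^bsub>M\<^esub> y" by (auto simp: a_r_coset_def')
    then have "x \<ominus>\<^bsub>M\<^esub> y = b" using subsetD[OF B(1) b(1)] assms(4) by (simp add: M.group_simps)
    then show "x \<ominus>\<^bsub>M\<^esub> y \<in> B" using b by simp
  next
    assume d: "x \<ominus>\<^bsub>M\<^esub> y \<in> B"
    have 1: "b \<oplus>\<^bsub>M\<^esub> x = (b \<oplus>\<^bsub>M\<^esub> (x \<ominus>\<^bsub>M\<^esub> y)) \<oplus>\<^bsub>M\<^esub> y" if "b \<in> B" for b
      using subsetD[OF B(1) that] assms(3,4) by (simp add: M.group_simps)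
    have 2: "b \<oplus>\<^bsub>M\<^esub> y = (b \<ominus>\<^bsub>M\<^esub> (x \<ominus>\<^bsub>M\<^esub> y)) \<oplus>\<^bsub>M\<^esub> x" if "b \<in> B" for b
      using subsetD[OF B(1) that] assms(3,4) by (simp add: M.group_simps)
    show "B +>\<^bsub>M\<^esub> x = B +>\<^bsub>M\<^esub> y"
    proof
      show "B +>\<^bsub>M\<^esub> x \<subseteq> B +>\<^bsub>M\<^esub> y"
      proof
        fix z assume "z \<in> B +>\<^bsub>M\<^esub> x"
        then obtain b where "b \<in> B" "z = b \<oplus>\<^bsub>M\<^esub> x" by (auto simp: a_r_coset_def')
        with 1[of b] B(3)[OF _ d, of b] show "z \<in> B +>\<^bsub>M\<^esub> y" unfolding a_r_coset_def' by blast
      qed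
      show "B +>\<^bsub>M\<^esub> y \<subseteq> B +>\<^bsub>M\<^esub> x"
      proof
        fix z assume "z \<in> B +>\<^bsub>M\<^esub> y"
        then obtain b where "b \<in> B" "z = b \<oplus>\<^bsub>M\<^esub> y" by (auto simp: a_r_coset_def')
        with 2[of b] B(5)[OF _ d, of b] show "z \<in> B +>\<^bsub>M\<^esub> x" unfolding a_r_coset_def' by blast
      qed
    qed
  qed
qed

text \<open>The induced map sends the coset of z to the coset of f z. It is injective when only
  elements of \<open>B\<close> are sent into \<open>B'\<close>, and surjective when every element of
  \<open>Z'\<close> is hit up to \<open>B'\<close>; no cosets remain on the right-hand side.\<close>

lemma coset_bij_iff:
  assumes M: "abelian_group M" and N: "abelian_group N"
    and f: "\<And>x. x \<in> carrier M \<Longrightarrow> f x \<in> carrier N"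
      "\<And>x y. x \<in> carrier M \<Longrightarrow> y \<in> carrier M \<Longrightarrow> f (x \<oplus>\<^bsub>M\<^esub> y) = f x \<oplus>\<^bsub>N\<^esub> f y"
    and sub: "additive_subgroup B M" "additive_subgroup Z M" "additive_subgroup B' N" "additive_subgroup Z' N"
    and fZ: "f ` Z \<subseteq> Z'" and fB: "f ` B \<subseteq> B'"
  shows "bij_betw (\<lambda>S. B' <+>\<^bsub>N\<^esub> f ` S) ((\<lambda>z. B +>\<^bsub>M\<^esub> z) ` Z) ((\<lambda>z. B' +>\<^bsub>N\<^esub> z) ` Z')
    \<longleftrightarrow> (\<forall>x\<in>Z. f x \<in> B' \<longrightarrow> x \<in> B) \<and> (\<forall>y\<in>Z'. \<exists>x\<in>Z. y \<ominus>\<^bsub>N\<^esub> f x \<in> B')"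
proof -
  interpret M: abelian_group M by fact
  interpret N: abelian_group N by fact
  note B = additive_subgroupD[OF M sub(1)] and Z = additive_subgroupD[OF M sub(2)]
  note B' = additive_subgroupD[OF N sub(3)] and Z' = additive_subgroupD[OF N sub(4)]
  have fm: "f (x \<ominus>\<^bsub>M\<^esub> y) = f x \<ominus>\<^bsub>N\<^esub> f y" if "x \<in> carrier M" "y \<in> carrier M" for x y
    by (rule additive_zero_inv(3)[OF M N _ f(2) that]) (use f(1) in auto)
  have F: "B' <+>\<^bsub>N\<^esub> f ` (B +>\<^bsub>M\<^esub> z) = B' +>\<^bsub>N\<^esub> f z" if z: "z \<in> carrier M" for z
  proof -
    \<comment> \<open>The image of a coset of \<open>B\<close> need not be a full coset of
      \<open>B'\<close>; adding \<open>B'\<close> absorbs the image of \<open>B\<close> and makes it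
      one.\<close>
    have "b' \<oplus>\<^bsub>N\<^esub> f (b \<oplus>\<^bsub>M\<^esub> z) = (b' \<oplus>\<^bsub>N\<^esub> f b) \<oplus>\<^bsub>N\<^esub> f z" if "b' \<in> B'" "b \<in> B" for b' b
      using f z subsetD[OF B(1) that(2)] subsetD[OF B'(1) that(1)] by (simp add: N.a_assoc)
    moreover have "b' \<oplus>\<^bsub>N\<^esub> f b \<in> B'" if "b' \<in> B'" "b \<in> B" for b' b
      using B'(3) that fB by blast
    moreover have "b' \<oplus>\<^bsub>N\<^esub> f z = b' \<oplus>\<^bsub>N\<^esub> f (\<zero>\<^bsub>M\<^esub> \<oplus>\<^bsub>M\<^esub> z)" if "b' \<in> B'" for b' using z by simp
    ultimately show ?thesis using B(2) unfolding a_r_coset_def' set_add_defs(1) set_mult_def by fastforce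
  qed
  have cM: "B +>\<^bsub>M\<^esub> x = B +>\<^bsub>M\<^esub> y \<longleftrightarrow> x \<ominus>\<^bsub>M\<^esub> y \<in> B" if "x \<in> Z" "y \<in> Z" for x y
    by (rule coset_eq_iff[OF M sub(1)]) (use that Z in auto)
  have cN: "B' +>\<^bsub>N\<^esub> x = B' +>\<^bsub>N\<^esub> y \<longleftrightarrow> x \<ominus>\<^bsub>N\<^esub> y \<in> B'" if "x \<in> Z'" "y \<in> Z'" for x y
    by (rule coset_eq_iff[OF N sub(3)]) (use that Z' in auto)
  have FZ: "(\<lambda>S. B' <+>\<^bsub>N\<^esub> f ` S) ` (\<lambda>z. B +>\<^bsub>M\<^esub> z) ` Z = (\<lambda>z. B' +>\<^bsub>N\<^esub> f z) ` Z"
    unfolding image_image using F Z(1) by (intro image_cong) auto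
  have "inj_on (\<lambda>S. B' <+>\<^bsub>N\<^esub> f ` S) ((\<lambda>z. B +>\<^bsub>M\<^esub> z) ` Z) \<longleftrightarrow> (\<forall>x\<in>Z. f x \<in> B' \<longrightarrow> x \<in> B)" (is "?I = ?J")
  proof -
    have "?I \<longleftrightarrow> (\<forall>x\<in>Z. \<forall>y\<in>Z. B' +>\<^bsub>N\<^esub> f x = B' +>\<^bsub>N\<^esub> f y \<longrightarrow> B +>\<^bsub>M\<^esub> x = B +>\<^bsub>M\<^esub> y)"
      unfolding inj_on_def using F Z(1) by (auto simp: subset_iff)
    also have "\<dots> \<longleftrightarrow> (\<forall>x\<in>Z. \<forall>y\<in>Z. f (x \<ominus>\<^bsub>M\<^esub> y) \<in> B' \<longrightarrow> x \<ominus>\<^bsub>M\<^esub> y \<in> B)"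
      using cM cN fZ fm Z(1) by (auto simp: subset_iff image_subset_iff)
    also have "\<dots> \<longleftrightarrow> ?J"
    proof
      assume *: "\<forall>x\<in>Z. \<forall>y\<in>Z. f (x \<ominus>\<^bsub>M\<^esub> y) \<in> B' \<longrightarrow> x \<ominus>\<^bsub>M\<^esub> y \<in> B"
      have "x \<ominus>\<^bsub>M\<^esub> \<zero>\<^bsub>M\<^esub> = x" if "x \<in> Z" for x using subsetD[OF Z(1) that] by (simp add: M.group_simps)
      then show ?J using * Z(2) by metis
    qed (use Z(5) in blast)
    finally show ?thesis .
  qed
  moreover have "(\<lambda>S. B' <+>\<^bsub>N\<^esub> f ` S) ` (\<lambda>z. B +>\<^bsub>M\<^esub> z) ` Z = (\<lambda>z. B' +>\<^bsub>N\<^esub> z) ` Z' \<longleftrightarrow>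
     (\<forall>y\<in>Z'. \<exists>x\<in>Z. y \<ominus>\<^bsub>N\<^esub> f x \<in> B')"
  proof -
    have "(\<lambda>z. B' +>\<^bsub>N\<^esub> f z) ` Z \<subseteq> (\<lambda>z. B' +>\<^bsub>N\<^esub> z) ` Z'" using fZ by auto
    then have "(\<lambda>z. B' +>\<^bsub>N\<^esub> f z) ` Z = (\<lambda>z. B' +>\<^bsub>N\<^esub> z) ` Z' \<longleftrightarrow>
        (\<forall>y\<in>Z'. \<exists>x\<in>Z. B' +>\<^bsub>N\<^esub> y = B' +>\<^bsub>N\<^esub> f x)"
      unfolding set_eq_subset image_subset_iff image_iff by blast
    also have "\<dots> \<longleftrightarrow> (\<forall>y\<in>Z'. \<exists>x\<in>Z. y \<ominus>\<^bsub>N\<^esub> f x \<in> B')" using cN fZ by (auto simp: image_subset_iff)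
    finally show ?thesis unfolding FZ .
  qed
  ultimately show ?thesis unfolding bij_betw_def by blast
qed

lemma chmap_gr_cycles:
  assumes "fcomplex C" "chmap C D f" "x \<in> gr_cycles C i k"
  shows "f k x \<in> gr_cycles D i k"
  using assms gfhomD(5)[OF chmapD(1)[OF assms(2)]] chmapD(2)[OF assms(2)] gfmodule_fil_carrier[OF fcomplexD(1)[OF assms(1)]]
  by (auto simp: gr_cycles_def)

lemma chmap_gr_boundaries:
  assumes "fcomplex C" "chmap C D f" "x \<in> gr_boundaries C i k"
  shows "f k x \<in> gr_boundaries D i k"
proof -
  note fc = gfmodule_fil_carrier[OF fcomplexD(1)[OF assms(1)]]
  obtain y w where yw: "x = cdif C (k + 1) y \<oplus>\<^bsub>cpart C k\<^esub> w" "y \<in> fil (cpart C (k + 1)) i"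
    "w \<in> fil (cpart C k) (i + 1)" using assms(3) by (auto simp: gr_boundaries_def)
  have "f k x = cdif D (k + 1) (f (k + 1) y) \<oplus>\<^bsub>cpart D k\<^esub> f k w"
    unfolding yw(1) chmapD1[OF assms(2) fc[OF yw(2)]]
    by (rule gfhomD(2)[OF chmapD(1)[OF assms(2)] gfhomD(1)[OF fcomplexD1(1)[OF assms(1)] fc[OF yw(2)]] fc[OF yw(3)]])
  then show ?thesis unfolding gr_boundaries_def using gfhomD(5)[OF chmapD(1)[OF assms(2)]] yw(2,3) by blast
qed

text \<open>The arguments about filtered quasi-isomorphisms below run through this form: two
  conditions on elements for each graded piece, one for injectivity on homology and one for
  surjectivity.\<close>

lemma fqis_iff:
  assumes C: "fcomplex C" and D: "fcomplex D"
  shows "fqis C D f \<longleftrightarrow> chmap C D f \<and>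
    (\<forall>i k. (\<forall>x\<in>gr_cycles C i k. f k x \<in> gr_boundaries D i k \<longrightarrow> x \<in> gr_boundaries C i k) \<and>
      (\<forall>y\<in>gr_cycles D i k. \<exists>x\<in>gr_cycles C i k. y \<ominus>\<^bsub>cpart D k\<^esub> f k x \<in> gr_boundaries D i k))"
proof (cases "chmap C D f")
  case True
  note f = gfhomD[OF chmapD(1)[OF True]]
  have "bij_betw (\<lambda>Z. gr_boundaries D i k <+>\<^bsub>cpart D k\<^esub> f k ` Z) (gr_homology C i k) (gr_homology D i k) \<longleftrightarrow>
     (\<forall>x\<in>gr_cycles C i k. f k x \<in> gr_boundaries D i k \<longrightarrow> x \<in> gr_boundaries C i k) \<and>
      (\<forall>y\<in>gr_cycles D i k. \<exists>x\<in>gr_cycles C i k. y \<ominus>\<^bsub>cpart D k\<^esub> f k x \<in> gr_boundaries D i k)" for i k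
    unfolding gr_homology_def
    by (rule coset_bij_iff[OF fcomplex_ab[OF C] fcomplex_ab[OF D] f(1,2) gr_boundaries_subgroup[OF C]
        gr_cycles_subgroup[OF C] gr_boundaries_subgroup[OF D] gr_cycles_subgroup[OF D]])
      (use chmap_gr_cycles[OF C True] chmap_gr_boundaries[OF C True] in auto)
  then show ?thesis using True by (simp add: fqis_def)
qed (simp add: fqis_def)

lemma fqisD:
  assumes "fcomplex C" "fcomplex D" "fqis C D f"
  shows "chmap C D f"
    "x \<in> gr_cycles C i k \<Longrightarrow> f k x \<in> gr_boundaries D i k \<Longrightarrow> x \<in> gr_boundaries C i k"
    "y \<in> gr_cycles D i k \<Longrightarrow> \<exists>x\<in>gr_cycles C i k. y \<ominus>\<^bsub>cpart D k\<^esub> f k x \<in> gr_boundaries D i k"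
  using assms(3) fqis_iff[OF assms(1,2)] by auto

lemma gr_cycles_carrier: "fcomplex C \<Longrightarrow> x \<in> gr_cycles C i k \<Longrightarrow> x \<in> carrier (cpart C k)"
  by (rule gfmodule_fil_carrier[OF fcomplexD(1) gr_cyclesD(1)])

lemma fqis_comp:
  assumes C: "fcomplex C" and D: "fcomplex D" and A: "fcomplex A" and u: "fqis C D u" and s: "fqis D A s"
  shows "fqis C A (\<lambda>k. s k \<circ> u k)" unfolding fqis_iff[OF C A]
proof (intro conjI allI ballI impI)
  note u' = fqisD[OF C D u] and s' = fqisD[OF D A s]
  show "chmap C A (\<lambda>k. s k \<circ> u k)" by (rule chmap_comp[OF u'(1) s'(1)])
  fix i k
  show "x \<in> gr_boundaries C i k" if "x \<in> gr_cycles C i k" "(s k \<circ> u k) x \<in> gr_boundaries A i k" for x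
    using that u'(2) s'(2) chmap_gr_cycles[OF C u'(1)] by auto
  fix y assume y: "y \<in> gr_cycles A i k"
  obtain x where x: "x \<in> gr_cycles D i k" "y \<ominus>\<^bsub>cpart A k\<^esub> s k x \<in> gr_boundaries A i k" using s'(3)[OF y] by blast
  obtain w where w: "w \<in> gr_cycles C i k" "x \<ominus>\<^bsub>cpart D k\<^esub> u k w \<in> gr_boundaries D i k" using u'(3)[OF x(1)] by blast
  interpret A: abelian_group "cpart A k" by (rule fcomplex_ab[OF A])
  have uw: "u k w \<in> gr_cycles D i k" by (rule chmap_gr_cycles[OF C u'(1) w(1)])
  note sg = gfhomD(1)[OF chmapD(1)[OF s'(1)]]
  have "y \<ominus>\<^bsub>cpart A k\<^esub> s k (u k w) = (y \<ominus>\<^bsub>cpart A k\<^esub> s k x) \<oplus>\<^bsub>cpart A k\<^esub> (s k x \<ominus>\<^bsub>cpart A k\<^esub> s k (u k w))"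
    using gr_cycles_carrier[OF A y] sg[OF gr_cycles_carrier[OF D x(1)]] sg[OF gr_cycles_carrier[OF D uw]] by (simp add: A.group_simps)
  also have "s k x \<ominus>\<^bsub>cpart A k\<^esub> s k (u k w) = s k (x \<ominus>\<^bsub>cpart D k\<^esub> u k w)"
    using gfhomD0(3)[OF fcomplexD(1)[OF D] fcomplexD(1)[OF A] chmapD(1)[OF s'(1)]]
      gr_cycles_carrier[OF D x(1)] gr_cycles_carrier[OF D uw] by simp
  finally show "\<exists>x\<in>gr_cycles C i k. y \<ominus>\<^bsub>cpart A k\<^esub> (s k \<circ> u k) x \<in> gr_boundaries A i k"
    using additive_subgroupD(3)[OF fcomplex_ab[OF A] gr_boundaries_subgroup[OF A] x(2)]
      chmap_gr_boundaries[OF D s'(1) w(2)] w(1) by (intro bexI[OF _ w(1)]) simp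
qed

text \<open>The half of two-out-of-three that right fractions need: a map into the apex of a
  denominator whose composite with it is again a denominator is itself one.\<close>

lemma fqis_cancel:
  assumes C: "fcomplex C" and D: "fcomplex D" and A: "fcomplex A" and u: "chmap C D u" and s: "fqis D A s"
    and su: "fqis C A (\<lambda>k. s k \<circ> u k)"
  shows "fqis C D u" unfolding fqis_iff[OF C D]
proof (intro conjI allI ballI impI)
  note s' = fqisD[OF D A s] and su' = fqisD[OF C A su]
  show "chmap C D u" by fact
  fix i k
  show "x \<in> gr_boundaries C i k" if "x \<in> gr_cycles C i k" "u k x \<in> gr_boundaries D i k" for x
    using su'(2)[OF that(1)] chmap_gr_boundaries[OF D s'(1) that(2)] by simp
  fix y assume y: "y \<in> gr_cycles D i k"
  \<comment> \<open>Lift s y through s u; injectivity of s on homology then transfers the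
    approximation from \<open>A\<close> back to \<open>D\<close>.\<close>
  obtain w where w: "w \<in> gr_cycles C i k" "s k y \<ominus>\<^bsub>cpart A k\<^esub> s k (u k w) \<in> gr_boundaries A i k"
    using su'(3)[OF chmap_gr_cycles[OF D s'(1) y]] by auto
  have uw: "u k w \<in> gr_cycles D i k" by (rule chmap_gr_cycles[OF C u w(1)])
  have "s k y \<ominus>\<^bsub>cpart A k\<^esub> s k (u k w) = s k (y \<ominus>\<^bsub>cpart D k\<^esub> u k w)"
    using gfhomD0(3)[OF fcomplexD(1)[OF D] fcomplexD(1)[OF A] chmapD(1)[OF s'(1)]]
      gr_cycles_carrier[OF D y] gr_cycles_carrier[OF D uw] by simp
  then show "\<exists>x\<in>gr_cycles C i k. y \<ominus>\<^bsub>cpart D k\<^esub> u k x \<in> gr_boundaries D i k"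
    using s'(2) additive_subgroupD(5)[OF fcomplex_ab[OF D] gr_cycles_subgroup[OF D] y uw] w by (intro bexI[of _ w]) auto
qed

text \<open>On a cycle x of a graded piece, f x - g x = d h x + h d x. The first term is a boundary,
  and d x lies in F^{i+1}, which h preserves; so both maps agree on the homology of every graded
  piece.\<close>

lemma fqis_homotopic:
  assumes C: "fcomplex C" and D: "fcomplex D" and f: "fqis C D f" and g: "chmap C D g" and fg: "fhomotopic C D f g"
  shows "fqis C D g"
proof -
  note f' = fqisD[OF C D f]
  obtain h where h: "\<And>k. gfhom (cpart C k) (cpart D (k + 1)) (h k)"
    "\<And>k x. x \<in> carrier (cpart C k) \<Longrightarrow>
       f k x = g k x \<oplus>\<^bsub>cpart D k\<^esub> (cdif D (k + 1) (h k x) \<oplus>\<^bsub>cpart D k\<^esub> h (k - 1) (cdif C k x))"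
    using fhomotopicE[OF fg] by blast
  have diff: "f k x \<ominus>\<^bsub>cpart D k\<^esub> g k x \<in> gr_boundaries D i k" if x: "x \<in> gr_cycles C i k" for i k x
  proof -
    have xC: "x \<in> carrier (cpart C k)" by (rule gr_cycles_carrier[OF C x])
    interpret D: abelian_group "cpart D k" by (rule fcomplex_ab[OF D])
    have "f k x \<ominus>\<^bsub>cpart D k\<^esub> g k x = cdif D (k + 1) (h k x) \<oplus>\<^bsub>cpart D k\<^esub> h (k - 1) (cdif C k x)"
      unfolding h(2)[OF xC] using homotopy_closed[OF C D h(1) xC] gfhomD(1)[OF chmapD(1)[OF g] xC] by (simp add: D.group_simps)
    moreover have "h k x \<in> fil (cpart D (k + 1)) i" by (rule gfhomD(5)[OF h(1) gr_cyclesD(1)[OF x]])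
    moreover have "h (k - 1) (cdif C k x) \<in> fil (cpart D k) (i + 1)" using gfhomD(5)[OF h(1) gr_cyclesD(2)[OF x]] by simp
    ultimately show ?thesis unfolding gr_boundaries_def by blast
  qed
  show ?thesis unfolding fqis_iff[OF C D]
  proof (intro conjI allI ballI impI)
    fix i k
    interpret D: abelian_group "cpart D k" by (rule fcomplex_ab[OF D])
    note B = additive_subgroupD[OF fcomplex_ab[OF D] gr_boundaries_subgroup[OF D]]
    have fgc: "f k x \<in> carrier (cpart D k)" "g k x \<in> carrier (cpart D k)" if "x \<in> gr_cycles C i k" for x
      using gr_cycles_carrier[OF C that] gfhomD(1)[OF chmapD(1)[OF g]] gfhomD(1)[OF chmapD(1)[OF f'(1)]] by auto
    show "x \<in> gr_boundaries C i k" if x: "x \<in> gr_cycles C i k" "g k x \<in> gr_boundaries D i k" for x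
    proof -
      have "f k x = (f k x \<ominus>\<^bsub>cpart D k\<^esub> g k x) \<oplus>\<^bsub>cpart D k\<^esub> g k x" using fgc[OF x(1)] by (simp add: D.group_simps)
      then show ?thesis using B(3)[OF diff[OF x(1)] x(2)] f'(2)[OF x(1)] by simp
    qed
    fix y assume y: "y \<in> gr_cycles D i k"
    obtain x where x: "x \<in> gr_cycles C i k" "y \<ominus>\<^bsub>cpart D k\<^esub> f k x \<in> gr_boundaries D i k" using f'(3)[OF y] by blast
    have "y \<ominus>\<^bsub>cpart D k\<^esub> g k x = (y \<ominus>\<^bsub>cpart D k\<^esub> f k x) \<oplus>\<^bsub>cpart D k\<^esub> (f k x \<ominus>\<^bsub>cpart D k\<^esub> g k x)"
      using fgc[OF x(1)] gr_cycles_carrier[OF D y] by (simp add: D.group_simps)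
    then show "\<exists>x\<in>gr_cycles C i k. y \<ominus>\<^bsub>cpart D k\<^esub> g k x \<in> gr_boundaries D i k"
      using B(3)[OF x(2) diff[OF x(1)]] by (intro bexI[OF _ x(1)]) simp
  qed fact
qed

subsection \<open>Transport into the universe\<close>

lemma gfhom_gf_copy:
  assumes M: "gfmodule M" and g: "inj_on g (carrier M)"
  shows "gfhom M (gf_copy g M) g" "gfhom (gf_copy g M) M (inv_into (carrier M) g)"
proof -
  interpret module PR M by (rule gfmodule_module[OF M])
  have i: "inv_into (carrier M) g (g x) = x" if "x \<in> carrier M" for x using that g by simp
  show "gfhom M (gf_copy g M) g" by (auto simp: gfhom_def gf_copy_def Let_def i)
  show "gfhom (gf_copy g M) M (inv_into (carrier M) g)" unfolding gfhom_def gf_copy_def Let_def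
    using i gfmodule_fil_carrier[OF M] gfmodule_qpart_carrier[OF M] smult_closed by (auto simp: image_subset_iff)
qed

lemma iso_fqis:
  assumes C: "fcomplex C" and A: "fcomplex A" and s: "chmap C A s" and r: "chmap A C r"
    and rs: "\<And>k x. x \<in> carrier (cpart C k) \<Longrightarrow> r k (s k x) = x"
    and sr: "\<And>k x. x \<in> carrier (cpart A k) \<Longrightarrow> s k (r k x) = x"
  shows "fqis C A s" unfolding fqis_iff[OF C A]
proof (intro conjI allI ballI impI)
  fix i k
  show "x \<in> gr_boundaries C i k" if "x \<in> gr_cycles C i k" "s k x \<in> gr_boundaries A i k" for x
    using chmap_gr_boundaries[OF A r that(2)] rs[OF gr_cycles_carrier[OF C that(1)]] by simp
  fix y assume y: "y \<in> gr_cycles A i k"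
  interpret A: abelian_group "cpart A k" by (rule fcomplex_ab[OF A])
  note B = additive_subgroupD[OF fcomplex_ab[OF A] gr_boundaries_subgroup[OF A]]
  have "y \<ominus>\<^bsub>cpart A k\<^esub> s k (r k y) = \<zero>\<^bsub>cpart A k\<^esub>"
    using sr gr_cycles_carrier[OF A y] by (simp add: A.group_simps)
  then show "\<exists>x\<in>gr_cycles C i k. y \<ominus>\<^bsub>cpart A k\<^esub> s k x \<in> gr_boundaries A i k"
    using B(2) chmap_gr_cycles[OF A r y] by (intro bexI[of _ "r k y"]) auto
qed (rule s)

lemma fqis_id: "fcomplex C \<Longrightarrow> fqis C C (\<lambda>k x. x)"
  by (rule iso_fqis[where r = "\<lambda>k x. x"]) (auto simp: chmap_id)

text \<open>The copy is isomorphic to \<open>A\<close>. Besides the quasi-isomorphism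
  \<open>s\<close> back to \<open>A\<close>, its strict right inverse \<open>r\<close> is kept: it
  lets every map into \<open>A\<close> factor through the copy without a further
  denominator.\<close>

lemma fcomplex_transport:
  fixes A :: "('n, 'a) fcx"
  assumes "dobj TYPE('u) A"
  obtains C :: "('n, 'u) fcx" and s r where "fcomplex C" "fqis C A s" "chmap A C r"
    "\<And>k x. x \<in> carrier (cpart A k) \<Longrightarrow> s k (r k x) = x"
proof -
  have A: "fcomplex A" using assms by (simp add: dobj_def)
  obtain g :: "int \<Rightarrow> 'a \<Rightarrow> 'u" where g: "\<And>k. inj_on (g k) (carrier (cpart A k))"
    using assms unfolding dobj_def by metis
  define g' where "g' = (\<lambda>k. inv_into (carrier (cpart A k)) (g k))"
  have g'g: "g' k (g k x) = x" if "x \<in> carrier (cpart A k)" for k x using g that by (simp add: g'_def)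
  have h1: "gfhom (cpart A k) (gf_copy (g k) (cpart A k)) (g k)"
    and h2: "gfhom (gf_copy (g k) (cpart A k)) (cpart A k) (g' k)" for k
    using gfhom_gf_copy[OF fcomplexD(1)[OF A] g] by (auto simp: g'_def)
  define C :: "('n, 'u) fcx" where "C = \<lparr>cpart = \<lambda>k. gf_copy (g k) (cpart A k),
    cdif = \<lambda>k x. g (k - 1) (cdif A k (g' k x))\<rparr>"
  have car: "carrier (cpart C k) = g k ` carrier (cpart A k)" for k by (simp add: C_def gf_copy_def Let_def)
  note dA = gfhomD(1)[OF fcomplexD(2)[OF A]]
  have C: "fcomplex C" unfolding fcomplex_def
  proof (intro allI conjI ballI)
    fix k
    show "gfmodule (cpart C k)" using gfmodule_gf_copy[OF fcomplexD(1)[OF A] g] by (simp add: C_def)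
    show "gfhom (cpart C k) (cpart C (k - 1)) (cdif C k)"
      using gfhom_comp[OF gfhom_comp[OF h2 fcomplexD(2)[OF A]] h1] by (simp add: C_def)
    fix x assume "x \<in> carrier (cpart C k)"
    then obtain y where y: "y \<in> carrier (cpart A k)" "x = g k y" using car by blast
    show "cdif C (k - 1) (cdif C k x) = \<zero>\<^bsub>cpart C (k - 2)\<^esub>"
      using y dA[OF y(1)] fcomplexD(3)[OF A y(1)] by (simp add: C_def g'g gf_copy_def Let_def)
  qed
  have s: "chmap C A g'" unfolding chmap_def
  proof (intro allI conjI ballI)
    show "gfhom (cpart C k) (cpart A k) (g' k)" for k using h2 by (simp add: C_def)
    fix k x assume "x \<in> carrier (cpart C k)"
    then obtain y where y: "y \<in> carrier (cpart A k)" "x = g k y" using car by blast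
    show "cdif A k (g' k x) = g' (k - 1) (cdif C k x)" using y dA[OF y(1)] by (simp add: C_def g'g)
  qed
  have r: "chmap A C g" unfolding chmap_def
  proof (intro allI conjI ballI)
    show "gfhom (cpart A k) (cpart C k) (g k)" for k using h1 by (simp add: C_def)
    show "cdif C k (g k x) = g (k - 1) (cdif A k x)" if "x \<in> carrier (cpart A k)" for k x
      using that by (simp add: C_def g'g)
  qed
  have "fqis C A g'" by (rule iso_fqis[OF C A s r]) (auto simp: car g'g)
  then show thesis using that[OF C _ r] g'g by blast
qed

subsection \<open>The Ore condition\<close>

datatype cone_index = CX | CY | CZ

definition cone_case :: "'b \<Rightarrow> 'b \<Rightarrow> 'b \<Rightarrow> cone_index \<Rightarrow> 'b" where
  "cone_case x y z i = (case i of CX \<Rightarrow> x | CY \<Rightarrow> y | CZ \<Rightarrow> z)"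

lemma cone_case_simps [simp]:
  "cone_case x y z CX = x" "cone_case x y z CY = y" "cone_case x y z CZ = z" by (simp_all add: cone_case_def)

lemma all_cone_index: "(\<forall>i. P i) \<longleftrightarrow> P CX \<and> P CY \<and> P CZ"
  by (metis cone_index.exhaust)

lemma finite_cone_index: "finite (S :: cone_index set)"
proof (rule finite_subset)
  show "S \<subseteq> {CX, CY, CZ}" using cone_index.exhaust by blast
qed simp

text \<open>A direct sum over a three-element index type rather than a product type, so that the
  module axioms are those of \<open>gf_dsum\<close>.\<close>

definition cone_mod ::
  "('n bpoly, 'a) gfmod \<Rightarrow> ('n bpoly, 'a) gfmod \<Rightarrow> ('n bpoly, 'a) gfmod \<Rightarrow> ('n bpoly, cone_index \<Rightarrow> 'a) gfmod" where
  "cone_mod U Y Z = gf_dsum (cone_case U Y Z)"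

lemma cone_mod_simps:
  "c \<in> carrier (cone_mod U Y Z) \<longleftrightarrow> c CX \<in> carrier U \<and> c CY \<in> carrier Y \<and> c CZ \<in> carrier Z"
  "\<zero>\<^bsub>cone_mod U Y Z\<^esub> = (\<lambda>i. \<zero>\<^bsub>cone_case U Y Z i\<^esub>)"
  "c \<oplus>\<^bsub>cone_mod U Y Z\<^esub> c' = (\<lambda>i. c i \<oplus>\<^bsub>cone_case U Y Z i\<^esub> c' i)"
  "p \<odot>\<^bsub>cone_mod U Y Z\<^esub> c = (\<lambda>i. p \<odot>\<^bsub>cone_case U Y Z i\<^esub> c i)"
  "c \<in> qpart (cone_mod U Y Z) q \<longleftrightarrow> c \<in> carrier (cone_mod U Y Z) \<and>
     c CX \<in> qpart U q \<and> c CY \<in> qpart Y q \<and> c CZ \<in> qpart Z q"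
  "c \<in> fil (cone_mod U Y Z) k \<longleftrightarrow> c \<in> carrier (cone_mod U Y Z) \<and>
     c CX \<in> fil U k \<and> c CY \<in> fil Y k \<and> c CZ \<in> fil Z k"
  by (auto simp: cone_mod_def gf_dsum_simps all_cone_index finite_cone_index)

lemma gfmodule_cone_mod:
  fixes U Y Z :: "('n bpoly, 'a) gfmod"
  assumes "gfmodule U" "gfmodule Y" "gfmodule Z"
  shows "gfmodule (cone_mod U Y Z)"
    and "c \<in> carrier (cone_mod U Y Z) \<Longrightarrow> (\<ominus>\<^bsub>cone_mod U Y Z\<^esub> c) i = \<ominus>\<^bsub>cone_case U Y Z i\<^esub> c i"
proof -
  have "gfmodule (cone_case U Y Z i)" for i using assms by (cases i) auto
  note * = gfmodule_gf_dsum[OF this]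
  show "gfmodule (cone_mod U Y Z)" unfolding cone_mod_def by (rule *)
  show "c \<in> carrier (cone_mod U Y Z) \<Longrightarrow> (\<ominus>\<^bsub>cone_mod U Y Z\<^esub> c) i = \<ominus>\<^bsub>cone_case U Y Z i\<^esub> c i"
    unfolding cone_mod_def by (rule *)
qed

lemma gfhom_cone_mod:
  assumes "gfhom M U f" "gfhom M Y g" "gfhom M Z h" "gfmodule M"
  shows "gfhom M (cone_mod U Y Z) (\<lambda>c. cone_case (f c) (g c) (h c))"
proof -
  note f = gfhomD[OF assms(1)] and g = gfhomD[OF assms(2)] and h = gfhomD[OF assms(3)]
  note q = gfmodule_qpart_carrier[OF assms(4)] and fl = gfmodule_fil_carrier[OF assms(4)]
  show ?thesis unfolding gfhom_def image_subset_iff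
    by (auto simp: cone_mod_simps fun_eq_iff all_cone_index f g h f(1)[OF q] f(1)[OF fl] g(1)[OF q] g(1)[OF fl]
      h(1)[OF q] h(1)[OF fl])
qed

lemma gfhom_cone_proj:
  "gfhom (cone_mod U Y Z) U (\<lambda>c. c CX)" "gfhom (cone_mod U Y Z) Y (\<lambda>c. c CY)" "gfhom (cone_mod U Y Z) Z (\<lambda>c. c CZ)"
  by (auto simp: gfhom_def cone_mod_simps)

text \<open>The homotopy pullback of U -> Z <- Y, that is, the shifted cone of (\<alpha>, -\<beta>),
  which is why the coordinate in Z has degree one higher. The sign of its differential makes the
  square zero and makes \<open>CZ\<close> itself a homotopy between the two composites to Z.\<close>

definition hpullback :: "('n, 'a) fcx \<Rightarrow> ('n, 'a) fcx \<Rightarrow> ('n, 'a) fcx \<Rightarrow> (int \<Rightarrow> 'a \<Rightarrow> 'a) \<Rightarrow> (int \<Rightarrow> 'a \<Rightarrow> 'a)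
    \<Rightarrow> ('n, cone_index \<Rightarrow> 'a) fcx" where
  "hpullback U Y Z \<alpha> \<beta> = \<lparr>cpart = \<lambda>k. cone_mod (cpart U k) (cpart Y k) (cpart Z (k + 1)),
     cdif = \<lambda>k c. cone_case (cdif U k (c CX)) (cdif Y k (c CY))
       (\<alpha> k (c CX) \<ominus>\<^bsub>cpart Z k\<^esub> \<beta> k (c CY) \<ominus>\<^bsub>cpart Z k\<^esub> cdif Z (k + 1) (c CZ))\<rparr>"

context
  fixes U Y Z :: "('n, 'a) fcx" and \<alpha> \<beta>
  assumes U: "fcomplex U" and Y: "fcomplex Y" and Z: "fcomplex Z"
    and \<alpha>: "chmap U Z \<alpha>" and \<beta>: "chmap Y Z \<beta>"
begin

private abbreviation hpb where "hpb \<equiv> hpullback U Y Z \<alpha> \<beta>"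

lemma hpullback_cpart: "cpart hpb k = cone_mod (cpart U k) (cpart Y k) (cpart Z (k + 1))" by (simp add: hpullback_def)

lemma hpullback_cdif:
  "cdif hpb k c CX = cdif U k (c CX)" "cdif hpb k c CY = cdif Y k (c CY)"
  "cdif hpb k c CZ = \<alpha> k (c CX) \<ominus>\<^bsub>cpart Z k\<^esub> \<beta> k (c CY) \<ominus>\<^bsub>cpart Z k\<^esub> cdif Z (k + 1) (c CZ)"
  by (simp_all add: hpullback_def)

lemma hpullback_gfmodule: "gfmodule (cpart hpb k)"
  unfolding hpullback_cpart by (intro gfmodule_cone_mod fcomplexD(1) U Y Z)

lemma gfhom_a_minus:
  assumes "gfmodule M" "gfmodule N" "gfhom M N f" "gfhom M N g"
  shows "gfhom M N (\<lambda>x. f x \<ominus>\<^bsub>N\<^esub> g x)"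
  unfolding a_minus_def by (intro gfhom_add gfhom_minus assms)

lemma fcomplex_hpullback: "fcomplex hpb" unfolding fcomplex_def
proof (intro allI conjI ballI)
  fix k
  show "gfmodule (cpart hpb k)" by (rule hpullback_gfmodule)
  let ?M = "cpart hpb k"
  have "gfhom ?M (cpart Z k) (\<lambda>c. \<alpha> k (c CX) \<ominus>\<^bsub>cpart Z k\<^esub> \<beta> k (c CY) \<ominus>\<^bsub>cpart Z k\<^esub> cdif Z (k + 1) (c CZ))"
    by (intro gfhom_a_minus hpullback_gfmodule fcomplexD(1)[OF Z])
      (auto simp: hpullback_cpart intro: gfhom_comp[OF gfhom_cone_proj(1) chmapD(1)[OF \<alpha>]]
        gfhom_comp[OF gfhom_cone_proj(2) chmapD(1)[OF \<beta>]] gfhom_comp[OF gfhom_cone_proj(3) fcomplexD1(1)[OF Z]])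
  then have "gfhom ?M (cone_mod (cpart U (k - 1)) (cpart Y (k - 1)) (cpart Z k)) (cdif hpb k)"
    unfolding hpullback_def fcx.simps by (intro gfhom_cone_mod gfhom_comp[OF gfhom_cone_proj(1) fcomplexD(2)[OF U]]
        gfhom_comp[OF gfhom_cone_proj(2) fcomplexD(2)[OF Y]] gfmodule_cone_mod fcomplexD(1) U Y Z)
  then show "gfhom (cpart hpb k) (cpart hpb (k - 1)) (cdif hpb k)" by (simp add: hpullback_cpart)
  fix c assume "c \<in> carrier (cpart hpb k)"
  then have c: "c CX \<in> carrier (cpart U k)" "c CY \<in> carrier (cpart Y k)" "c CZ \<in> carrier (cpart Z (k + 1))"
    by (auto simp: hpullback_cpart cone_mod_simps)
  interpret Z: abelian_group "cpart Z (k - 1)" by (rule fcomplex_ab[OF Z])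
  have cl: "\<alpha> k (c CX) \<in> carrier (cpart Z k)" "\<beta> k (c CY) \<in> carrier (cpart Z k)" "cdif Z (k + 1) (c CZ) \<in> carrier (cpart Z k)"
    using gfhomD(1)[OF chmapD(1)[OF \<alpha>] c(1)] gfhomD(1)[OF chmapD(1)[OF \<beta>] c(2)] gfhomD(1)[OF fcomplexD1(1)[OF Z] c(3)]
    by auto
  note dm = gfhomD0(3)[OF fcomplexD(1)[OF Z] fcomplexD(1)[OF Z] fcomplexD(2)[OF Z]]
  interpret Zk: abelian_group "cpart Z k" by (rule fcomplex_ab[OF Z])
  have "cdif Z k (\<alpha> k (c CX) \<ominus>\<^bsub>cpart Z k\<^esub> \<beta> k (c CY) \<ominus>\<^bsub>cpart Z k\<^esub> cdif Z (k + 1) (c CZ))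
     = \<alpha> (k - 1) (cdif U k (c CX)) \<ominus>\<^bsub>cpart Z (k - 1)\<^esub> \<beta> (k - 1) (cdif Y k (c CY)) \<ominus>\<^bsub>cpart Z (k - 1)\<^esub> \<zero>\<^bsub>cpart Z (k - 1)\<^esub>"
    using cl by (simp add: dm chmapD(2)[OF \<alpha> c(1), symmetric] chmapD(2)[OF \<beta> c(2), symmetric] fcomplexD1(2)[OF Z c(3)])
  moreover have "\<alpha> (k - 1) (cdif U k (c CX)) \<in> carrier (cpart Z (k - 1))"
    "\<beta> (k - 1) (cdif Y k (c CY)) \<in> carrier (cpart Z (k - 1))"
    using gfhomD(1)[OF chmapD(1)[OF \<alpha>] gfhomD(1)[OF fcomplexD(2)[OF U] c(1)]]
      gfhomD(1)[OF chmapD(1)[OF \<beta>] gfhomD(1)[OF fcomplexD(2)[OF Y] c(2)]] .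
  ultimately have "cdif hpb (k - 1) (cdif hpb k c) CZ = \<zero>\<^bsub>cpart Z (k - 1)\<^esub>"
    by (simp add: hpullback_cdif Z.group_simps)
  moreover have "k - 2 + 1 = k - 1" by simp
  ultimately show "cdif hpb (k - 1) (cdif hpb k c) = \<zero>\<^bsub>cpart hpb (k - 2)\<^esub>"
    using fcomplexD(3)[OF U c(1)] fcomplexD(3)[OF Y c(2)]
    by (simp add: hpullback_cpart cone_mod_simps fun_eq_iff all_cone_index hpullback_cdif(1,2))
qed

lemma hpullback_proj: "chmap hpb U (\<lambda>k c. c CX)" "chmap hpb Y (\<lambda>k c. c CY)"
  by (auto simp: chmap_def hpullback_cdif hpullback_cpart gfhom_cone_proj)

lemma hpullback_homotopic: "fhomotopic hpb Z (\<lambda>k. \<alpha> k \<circ> (\<lambda>c. c CX)) (\<lambda>k. \<beta> k \<circ> (\<lambda>c. c CY))"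
proof (rule fhomotopicI[where h = "\<lambda>k c. c CZ"])
  show "gfhom (cpart hpb k) (cpart Z (k + 1)) (\<lambda>c. c CZ)" for k unfolding hpullback_cpart by (rule gfhom_cone_proj)
  fix k c assume "c \<in> carrier (cpart hpb k)"
  then have c: "c CX \<in> carrier (cpart U k)" "c CY \<in> carrier (cpart Y k)" "c CZ \<in> carrier (cpart Z (k + 1))"
    by (auto simp: hpullback_cpart cone_mod_simps)
  interpret Z: abelian_group "cpart Z k" by (rule fcomplex_ab[OF Z])
  show "(\<alpha> k \<circ> (\<lambda>c. c CX)) c = (\<beta> k \<circ> (\<lambda>c. c CY)) c \<oplus>\<^bsub>cpart Z k\<^esub> (cdif Z (k + 1) (c CZ) \<oplus>\<^bsub>cpart Z k\<^esub> cdif hpb k c CZ)"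
    unfolding hpullback_cdif comp_def
    using gfhomD(1)[OF chmapD(1)[OF \<alpha>] c(1)] gfhomD(1)[OF chmapD(1)[OF \<beta>] c(2)] gfhomD(1)[OF fcomplexD1(1)[OF Z] c(3)]
    by (simp add: Z.group_simps)
qed

lemma hpullback_a_minus:
  assumes "c \<in> carrier (cpart hpb k)" "c' \<in> carrier (cpart hpb k)"
  shows "(c \<ominus>\<^bsub>cpart hpb k\<^esub> c') i
    = c i \<ominus>\<^bsub>cone_case (cpart U k) (cpart Y k) (cpart Z (k + 1)) i\<^esub> c' i"
  using gfmodule_cone_mod(2)[OF fcomplexD(1)[OF U] fcomplexD(1)[OF Y] fcomplexD(1)[OF Z], of c' k k "k + 1" i] assms
  by (simp add: a_minus_def hpullback_cpart cone_mod_simps(3))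

text \<open>A pullback of \<beta> inherits its being a quasi-isomorphism, by a chase in each graded
  piece. Injectivity uses both halves of the assumption: injectivity of \<beta> in degree k makes y
  a boundary, surjectivity in degree k + 1 repairs the coordinate in Z. For surjectivity, \<alpha> x
  is lifted through \<beta> up to a boundary, whose primitive becomes the third coordinate.\<close>

lemma hpullback_fqis:
  assumes q: "fqis Y Z \<beta>"
  shows "fqis hpb U (\<lambda>k c. c CX)" unfolding fqis_iff[OF fcomplex_hpullback U]
proof (intro conjI allI ballI impI)
  note hpb = fcomplex_hpullback and q' = fqisD[OF Y Z q]
  note Xm = fcomplexD(1)[OF U] and Ym = fcomplexD(1)[OF Y] and Zm = fcomplexD(1)[OF Z]
  note cX = gfmodule_fil_carrier[OF Xm] and cY = gfmodule_fil_carrier[OF Ym] and cZ = gfmodule_fil_carrier[OF Zm]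
  note dX = gfhomD[OF fcomplexD1(1)[OF U]] and dY = gfhomD[OF fcomplexD1(1)[OF Y]] and dZ = gfhomD[OF fcomplexD1(1)[OF Z]]
  note al = gfhomD[OF chmapD(1)[OF \<alpha>]] and be = gfhomD[OF chmapD(1)[OF \<beta>]]
  note dZ0 = gfhomD0[OF Zm Zm fcomplexD1(1)[OF Z]]
  note be0 = gfhomD0[OF Ym Zm chmapD(1)[OF \<beta>]]
  show "chmap hpb U (\<lambda>k c. c CX)" by (rule hpullback_proj)
  fix i k
  interpret Zk: abelian_group "cpart Z k" by (rule fcomplex_ab[OF Z])
  interpret Zk1: abelian_group "cpart Z (k + 1)" by (rule fcomplex_ab[OF Z])
  interpret Yk1: abelian_group "cpart Y (k + 1)" by (rule fcomplex_ab[OF Y])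
  interpret Yk: abelian_group "cpart Y k" by (rule fcomplex_ab[OF Y])
  interpret Uk: abelian_group "cpart U k" by (rule fcomplex_ab[OF U])
  {
    fix c assume c: "c \<in> gr_cycles hpb i k" and bx: "c CX \<in> gr_boundaries U i k"
    let ?x = "c CX" and ?y = "c CY" and ?z = "c CZ"
    have fE: "c \<in> fil (cpart hpb k) i" and dE: "cdif hpb k c \<in> fil (cpart hpb (k - 1)) (i + 1)"
      using gr_cyclesD[OF c] .
    have cc: "c \<in> carrier (cpart hpb k)" by (rule gr_cycles_carrier[OF hpb c])
    have f: "?x \<in> fil (cpart U k) i" "?y \<in> fil (cpart Y k) i" "?z \<in> fil (cpart Z (k + 1)) i"
      using fE by (auto simp: hpullback_cpart cone_mod_simps)
    have d: "cdif U k ?x \<in> fil (cpart U (k - 1)) (i + 1)" "cdif Y k ?y \<in> fil (cpart Y (k - 1)) (i + 1)"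
      using dE by (auto simp: hpullback_cpart cone_mod_simps hpullback_cdif)
    \<comment> \<open>The third coordinate of the differential of \<open>c\<close>; it lies in
      F^{i+1} because \<open>c\<close> is a cycle of the graded piece.\<close>
    define t where "t = \<alpha> k ?x \<ominus>\<^bsub>cpart Z k\<^esub> \<beta> k ?y \<ominus>\<^bsub>cpart Z k\<^esub> cdif Z (k + 1) ?z"
    have t: "t \<in> fil (cpart Z k) (i + 1)"
      using dE by (auto simp: hpullback_cpart cone_mod_simps hpullback_cdif t_def)
    obtain x' where x': "x' \<in> fil (cpart U (k + 1)) i"
      and w: "?x \<ominus>\<^bsub>cpart U k\<^esub> cdif U (k + 1) x' \<in> fil (cpart U k) (i + 1)"
      using bx gr_boundaries_iff[OF U] by blast
    define w where "w = ?x \<ominus>\<^bsub>cpart U k\<^esub> cdif U (k + 1) x'"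
    note wf = w[folded w_def]
    have xeq: "?x = cdif U (k + 1) x' \<oplus>\<^bsub>cpart U k\<^esub> w"
      unfolding w_def using cX[OF f(1)] dX(1)[OF cX[OF x']] by (simp add: Uk.group_simps)
    have axeq: "\<alpha> k ?x = cdif Z (k + 1) (\<alpha> (k + 1) x') \<oplus>\<^bsub>cpart Z k\<^esub> \<alpha> k w"
      unfolding chmapD1[OF \<alpha> cX[OF x']] al(2)[OF dX(1)[OF cX[OF x']] cX[OF wf], symmetric] using xeq by simp
    have cl: "\<alpha> k ?x \<in> carrier (cpart Z k)" "\<beta> k ?y \<in> carrier (cpart Z k)" "cdif Z (k + 1) ?z \<in> carrier (cpart Z k)"
      "\<alpha> k w \<in> carrier (cpart Z k)" "\<alpha> (k + 1) x' \<in> carrier (cpart Z (k + 1))"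
      "cdif Z (k + 1) (\<alpha> (k + 1) x') \<in> carrier (cpart Z k)" "t \<in> carrier (cpart Z k)"
      using al(1)[OF cX[OF f(1)]] be(1)[OF cY[OF f(2)]] dZ(1)[OF cZ[OF f(3)]] al(1)[OF cX[OF wf]]
        al(1)[OF cX[OF x']] dZ(1)[OF al(1)[OF cX[OF x']]] cZ[OF t] by auto
    have zC: "?z \<in> carrier (cpart Z (k + 1))" by (rule cZ[OF f(3)])
    have byeq: "\<beta> k ?y = cdif Z (k + 1) (\<alpha> (k + 1) x') \<oplus>\<^bsub>cpart Z k\<^esub> \<alpha> k w \<ominus>\<^bsub>cpart Z k\<^esub> cdif Z (k + 1) ?z \<ominus>\<^bsub>cpart Z k\<^esub> t"
      unfolding t_def axeq using cl by (simp add: Zk.group_simps)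
    \<comment> \<open>Modulo F^{i+1}, \<beta> y is the boundary of \<alpha> x' - z, so injectivity
      of \<beta> on homology makes y a boundary.\<close>
    have "\<beta> k ?y \<in> gr_boundaries Z i k" unfolding gr_boundaries_iff[OF Z]
    proof (intro conjI bexI)
      show "\<alpha> (k + 1) x' \<ominus>\<^bsub>cpart Z (k + 1)\<^esub> ?z \<in> fil (cpart Z (k + 1)) i"
        by (rule gf_fil_closed(4)[OF Zm al(5)[OF x'] f(3)])
      have "\<beta> k ?y \<ominus>\<^bsub>cpart Z k\<^esub> cdif Z (k + 1) (\<alpha> (k + 1) x' \<ominus>\<^bsub>cpart Z (k + 1)\<^esub> ?z) = \<alpha> k w \<ominus>\<^bsub>cpart Z k\<^esub> t"
        unfolding dZ0(3)[OF cl(5) zC] byeq using cl by (simp add: Zk.group_simps)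
      then show "\<beta> k ?y \<ominus>\<^bsub>cpart Z k\<^esub> cdif Z (k + 1) (\<alpha> (k + 1) x' \<ominus>\<^bsub>cpart Z (k + 1)\<^esub> ?z) \<in> fil (cpart Z k) (i + 1)"
        using gf_fil_closed(4)[OF Zm al(5)[OF wf] t] by simp
    qed (rule cl)
    moreover have "?y \<in> gr_cycles Y i k" using f(2) d(2) by (simp add: gr_cycles_def)
    ultimately have "?y \<in> gr_boundaries Y i k" using q'(2) by blast
    then obtain y' where y': "y' \<in> fil (cpart Y (k + 1)) i"
      and w': "?y \<ominus>\<^bsub>cpart Y k\<^esub> cdif Y (k + 1) y' \<in> fil (cpart Y k) (i + 1)"
      using gr_boundaries_iff[OF Y] by blast
    define w' where "w' = ?y \<ominus>\<^bsub>cpart Y k\<^esub> cdif Y (k + 1) y'"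
    note w'f = w'[folded w'_def]
    have yeq: "?y = cdif Y (k + 1) y' \<oplus>\<^bsub>cpart Y k\<^esub> w'"
      unfolding w'_def using cY[OF f(2)] dY(1)[OF cY[OF y']] by (simp add: Yk.group_simps)
    have byeq2: "\<beta> k ?y = cdif Z (k + 1) (\<beta> (k + 1) y') \<oplus>\<^bsub>cpart Z k\<^esub> \<beta> k w'"
      unfolding chmapD1[OF \<beta> cY[OF y']] be(2)[OF dY(1)[OF cY[OF y']] cY[OF w'f], symmetric] using yeq by simp
    have cl2: "\<beta> (k + 1) y' \<in> carrier (cpart Z (k + 1))" "cdif Z (k + 1) (\<beta> (k + 1) y') \<in> carrier (cpart Z k)"
      "\<beta> k w' \<in> carrier (cpart Z k)" using be(1)[OF cY[OF y']] dZ(1)[OF be(1)[OF cY[OF y']]] be(1)[OF cY[OF w'f]] by auto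
    \<comment> \<open>The two primitives \<alpha> x' - z and \<beta> y' of \<beta> y differ by a
      cycle of the graded piece in degree k + 1. Surjectivity of \<beta> on homology there supplies
      \<open>y3\<close>, by which \<open>y'\<close> is corrected.\<close>
    define z2 where "z2 = ?z \<ominus>\<^bsub>cpart Z (k + 1)\<^esub> \<alpha> (k + 1) x' \<oplus>\<^bsub>cpart Z (k + 1)\<^esub> \<beta> (k + 1) y'"
    have z2f: "z2 \<in> fil (cpart Z (k + 1)) i" unfolding z2_def
      by (rule gf_fil_closed(2)[OF Zm gf_fil_closed(4)[OF Zm f(3) al(5)[OF x']] be(5)[OF y']])
    have "cdif Z (k + 1) z2 = cdif Z (k + 1) ?z \<ominus>\<^bsub>cpart Z k\<^esub> cdif Z (k + 1) (\<alpha> (k + 1) x') \<oplus>\<^bsub>cpart Z k\<^esub>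
        cdif Z (k + 1) (\<beta> (k + 1) y')"
      unfolding z2_def using dZ(2)[OF Zk1.minus_closed[OF zC cl(5)] cl2(1)] dZ0(3)[OF zC cl(5)] by simp
    also have "\<dots> = \<alpha> k w \<ominus>\<^bsub>cpart Z k\<^esub> t \<ominus>\<^bsub>cpart Z k\<^esub> \<beta> k w'"
      using byeq[unfolded byeq2] cl cl2 by (simp add: Zk.group_simps)
    finally have "cdif Z (k + 1) z2 \<in> fil (cpart Z k) (i + 1)"
      using gf_fil_closed(4)[OF Zm gf_fil_closed(4)[OF Zm al(5)[OF wf] t] be(5)[OF w'f]] by simp
    then have "z2 \<in> gr_cycles Z i (k + 1)" using z2f by (simp add: gr_cycles_def)
    then obtain y3 where y3: "y3 \<in> gr_cycles Y i (k + 1)"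
      and b3: "z2 \<ominus>\<^bsub>cpart Z (k + 1)\<^esub> \<beta> (k + 1) y3 \<in> gr_boundaries Z i (k + 1)" using q'(3) by blast
    obtain z4 where z4: "z4 \<in> fil (cpart Z (k + 1 + 1)) i"
      and w4: "z2 \<ominus>\<^bsub>cpart Z (k + 1)\<^esub> \<beta> (k + 1) y3 \<ominus>\<^bsub>cpart Z (k + 1)\<^esub> cdif Z (k + 1 + 1) z4 \<in> fil (cpart Z (k + 1)) (i + 1)"
      using b3 gr_boundaries_iff[OF Z] by blast
    have y3f: "y3 \<in> fil (cpart Y (k + 1)) i" and dy3: "cdif Y (k + 1) y3 \<in> fil (cpart Y k) (i + 1)"
      using gr_cyclesD[OF y3] by auto
    \<comment> \<open>The sign of \<open>z4\<close> compensates the minus sign with which the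
      differential of Z enters that of the pullback.\<close>
    define e where "e = cone_case x' (y' \<ominus>\<^bsub>cpart Y (k + 1)\<^esub> y3) (\<ominus>\<^bsub>cpart Z (k + 1 + 1)\<^esub> z4)"
    have yy3: "y' \<ominus>\<^bsub>cpart Y (k + 1)\<^esub> y3 \<in> fil (cpart Y (k + 1)) i" by (rule gf_fil_closed(4)[OF Ym y' y3f])
    have nz4: "\<ominus>\<^bsub>cpart Z (k + 1 + 1)\<^esub> z4 \<in> fil (cpart Z (k + 1 + 1)) i" by (rule gf_fil_closed(3)[OF Zm z4])
    have ef: "e \<in> fil (cpart hpb (k + 1)) i" unfolding e_def hpullback_cpart cone_mod_simps
      using x' yy3 nz4 cX[OF x'] cY[OF yy3] cZ[OF nz4] by simp
    have eC: "e \<in> carrier (cpart hpb (k + 1))" by (rule gfmodule_fil_carrier[OF hpullback_gfmodule ef])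
    have deC: "cdif hpb (k + 1) e \<in> carrier (cpart hpb k)" by (rule gfhomD(1)[OF fcomplexD1(1)[OF hpb] eC])
    have "c \<ominus>\<^bsub>cpart hpb k\<^esub> cdif hpb (k + 1) e \<in> fil (cpart hpb k) (i + 1)"
    proof -
      have Ek: "abelian_group (cpart hpb k)" by (rule fcomplex_ab[OF hpb])
      have "c \<ominus>\<^bsub>cpart hpb k\<^esub> cdif hpb (k + 1) e \<in> carrier (cpart hpb k)"
        by (rule abelian_group.minus_closed[OF Ek cc deC])
      moreover have "?x \<ominus>\<^bsub>cpart U k\<^esub> cdif hpb (k + 1) e CX \<in> fil (cpart U k) (i + 1)"
        using wf by (simp add: hpullback_cdif e_def w_def)
      moreover have "?y \<ominus>\<^bsub>cpart Y k\<^esub> cdif hpb (k + 1) e CY \<in> fil (cpart Y k) (i + 1)"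
      proof -
        have "cdif hpb (k + 1) e CY = cdif Y (k + 1) y' \<ominus>\<^bsub>cpart Y k\<^esub> cdif Y (k + 1) y3"
          using gfhomD0(3)[OF Ym Ym fcomplexD1(1)[OF Y] cY[OF y'] cY[OF y3f]] by (simp add: hpullback_cdif e_def)
        then have "?y \<ominus>\<^bsub>cpart Y k\<^esub> cdif hpb (k + 1) e CY = w' \<oplus>\<^bsub>cpart Y k\<^esub> cdif Y (k + 1) y3"
          using cY[OF f(2)] dY(1)[OF cY[OF y']] dY(1)[OF cY[OF y3f]] by (simp add: w'_def Yk.group_simps)
        then show ?thesis using gf_fil_closed(2)[OF Ym w'f dy3] by simp
      qed
      moreover have "?z \<ominus>\<^bsub>cpart Z (k + 1)\<^esub> cdif hpb (k + 1) e CZ \<in> fil (cpart Z (k + 1)) (i + 1)"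
      proof -
        have 1: "\<beta> (k + 1) (y' \<ominus>\<^bsub>cpart Y (k + 1)\<^esub> y3) = \<beta> (k + 1) y' \<ominus>\<^bsub>cpart Z (k + 1)\<^esub> \<beta> (k + 1) y3"
          by (rule be0(3)[OF cY[OF y'] cY[OF y3f]])
        have 2: "cdif Z (k + 1 + 1) (\<ominus>\<^bsub>cpart Z (k + 1 + 1)\<^esub> z4) = \<ominus>\<^bsub>cpart Z (k + 1)\<^esub> cdif Z (k + 1 + 1) z4"
          by (rule dZ0(2)[OF cZ[OF z4]])
        have "cdif hpb (k + 1) e CZ = \<alpha> (k + 1) x' \<ominus>\<^bsub>cpart Z (k + 1)\<^esub> (\<beta> (k + 1) y' \<ominus>\<^bsub>cpart Z (k + 1)\<^esub> \<beta> (k + 1) y3)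
            \<ominus>\<^bsub>cpart Z (k + 1)\<^esub> \<ominus>\<^bsub>cpart Z (k + 1)\<^esub> cdif Z (k + 1 + 1) z4"
          unfolding hpullback_cdif e_def cone_case_simps 1 2 ..
        then have "?z \<ominus>\<^bsub>cpart Z (k + 1)\<^esub> cdif hpb (k + 1) e CZ =
           z2 \<ominus>\<^bsub>cpart Z (k + 1)\<^esub> \<beta> (k + 1) y3 \<ominus>\<^bsub>cpart Z (k + 1)\<^esub> cdif Z (k + 1 + 1) z4"
          unfolding z2_def using zC cl(5) cl2(1) be(1)[OF cY[OF y3f]] dZ(1)[OF cZ[OF z4]] by (simp add: Zk1.group_simps)
        then show ?thesis using w4 by simp
      qed
      ultimately show ?thesis using hpullback_a_minus[OF cc deC] by (simp add: hpullback_cpart cone_mod_simps(6))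
    qed
    then show "c \<in> gr_boundaries hpb i k" using gr_boundaries_iff[OF hpb] cc ef by blast
  }
  {
    fix x assume x: "x \<in> gr_cycles U i k"
    have xf: "x \<in> fil (cpart U k) i" and dx: "cdif U k x \<in> fil (cpart U (k - 1)) (i + 1)"
      using gr_cyclesD[OF x] by auto
    obtain y where y: "y \<in> gr_cycles Y i k" and b: "\<alpha> k x \<ominus>\<^bsub>cpart Z k\<^esub> \<beta> k y \<in> gr_boundaries Z i k"
      using q'(3)[OF chmap_gr_cycles[OF U \<alpha> x]] by blast
    have yf: "y \<in> fil (cpart Y k) i" and dy: "cdif Y k y \<in> fil (cpart Y (k - 1)) (i + 1)"
      using gr_cyclesD[OF y] by auto
    obtain z where z: "z \<in> fil (cpart Z (k + 1)) i"
      "\<alpha> k x \<ominus>\<^bsub>cpart Z k\<^esub> \<beta> k y \<ominus>\<^bsub>cpart Z k\<^esub> cdif Z (k + 1) z \<in> fil (cpart Z k) (i + 1)"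
      using b gr_boundaries_iff[OF Z] by blast
    have "cone_case x y z \<in> gr_cycles hpb i k"
      unfolding gr_cycles_def mem_Collect_eq hpullback_cpart cone_mod_simps cone_case_simps hpullback_cdif
      using xf yf z dx dy cX[OF xf] cY[OF yf] cZ[OF z(1)] cX[OF dx] cY[OF dy] cZ[OF z(2)] by simp
    moreover have "x \<ominus>\<^bsub>cpart U k\<^esub> cone_case x y z CX = \<zero>\<^bsub>cpart U k\<^esub>"
      using cX[OF xf] by (simp add: Uk.group_simps)
    ultimately show "\<exists>c\<in>gr_cycles hpb i k. x \<ominus>\<^bsub>cpart U k\<^esub> c CX \<in> gr_boundaries U i k"
      using additive_subgroupD(2)[OF fcomplex_ab[OF U] gr_boundaries_subgroup[OF U]]
      by (intro bexI[of _ "cone_case x y z"]) auto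
  }
qed

end

text \<open>The homotopy pullback has triples as elements and must be copied into \<open>'u\<close>
  to become the apex of a roof. An infinite set is equinumerous with its square, so a pairing used
  twice encodes the triples.\<close>

lemma ore_condition:
  fixes U Y Z :: "('n, 'u) fcx"
  assumes inf: "infinite (UNIV :: 'u set)" and U: "fcomplex U" and Y: "fcomplex Y" and Z: "fcomplex Z"
    and \<alpha>: "chmap U Z \<alpha>" and \<beta>: "fqis Y Z \<beta>"
  obtains E :: "('n, 'u) fcx" and u v where "fcomplex E" "fqis E U u" "chmap E Y v"
    "fhomotopic E Z (\<lambda>k. \<alpha> k \<circ> u k) (\<lambda>k. \<beta> k \<circ> v k)"
proof -
  note \<beta>c = fqisD(1)[OF Y Z \<beta>]
  let ?E = "hpullback U Y Z \<alpha> \<beta>"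
  obtain pr :: "'u \<times> 'u \<Rightarrow> 'u" where pr: "inj pr"
  proof -
    have "|UNIV \<times> UNIV :: ('u \<times> 'u) set| =o |UNIV :: 'u set|" by (rule card_of_Times_same_infinite[OF inf])
    then show ?thesis using that card_of_ordIso[of "UNIV :: ('u \<times> 'u) set" "UNIV :: 'u set"]
      by (auto simp: bij_betw_def)
  qed
  have "inj (\<lambda>c :: cone_index \<Rightarrow> 'u. pr (c CX, pr (c CY, c CZ)))"
  proof (rule injI)
    fix c c' :: "cone_index \<Rightarrow> 'u" assume "pr (c CX, pr (c CY, c CZ)) = pr (c' CX, pr (c' CY, c' CZ))"
    then have "c CX = c' CX" "c CY = c' CY" "c CZ = c' CZ" by (auto simp: inj_eq[OF pr])
    then show "c = c'" by (auto simp: fun_eq_iff all_cone_index)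
  qed
  then have "dobj TYPE('u) ?E"
    unfolding dobj_def using fcomplex_hpullback[OF U Y Z \<alpha> \<beta>c] inj_on_subset by blast
  then obtain E :: "('n, 'u) fcx" and s r where E: "fcomplex E" "fqis E ?E s" by (rule fcomplex_transport)
  note Ef = fcomplex_hpullback[OF U Y Z \<alpha> \<beta>c]
  note s = fqisD(1)[OF E(1) Ef E(2)]
  show thesis
  proof (rule that[OF E(1)])
    show "fqis E U (\<lambda>k. (\<lambda>c. c CX) \<circ> s k)"
      by (rule fqis_comp[OF E(1) Ef U E(2) hpullback_fqis[OF U Y Z \<alpha> \<beta>c \<beta>]])
    show "chmap E Y (\<lambda>k. (\<lambda>c. c CY) \<circ> s k)" by (rule chmap_comp[OF s hpullback_proj(2)[OF U Y Z \<alpha> \<beta>c]])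
    show "fhomotopic E Z (\<lambda>k. \<alpha> k \<circ> ((\<lambda>c. c CX) \<circ> s k)) (\<lambda>k. \<beta> k \<circ> ((\<lambda>c. c CY) \<circ> s k))"
      using fhomotopic_comp_right[OF s hpullback_homotopic[OF U Y Z \<alpha> \<beta>c]] by (simp add: comp_assoc)
  qed
qed

section \<open>Functoriality of the passage to the derived category\<close>

section \<open>The localization functor\<close>

text \<open>Unwinding the unions of roof classes, \<open>dmap A B g\<close> consists of the roofs \<open>(C, s, f)\<close> such that
  \<open>f\<close> and \<open>g \<circ> s\<close> become homotopic after precomposition with a quasi-isomorphism.\<close>

definition lroofs ::
  "('n, 'a) fcx \<Rightarrow> ('n, 'b) fcx \<Rightarrow> (int \<Rightarrow> 'a \<Rightarrow> 'b) \<Rightarrow> ('n, 'u, 'a, 'b) dmor" where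
  "lroofs A B g = {(C, s, f). fcomplex C \<and> fqis C A s \<and> chmap C B f \<and>
     (\<exists>(E :: ('n, 'u) fcx) v. fcomplex E \<and> fqis E C v \<and> fhomotopic E B (\<lambda>k. g k \<circ> (s k \<circ> v k)) (\<lambda>k. f k \<circ> v k))}"

lemma in_roof_class:
  fixes C C' :: "('n, 'u) fcx"
  shows
  "(C', s', f') \<in> roof_class A B (C, s, f) \<longleftrightarrow> fcomplex C' \<and> fqis C' A s' \<and> chmap C' B f' \<and>
     (\<exists>(E :: ('n, 'u) fcx) u v. fcomplex E \<and> chmap E C u \<and> chmap E C' v \<and> fqis E A (\<lambda>k. s k \<circ> u k) \<and>
       fhomotopic E A (\<lambda>k. s k \<circ> u k) (\<lambda>k. s' k \<circ> v k) \<and>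
       fhomotopic E B (\<lambda>k. f k \<circ> u k) (\<lambda>k. f' k \<circ> v k))"
  by (simp add: roof_class_def is_roof_def roof_equiv_def)

text \<open>Roof equivalence asks the composite through the first roof to be a quasi-isomorphism.
  The composite through the second is homotopic to it, hence one as well, and cancellation makes
  \<open>v\<close> a quasi-isomorphism: the refinement is a denominator over the second
  apex.\<close>

lemma roof_classE:
  fixes C C' :: "('n, 'u) fcx"
  assumes "(C', s', f') \<in> roof_class A B (C, s, f)" and A: "fcomplex A"
  obtains E :: "('n, 'u) fcx" and u v where "fcomplex C'" "fqis C' A s'" "chmap C' B f'" "fcomplex E" "chmap E C u" "fqis E C' v"
    "fqis E A (\<lambda>k. s k \<circ> u k)" "fhomotopic E A (\<lambda>k. s k \<circ> u k) (\<lambda>k. s' k \<circ> v k)"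
    "fhomotopic E B (\<lambda>k. f k \<circ> u k) (\<lambda>k. f' k \<circ> v k)"
proof -
  obtain E :: "('n, 'u) fcx" and u v where *: "fcomplex C'" "fqis C' A s'" "chmap C' B f'" "fcomplex E" "chmap E C u" "chmap E C' v"
    "fqis E A (\<lambda>k. s k \<circ> u k)" "fhomotopic E A (\<lambda>k. s k \<circ> u k) (\<lambda>k. s' k \<circ> v k)"
    "fhomotopic E B (\<lambda>k. f k \<circ> u k) (\<lambda>k. f' k \<circ> v k)"
    using assms(1) unfolding in_roof_class by blast
  have "fqis E A (\<lambda>k. s' k \<circ> v k)"
    by (rule fqis_homotopic[OF *(4) A *(7) chmap_comp[OF *(6) fqisD(1)[OF *(1) A *(2)]] *(8)])
  then have "fqis E C' v" by (rule fqis_cancel[OF *(4,1) A *(6,2)])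
  then show thesis using that * by blast
qed

lemma lroofsE:
  fixes C :: "('n, 'u) fcx"
  assumes "(C, s, f) \<in> lroofs A B g"
  obtains E :: "('n, 'u) fcx" and v where "fcomplex C" "fqis C A s" "chmap C B f" "fcomplex E" "fqis E C v"
    "fhomotopic E B (\<lambda>k. g k \<circ> (s k \<circ> v k)) (\<lambda>k. f k \<circ> v k)"
  using assms unfolding lroofs_def by blast

lemma lroofsI:
  fixes C E :: "('n, 'u) fcx"
  assumes "fcomplex C" "fqis C A s" "chmap C B f" "fcomplex E" "fqis E C v"
    "fhomotopic E B (\<lambda>k. g k \<circ> (s k \<circ> v k)) (\<lambda>k. f k \<circ> v k)"
  shows "(C, s, f) \<in> lroofs A B g" using assms unfolding lroofs_def by blast

text \<open>Over a suitable denominator the right leg of a member of \<open>lroofs\<close> may be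
  taken to be literally \<open>g\<close> after the left leg, which is the shape of roof from which
  \<open>dmap\<close> is assembled.\<close>

lemma lroofs_refine:
  fixes C :: "('n, 'u) fcx"
  assumes A: "fcomplex A" and B: "fcomplex B" and g: "chmap A B g" and "(C, s, f) \<in> lroofs A B g"
  obtains E :: "('n, 'u) fcx" and v where "fcomplex E" "fqis E C v"
    "(E, \<lambda>k. s k \<circ> v k, \<lambda>k. g k \<circ> (s k \<circ> v k)) \<in> lroofs A B g"
    "(C, s, f) \<in> roof_class A B (E, \<lambda>k. s k \<circ> v k, \<lambda>k. g k \<circ> (s k \<circ> v k))"
proof -
  obtain E :: "('n, 'u) fcx" and v where *: "fcomplex C" "fqis C A s" "chmap C B f" "fcomplex E" "fqis E C v"
    "fhomotopic E B (\<lambda>k. g k \<circ> (s k \<circ> v k)) (\<lambda>k. f k \<circ> v k)"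
    using assms(4) by (rule lroofsE)
  have sv: "fqis E A (\<lambda>k. s k \<circ> v k)" by (rule fqis_comp[OF *(4,1) A *(5,2)])
  note svc = fqisD(1)[OF *(4) A sv]
  note gsv = chmap_comp[OF svc g]
  have id: "fqis E E (\<lambda>k x. x)" by (rule fqis_id[OF *(4)])
  show thesis
  proof (rule that[OF *(4,5)])
    show "(E, \<lambda>k. s k \<circ> v k, \<lambda>k. g k \<circ> (s k \<circ> v k)) \<in> lroofs A B g"
      by (rule lroofsI[OF *(4) sv gsv *(4) id]) (use fhomotopic_refl[OF *(4) B gsv] in \<open>simp add: comp_def\<close>)
    show "(C, s, f) \<in> roof_class A B (E, \<lambda>k. s k \<circ> v k, \<lambda>k. g k \<circ> (s k \<circ> v k))"
      unfolding in_roof_class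
      by (intro conjI exI[of _ E] exI[of _ "\<lambda>k x. x"] exI[of _ v] *(1-4) fqisD(1)[OF *(4,1,5)] chmap_id)
        (use sv fhomotopic_refl[OF *(4) A svc] *(6) in \<open>simp_all add: comp_def\<close>)
  qed
qed

text \<open>Membership is inherited along roof equivalence: apply \<open>g\<close> to the homotopy
  between the left legs and continue with the one between the right legs.\<close>

lemma roof_class_lroofs:
  fixes C :: "('n, 'u) fcx"
  assumes A: "fcomplex A" and B: "fcomplex B" and g: "chmap A B g" and C: "fcomplex C" and s: "fqis C A s"
  shows "roof_class A B (C, s, \<lambda>k. g k \<circ> s k) \<subseteq> lroofs A B g"
proof (clarify)
  fix C' :: "('n, 'u) fcx" and s' f' assume "(C', s', f') \<in> roof_class A B (C, s, \<lambda>k. g k \<circ> s k)"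
  then obtain E :: "('n, 'u) fcx" and u v where *: "fcomplex C'" "fqis C' A s'" "chmap C' B f'" "fcomplex E" "chmap E C u" "fqis E C' v"
    "fqis E A (\<lambda>k. s k \<circ> u k)" "fhomotopic E A (\<lambda>k. s k \<circ> u k) (\<lambda>k. s' k \<circ> v k)"
    "fhomotopic E B (\<lambda>k. (g k \<circ> s k) \<circ> u k) (\<lambda>k. f' k \<circ> v k)"
    by (rule roof_classE[OF _ A])
  note v = fqisD(1)[OF *(4,1,6)] and s' = fqisD(1)[OF *(1) A *(2)] and su = fqisD(1)[OF *(4) A *(7)]
  have "fhomotopic E B (\<lambda>k. g k \<circ> (s' k \<circ> v k)) (\<lambda>k. g k \<circ> (s k \<circ> u k))"
    by (rule fhomotopic_comp_left[OF *(4) A B su g fhomotopic_sym[OF *(4) A chmap_comp[OF v s'] *(8)]])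
  then have "fhomotopic E B (\<lambda>k. g k \<circ> (s' k \<circ> v k)) (\<lambda>k. f' k \<circ> v k)"
    by (rule fhomotopic_trans[OF *(4) B chmap_comp[OF v *(3)]]) (use *(9) in \<open>simp add: comp_assoc\<close>)
  then show "(C', s', f') \<in> lroofs A B g" by (rule lroofsI[OF *(1-4,6)])
qed

text \<open>A direct criterion for membership in the union over all denominators. Calculations with
  composites and sums then only have to produce homotopies, and no transitivity of roof equivalence
  is invoked.\<close>

lemma dmap_lroofs:
  assumes A: "fcomplex A" and B: "fcomplex B" and g: "chmap A B g"
  shows "dmap A B g = (lroofs A B g :: ('n, 'u, 'a, 'b) dmor)"
proof
  show "dmap A B g \<subseteq> (lroofs A B g :: ('n, 'u, 'a, 'b) dmor)"
    unfolding dmap_def using roof_class_lroofs[OF A B g] by blast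
  show "lroofs A B g \<subseteq> (dmap A B g :: ('n, 'u, 'a, 'b) dmor)"
  proof clarify
    fix C :: "('n, 'u) fcx" and s f assume *: "(C, s, f) \<in> lroofs A B g"
    then obtain E :: "('n, 'u) fcx" and v where E: "fcomplex E" "fqis E C v"
      "(C, s, f) \<in> roof_class A B (E, \<lambda>k. s k \<circ> v k, \<lambda>k. g k \<circ> (s k \<circ> v k))"
      by (rule lroofs_refine[OF A B g])
    have "fcomplex C" "fqis C A s" using * by (auto simp: lroofs_def)
    then have "fqis E A (\<lambda>k. s k \<circ> v k)" using fqis_comp[OF E(1) _ A E(2)] by blast
    then show "(C, s, f) \<in> dmap A B g" unfolding dmap_def using E(1,3) by blast
  qed
qed

text \<open>A representative of \<open>A\<close> inside the universe serves as the apex of a roof representing \<open>dmap A B g\<close>.\<close>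

lemma dmap_in_dhom:
  assumes A: "dobj TYPE('u) A" and B: "fcomplex B" and g: "chmap A B g"
  shows "(dmap A B g :: ('n, 'u, 'a, 'b) dmor) \<in> dhom A B"
proof -
  have Af: "fcomplex A" using A by (simp add: dobj_def)
  obtain C :: "('n, 'u) fcx" and s r where C: "fcomplex C" "fqis C A s" "chmap A C r"
    "\<And>k x. x \<in> carrier (cpart A k) \<Longrightarrow> s k (r k x) = x" using fcomplex_transport[OF A] by metis
  note s = fqisD(1)[OF C(1) Af C(2)]
  have "(C', s', f') \<in> roof_class A B (C, s, \<lambda>k. g k \<circ> s k)" if l: "(C', s', f') \<in> lroofs A B g"
    for C' :: "('n, 'u) fcx" and s' f'
  proof -
    obtain E :: "('n, 'u) fcx" and v where *: "fcomplex C'" "fqis C' A s'" "chmap C' B f'" "fcomplex E" "fqis E C' v"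
      "fhomotopic E B (\<lambda>k. g k \<circ> (s' k \<circ> v k)) (\<lambda>k. f' k \<circ> v k)"
      using l by (rule lroofsE)
    have sv: "fqis E A (\<lambda>k. s' k \<circ> v k)" by (rule fqis_comp[OF *(4,1) Af *(5,2)])
    note svc = fqisD(1)[OF *(4) Af sv]
    note u = chmap_comp[OF svc C(3)]
    \<comment> \<open>As \<open>s\<close> after \<open>r\<close> is the identity, the refinement
      maps to the apex \<open>C\<close> by \<open>r\<close> after its own left leg, strictly
      compatible with the left legs.\<close>
    have eq: "(s k \<circ> (r k \<circ> (s' k \<circ> v k))) x = (s' k \<circ> v k) x" if "x \<in> carrier (cpart E k)" for k x
      using C(4) gfhomD(1)[OF chmapD(1)[OF svc] that] by simp
    have h: "fhomotopic E A (\<lambda>k. s k \<circ> (r k \<circ> (s' k \<circ> v k))) (\<lambda>k. s' k \<circ> v k)"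
      by (rule fhomotopic_eqI[OF *(4) Af chmap_comp[OF u s]]) (rule eq)
    have q: "fqis E A (\<lambda>k. s k \<circ> (r k \<circ> (s' k \<circ> v k)))"
      by (rule fqis_homotopic[OF *(4) Af sv chmap_comp[OF u s] fhomotopic_sym[OF *(4) Af svc h]])
    have "fhomotopic E B (\<lambda>k. g k \<circ> (s k \<circ> (r k \<circ> (s' k \<circ> v k)))) (\<lambda>k. f' k \<circ> v k)"
      by (rule fhomotopic_trans[OF *(4) B chmap_comp[OF fqisD(1)[OF *(4,1,5)] *(3)]
          fhomotopic_comp_left[OF *(4) Af B svc g h] *(6)])
    then show ?thesis unfolding in_roof_class
      by (intro conjI *(1-3) exI[of _ E] exI[of _ "\<lambda>k. r k \<circ> (s' k \<circ> v k)"] exI[of _ v] *(4) u fqisD(1)[OF *(4,1,5)] q h)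
        (simp add: comp_assoc)
  qed
  then have "lroofs A B g = roof_class A B (C, s, \<lambda>k. g k \<circ> s k)"
    using roof_class_lroofs[OF Af B g C(1,2)] by auto
  moreover have "is_roof A B (C, s, \<lambda>k. g k \<circ> s k)"
    using C(1,2) chmap_comp[OF s g] by (simp add: is_roof_def)
  ultimately show ?thesis unfolding dmap_lroofs[OF Af B g] dhom_def by blast
qed

text \<open>Chain maps are families of total functions, and a calculation usually controls them on
  carriers alone; this is the congruence by which such calculations become equations in the derived
  category.\<close>

lemma dmap_cong:
  assumes A: "fcomplex A" and B: "fcomplex B" and f: "chmap A B f"
    and eq: "\<And>k x. x \<in> carrier (cpart A k) \<Longrightarrow> f k x = g k x"
  shows "dmap A B f = (dmap A B g :: ('n, 'u, 'a, 'b) dmor)"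
proof -
  have *: "lroofs A B f \<subseteq> (lroofs A B g :: ('n, 'u, 'a, 'b) dmor)" if f: "chmap A B f" and g: "chmap A B g"
    and eq: "\<And>k x. x \<in> carrier (cpart A k) \<Longrightarrow> f k x = g k x" for f g
  proof clarify
    fix C :: "('n, 'u) fcx" and s p assume "(C, s, p) \<in> lroofs A B f"
    then obtain E :: "('n, 'u) fcx" and v where *: "fcomplex C" "fqis C A s" "chmap C B p" "fcomplex E" "fqis E C v"
      "fhomotopic E B (\<lambda>k. f k \<circ> (s k \<circ> v k)) (\<lambda>k. p k \<circ> v k)" by (rule lroofsE)
    note sv = fqisD(1)[OF *(4) A fqis_comp[OF *(4,1) A *(5,2)]]
    have "fhomotopic E B (\<lambda>k. g k \<circ> (s k \<circ> v k)) (\<lambda>k. f k \<circ> (s k \<circ> v k))"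
      by (rule fhomotopic_eqI[OF *(4) B chmap_comp[OF sv g]]) (use eq gfhomD(1)[OF chmapD(1)[OF sv]] in auto)
    from fhomotopic_trans[OF *(4) B chmap_comp[OF fqisD(1)[OF *(4,1,5)] *(3)] this *(6)]
    show "(C, s, p) \<in> lroofs A B g" by (rule lroofsI[OF *(1-5)])
  qed
  have g: "chmap A B g" by (rule chmap_cong[OF A f eq])
  show ?thesis unfolding dmap_lroofs[OF A B f] dmap_lroofs[OF A B g]
    using *[OF f g eq] *[OF g f eq[symmetric]] by blast
qed

lemma fhomotopic_middle:
  assumes "fcomplex W" "fcomplex C" "fcomplex D" "fcomplex E" "chmap W C m" "chmap C D y" "chmap D E g"
    "fhomotopic C D x y"
  shows "fhomotopic W E (\<lambda>k. g k \<circ> (x k \<circ> m k)) (\<lambda>k. g k \<circ> (y k \<circ> m k))"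
  by (rule fhomotopic_comp_left[OF assms(1,3,4) chmap_comp[OF assms(5,6)] assms(7)
      fhomotopic_comp_right[OF assms(5,8)]])

text \<open>A member of the composite comes with two roofs, each with its own denominator over which
  its right leg is the given map up to homotopy. Two uses of the Ore condition pull all of them back
  to one apex, where a chain of homotopies remains. Conversely, a roof for g f is factored
  explicitly, with the second factor over a copy of \<open>B\<close>.\<close>

lemma dcomp_dmap:
  assumes inf: "infinite (UNIV :: 'u set)"
    and A: "fcomplex A" and B: "dobj TYPE('u) B" and D: "fcomplex D" and f: "chmap A B f" and g: "chmap B D g"
  shows "dcomp A B D (dmap B D g) (dmap A B f) = (dmap A D (\<lambda>k. g k \<circ> f k) :: ('n, 'u, 'a, 'd) dmor)"
proof -
  have Bf: "fcomplex B" using B by (simp add: dobj_def)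
  note gf = chmap_comp[OF f g]
  have "dcomp A B D (lroofs B D g) (lroofs A B f) \<subseteq> (lroofs A D (\<lambda>k. g k \<circ> f k) :: ('n, 'u, 'a, 'd) dmor)"
  proof clarify
    fix P :: "('n, 'u) fcx" and p q assume "(P, p, q) \<in> dcomp A B D (lroofs B D g) (lroofs A B f)"
    then obtain E C C' :: "('n, 'u) fcx" and u v s f' s' g' where cl: "(C, s, f') \<in> lroofs A B f" "(C', s', g') \<in> lroofs B D g"
      and E: "fcomplex E" "fqis E C u" "chmap E C' v" "fhomotopic E B (\<lambda>k. f' k \<circ> u k) (\<lambda>k. s' k \<circ> v k)"
      and P: "(P, p, q) \<in> roof_class A D (E, \<lambda>k. s k \<circ> u k, \<lambda>k. g' k \<circ> v k)"
      unfolding dcomp_def Union_iff mem_Collect_eq by blast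
    obtain E2 :: "('n, 'u) fcx" and v2 where C: "fcomplex C" "fqis C A s" "chmap C B f'" and E2: "fcomplex E2" "fqis E2 C v2"
      "fhomotopic E2 B (\<lambda>k. f k \<circ> (s k \<circ> v2 k)) (\<lambda>k. f' k \<circ> v2 k)" using cl(1) by (rule lroofsE)
    obtain E1 :: "('n, 'u) fcx" and v1 where C': "fcomplex C'" "fqis C' B s'" "chmap C' D g'" and E1: "fcomplex E1" "fqis E1 C' v1"
      "fhomotopic E1 D (\<lambda>k. g k \<circ> (s' k \<circ> v1 k)) (\<lambda>k. g' k \<circ> v1 k)" using cl(2) by (rule lroofsE)
    obtain W :: "('n, 'u) fcx" and a w where P: "fcomplex P" "fqis P A p" "chmap P D q" and W: "fcomplex W" "chmap W E a" "fqis W P w"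
      "fhomotopic W A (\<lambda>k. (s k \<circ> u k) \<circ> a k) (\<lambda>k. p k \<circ> w k)"
      "fhomotopic W D (\<lambda>k. (g' k \<circ> v k) \<circ> a k) (\<lambda>k. q k \<circ> w k)"
      using P by (rule roof_classE[OF _ A])
    note s = fqisD(1)[OF C(1) A C(2)] and u = fqisD(1)[OF E(1) C(1) E(2)] and s' = fqisD(1)[OF C'(1) Bf C'(2)]
      and v2 = fqisD(1)[OF E2(1) C(1) E2(2)] and v1 = fqisD(1)[OF E1(1) C'(1) E1(2)]
      and w = fqisD(1)[OF W(1) P(1) W(3)] and p = fqisD(1)[OF P(1) A P(2)]
    note ua = chmap_comp[OF W(2) u] and va = chmap_comp[OF W(2) E(3)]
    \<comment> \<open>Ore over \<open>C\<close>: makes the denominator \<open>v2\<close> of the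
      first roof available, over which \<open>f'\<close> is f s up to homotopy.\<close>
    obtain F1 :: "('n, 'u) fcx" and a1 b1 where F1: "fcomplex F1" "fqis F1 W a1" "chmap F1 E2 b1"
      "fhomotopic F1 C (\<lambda>k. (u k \<circ> a k) \<circ> a1 k) (\<lambda>k. v2 k \<circ> b1 k)"
      by (rule ore_condition[OF inf W(1) E2(1) C(1) ua E2(2)])
    note a1 = fqisD(1)[OF F1(1) W(1) F1(2)]
    \<comment> \<open>Ore over \<open>C'\<close>, for the denominator \<open>v1\<close> of the
      second roof, over which \<open>g'\<close> is g s' up to homotopy.\<close>
    obtain F :: "('n, 'u) fcx" and a2 b2 where F: "fcomplex F" "fqis F F1 a2" "chmap F E1 b2"
      "fhomotopic F C' (\<lambda>k. ((v k \<circ> a k) \<circ> a1 k) \<circ> a2 k) (\<lambda>k. v1 k \<circ> b2 k)"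
      by (rule ore_condition[OF inf F1(1) E1(1) C'(1) chmap_comp[OF a1 va] E1(2)])
    note a2 = fqisD(1)[OF F(1) F1(1) F(2)]
    define m where "m = (\<lambda>k. a1 k \<circ> a2 k)"
    have mq: "fqis F W m" unfolding m_def by (rule fqis_comp[OF F(1) F1(1) W(1) F(2) F1(2)])
    note m = fqisD(1)[OF F(1) W(1) mq]
    have wm: "fqis F P (\<lambda>k. w k \<circ> m k)" by (rule fqis_comp[OF F(1) W(1) P(1) mq W(3)])
    note tr = fhomotopic_trans[OF F(1) D]
    note am = chmap_comp[OF m W(2)]
    note vam = chmap_comp[OF am E(3)] and uam = chmap_comp[OF am u]
    \<comment> \<open>Over \<open>F\<close>, the composite g f p w is moved to g f s u a; then f s
      is replaced by f' along \<open>v2\<close>, f' u by s' v, and g s' by g' along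
      \<open>v1\<close>. The numbered homotopies are these replacements, listed from the far end of
      the chain.\<close>
    have h1: "fhomotopic F D (\<lambda>k. g' k \<circ> (v k \<circ> (a k \<circ> m k))) (\<lambda>k. q k \<circ> (w k \<circ> m k))"
      using fhomotopic_comp_right[OF m W(5)] by (simp add: comp_assoc)
    have h2: "fhomotopic F C' (\<lambda>k. v k \<circ> (a k \<circ> m k)) (\<lambda>k. v1 k \<circ> b2 k)"
      using F(4) by (simp add: m_def comp_assoc)
    note vb = chmap_comp[OF F(3) v1]
    have h3: "fhomotopic F D (\<lambda>k. g' k \<circ> (v1 k \<circ> b2 k)) (\<lambda>k. g' k \<circ> (v k \<circ> (a k \<circ> m k)))"
      by (rule fhomotopic_comp_left[OF F(1) C'(1) D vam C'(3) fhomotopic_sym[OF F(1) C'(1) vb h2]])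
    have h4: "fhomotopic F D (\<lambda>k. g k \<circ> (s' k \<circ> (v1 k \<circ> b2 k))) (\<lambda>k. g' k \<circ> (v1 k \<circ> b2 k))"
      using fhomotopic_comp_right[OF F(3) E1(3)] by (simp add: comp_assoc)
    have h5: "fhomotopic F D (\<lambda>k. g k \<circ> (s' k \<circ> (v k \<circ> (a k \<circ> m k)))) (\<lambda>k. g k \<circ> (s' k \<circ> (v1 k \<circ> b2 k)))"
      using fhomotopic_comp_left[OF F(1) C'(1) D vb chmap_comp[OF s' g] h2] by (simp add: comp_assoc)
    have h6: "fhomotopic F D (\<lambda>k. g k \<circ> (f' k \<circ> (u k \<circ> (a k \<circ> m k)))) (\<lambda>k. g k \<circ> (s' k \<circ> (v k \<circ> (a k \<circ> m k))))"
      using fhomotopic_middle[OF F(1) E(1) Bf D am chmap_comp[OF E(3) s'] g E(4)] by (simp add: comp_assoc)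
    have h7: "fhomotopic F C (\<lambda>k. u k \<circ> (a k \<circ> m k)) (\<lambda>k. v2 k \<circ> (b1 k \<circ> a2 k))"
      using fhomotopic_comp_right[OF a2 F1(4)] by (simp add: m_def comp_assoc)
    note vba = chmap_comp[OF chmap_comp[OF a2 F1(3)] v2]
    have h8: "fhomotopic F D (\<lambda>k. g k \<circ> (f' k \<circ> (v2 k \<circ> (b1 k \<circ> a2 k)))) (\<lambda>k. g k \<circ> (f' k \<circ> (u k \<circ> (a k \<circ> m k))))"
      using fhomotopic_comp_left[OF F(1) C(1) D uam chmap_comp[OF C(3) g] fhomotopic_sym[OF F(1) C(1) vba h7]]
      by (simp add: comp_assoc)
    have h9: "fhomotopic F D (\<lambda>k. g k \<circ> (f k \<circ> (s k \<circ> (v2 k \<circ> (b1 k \<circ> a2 k))))) (\<lambda>k. g k \<circ> (f' k \<circ> (v2 k \<circ> (b1 k \<circ> a2 k))))"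
      using fhomotopic_middle[OF F(1) E2(1) Bf D chmap_comp[OF a2 F1(3)] chmap_comp[OF v2 C(3)] g E2(3)]
      by (simp add: comp_assoc)
    have h10: "fhomotopic F D (\<lambda>k. g k \<circ> (f k \<circ> (s k \<circ> (u k \<circ> (a k \<circ> m k)))))
        (\<lambda>k. g k \<circ> (f k \<circ> (s k \<circ> (v2 k \<circ> (b1 k \<circ> a2 k)))))"
      using fhomotopic_comp_left[OF F(1) C(1) D vba chmap_comp[OF s gf] h7] by (simp add: comp_assoc)
    have h11: "fhomotopic F D (\<lambda>k. g k \<circ> (f k \<circ> (p k \<circ> (w k \<circ> m k)))) (\<lambda>k. g k \<circ> (f k \<circ> (s k \<circ> (u k \<circ> (a k \<circ> m k)))))"
      using fhomotopic_middle[OF F(1) W(1) A D m chmap_comp[OF ua s] gf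
        fhomotopic_sym[OF W(1) A chmap_comp[OF w p] W(4)[unfolded comp_assoc]]] by (simp add: comp_assoc)
    have "fhomotopic F D (\<lambda>k. g k \<circ> (f k \<circ> (p k \<circ> (w k \<circ> m k)))) (\<lambda>k. q k \<circ> (w k \<circ> m k))"
      by (rule tr[OF _ h11] tr[OF _ h10] tr[OF _ h9] tr[OF _ h8] tr[OF _ h6] tr[OF _ h5] tr[OF _ h4] tr[OF _ h3] h1
          chmap_comp[OF chmap_comp[OF m w] P(3)])+
    then have "fhomotopic F D (\<lambda>k. (g k \<circ> f k) \<circ> (p k \<circ> (w k \<circ> m k))) (\<lambda>k. q k \<circ> (w k \<circ> m k))"
      by (simp add: comp_assoc)
    then show "(P, p, q) \<in> lroofs A D (\<lambda>k. g k \<circ> f k)" by (rule lroofsI[OF P F(1) wm])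
  qed
  moreover have "lroofs A D (\<lambda>k. g k \<circ> f k) \<subseteq> (dcomp A B D (lroofs B D g) (lroofs A B f) :: ('n, 'u, 'a, 'd) dmor)"
  proof clarify
    fix P :: "('n, 'u) fcx" and p q assume "(P, p, q) \<in> lroofs A D (\<lambda>k. g k \<circ> f k)"
    then obtain E :: "('n, 'u) fcx" and v where P: "fcomplex P" "fqis P A p" "chmap P D q" and E: "fcomplex E" "fqis E P v"
      "fhomotopic E D (\<lambda>k. (g k \<circ> f k) \<circ> (p k \<circ> v k)) (\<lambda>k. q k \<circ> v k)" by (rule lroofsE)
    have pv: "fqis E A (\<lambda>k. p k \<circ> v k)" by (rule fqis_comp[OF E(1) P(1) A E(2) P(2)])
    note pvc = fqisD(1)[OF E(1) A pv]
    note fpv = chmap_comp[OF pvc f]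
    \<comment> \<open>A copy of \<open>B\<close> inside the universe is the apex of the second
      factor; its map \<open>r\<close> gives a comparison with the first factor that commutes on the
      nose.\<close>
    obtain C :: "('n, 'u) fcx" and s r where C: "fcomplex C" "fqis C B s" "chmap B C r"
      "\<And>k x. x \<in> carrier (cpart B k) \<Longrightarrow> s k (r k x) = x" using fcomplex_transport[OF B] by metis
    note s = fqisD(1)[OF C(1) Bf C(2)]
    note idE = fqis_id[OF E(1)] and idC = fqis_id[OF C(1)]
    have 1: "(E, \<lambda>k. p k \<circ> v k, \<lambda>k. f k \<circ> (p k \<circ> v k)) \<in> lroofs A B f"
      by (rule lroofsI[OF E(1) pv fpv E(1) idE]) (use fhomotopic_refl[OF E(1) Bf fpv] in \<open>simp add: comp_def\<close>)
    have 2: "(C, s, \<lambda>k. g k \<circ> s k) \<in> lroofs B D g"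
      by (rule lroofsI[OF C(1,2) chmap_comp[OF s g] C(1) idC])
        (use fhomotopic_refl[OF C(1) D chmap_comp[OF s g]] in \<open>simp add: comp_def\<close>)
    let ?v = "\<lambda>k. r k \<circ> (f k \<circ> (p k \<circ> v k))"
    have v: "chmap E C ?v" by (rule chmap_comp[OF fpv C(3)])
    have eq: "(f k \<circ> (p k \<circ> v k)) x = (s k \<circ> ?v k) x" if "x \<in> carrier (cpart E k)" for k x
      using C(4) gfhomD(1)[OF chmapD(1)[OF fpv] that] by simp
    have 3: "fhomotopic E B (\<lambda>k. (f k \<circ> (p k \<circ> v k)) \<circ> (\<lambda>x. x)) (\<lambda>k. s k \<circ> ?v k)"
      using fhomotopic_eqI[OF E(1) Bf fpv eq] by (simp add: comp_def)
    have 4: "fhomotopic E D (\<lambda>k. (g k \<circ> s k) \<circ> ?v k) (\<lambda>k. q k \<circ> v k)"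
    proof (rule fhomotopic_trans[OF E(1) D chmap_comp[OF fqisD(1)[OF E(1) P(1) E(2)] P(3)] _ E(3)])
      show "fhomotopic E D (\<lambda>k. (g k \<circ> s k) \<circ> ?v k) (\<lambda>k. (g k \<circ> f k) \<circ> (p k \<circ> v k))"
        by (rule fhomotopic_eqI[OF E(1) D chmap_comp[OF v chmap_comp[OF s g]]]) (use eq in auto)
    qed
    have "(P, p, q) \<in> roof_class A D (E, \<lambda>k. (p k \<circ> v k) \<circ> (\<lambda>x. x), \<lambda>k. (g k \<circ> s k) \<circ> ?v k)"
      unfolding in_roof_class
      by (intro conjI P exI[of _ E] exI[of _ "\<lambda>k x. x"] exI[of _ v] E(1) chmap_id fqisD(1)[OF E(1) P(1) E(2)])
        (use pv fhomotopic_refl[OF E(1) A pvc] 4 in \<open>simp_all add: comp_def\<close>)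
    then show "(P, p, q) \<in> dcomp A B D (lroofs B D g) (lroofs A B f)"
      unfolding dcomp_def using 1 2 E(1) idE v 3 by blast
  qed
  ultimately show ?thesis unfolding dmap_lroofs[OF A Bf f] dmap_lroofs[OF Bf D g] dmap_lroofs[OF A D gf] by blast
qed

text \<open>By definition the summands share apex and left leg, but each has its own denominator
  over which its right leg becomes the given map. Two uses of the Ore condition yield one apex that
  serves both.\<close>

lemma dadd_dmap:
  assumes inf: "infinite (UNIV :: 'u set)"
    and A: "fcomplex A" and B: "fcomplex B" and f: "chmap A B f" and g: "chmap A B g"
  shows "dadd A B (dmap A B f) (dmap A B g) = (dmap A B (\<lambda>k x. f k x \<oplus>\<^bsub>cpart B k\<^esub> g k x) :: ('n, 'u, 'a, 'b) dmor)"
proof -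
  note fg = chmap_add[OF A B f g]
  let ?fg = "\<lambda>k x. f k x \<oplus>\<^bsub>cpart B k\<^esub> g k x"
  have "dadd A B (lroofs A B f) (lroofs A B g) \<subseteq> (lroofs A B ?fg :: ('n, 'u, 'a, 'b) dmor)"
  proof clarify
    fix P :: "('n, 'u) fcx" and p q assume "(P, p, q) \<in> dadd A B (lroofs A B f) (lroofs A B g)"
    then obtain C :: "('n, 'u) fcx" and s f' g' where cl: "(C, s, f') \<in> lroofs A B f" "(C, s, g') \<in> lroofs A B g"
      and P: "(P, p, q) \<in> roof_class A B (C, s, \<lambda>k x. f' k x \<oplus>\<^bsub>cpart B k\<^esub> g' k x)"
      unfolding dadd_def Union_iff mem_Collect_eq by blast
    obtain E1 :: "('n, 'u) fcx" and v1 where C: "fcomplex C" "fqis C A s" "chmap C B f'" and E1: "fcomplex E1" "fqis E1 C v1"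
      "fhomotopic E1 B (\<lambda>k. f k \<circ> (s k \<circ> v1 k)) (\<lambda>k. f' k \<circ> v1 k)" using cl(1) by (rule lroofsE)
    obtain E2 :: "('n, 'u) fcx" and v2 where g': "chmap C B g'" and E2: "fcomplex E2" "fqis E2 C v2"
      "fhomotopic E2 B (\<lambda>k. g k \<circ> (s k \<circ> v2 k)) (\<lambda>k. g' k \<circ> v2 k)" using cl(2) by (rule lroofsE)
    obtain W :: "('n, 'u) fcx" and a w where P: "fcomplex P" "fqis P A p" "chmap P B q" and W: "fcomplex W" "chmap W C a" "fqis W P w"
      "fhomotopic W A (\<lambda>k. s k \<circ> a k) (\<lambda>k. p k \<circ> w k)"
      "fhomotopic W B (\<lambda>k. (\<lambda>x. f' k x \<oplus>\<^bsub>cpart B k\<^esub> g' k x) \<circ> a k) (\<lambda>k. q k \<circ> w k)"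
      using P by (rule roof_classE[OF _ A])
    note s = fqisD(1)[OF C(1) A C(2)]
      and v2 = fqisD(1)[OF E2(1) C(1) E2(2)] and v1 = fqisD(1)[OF E1(1) C(1) E1(2)]
      and w = fqisD(1)[OF W(1) P(1) W(3)] and p = fqisD(1)[OF P(1) A P(2)]
    obtain F1 :: "('n, 'u) fcx" and a1 b1 where F1: "fcomplex F1" "fqis F1 W a1" "chmap F1 E1 b1"
      "fhomotopic F1 C (\<lambda>k. a k \<circ> a1 k) (\<lambda>k. v1 k \<circ> b1 k)"
      by (rule ore_condition[OF inf W(1) E1(1) C(1) W(2) E1(2)])
    note a1 = fqisD(1)[OF F1(1) W(1) F1(2)]
    obtain F :: "('n, 'u) fcx" and a2 b2 where F: "fcomplex F" "fqis F F1 a2" "chmap F E2 b2"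
      "fhomotopic F C (\<lambda>k. (a k \<circ> a1 k) \<circ> a2 k) (\<lambda>k. v2 k \<circ> b2 k)"
      by (rule ore_condition[OF inf F1(1) E2(1) C(1) chmap_comp[OF a1 W(2)] E2(2)])
    note a2 = fqisD(1)[OF F(1) F1(1) F(2)]
    define m where "m = (\<lambda>k. a1 k \<circ> a2 k)"
    have mq: "fqis F W m" unfolding m_def by (rule fqis_comp[OF F(1) F1(1) W(1) F(2) F1(2)])
    note m = fqisD(1)[OF F(1) W(1) mq]
    have wm: "fqis F P (\<lambda>k. w k \<circ> m k)" by (rule fqis_comp[OF F(1) W(1) P(1) mq W(3)])
    note am = chmap_comp[OF m W(2)]
    \<comment> \<open>Treats both summands at once: a homotopy valid over a denominator
      \<open>vv\<close> is carried to the refinement along the homotopy from a m to vv b.\<close>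
    have key: "fhomotopic F B (\<lambda>k. l k \<circ> (s k \<circ> (a k \<circ> m k))) (\<lambda>k. l' k \<circ> (a k \<circ> m k))"
      if l: "chmap A B l" and l': "chmap C B l'" and vb: "chmap F C (\<lambda>k. vv k \<circ> b k)"
        and h: "fhomotopic F C (\<lambda>k. a k \<circ> m k) (\<lambda>k. vv k \<circ> b k)"
        and e: "fhomotopic F B (\<lambda>k. l k \<circ> (s k \<circ> (vv k \<circ> b k))) (\<lambda>k. l' k \<circ> (vv k \<circ> b k))" for l l' vv b
    proof -
      have 1: "fhomotopic F B (\<lambda>k. l k \<circ> (s k \<circ> (a k \<circ> m k))) (\<lambda>k. l k \<circ> (s k \<circ> (vv k \<circ> b k)))"
        using fhomotopic_comp_left[OF F(1) C(1) B vb chmap_comp[OF s l] h] by (simp add: comp_assoc)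
      have 2: "fhomotopic F B (\<lambda>k. l' k \<circ> (vv k \<circ> b k)) (\<lambda>k. l' k \<circ> (a k \<circ> m k))"
        by (rule fhomotopic_comp_left[OF F(1) C(1) B am l' fhomotopic_sym[OF F(1) C(1) vb h]])
      show ?thesis by (rule fhomotopic_trans[OF F(1) B chmap_comp[OF am l'] 1]
          fhomotopic_trans[OF F(1) B chmap_comp[OF am l'] e 2])+
    qed
    note b1a2 = chmap_comp[OF a2 F1(3)]
    have kf: "fhomotopic F B (\<lambda>k. f k \<circ> (s k \<circ> (a k \<circ> m k))) (\<lambda>k. f' k \<circ> (a k \<circ> m k))"
      by (rule key[OF f C(3) chmap_comp[OF b1a2 v1]])
        (use fhomotopic_comp_right[OF a2 F1(4)] fhomotopic_comp_right[OF b1a2 E1(3)] in \<open>simp_all add: m_def comp_assoc\<close>)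
    have kg: "fhomotopic F B (\<lambda>k. g k \<circ> (s k \<circ> (a k \<circ> m k))) (\<lambda>k. g' k \<circ> (a k \<circ> m k))"
      by (rule key[OF g g' chmap_comp[OF F(3) v2]])
        (use F(4) fhomotopic_comp_right[OF F(3) E2(3)] in \<open>simp_all add: m_def comp_assoc\<close>)
    have h1: "fhomotopic F B (\<lambda>k. ?fg k \<circ> (s k \<circ> (a k \<circ> m k)))
        (\<lambda>k. (\<lambda>x. f' k x \<oplus>\<^bsub>cpart B k\<^esub> g' k x) \<circ> (a k \<circ> m k))"
      using fhomotopic_add[OF F(1) B chmap_comp[OF am C(3)] chmap_comp[OF am g'] kf kg] by (simp add: comp_def)
    have h2: "fhomotopic F B (\<lambda>k. (\<lambda>x. f' k x \<oplus>\<^bsub>cpart B k\<^esub> g' k x) \<circ> (a k \<circ> m k)) (\<lambda>k. q k \<circ> (w k \<circ> m k))"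
      using fhomotopic_comp_right[OF m W(5)] by (simp add: comp_assoc)
    have h3: "fhomotopic F B (\<lambda>k. ?fg k \<circ> (p k \<circ> (w k \<circ> m k))) (\<lambda>k. ?fg k \<circ> (s k \<circ> (a k \<circ> m k)))"
      using fhomotopic_middle[OF F(1) W(1) A B m chmap_comp[OF W(2) s] fg
        fhomotopic_sym[OF W(1) A chmap_comp[OF w p] W(4)]] by (simp add: comp_assoc)
    note qwm = chmap_comp[OF chmap_comp[OF m w] P(3)]
    have "fhomotopic F B (\<lambda>k. ?fg k \<circ> (p k \<circ> (w k \<circ> m k))) (\<lambda>k. q k \<circ> (w k \<circ> m k))"
      by (rule fhomotopic_trans[OF F(1) B qwm h3 fhomotopic_trans[OF F(1) B qwm h1 h2]])
    then show "(P, p, q) \<in> lroofs A B ?fg" by (rule lroofsI[OF P F(1) wm])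
  qed
  moreover have "lroofs A B ?fg \<subseteq> (dadd A B (lroofs A B f) (lroofs A B g) :: ('n, 'u, 'a, 'b) dmor)"
  proof clarify
    fix P :: "('n, 'u) fcx" and p q assume "(P, p, q) \<in> lroofs A B ?fg"
    then obtain E :: "('n, 'u) fcx" and v where P: "fcomplex P" "fqis P A p" "chmap P B q" and E: "fcomplex E" "fqis E P v"
      "fhomotopic E B (\<lambda>k. ?fg k \<circ> (p k \<circ> v k)) (\<lambda>k. q k \<circ> v k)" by (rule lroofsE)
    have pv: "fqis E A (\<lambda>k. p k \<circ> v k)" by (rule fqis_comp[OF E(1) P(1) A E(2) P(2)])
    note pvc = fqisD(1)[OF E(1) A pv]
    note idE = fqis_id[OF E(1)]
    have 1: "(E, \<lambda>k. p k \<circ> v k, \<lambda>k. l k \<circ> (p k \<circ> v k)) \<in> lroofs A B l" if "chmap A B l" for l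
      by (rule lroofsI[OF E(1) pv chmap_comp[OF pvc that] E(1) idE])
        (use fhomotopic_refl[OF E(1) B chmap_comp[OF pvc that]] in \<open>simp add: comp_def\<close>)
    have "(P, p, q) \<in> roof_class A B (E, \<lambda>k. p k \<circ> v k,
        \<lambda>k x. (f k \<circ> (p k \<circ> v k)) x \<oplus>\<^bsub>cpart B k\<^esub> (g k \<circ> (p k \<circ> v k)) x)"
      unfolding in_roof_class
      by (intro conjI P exI[of _ E] exI[of _ "\<lambda>k x. x"] exI[of _ v] E(1) chmap_id fqisD(1)[OF E(1) P(1) E(2)])
        (use pv fhomotopic_refl[OF E(1) A pvc] E(3) in \<open>simp_all add: comp_def\<close>)
    then show "(P, p, q) \<in> dadd A B (lroofs A B f) (lroofs A B g)"
      unfolding dadd_def using 1[OF f] 1[OF g] by blast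
  qed
  ultimately show ?thesis unfolding dmap_lroofs[OF A B f] dmap_lroofs[OF A B g] dmap_lroofs[OF A B fg] by blast
qed

section \<open>Polynomials: induction, evaluation homomorphisms and degree\<close>

section \<open>Evaluation and degree of polynomials\<close>

lemma pm_sum_single: "(\<Sum>k\<in>Poly_Mapping.keys p. Poly_Mapping.single k (Poly_Mapping.lookup p k)) = p"
  by (rule poly_mapping_eqI)
    (simp add: lookup_sum lookup_single when_def in_keys_iff)

lemma pm_induct [case_names zero single add]:
  assumes "P 0" "\<And>k a. P (Poly_Mapping.single k a)" "\<And>p q. P p \<Longrightarrow> P q \<Longrightarrow> P (p + q)"
  shows "P (p :: 'a \<Rightarrow>\<^sub>0 'b::comm_monoid_add)"
proof -
  have "P (\<Sum>k\<in>S. Poly_Mapping.single k (Poly_Mapping.lookup p k))" if "finite S" for S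
    using that by induction (use assms in auto)
  from this[of "Poly_Mapping.keys p"] show ?thesis by (simp add: pm_sum_single)
qed

lemma nat_pm_induct [case_names zero plus]:
  assumes "P 0" "\<And>v \<mu>. P \<mu> \<Longrightarrow> P (Poly_Mapping.single v 1 + \<mu>)"
  shows "P (\<mu> :: 'v \<Rightarrow>\<^sub>0 nat)"
proof -
  have 1: "P (Poly_Mapping.single v n + \<mu>)" if "P \<mu>" for v n \<mu>
  proof (induction n)
    case (Suc n)
    have "Poly_Mapping.single v (Suc n) + \<mu> = Poly_Mapping.single v 1 + (Poly_Mapping.single v n + \<mu>)"
      using single_add[of v 1 n] by (simp add: add.assoc)
    then show ?case using assms(2)[OF Suc] by simp
  qed (simp add: that)
  have "P (p + q)" if "P q" for p q using that
  proof (induction p arbitrary: q rule: pm_induct)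
    case (add p p')
    then show ?case by (simp add: add.assoc)
  qed (auto intro: 1)
  from this[of 0 \<mu>] assms(1) show ?thesis by simp
qed

lemma mvar_mult_single: "mvar v * Poly_Mapping.single \<mu> a = Poly_Mapping.single (Poly_Mapping.single v 1 + \<mu>) a"
  by (simp add: mvar_def mult_single)

text \<open>Tailored to modules: linearity and middle balancing pass to sums and to products with
  one variable, so below they are checked on constants and variables.\<close>

lemma mpoly_induct [case_names const add var]:
  assumes "\<And>a. P (Poly_Mapping.single 0 a)" "\<And>p q. P p \<Longrightarrow> P q \<Longrightarrow> P (p + q)" "\<And>v p. P p \<Longrightarrow> P (mvar v * p)"
  shows "P (p :: 'v mpoly)"
proof (induction p rule: pm_induct)
  case zero
  show ?case using assms(1)[of 0] by simp
next
  case (single \<mu> a)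
  show ?case
  proof (induction \<mu> rule: nat_pm_induct)
    case (plus v \<mu>)
    then show ?case using assms(3)[of "Poly_Mapping.single \<mu> a" v] unfolding mvar_mult_single by simp
  qed (rule assms)
qed (rule assms)

definition mexp :: "('v \<Rightarrow> 'b::comm_ring_1) \<Rightarrow> ('v \<Rightarrow>\<^sub>0 nat) \<Rightarrow> 'b" where
  "mexp f \<mu> = (\<Prod>v\<in>Poly_Mapping.keys \<mu>. f v ^ Poly_Mapping.lookup \<mu> v)"

lemma mexp_superset:
  assumes "finite S" "Poly_Mapping.keys \<mu> \<subseteq> S"
  shows "mexp f \<mu> = (\<Prod>v\<in>S. f v ^ Poly_Mapping.lookup \<mu> v)"
  unfolding mexp_def by (rule prod.mono_neutral_left) (use assms in \<open>auto simp: in_keys_iff\<close>)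

lemma mexp_0 [simp]: "mexp f 0 = 1" by (simp add: mexp_def)

lemma mexp_add: "mexp f (\<mu> + \<nu>) = mexp f \<mu> * mexp f \<nu>"
proof -
  let ?S = "Poly_Mapping.keys \<mu> \<union> Poly_Mapping.keys \<nu>"
  have "mexp f (\<mu> + \<nu>) = (\<Prod>v\<in>?S. f v ^ Poly_Mapping.lookup (\<mu> + \<nu>) v)"
    by (rule mexp_superset) (use Poly_Mapping.keys_add[of \<mu> \<nu>] in auto)
  also have "\<dots> = mexp f \<mu> * mexp f \<nu>"
    by (simp add: lookup_add power_add prod.distrib mexp_superset[of ?S])
  finally show ?thesis .
qed

lemma mexp_single [simp]: "mexp f (Poly_Mapping.single v n) = f v ^ n" by (subst mexp_superset[of "{v}"]) auto

text \<open>A ring homomorphism from the rationals as a plain function, so that polynomials can be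
  evaluated in any commutative ring carrying one; besides polynomial rings this will be the
  quadratic extension \<open>quad\<close>.\<close>

definition rat_algebra :: "(rat \<Rightarrow> 'b::comm_ring_1) \<Rightarrow> bool" where
  "rat_algebra c \<longleftrightarrow> c 1 = 1 \<and> (\<forall>a b. c (a + b) = c a + c b \<and> c (a * b) = c a * c b)"

lemma rat_algebraD:
  assumes "rat_algebra c"
  shows "c 0 = 0" "c 1 = 1" "c (a + b) = c a + c b" "c (a * b) = c a * c b"
proof -
  show "c 1 = 1" and *: "c (a + b) = c a + c b" and "c (a * b) = c a * c b" for a b
    using assms by (auto simp: rat_algebra_def)
  show "c 0 = 0" using *[of 0 0] by simp
qed

lemma rat_algebra_single: "rat_algebra (Poly_Mapping.single 0 :: rat \<Rightarrow> 'v mpoly)"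
  by (simp add: rat_algebra_def single_add mult_single)

definition meval :: "(rat \<Rightarrow> 'b::comm_ring_1) \<Rightarrow> ('v \<Rightarrow> 'b) \<Rightarrow> 'v mpoly \<Rightarrow> 'b" where
  "meval c f p = (\<Sum>\<mu>\<in>Poly_Mapping.keys p. c (Poly_Mapping.lookup p \<mu>) * mexp f \<mu>)"

lemma mpoly_subst_meval: "mpoly_subst f p = meval (Poly_Mapping.single 0) f p"
  by (simp add: mpoly_subst_def meval_def mexp_def)

context
  fixes c :: "rat \<Rightarrow> 'b::comm_ring_1" and f :: "'v \<Rightarrow> 'b"
  assumes c: "rat_algebra c"
begin

lemma meval_superset:
  assumes "finite S" "Poly_Mapping.keys p \<subseteq> S"
  shows "meval c f p = (\<Sum>\<mu>\<in>S. c (Poly_Mapping.lookup p \<mu>) * mexp f \<mu>)"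
  unfolding meval_def by (rule sum.mono_neutral_left) (use assms rat_algebraD[OF c] in \<open>auto simp: in_keys_iff\<close>)

lemma meval_single [simp]: "meval c f (Poly_Mapping.single \<mu> a) = c a * mexp f \<mu>"
  by (subst meval_superset[of "{\<mu>}"]) auto

lemma meval_0 [simp]: "meval c f 0 = 0" by (simp add: meval_def)

lemma meval_add [simp]: "meval c f (p + q) = meval c f p + meval c f q"
proof -
  let ?S = "Poly_Mapping.keys p \<union> Poly_Mapping.keys q"
  have "meval c f (p + q) = (\<Sum>\<mu>\<in>?S. c (Poly_Mapping.lookup (p + q) \<mu>) * mexp f \<mu>)"
    by (rule meval_superset) (use Poly_Mapping.keys_add[of p q] in auto)
  also have "\<dots> = meval c f p + meval c f q"
    by (simp add: lookup_add rat_algebraD[OF c] distrib_right sum.distrib meval_superset[of ?S])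
  finally show ?thesis .
qed

lemma meval_mult [simp]: "meval c f (p * q) = meval c f p * meval c f q"
proof (induction p rule: pm_induct)
  case (single \<mu> a)
  show ?case by (induction q rule: pm_induct)
      (simp_all add: mult_single rat_algebraD[OF c] mexp_add ring_distribs mult.assoc mult.left_commute)
qed (simp_all add: distrib_right)

lemma meval_1 [simp]: "meval c f 1 = 1" using meval_single[of 0 1] by (simp add: rat_algebraD[OF c])

lemma meval_uminus [simp]: "meval c f (- p) = - meval c f p" using meval_add[of p "- p"] by (simp add: minus_unique)

lemma meval_diff [simp]: "meval c f (p - q) = meval c f p - meval c f q" using meval_add[of p "- q"] by simp

lemma meval_mvar [simp]: "meval c f (mvar v) = f v" by (simp add: mvar_def rat_algebraD[OF c])

end

lemmas mpoly_subst_simps =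
  meval_add[OF rat_algebra_single, folded mpoly_subst_meval]
  meval_mult[OF rat_algebra_single, folded mpoly_subst_meval]
  meval_mvar[OF rat_algebra_single, folded mpoly_subst_meval]

lemma mpoly_subst_const: "mpoly_subst f (Poly_Mapping.single 0 a) = Poly_Mapping.single 0 a"
  by (simp add: mpoly_subst_meval meval_single[OF rat_algebra_single])

subsection \<open>Homogeneous polynomials\<close>

definition qdeg :: "('v \<Rightarrow>\<^sub>0 nat) \<Rightarrow> int" where
  "qdeg \<mu> = 2 * (\<Sum>v\<in>Poly_Mapping.keys \<mu>. int (Poly_Mapping.lookup \<mu> v))"

lemma qdeg_superset:
  assumes "finite S" "Poly_Mapping.keys \<mu> \<subseteq> S"
  shows "qdeg \<mu> = 2 * (\<Sum>v\<in>S. int (Poly_Mapping.lookup \<mu> v))"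
  unfolding qdeg_def by (subst sum.mono_neutral_left) (use assms in \<open>auto simp: in_keys_iff\<close>)

lemma qdeg_0 [simp]: "qdeg 0 = 0" by (simp add: qdeg_def)

lemma qdeg_single [simp]: "qdeg (Poly_Mapping.single v n) = 2 * int n" by (subst qdeg_superset[of "{v}"]) auto

lemma qdeg_add: "qdeg (\<mu> + \<nu>) = qdeg \<mu> + qdeg \<nu>"
proof -
  let ?S = "Poly_Mapping.keys \<mu> \<union> Poly_Mapping.keys \<nu>"
  have "qdeg (\<mu> + \<nu>) = 2 * (\<Sum>v\<in>?S. int (Poly_Mapping.lookup (\<mu> + \<nu>) v))"
    by (rule qdeg_superset) (use Poly_Mapping.keys_add[of \<mu> \<nu>] in auto)
  also have "\<dots> = qdeg \<mu> + qdeg \<nu>" by (simp add: lookup_add sum.distrib qdeg_superset[of ?S])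
  finally show ?thesis .
qed

lemma homog_iff: "homog d p \<longleftrightarrow> (\<forall>\<mu>\<in>Poly_Mapping.keys p. qdeg \<mu> = d)"
  by (simp add: homog_def qdeg_def)

lemma homog_0 [simp]: "homog d 0" by (simp add: homog_def)

lemma homog_single: "homog (qdeg \<mu>) (Poly_Mapping.single \<mu> a)" by (simp add: homog_iff)

lemma homog_add: "homog d p \<Longrightarrow> homog d q \<Longrightarrow> homog d (p + q)"
  using Poly_Mapping.keys_add[of p q] by (auto simp: homog_iff)

lemma homog_uminus: "homog d p \<Longrightarrow> homog d (- p)" by (simp add: homog_iff in_keys_iff)

lemma homog_diff: "homog d p \<Longrightarrow> homog d q \<Longrightarrow> homog d (p - q)"
  using homog_add[OF _ homog_uminus, of d p q] by simp

lemma homog_const: "homog 0 (Poly_Mapping.single 0 a)" using homog_single[of 0 a] by simp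

lemma homog_mvar: "homog 2 (mvar v)" using homog_single[of "Poly_Mapping.single v 1" 1] by (simp add: mvar_def)

lemma homog_one: "homog 0 1" using homog_const[of 1] by simp

lemma homog_mult:
  assumes "homog d p" "homog e q"
  shows "homog (d + e) (p * q)" unfolding homog_iff
proof
  fix \<mu> assume "\<mu> \<in> Poly_Mapping.keys (p * q)"
  then obtain a b where "a \<in> Poly_Mapping.keys p" "b \<in> Poly_Mapping.keys q" "\<mu> = a + b"
    using Poly_Mapping.keys_mult[of p q] by auto
  then show "qdeg \<mu> = d + e" using assms by (auto simp: homog_iff qdeg_add)
qed

definition hcomp :: "int \<Rightarrow> 'v mpoly \<Rightarrow> 'v mpoly" where
  "hcomp d p = (\<Sum>\<mu>\<in>{\<mu> \<in> Poly_Mapping.keys p. qdeg \<mu> = d}. Poly_Mapping.single \<mu> (Poly_Mapping.lookup p \<mu>))"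

lemma lookup_hcomp: "Poly_Mapping.lookup (hcomp d p) \<mu> = (if qdeg \<mu> = d then Poly_Mapping.lookup p \<mu> else 0)"
  unfolding hcomp_def lookup_sum lookup_single when_def by (subst sum.delta) (auto simp: in_keys_iff)

lemma homog_hcomp: "homog d (hcomp d p)" by (auto simp: homog_iff in_keys_iff lookup_hcomp split: if_splits)

lemma hcomp_add: "hcomp d (p + q) = hcomp d p + hcomp d q"
  by (rule poly_mapping_eqI) (simp add: lookup_hcomp lookup_add)

lemma hcomp_0 [simp]: "hcomp d 0 = 0" by (rule poly_mapping_eqI) (simp add: lookup_hcomp)

lemma hcomp_homog: "homog d p \<Longrightarrow> hcomp e p = (if e = d then p else 0)"
  by (rule poly_mapping_eqI) (auto simp: lookup_hcomp homog_iff in_keys_iff)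

text \<open>Consequently ideals generated by homogeneous elements, and filtration steps generated by
  one, are closed under taking components.\<close>

lemma hcomp_mult:
  assumes "homog e q"
  shows "hcomp d (q * p) = q * hcomp (d - e) p"
proof (induction p rule: pm_induct)
  case (single \<mu> a)
  have "homog (e + qdeg \<mu>) (q * Poly_Mapping.single \<mu> a)" by (rule homog_mult[OF assms homog_single])
  then show ?case by (simp add: hcomp_homog hcomp_homog[OF homog_single] diff_eq_eq add.commute)
qed (simp_all add: distrib_left hcomp_add)

lemma hcomp_sum:
  assumes "finite S" "qdeg ` Poly_Mapping.keys p \<subseteq> S"
  shows "(\<Sum>d\<in>S. hcomp d p) = p"
proof (rule poly_mapping_eqI)
  fix \<mu>
  have "(\<Sum>d\<in>S. Poly_Mapping.lookup (hcomp d p) \<mu>) = (\<Sum>d\<in>S. if qdeg \<mu> = d then Poly_Mapping.lookup p \<mu> else 0)"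
    by (simp add: lookup_hcomp)
  also have "\<dots> = Poly_Mapping.lookup p \<mu>" using assms by (auto simp: sum.delta' image_subset_iff in_keys_iff)
  finally show "Poly_Mapping.lookup (\<Sum>d\<in>S. hcomp d p) \<mu> = Poly_Mapping.lookup p \<mu>" by (simp add: lookup_sum)
qed

lemma hcomp_eq_0:
  assumes "d \<notin> qdeg ` Poly_Mapping.keys p"
  shows "hcomp d p = 0" using assms by (intro poly_mapping_eqI) (auto simp: lookup_hcomp in_keys_iff image_iff)

section \<open>Tensor products over the middle variables: universal property, action,
  grading\<close>

section \<open>Tensor products\<close>

abbreviation xvars :: "'n mpoly \<Rightarrow> 'n bpoly" where
  "xvars p \<equiv> mpoly_subst (\<lambda>i. mvar (Xv i)) p"

abbreviation yvars :: "'n mpoly \<Rightarrow> 'n bpoly" where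
  "yvars p \<equiv> mpoly_subst (\<lambda>i. mvar (Yv i)) p"

abbreviation const :: "rat \<Rightarrow> 'v mpoly" where
  "const \<equiv> Poly_Mapping.single 0"

definition ptens :: "('n bpoly, 'a) gfmod \<Rightarrow> ('n bpoly, 'b) gfmod \<Rightarrow> 'a \<Rightarrow> 'b \<Rightarrow> (('a \<times> 'b) \<Rightarrow>\<^sub>0 int) set" where
  "ptens M N m n = tens_class M N (frag_of (m, n))"

text \<open>The target only has to carry an addition: the first maps to be descended, the action of
  a polynomial and the degree projections, are merely additive and serve to establish the module
  structure and the grading.\<close>

definition balanced ::
  "('n bpoly, 'a) gfmod \<Rightarrow> ('n bpoly, 'b) gfmod \<Rightarrow> ('c, 'd) ring_scheme \<Rightarrow> ('a \<Rightarrow> 'b \<Rightarrow> 'c) \<Rightarrow> bool" where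
  "balanced M N H \<phi> \<longleftrightarrow>
     (\<forall>m\<in>carrier M. \<forall>n\<in>carrier N. \<phi> m n \<in> carrier H) \<and>
     (\<forall>m\<in>carrier M. \<forall>m'\<in>carrier M. \<forall>n\<in>carrier N. \<phi> (m \<oplus>\<^bsub>M\<^esub> m') n = \<phi> m n \<oplus>\<^bsub>H\<^esub> \<phi> m' n) \<and>
     (\<forall>m\<in>carrier M. \<forall>n\<in>carrier N. \<forall>n'\<in>carrier N. \<phi> m (n \<oplus>\<^bsub>N\<^esub> n') = \<phi> m n \<oplus>\<^bsub>H\<^esub> \<phi> m n') \<and>
     (\<forall>p. \<forall>m\<in>carrier M. \<forall>n\<in>carrier N. \<phi> (xvars p \<odot>\<^bsub>M\<^esub> m) n = \<phi> m (yvars p \<odot>\<^bsub>N\<^esub> n))"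

lemma balancedD:
  assumes "balanced M N H \<phi>"
  shows "m \<in> carrier M \<Longrightarrow> n \<in> carrier N \<Longrightarrow> \<phi> m n \<in> carrier H"
    "m \<in> carrier M \<Longrightarrow> m' \<in> carrier M \<Longrightarrow> n \<in> carrier N \<Longrightarrow> \<phi> (m \<oplus>\<^bsub>M\<^esub> m') n = \<phi> m n \<oplus>\<^bsub>H\<^esub> \<phi> m' n"
    "m \<in> carrier M \<Longrightarrow> n \<in> carrier N \<Longrightarrow> n' \<in> carrier N \<Longrightarrow> \<phi> m (n \<oplus>\<^bsub>N\<^esub> n') = \<phi> m n \<oplus>\<^bsub>H\<^esub> \<phi> m n'"
    "m \<in> carrier M \<Longrightarrow> n \<in> carrier N \<Longrightarrow> \<phi> (xvars p \<odot>\<^bsub>M\<^esub> m) n = \<phi> m (yvars p \<odot>\<^bsub>N\<^esub> n)"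
  using assms unfolding balanced_def by blast+

lemma module_smult_facts:
  fixes M :: "('n bpoly, 'a) gfmod"
  assumes "module PR M" "m \<in> carrier M"
  shows "p \<odot>\<^bsub>M\<^esub> m \<in> carrier M" "(p + q) \<odot>\<^bsub>M\<^esub> m = p \<odot>\<^bsub>M\<^esub> m \<oplus>\<^bsub>M\<^esub> q \<odot>\<^bsub>M\<^esub> m"
    "(p * q) \<odot>\<^bsub>M\<^esub> m = p \<odot>\<^bsub>M\<^esub> (q \<odot>\<^bsub>M\<^esub> m)" "1 \<odot>\<^bsub>M\<^esub> m = m" "0 \<odot>\<^bsub>M\<^esub> m = \<zero>\<^bsub>M\<^esub>"
    "m' \<in> carrier M \<Longrightarrow> p \<odot>\<^bsub>M\<^esub> (m \<oplus>\<^bsub>M\<^esub> m') = p \<odot>\<^bsub>M\<^esub> m \<oplus>\<^bsub>M\<^esub> p \<odot>\<^bsub>M\<^esub> m'"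
    "(- p) \<odot>\<^bsub>M\<^esub> m = \<ominus>\<^bsub>M\<^esub> (p \<odot>\<^bsub>M\<^esub> m)"
  using module.smult_closed[OF assms(1), of p m] module.smult_l_distr[OF assms(1), of p q m]
    module.smult_assoc1[OF assms(1), of p q m] module.smult_one[OF assms(1), of m]
    module.smult_l_null[OF assms(1), of m] module.smult_r_distr[OF assms(1), of p m m']
    module.smult_l_minus[OF assms(1), of p m] assms(2) by simp_all

text \<open>Middle linearity extends from variables to polynomials by moving one variable at a time
  across the tensor sign; this reverses the order of the factors, which commutativity
  repairs.\<close>

lemma balancedI:
  fixes M :: "('n bpoly, 'a) gfmod" and N :: "('n bpoly, 'b) gfmod"
  assumes M: "module PR M" and N: "module PR N"
    and cl: "\<And>m n. m \<in> carrier M \<Longrightarrow> n \<in> carrier N \<Longrightarrow> \<phi> m n \<in> carrier H"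
    and l: "\<And>m m' n. m \<in> carrier M \<Longrightarrow> m' \<in> carrier M \<Longrightarrow> n \<in> carrier N \<Longrightarrow> \<phi> (m \<oplus>\<^bsub>M\<^esub> m') n = \<phi> m n \<oplus>\<^bsub>H\<^esub> \<phi> m' n"
    and r: "\<And>m n n'. m \<in> carrier M \<Longrightarrow> n \<in> carrier N \<Longrightarrow> n' \<in> carrier N \<Longrightarrow> \<phi> m (n \<oplus>\<^bsub>N\<^esub> n') = \<phi> m n \<oplus>\<^bsub>H\<^esub> \<phi> m n'"
    and c: "\<And>a m n. m \<in> carrier M \<Longrightarrow> n \<in> carrier N \<Longrightarrow> \<phi> (const a \<odot>\<^bsub>M\<^esub> m) n = \<phi> m (const a \<odot>\<^bsub>N\<^esub> n)"
    and v: "\<And>i m n. m \<in> carrier M \<Longrightarrow> n \<in> carrier N \<Longrightarrow> \<phi> (mvar (Xv i) \<odot>\<^bsub>M\<^esub> m) n = \<phi> m (mvar (Yv i) \<odot>\<^bsub>N\<^esub> n)"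
  shows "balanced M N H \<phi>"
proof -
  note Mf = module_smult_facts[OF M] and Nf = module_smult_facts[OF N]
  have "\<forall>m\<in>carrier M. \<forall>n\<in>carrier N. \<phi> (xvars p \<odot>\<^bsub>M\<^esub> m) n = \<phi> m (yvars p \<odot>\<^bsub>N\<^esub> n)" for p
  proof (induction p rule: mpoly_induct)
    case (const a)
    then show ?case using c by (simp add: mpoly_subst_const)
  next
    case (add p q)
    then show ?case using l r Mf Nf by (simp add: mpoly_subst_simps)
  next
    case (var i p)
    show ?case
    proof (intro ballI)
      fix m n assume m: "m \<in> carrier M" and n: "n \<in> carrier N"
      have "\<phi> (xvars (mvar i * p) \<odot>\<^bsub>M\<^esub> m) n = \<phi> (xvars p \<odot>\<^bsub>M\<^esub> m) (mvar (Yv i) \<odot>\<^bsub>N\<^esub> n)"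
        using v Mf(1,3) m n by (simp add: mpoly_subst_simps)
      also have "\<dots> = \<phi> m (yvars p \<odot>\<^bsub>N\<^esub> (mvar (Yv i) \<odot>\<^bsub>N\<^esub> n))" using var m n Nf(1) by simp
      also have "yvars p \<odot>\<^bsub>N\<^esub> (mvar (Yv i) \<odot>\<^bsub>N\<^esub> n) = yvars (mvar i * p) \<odot>\<^bsub>N\<^esub> n"
        using Nf(3)[OF n, symmetric] by (simp add: mpoly_subst_simps mult.commute)
      finally show "\<phi> (xvars (mvar i * p) \<odot>\<^bsub>M\<^esub> m) n = \<phi> m (yvars (mvar i * p) \<odot>\<^bsub>N\<^esub> n)" .
    qed
  qed
  then show ?thesis using cl l r by (simp add: balanced_def)
qed

lemma balanced_cong:
  fixes M :: "('n bpoly, 'a) gfmod" and N :: "('n bpoly, 'b) gfmod"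
  assumes M: "module PR M" and N: "module PR N" and bal: "balanced M N H \<phi>"
    and eq: "\<And>m n. m \<in> carrier M \<Longrightarrow> n \<in> carrier N \<Longrightarrow> \<psi> m n = \<phi> m n"
  shows "balanced M N H \<psi>"
proof -
  interpret M: module PR M by (rule M)
  interpret N: module PR N by (rule N)
  note b = balancedD[OF bal]
  show ?thesis unfolding balanced_def by (intro conjI ballI allI)
      (simp_all add: eq b module_smult_facts(1)[OF M] module_smult_facts(1)[OF N])
qed

subsection \<open>The underlying group and its universal property\<close>

context
  fixes M :: "('n::finite bpoly, 'a) gfmod" and N :: "('n bpoly, 'b) gfmod"
  assumes M: "module PR M" and N: "module PR N"
begin

private abbreviation "S \<equiv> carrier M \<times> carrier N"
private abbreviation "F \<equiv> tens_free M N"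
private abbreviation "R \<equiv> tens_rel M N"

lemma tens_free_simps [simp]:
  "c \<in> carrier F \<longleftrightarrow> Poly_Mapping.keys c \<subseteq> S" "x \<otimes>\<^bsub>F\<^esub> y = x + y" "\<one>\<^bsub>F\<^esub> = 0"
  "Poly_Mapping.keys c \<subseteq> S \<Longrightarrow> inv\<^bsub>F\<^esub> c = - c" by (auto simp: tens_free_def)

lemma comm_group_tens_free: "comm_group F" unfolding tens_free_def by (rule abelian_free_Abelian_group)

definition tens_gens :: "(('a \<times> 'b) \<Rightarrow>\<^sub>0 int) set" where
  "tens_gens = ({frag_of (m \<oplus>\<^bsub>M\<^esub> m', n) - frag_of (m, n) - frag_of (m', n) | m m' n.
        m \<in> carrier M \<and> m' \<in> carrier M \<and> n \<in> carrier N} \<union>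
     {frag_of (m, n \<oplus>\<^bsub>N\<^esub> n') - frag_of (m, n) - frag_of (m, n') | m n n'.
        m \<in> carrier M \<and> n \<in> carrier N \<and> n' \<in> carrier N} \<union>
     {frag_of (xvars p \<odot>\<^bsub>M\<^esub> m, n) - frag_of (m, yvars p \<odot>\<^bsub>N\<^esub> n) | (p :: 'n mpoly) m n.
        m \<in> carrier M \<and> n \<in> carrier N})"

lemma tens_rel_gens: "R = generate F tens_gens" by (simp add: tens_rel_def tens_gens_def)

lemma keys_diff_subset:
  assumes "Poly_Mapping.keys (a :: 'c \<Rightarrow>\<^sub>0 int) \<subseteq> U" "Poly_Mapping.keys b \<subseteq> U"
  shows "Poly_Mapping.keys (a - b) \<subseteq> U" using keys_diff[of a b] assms by blast

lemma tens_gens_carrier: "tens_gens \<subseteq> carrier F"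
proof -
  interpret M: module PR M by (rule M)
  interpret N: module PR N by (rule N)
  show ?thesis unfolding tens_gens_def using module_smult_facts(1)[OF M] module_smult_facts(1)[OF N]
    by (auto intro!: keys_diff_subset simp: subset_iff dest!: subsetD[OF keys_diff])
qed

lemma subgroup_tens_rel: "subgroup R F"
proof -
  interpret F: comm_group F by (rule comm_group_tens_free)
  show ?thesis unfolding tens_rel_gens by (rule F.generate_is_subgroup[OF tens_gens_carrier])
qed

lemma tens_rel_normal: "R \<lhd> F"
proof -
  interpret F: comm_group F by (rule comm_group_tens_free)
  show ?thesis using subgroup_tens_rel by (simp add: F.normal_iff_subgroup)
qed

text \<open>The kernel of \<open>h\<close> is a subgroup, so it contains the relations once it
  contains their three families of generators; balancedness on symbols says exactly that.\<close>

lemma tens_rel_kernel: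
  assumes H: "abelian_group H"
    and h: "\<And>a b. a \<in> carrier F \<Longrightarrow> b \<in> carrier F \<Longrightarrow> h (a + b) = h a \<oplus>\<^bsub>H\<^esub> h b"
      "\<And>a. a \<in> carrier F \<Longrightarrow> h a \<in> carrier H"
    and bal: "balanced M N H (\<lambda>m n. h (frag_of (m, n)))"
    and c: "c \<in> R"
  shows "h c = \<zero>\<^bsub>H\<^esub>"
proof -
  interpret H: abelian_group H by (rule H)
  interpret F: comm_group F by (rule comm_group_tens_free)
  have hom: "group_hom F (add_monoid H) h"
    by (intro group_hom.intro group_hom_axioms.intro F.is_group H.a_group homI) (use h in auto)
  interpret group_hom F "add_monoid H" h by (rule hom)
  have hd: "h (a - b) = h a \<ominus>\<^bsub>H\<^esub> h b" if "a \<in> carrier F" "b \<in> carrier F" for a b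
  proof -
    have k: "Poly_Mapping.keys (a - b) \<subseteq> S" using that by (simp add: keys_diff_subset)
    have "h (a - b) \<oplus>\<^bsub>H\<^esub> h b = h a" using h(1)[of "a - b" b] that k by simp
    then show ?thesis using h(2)[of a] h(2)[of b] h(2)[of "a - b"] that k by (simp add: H.group_simps)
  qed
  note b = balancedD[OF bal]
  interpret M: module PR M by (rule M)
  interpret N: module PR N by (rule N)
  have "tens_gens \<subseteq> kernel F (add_monoid H) h"
  proof
    fix g assume g: "g \<in> tens_gens"
    then have gF: "g \<in> carrier F" using tens_gens_carrier by blast
    have sm: "xvars p \<odot>\<^bsub>M\<^esub> m \<in> carrier M" "yvars p \<odot>\<^bsub>N\<^esub> n \<in> carrier N" if "m \<in> carrier M" "n \<in> carrier N" for p m n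
      using that module_smult_facts(1)[OF M] module_smult_facts(1)[OF N] by auto
    have "h g = \<zero>\<^bsub>H\<^esub>" using g unfolding tens_gens_def
      by (auto simp: hd b sm keys_diff_subset H.group_simps)
    then show "g \<in> kernel F (add_monoid H) h" using gF by (simp add: kernel_def)
  qed
  then have "R \<subseteq> kernel F (add_monoid H) h"
    unfolding tens_rel_gens by (rule F.generate_subgroup_incl[OF _ subgroup_kernel])
  then show ?thesis using c by (auto simp: kernel_def)
qed

lemma tens_class_mem: "c \<in> carrier F \<Longrightarrow> x \<in> tens_class M N c \<longleftrightarrow> x \<in> carrier F \<and> x - c \<in> R"
proof -
  assume c: "c \<in> carrier F"
  have "R \<subseteq> carrier F" using subgroup.subset[OF subgroup_tens_rel] .
  moreover have "Poly_Mapping.keys (r + c) \<subseteq> S" if "r \<in> carrier F" for r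
    using that c Poly_Mapping.keys_add[of r c] by auto
  moreover have "x \<in> tens_class M N c \<longleftrightarrow> (\<exists>r\<in>R. x = r + c)"
    by (auto simp: tens_class_def r_coset_def)
  moreover have "(\<exists>r\<in>R. x = r + c) \<longleftrightarrow> x - c \<in> R"
    by (metis add_diff_cancel_right' diff_add_cancel)
  ultimately show ?thesis by (metis (no_types, lifting) diff_add_cancel subsetD tens_free_simps(1))
qed

lemma tens_class_eq_iff:
  assumes "c \<in> carrier F" "d \<in> carrier F"
  shows "tens_class M N c = tens_class M N d \<longleftrightarrow> c - d \<in> R"
proof -
  interpret F: comm_group F by (rule comm_group_tens_free)
  have zero: "0 \<in> R" using subgroup.one_closed[OF subgroup_tens_rel] by simp
  have add: "a + b \<in> R" if "a \<in> R" "b \<in> R" for a b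
    using subgroup.m_closed[OF subgroup_tens_rel that] by simp
  have neg: "- a \<in> R" if "a \<in> R" for a
    using subgroup.m_inv_closed[OF subgroup_tens_rel that] subgroup.mem_carrier[OF subgroup_tens_rel that] by simp
  show ?thesis
  proof
    assume "tens_class M N c = tens_class M N d"
    moreover have "c \<in> tens_class M N c" using assms zero by (simp add: tens_class_mem del: tens_free_simps)
    ultimately show "c - d \<in> R" using assms by (simp add: tens_class_mem del: tens_free_simps)
  next
    assume cd: "c - d \<in> R"
    show "tens_class M N c = tens_class M N d"
    proof (intro Set.set_eqI)
      fix x
      have "x - d = (x - c) + (c - d)" "x - c = (x - d) + - (c - d)" by simp_all
      then have "x - c \<in> R \<longleftrightarrow> x - d \<in> R" using add[OF _ cd] add[OF _ neg[OF cd]] by metis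
      then show "x \<in> tens_class M N c \<longleftrightarrow> x \<in> tens_class M N d"
        unfolding tens_class_mem[OF assms(1)] tens_class_mem[OF assms(2)] by blast
    qed
  qed
qed

lemma tens_carrier: "carrier (tens M N) = tens_class M N ` carrier F"
  by (auto simp: tens_def Let_def tens_class_def carrier_FactGroup)

lemma tens_zero: "\<zero>\<^bsub>tens M N\<^esub> = tens_class M N 0"
proof -
  have "tens_class M N 0 = R"
  proof (intro Set.set_eqI)
    show "x \<in> tens_class M N 0 \<longleftrightarrow> x \<in> R" for x
      using tens_class_mem[of 0 x] subgroup.mem_carrier[OF subgroup_tens_rel, of x] by auto
  qed
  then show ?thesis by (simp add: tens_def Let_def)
qed

lemma tens_add:
  assumes "c \<in> carrier F" "d \<in> carrier F"
  shows "tens_class M N c \<oplus>\<^bsub>tens M N\<^esub> tens_class M N d = tens_class M N (c + d)"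
  using normal.rcos_sum[OF tens_rel_normal assms] by (simp add: tens_def Let_def tens_class_def)

lemma abelian_group_tens: "abelian_group (tens M N)"
proof (rule abelian_groupI)
  have add: "a + b \<in> carrier F" if "a \<in> carrier F" "b \<in> carrier F" for a b
    using that Poly_Mapping.keys_add[of a b] by auto
  fix x y z assume "x \<in> carrier (tens M N)" "y \<in> carrier (tens M N)" "z \<in> carrier (tens M N)"
  then obtain a b c where *: "x = tens_class M N a" "y = tens_class M N b" "z = tens_class M N c"
    "a \<in> carrier F" "b \<in> carrier F" "c \<in> carrier F" unfolding tens_carrier by blast
  note add[OF *(4,5)] add[OF *(5,6)]
  then show "x \<oplus>\<^bsub>tens M N\<^esub> y \<in> carrier (tens M N)"
    "x \<oplus>\<^bsub>tens M N\<^esub> y \<oplus>\<^bsub>tens M N\<^esub> z = x \<oplus>\<^bsub>tens M N\<^esub> (y \<oplus>\<^bsub>tens M N\<^esub> z)"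
    "x \<oplus>\<^bsub>tens M N\<^esub> y = y \<oplus>\<^bsub>tens M N\<^esub> x" "\<zero>\<^bsub>tens M N\<^esub> \<oplus>\<^bsub>tens M N\<^esub> x = x"
    using * by (auto simp: tens_add tens_carrier tens_zero ac_simps)
  show "\<exists>y\<in>carrier (tens M N). y \<oplus>\<^bsub>tens M N\<^esub> x = \<zero>\<^bsub>tens M N\<^esub>"
    using * by (intro bexI[of _ "tens_class M N (- a)"]) (auto simp: tens_add tens_carrier tens_zero)
next
  show "\<zero>\<^bsub>tens M N\<^esub> \<in> carrier (tens M N)" by (auto simp: tens_carrier tens_zero)
qed

lemma ptens_closed: "m \<in> carrier M \<Longrightarrow> n \<in> carrier N \<Longrightarrow> ptens M N m n \<in> carrier (tens M N)"
  by (auto simp: tens_carrier ptens_def)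

lemma ptens_balanced: "balanced M N (tens M N) (ptens M N)"
proof -
  interpret M: module PR M by (rule M)
  interpret N: module PR N by (rule N)
  have gen: "tens_class M N c = tens_class M N d" if "c - d \<in> tens_gens" "c \<in> carrier F" "d \<in> carrier F" for c d
    unfolding tens_class_eq_iff[OF that(2,3)] tens_rel_gens by (rule generate.incl[OF that(1)])
  show ?thesis unfolding balanced_def
  proof (intro conjI ballI allI)
    show "ptens M N m n \<in> carrier (tens M N)" if "m \<in> carrier M" "n \<in> carrier N" for m n
      using that by (rule ptens_closed)
    show "ptens M N (m \<oplus>\<^bsub>M\<^esub> m') n = ptens M N m n \<oplus>\<^bsub>tens M N\<^esub> ptens M N m' n"
      if "m \<in> carrier M" "m' \<in> carrier M" "n \<in> carrier N" for m m' n
    proof -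
      have "frag_of (m \<oplus>\<^bsub>M\<^esub> m', n) - (frag_of (m, n) + frag_of (m', n)) \<in> tens_gens"
        unfolding tens_gens_def using that by (auto simp: diff_diff_eq)
      then have "ptens M N (m \<oplus>\<^bsub>M\<^esub> m') n = tens_class M N (frag_of (m, n) + frag_of (m', n))"
        unfolding ptens_def using that Poly_Mapping.keys_add[of "frag_of (m, n)" "frag_of (m', n)"]
        by (intro gen) auto
      then show ?thesis using that by (simp add: ptens_def tens_add)
    qed
    show "ptens M N m (n \<oplus>\<^bsub>N\<^esub> n') = ptens M N m n \<oplus>\<^bsub>tens M N\<^esub> ptens M N m n'"
      if "m \<in> carrier M" "n \<in> carrier N" "n' \<in> carrier N" for m n n'
    proof -
      have "frag_of (m, n \<oplus>\<^bsub>N\<^esub> n') - (frag_of (m, n) + frag_of (m, n')) \<in> tens_gens"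
        unfolding tens_gens_def using that by (auto simp: diff_diff_eq)
      then have "ptens M N m (n \<oplus>\<^bsub>N\<^esub> n') = tens_class M N (frag_of (m, n) + frag_of (m, n'))"
        unfolding ptens_def using that Poly_Mapping.keys_add[of "frag_of (m, n)" "frag_of (m, n')"]
        by (intro gen) auto
      then show ?thesis using that by (simp add: ptens_def tens_add)
    qed
    show "ptens M N (xvars p \<odot>\<^bsub>M\<^esub> m) n = ptens M N m (yvars p \<odot>\<^bsub>N\<^esub> n)" if "m \<in> carrier M" "n \<in> carrier N" for p m n
      unfolding ptens_def
      by (rule gen) (use that module_smult_facts(1)[OF M] module_smult_facts(1)[OF N] in \<open>auto simp: tens_gens_def\<close>)
  qed
qed

text \<open>Integer coefficients cause no extra case: a negated pure tensor is the pure tensor of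
  the negated left entry.\<close>

lemma tens_induct [consumes 1, case_names zero ptens add]:
  assumes "x \<in> carrier (tens M N)" "P \<zero>\<^bsub>tens M N\<^esub>"
    "\<And>m n. m \<in> carrier M \<Longrightarrow> n \<in> carrier N \<Longrightarrow> P (ptens M N m n)"
    "\<And>x y. x \<in> carrier (tens M N) \<Longrightarrow> y \<in> carrier (tens M N) \<Longrightarrow> P x \<Longrightarrow> P y \<Longrightarrow> P (x \<oplus>\<^bsub>tens M N\<^esub> y)"
  shows "P x"
proof -
  obtain c where c: "Poly_Mapping.keys c \<subseteq> S" "x = tens_class M N c"
    using assms(1) by (auto simp: tens_carrier)
  interpret M: module PR M by (rule M)
  interpret T: abelian_group "tens M N" by (rule abelian_group_tens)
  \<comment> \<open>Induction on a free abelian group closes under differences; carrying the claim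
    for \<open>- c\<close> along turns differences into sums.\<close>
  have "P (tens_class M N c) \<and> P (tens_class M N (- c))"
  proof (rule free_Abelian_group_induct[OF c(1)])
    show "P (tens_class M N 0) \<and> P (tens_class M N (- 0))" using assms(2) by (simp add: tens_zero)
  next
    fix x y assume 2: "Poly_Mapping.keys x \<subseteq> S" "Poly_Mapping.keys y \<subseteq> S"
      "P (tens_class M N x) \<and> P (tens_class M N (- x))" "P (tens_class M N y) \<and> P (tens_class M N (- y))"
    have add: "P (tens_class M N (a + b))" if "Poly_Mapping.keys a \<subseteq> S" "Poly_Mapping.keys b \<subseteq> S"
      "P (tens_class M N a)" "P (tens_class M N b)" for a b
      using assms(4)[of "tens_class M N a" "tens_class M N b"] that by (auto simp: tens_add tens_carrier)
    show "P (tens_class M N (x - y)) \<and> P (tens_class M N (- (x - y)))"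
      using add[of x "- y"] add[of y "- x"] 2 by simp
  next
    fix a assume "a \<in> S"
    then obtain m n where a: "a = (m, n)" "m \<in> carrier M" "n \<in> carrier N" by auto
    have "tens_class M N (- frag_of (m, n)) = ptens M N (\<ominus>\<^bsub>M\<^esub> m) n"
    proof -
      note b = balancedD[OF ptens_balanced]
      have z: "ptens M N \<zero>\<^bsub>M\<^esub> n = \<zero>\<^bsub>tens M N\<^esub>"
        using b(2)[of "\<zero>\<^bsub>M\<^esub>" "\<zero>\<^bsub>M\<^esub>" n] b(1)[of "\<zero>\<^bsub>M\<^esub>" n] a
          T.add.r_cancel_one'[of "ptens M N \<zero>\<^bsub>M\<^esub> n" "ptens M N \<zero>\<^bsub>M\<^esub> n"] by simp
      have "ptens M N (\<ominus>\<^bsub>M\<^esub> m) n \<oplus>\<^bsub>tens M N\<^esub> ptens M N m n = \<zero>\<^bsub>tens M N\<^esub>"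
        using b(2)[of "\<ominus>\<^bsub>M\<^esub> m" m n] a z by (simp add: M.M.l_neg)
      moreover have "tens_class M N (- frag_of (m, n)) \<oplus>\<^bsub>tens M N\<^esub> ptens M N m n = \<zero>\<^bsub>tens M N\<^esub>"
        using a by (simp add: ptens_def tens_add tens_zero)
      moreover have "tens_class M N (- frag_of (m, n)) \<in> carrier (tens M N)" using a by (auto simp: tens_carrier)
      ultimately show ?thesis
        using T.add.right_cancel[of "ptens M N m n" "tens_class M N (- frag_of (m, n))" "ptens M N (\<ominus>\<^bsub>M\<^esub> m) n"]
          b(1)[of m n] b(1)[of "\<ominus>\<^bsub>M\<^esub> m" n] a M.M.a_inv_closed by simp
    qed
    then show "P (tens_class M N (frag_of a)) \<and> P (tens_class M N (- frag_of a))"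
      using assms(3) a by (simp add: ptens_def[symmetric])
  qed
  then show ?thesis using c by simp
qed

lemma tens_additive_eqI:
  assumes H: "abelian_group H" and "f \<in> carrier (tens M N) \<rightarrow> carrier H" "g \<in> carrier (tens M N) \<rightarrow> carrier H"
    and f: "\<And>x y. x \<in> carrier (tens M N) \<Longrightarrow> y \<in> carrier (tens M N) \<Longrightarrow> f (x \<oplus>\<^bsub>tens M N\<^esub> y) = f x \<oplus>\<^bsub>H\<^esub> f y"
    and g: "\<And>x y. x \<in> carrier (tens M N) \<Longrightarrow> y \<in> carrier (tens M N) \<Longrightarrow> g (x \<oplus>\<^bsub>tens M N\<^esub> y) = g x \<oplus>\<^bsub>H\<^esub> g y"
    and eq: "\<And>m n. m \<in> carrier M \<Longrightarrow> n \<in> carrier N \<Longrightarrow> f (ptens M N m n) = g (ptens M N m n)"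
    and x: "x \<in> carrier (tens M N)"
  shows "f x = g x" using x
proof (induction x rule: tens_induct)
  case zero
  show ?case using additive_zero_inv(1)[OF abelian_group_tens H assms(2) f]
      additive_zero_inv(1)[OF abelian_group_tens H assms(3) g] by simp
qed (use f g eq in auto)

lemma tens_universal:
  fixes H :: "('c, 'd) ring_scheme"
  assumes H: "abelian_group H" and bal: "balanced M N H \<phi>"
  shows "\<exists>h. h \<in> carrier (tens M N) \<rightarrow> carrier H \<and>
    (\<forall>x\<in>carrier (tens M N). \<forall>y\<in>carrier (tens M N). h (x \<oplus>\<^bsub>tens M N\<^esub> y) = h x \<oplus>\<^bsub>H\<^esub> h y) \<and>
    (\<forall>m\<in>carrier M. \<forall>n\<in>carrier N. h (ptens M N m n) = \<phi> m n)"
proof -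
  interpret H: abelian_group H by (rule H)
  obtain h where h: "h \<in> hom (free_Abelian_group S) (add_monoid H)"
    "\<And>x. x \<in> S \<Longrightarrow> h (frag_of x) = (\<lambda>(m, n). \<phi> m n) x"
  proof (rule comm_group.free_Abelian_group_universal[OF H.a_comm_group, of "\<lambda>(m, n). \<phi> m n" S])
    show "(\<lambda>(m, n). \<phi> m n) ` S \<subseteq> carrier (add_monoid H)" using balancedD(1)[OF bal] by auto
  qed (use that in auto)
  have hF: "h \<in> hom F (add_monoid H)" using h(1) by (simp add: tens_free_def)
  have h1: "h (a + b) = h a \<oplus>\<^bsub>H\<^esub> h b" if "a \<in> carrier F" "b \<in> carrier F" for a b
    using hom_mult[OF hF that] by simp
  have h2: "h a \<in> carrier H" if "a \<in> carrier F" for a using hF that by (auto simp: hom_def)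
  have bal': "balanced M N H (\<lambda>m n. h (frag_of (m, n)))"
  proof -
    interpret M: module PR M by (rule M)
    interpret N: module PR N by (rule N)
    show ?thesis using bal module_smult_facts(1)[OF M] module_smult_facts(1)[OF N] unfolding balanced_def
      by (simp add: h(2))
  qed
  interpret F: comm_group F by (rule comm_group_tens_free)
  have hom: "group_hom F (add_monoid H) h" by (intro group_hom.intro group_hom_axioms.intro F.is_group H.a_group hF)
  have ker: "R \<subseteq> kernel F (add_monoid H) h"
    using tens_rel_kernel[OF H h1 h2 bal'] subsetD[OF subgroup.subset[OF subgroup_tens_rel]]
    by (auto simp: kernel_def simp del: tens_free_simps)
  obtain g where g: "g \<in> hom (F Mod R) (add_monoid H)" "\<And>x. x \<in> carrier F \<Longrightarrow> g (R #>\<^bsub>F\<^esub> x) = h x"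
    using group_hom.FactGroup_universal_kernel[OF hom tens_rel_normal ker] by blast
  show ?thesis
  proof (intro exI[of _ g] conjI ballI)
    show "g \<in> carrier (tens M N) \<rightarrow> carrier H" using g(1) by (auto simp: hom_def tens_def Let_def)
    show "g (x \<oplus>\<^bsub>tens M N\<^esub> y) = g x \<oplus>\<^bsub>H\<^esub> g y" if "x \<in> carrier (tens M N)" "y \<in> carrier (tens M N)" for x y
      using g(1) that by (auto simp: hom_def tens_def Let_def)
    show "g (ptens M N m n) = \<phi> m n" if "m \<in> carrier M" "n \<in> carrier N" for m n
      using g(2)[of "frag_of (m, n)"] h(2)[of "(m, n)"] that by (simp add: ptens_def tens_class_def)
  qed
qed

end

text \<open>An arbitrary choice, but on the carrier the map is determined by its values on pure
  tensors.\<close>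

definition tens_lift ::
  "('n::finite bpoly, 'a) gfmod \<Rightarrow> ('n bpoly, 'b) gfmod \<Rightarrow> ('c, 'd) ring_scheme \<Rightarrow> ('a \<Rightarrow> 'b \<Rightarrow> 'c)
    \<Rightarrow> (('a \<times> 'b) \<Rightarrow>\<^sub>0 int) set \<Rightarrow> 'c" where
  "tens_lift M N H \<phi> = (SOME h. h \<in> carrier (tens M N) \<rightarrow> carrier H \<and>
    (\<forall>x\<in>carrier (tens M N). \<forall>y\<in>carrier (tens M N). h (x \<oplus>\<^bsub>tens M N\<^esub> y) = h x \<oplus>\<^bsub>H\<^esub> h y) \<and>
    (\<forall>m\<in>carrier M. \<forall>n\<in>carrier N. h (ptens M N m n) = \<phi> m n))"

lemma tens_lift:
  fixes M :: "('n::finite bpoly, 'a) gfmod" and N :: "('n bpoly, 'b) gfmod"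
  assumes "module PR M" "module PR N" "abelian_group H" "balanced M N H \<phi>"
  shows "tens_lift M N H \<phi> \<in> carrier (tens M N) \<rightarrow> carrier H"
    "x \<in> carrier (tens M N) \<Longrightarrow> y \<in> carrier (tens M N) \<Longrightarrow>
      tens_lift M N H \<phi> (x \<oplus>\<^bsub>tens M N\<^esub> y) = tens_lift M N H \<phi> x \<oplus>\<^bsub>H\<^esub> tens_lift M N H \<phi> y"
    "m \<in> carrier M \<Longrightarrow> n \<in> carrier N \<Longrightarrow> tens_lift M N H \<phi> (ptens M N m n) = \<phi> m n"
  using someI_ex[OF tens_universal[OF assms]] unfolding tens_lift_def[symmetric] by blast+

text \<open>The two operations on tensor products that are defined by a union over representatives.\<close>

lemma tens_descend:
  fixes M :: "('n::finite bpoly, 'a) gfmod" and N :: "('n bpoly, 'b) gfmod"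
    and M' :: "('n bpoly, 'c) gfmod" and N' :: "('n bpoly, 'd) gfmod"
  assumes M: "module PR M" "module PR N" and M': "module PR M'" "module PR N'"
    and k: "\<forall>m\<in>carrier M. \<forall>n\<in>carrier N. k (m, n) \<in> carrier (tens_free M' N')"
    and bal: "balanced M N (tens M' N') (\<lambda>m n. tens_class M' N' (k (m, n)))"
    and h_def: "h = (\<lambda>Z. \<Union>c\<in>Z. tens_class M' N' (frag_extend k c))"
  shows "h \<in> carrier (tens M N) \<rightarrow> carrier (tens M' N')"
    "x \<in> carrier (tens M N) \<Longrightarrow> y \<in> carrier (tens M N) \<Longrightarrow> h (x \<oplus>\<^bsub>tens M N\<^esub> y) = h x \<oplus>\<^bsub>tens M' N'\<^esub> h y"
    "m \<in> carrier M \<Longrightarrow> n \<in> carrier N \<Longrightarrow> h (ptens M N m n) = tens_class M' N' (k (m, n))"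
proof -
  let ?T' = "tens M' N'"
  have T': "abelian_group ?T'" by (rule abelian_group_tens[OF M'])
  have kF: "Poly_Mapping.keys (frag_extend k c) \<subseteq> carrier M' \<times> carrier N'"
    if "Poly_Mapping.keys c \<subseteq> carrier M \<times> carrier N" for c
    using keys_frag_extend[of k c] k that by (fastforce simp: tens_free_def)
  define g where "g = (\<lambda>c. tens_class M' N' (frag_extend k c))"
  have g1: "g (a + b) = g a \<oplus>\<^bsub>?T'\<^esub> g b" if "a \<in> carrier (tens_free M N)" "b \<in> carrier (tens_free M N)" for a b
    using that kF tens_add[OF M', of "frag_extend k a" "frag_extend k b"]
    by (simp add: g_def frag_extend_add tens_free_def)
  have g2: "g a \<in> carrier ?T'" if "a \<in> carrier (tens_free M N)" for a
    using that kF by (auto simp: g_def tens_carrier[OF M'] tens_free_def)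
  have gR: "g r = \<zero>\<^bsub>?T'\<^esub>" if "r \<in> tens_rel M N" for r
  proof -
    have "balanced M N ?T' (\<lambda>m n. g (frag_of (m, n)))" unfolding g_def frag_extend_of by (rule bal)
    from tens_rel_kernel[OF M T' g1 g2 this that] show ?thesis .
  qed
  interpret T': abelian_group ?T' by (rule T')
  have key: "h (tens_class M N c) = g c" if c: "c \<in> carrier (tens_free M N)" for c
  proof -
    \<comment> \<open>All representatives give the same value, so the union over the class is a
      union of equal sets and equals the common value.\<close>
    have "g x = g c" if x: "x \<in> tens_class M N c" for x
    proof -
      have xc: "x \<in> carrier (tens_free M N)" "x - c \<in> tens_rel M N" using x tens_class_mem[OF M c] by auto
      then have "x - c \<in> carrier (tens_free M N)" using subgroup.mem_carrier[OF subgroup_tens_rel[OF M]] by blast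
      from g1[OF this c] show ?thesis using gR[OF xc(2)] g2[OF c] by simp
    qed
    moreover have "c \<in> tens_class M N c"
      using tens_class_mem[OF M c, of c] c subgroup.one_closed[OF subgroup_tens_rel[OF M]] by (simp add: tens_free_def)
    moreover have "h (tens_class M N c) = (\<Union>x\<in>tens_class M N c. g x)" by (simp only: h_def g_def)
    ultimately show ?thesis by blast
  qed
  show "h \<in> carrier (tens M N) \<rightarrow> carrier ?T'" using key g2 by (auto simp: tens_carrier[OF M])
  show "m \<in> carrier M \<Longrightarrow> n \<in> carrier N \<Longrightarrow> h (ptens M N m n) = tens_class M' N' (k (m, n))"
    using key[of "frag_of (m, n)"] by (simp add: ptens_def g_def tens_free_def)
  show "h (x \<oplus>\<^bsub>tens M N\<^esub> y) = h x \<oplus>\<^bsub>?T'\<^esub> h y" if xy: "x \<in> carrier (tens M N)" "y \<in> carrier (tens M N)"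
  proof -
    obtain c d where cd: "x = tens_class M N c" "y = tens_class M N d" "c \<in> carrier (tens_free M N)"
      "d \<in> carrier (tens_free M N)" using xy by (auto simp: tens_carrier[OF M])
    have "c + d \<in> carrier (tens_free M N)" using cd Poly_Mapping.keys_add[of c d] by (auto simp: tens_free_def)
    then show ?thesis using cd key g1 by (simp add: tens_add[OF M])
  qed
qed

subsection \<open>The module structure\<close>

lemma tens_act_summand_add:
  "x_monom (\<mu> + \<nu>) = x_monom \<mu> * x_monom \<nu>" "y_monom (\<mu> + \<nu>) = y_monom \<mu> * y_monom \<nu>"
  by (simp_all add: x_monom_def y_monom_def lookup_add power_add prod.distrib)

lemma xy_monom_0 [simp]: "x_monom 0 = 1" "y_monom 0 = 1" by (simp_all add: x_monom_def y_monom_def)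

lemma prod_mvar_single:
  fixes i :: "'n::finite"
  assumes "inj f"
  shows "(\<Prod>j\<in>UNIV. mvar (f j) ^ Poly_Mapping.lookup (Poly_Mapping.single (f i) (Suc 0)) (f j)) = mvar (f i)"
proof -
  have "mvar (f j) ^ Poly_Mapping.lookup (Poly_Mapping.single (f i) (Suc 0)) (f j) = (if j = i then mvar (f i) else 1)" for j
    using assms by (auto simp: lookup_single when_def inj_eq)
  then show ?thesis by simp
qed

lemma xy_monom_single [simp]:
  "x_monom (Poly_Mapping.single (Xv i) (Suc 0)) = mvar (Xv i)" "y_monom (Poly_Mapping.single (Xv i) (Suc 0)) = 1"
  "y_monom (Poly_Mapping.single (Yv i) (Suc 0)) = mvar (Yv i)" "x_monom (Poly_Mapping.single (Yv i) (Suc 0)) = 1"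
  for i :: "'n::finite"
proof -
  have i: "inj (Xv :: 'n \<Rightarrow> 'n bvar)" "inj (Yv :: 'n \<Rightarrow> 'n bvar)" by (simp_all add: inj_def)
  show "x_monom (Poly_Mapping.single (Xv i) (Suc 0)) = mvar (Xv i)"
    "y_monom (Poly_Mapping.single (Yv i) (Suc 0)) = mvar (Yv i)"
    using prod_mvar_single[OF i(1)] prod_mvar_single[OF i(2)] by (simp_all add: x_monom_def y_monom_def)
  show "y_monom (Poly_Mapping.single (Xv i) (Suc 0)) = 1" "x_monom (Poly_Mapping.single (Yv i) (Suc 0)) = 1"
    by (simp_all add: x_monom_def y_monom_def lookup_single)
qed

lemma homog_prod_power:
  assumes "finite A" "\<And>i. i \<in> A \<Longrightarrow> homog 2 (f i)"
  shows "homog (2 * (\<Sum>i\<in>A. int (e i))) (\<Prod>i\<in>A. f i ^ e i)"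
proof -
  have pw: "homog (2 * int k) (p ^ k)" if "homog 2 p" for p :: "'v mpoly" and k
  proof (induction k)
    case (Suc k)
    then show ?case using homog_mult[OF that Suc] by (simp add: algebra_simps)
  qed (simp add: homog_one)
  show ?thesis using assms by (induction A) (auto simp: homog_one distrib_left intro!: homog_mult pw)
qed

text \<open>The y-part of a monomial acts on the left factor and the x-part on the right one; that
  their degrees add up makes the action on the tensor product graded.\<close>

lemma homog_xy_monom:
  fixes \<mu> :: "'n::finite bvar \<Rightarrow>\<^sub>0 nat"
  obtains dx dy where "homog dx (x_monom \<mu>)" "homog dy (y_monom \<mu>)" "qdeg \<mu> = dx + dy"
proof
  let ?dx = "2 * (\<Sum>i\<in>UNIV. int (Poly_Mapping.lookup \<mu> (Xv i)))"
  let ?dy = "2 * (\<Sum>i\<in>UNIV. int (Poly_Mapping.lookup \<mu> (Yv i)))"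
  show "homog ?dx (x_monom \<mu>)" unfolding x_monom_def by (rule homog_prod_power) (auto simp: homog_mvar)
  show "homog ?dy (y_monom \<mu>)" unfolding y_monom_def by (rule homog_prod_power) (auto simp: homog_mvar)
  have "qdeg \<mu> = 2 * (\<Sum>v\<in>range Xv \<union> range Yv. int (Poly_Mapping.lookup \<mu> v))"
  proof (rule qdeg_superset)
    have "v \<in> range Xv \<union> range Yv" for v :: "'n bvar" by (cases v) auto
    then show "Poly_Mapping.keys \<mu> \<subseteq> range Xv \<union> range Yv" by blast
  qed simp
  also have "\<dots> = ?dx + ?dy" by (subst sum.union_disjoint) (auto simp: sum.reindex inj_def)
  finally show "qdeg \<mu> = ?dx + ?dy" .
qed

context
  fixes M :: "('n::finite bpoly, 'a) gfmod" and N :: "('n bpoly, 'b) gfmod"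
  assumes M: "module PR M" and N: "module PR N"
begin

private abbreviation "TT \<equiv> tens M N"

definition act_summand :: "('n bvar \<Rightarrow>\<^sub>0 nat) \<Rightarrow> rat \<Rightarrow> 'a \<Rightarrow> 'b \<Rightarrow> (('a \<times> 'b) \<Rightarrow>\<^sub>0 int) set" where
  "act_summand \<mu> a m n = ptens M N ((const a * y_monom \<mu>) \<odot>\<^bsub>M\<^esub> m) (x_monom \<mu> \<odot>\<^bsub>N\<^esub> n)"

lemma tens_class_sum:
  assumes "finite A" "\<And>i. i \<in> A \<Longrightarrow> f i \<in> carrier (tens_free M N)"
  shows "tens_class M N (\<Sum>i\<in>A. f i) = finsum TT (\<lambda>i. tens_class M N (f i)) A"
proof -
  interpret TT: abelian_group TT by (rule abelian_group_tens[OF M N])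
  have "tens_class M N (\<Sum>i\<in>A. f i) = finsum TT (\<lambda>i. tens_class M N (f i)) A \<and> (\<Sum>i\<in>A. f i) \<in> carrier (tens_free M N)"
    using assms
  proof (induction A)
    case empty
    then show ?case by (simp add: tens_zero[OF M N] tens_free_simps[OF M N])
  next
    case (insert x A)
    have "f x + sum f A \<in> carrier (tens_free M N)" unfolding tens_free_simps(1)[OF M N]
      by (rule order_trans[OF Poly_Mapping.keys_add]) (use insert in \<open>simp add: tens_free_simps[OF M N]\<close>)
    moreover have "finsum TT (\<lambda>i. tens_class M N (f i)) (insert x A) =
        tens_class M N (f x) \<oplus>\<^bsub>TT\<^esub> finsum TT (\<lambda>i. tens_class M N (f i)) A"
      by (rule TT.finsum_insert) (use insert in \<open>auto simp: tens_carrier[OF M N]\<close>)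
    ultimately show ?case using insert tens_add[OF M N, of "f x" "sum f A"] by simp
  qed
  then show ?thesis by simp
qed

lemma balanced_finsum:
  assumes H: "abelian_group H" and "finite A" "\<And>i. i \<in> A \<Longrightarrow> balanced M N H (\<phi> i)"
  shows "balanced M N H (\<lambda>m n. finsum H (\<lambda>i. \<phi> i m n) A)"
proof -
  interpret H: abelian_group H by (rule H)
  note b = balancedD[OF assms(3)]
  have cl: "(\<lambda>i. \<phi> i m n) \<in> A \<rightarrow> carrier H" if "m \<in> carrier M" "n \<in> carrier N" for m n
    using b(1) that by blast
  show ?thesis unfolding balanced_def
  proof (intro conjI ballI allI)
    fix m m' assume m: "m \<in> carrier M" "m' \<in> carrier M"
    fix n n' assume n: "n \<in> carrier N" "n' \<in> carrier N"
    show "finsum H (\<lambda>i. \<phi> i (m \<oplus>\<^bsub>M\<^esub> m') n) A = finsum H (\<lambda>i. \<phi> i m n) A \<oplus>\<^bsub>H\<^esub> finsum H (\<lambda>i. \<phi> i m' n) A"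
      unfolding H.finsum_addf[OF cl[OF m(1) n(1)] cl[OF m(2) n(1)], symmetric]
      by (rule H.finsum_cong') (use b(2)[OF _ m n(1)] cl[OF m(1) n(1)] cl[OF m(2) n(1)] in auto)
    show "finsum H (\<lambda>i. \<phi> i m (n \<oplus>\<^bsub>N\<^esub> n')) A = finsum H (\<lambda>i. \<phi> i m n) A \<oplus>\<^bsub>H\<^esub> finsum H (\<lambda>i. \<phi> i m n') A"
      unfolding H.finsum_addf[OF cl[OF m(1) n(1)] cl[OF m(1) n(2)], symmetric]
      by (rule H.finsum_cong') (use b(3)[OF _ m(1) n] cl[OF m(1) n(1)] cl[OF m(1) n(2)] in auto)
  next
    fix m n assume mn: "m \<in> carrier M" "n \<in> carrier N"
    show "finsum H (\<lambda>i. \<phi> i m n) A \<in> carrier H" by (rule H.finsum_closed[OF cl[OF mn]])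
    show "finsum H (\<lambda>i. \<phi> i (xvars p \<odot>\<^bsub>M\<^esub> m) n) A = finsum H (\<lambda>i. \<phi> i m (yvars p \<odot>\<^bsub>N\<^esub> n)) A" for p
      by (rule H.finsum_cong') (use b(4)[OF _ mn] cl[OF mn(1) module_smult_facts(1)[OF N mn(2)]] in auto)
  qed
qed

lemma act_summand_balanced: "balanced M N TT (act_summand \<mu> a)"
proof -
  note b = balancedD[OF ptens_balanced[OF M N]]
  note Mf = module_smult_facts[OF M] and Nf = module_smult_facts[OF N]
  have cM: "p \<odot>\<^bsub>M\<^esub> (q \<odot>\<^bsub>M\<^esub> m) = q \<odot>\<^bsub>M\<^esub> (p \<odot>\<^bsub>M\<^esub> m)" if "m \<in> carrier M" for p q m
    using Mf(3)[OF that] by (metis mult.commute)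
  have cN: "p \<odot>\<^bsub>N\<^esub> (q \<odot>\<^bsub>N\<^esub> m) = q \<odot>\<^bsub>N\<^esub> (p \<odot>\<^bsub>N\<^esub> m)" if "m \<in> carrier N" for p q m
    using Nf(3)[OF that] by (metis mult.commute)
  show ?thesis unfolding balanced_def act_summand_def
  proof (intro conjI ballI allI)
    fix p m n assume m: "m \<in> carrier M" and n: "n \<in> carrier N"
    show "ptens M N ((const a * y_monom \<mu>) \<odot>\<^bsub>M\<^esub> (xvars p \<odot>\<^bsub>M\<^esub> m)) (x_monom \<mu> \<odot>\<^bsub>N\<^esub> n) =
        ptens M N ((const a * y_monom \<mu>) \<odot>\<^bsub>M\<^esub> m) (x_monom \<mu> \<odot>\<^bsub>N\<^esub> (yvars p \<odot>\<^bsub>N\<^esub> n))"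
      unfolding cM[OF m, of _ "xvars p"] cN[OF n, of _ "yvars p"] by (rule b(4)[OF Mf(1)[OF m] Nf(1)[OF n]])
  qed (simp_all add: Mf Nf b)
qed

text \<open>The action is defined by a union over representatives. It descends because it is a
  finite sum of actions of single terms, each of them balanced.\<close>

lemma tens_smult_raw:
  "module.smult TT p \<in> carrier TT \<rightarrow> carrier TT"
  "x \<in> carrier TT \<Longrightarrow> y \<in> carrier TT \<Longrightarrow> p \<odot>\<^bsub>TT\<^esub> (x \<oplus>\<^bsub>TT\<^esub> y) = p \<odot>\<^bsub>TT\<^esub> x \<oplus>\<^bsub>TT\<^esub> p \<odot>\<^bsub>TT\<^esub> y"
  "m \<in> carrier M \<Longrightarrow> n \<in> carrier N \<Longrightarrow>
    p \<odot>\<^bsub>TT\<^esub> ptens M N m n = finsum TT (\<lambda>\<mu>. act_summand \<mu> (Poly_Mapping.lookup p \<mu>) m n) (Poly_Mapping.keys p)"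
proof -
  interpret TT: abelian_group TT by (rule abelian_group_tens[OF M N])
  note Mf = module_smult_facts[OF M] and Nf = module_smult_facts[OF N]
  define k where "k = (\<lambda>(m, n). \<Sum>\<mu>\<in>Poly_Mapping.keys p.
     frag_of ((const (Poly_Mapping.lookup p \<mu>) * y_monom \<mu>) \<odot>\<^bsub>M\<^esub> m, x_monom \<mu> \<odot>\<^bsub>N\<^esub> n))"
  have kc: "tens_class M N (k (m, n)) = finsum TT (\<lambda>\<mu>. act_summand \<mu> (Poly_Mapping.lookup p \<mu>) m n) (Poly_Mapping.keys p)"
    if "m \<in> carrier M" "n \<in> carrier N" for m n unfolding k_def split act_summand_def ptens_def
    by (rule tens_class_sum) (use that Mf(1) Nf(1) in \<open>auto simp: tens_free_simps[OF M N]\<close>)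
  have kF: "k (m, n) \<in> carrier (tens_free M N)" if "m \<in> carrier M" "n \<in> carrier N" for m n
    unfolding k_def split tens_free_def by (rule sum_closed_free_Abelian_group) (use that Mf(1) Nf(1) in auto)
  have bal0: "balanced M N TT (\<lambda>m n. finsum TT (\<lambda>\<mu>. act_summand \<mu> (Poly_Mapping.lookup p \<mu>) m n) (Poly_Mapping.keys p))"
    by (rule balanced_finsum[OF TT.abelian_group_axioms]) (auto intro: act_summand_balanced)
  have bal: "balanced M N TT (\<lambda>m n. tens_class M N (k (m, n)))" by (rule balanced_cong[OF M N bal0 kc])
  have eq: "module.smult TT p = (\<lambda>Z. \<Union>c\<in>Z. tens_class M N (frag_extend k c))"
    by (simp add: tens_def Let_def tens_act_def k_def)
  have kF': "\<forall>m\<in>carrier M. \<forall>n\<in>carrier N. k (m, n) \<in> carrier (tens_free M N)" using kF by blast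
  note d = tens_descend[OF M N M N kF' bal eq]
  show "module.smult TT p \<in> carrier TT \<rightarrow> carrier TT" by (rule d(1))
  show "p \<odot>\<^bsub>TT\<^esub> (x \<oplus>\<^bsub>TT\<^esub> y) = p \<odot>\<^bsub>TT\<^esub> x \<oplus>\<^bsub>TT\<^esub> p \<odot>\<^bsub>TT\<^esub> y" if "x \<in> carrier TT" "y \<in> carrier TT"
    by (rule d(2)[OF that])
  show "p \<odot>\<^bsub>TT\<^esub> ptens M N m n = finsum TT (\<lambda>\<mu>. act_summand \<mu> (Poly_Mapping.lookup p \<mu>) m n) (Poly_Mapping.keys p)"
    if "m \<in> carrier M" "n \<in> carrier N" using d(3)[OF that] kc[OF that] by simp
qed

lemma ptens_zero:
  "n \<in> carrier N \<Longrightarrow> ptens M N \<zero>\<^bsub>M\<^esub> n = \<zero>\<^bsub>TT\<^esub>" "m \<in> carrier M \<Longrightarrow> ptens M N m \<zero>\<^bsub>N\<^esub> = \<zero>\<^bsub>TT\<^esub>"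
proof -
  note b = balancedD[OF ptens_balanced[OF M N]]
  interpret M: module PR M by (rule M)
  interpret N: module PR N by (rule N)
  show "ptens M N \<zero>\<^bsub>M\<^esub> n = \<zero>\<^bsub>TT\<^esub>" if "n \<in> carrier N"
    by (rule additive_zero_inv(1)[OF M.abelian_group_axioms abelian_group_tens[OF M N]]) (use b that in auto)
  show "ptens M N m \<zero>\<^bsub>N\<^esub> = \<zero>\<^bsub>TT\<^esub>" if "m \<in> carrier M"
    by (rule additive_zero_inv(1)[OF N.abelian_group_axioms abelian_group_tens[OF M N]]) (use b that in auto)
qed

lemma act_summand_props:
  assumes "m \<in> carrier M" "n \<in> carrier N"
  shows "act_summand \<mu> a m n \<in> carrier TT" "act_summand \<mu> 0 m n = \<zero>\<^bsub>TT\<^esub>"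
    "act_summand \<mu> (a + b) m n = act_summand \<mu> a m n \<oplus>\<^bsub>TT\<^esub> act_summand \<mu> b m n"
  using assms balancedD(1,2)[OF ptens_balanced[OF M N]]
  by (simp_all add: act_summand_def module_smult_facts[OF M] module_smult_facts[OF N] ptens_zero single_add distrib_right)

lemma tens_smult_ptens:
  assumes "finite A" "Poly_Mapping.keys p \<subseteq> A" "m \<in> carrier M" "n \<in> carrier N"
  shows "p \<odot>\<^bsub>TT\<^esub> ptens M N m n = finsum TT (\<lambda>\<mu>. act_summand \<mu> (Poly_Mapping.lookup p \<mu>) m n) A"
proof -
  interpret TT: abelian_group TT by (rule abelian_group_tens[OF M N])
  show ?thesis unfolding tens_smult_raw(3)[OF assms(3,4)] by (rule TT.add.finprod_mono_neutral_cong_left)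
      (use assms act_summand_props[OF assms(3,4)] in \<open>auto simp: in_keys_iff\<close>)
qed

lemma tens_smult_single:
  assumes "m \<in> carrier M" "n \<in> carrier N"
  shows "Poly_Mapping.single \<mu> a \<odot>\<^bsub>TT\<^esub> ptens M N m n = act_summand \<mu> a m n"
proof -
  interpret TT: abelian_group TT by (rule abelian_group_tens[OF M N])
  show ?thesis using tens_smult_ptens[of "{\<mu>}" "Poly_Mapping.single \<mu> a", OF _ _ assms] act_summand_props[OF assms]
    by simp
qed

text \<open>Each law compares additive maps and is tested on pure tensors. Associativity is additive
  in both polynomials, which reduces it to two monomials, where the exponents of the x-parts and of
  the y-parts add separately.\<close>

lemma module_tens: "module PR TT"
proof -
  interpret TT: abelian_group TT by (rule abelian_group_tens[OF M N])
  note sm = tens_smult_raw(1,2)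
  have cl: "p \<odot>\<^bsub>TT\<^esub> x \<in> carrier TT" if "x \<in> carrier TT" for p x using sm(1) that by blast
  have l: "(p + q) \<odot>\<^bsub>TT\<^esub> x = p \<odot>\<^bsub>TT\<^esub> x \<oplus>\<^bsub>TT\<^esub> q \<odot>\<^bsub>TT\<^esub> x" if "x \<in> carrier TT" for p q x
  proof (rule tens_additive_eqI[OF M N TT.abelian_group_axioms _ _ _ _ _ that])
    show "(p + q) \<odot>\<^bsub>TT\<^esub> ptens M N m n = p \<odot>\<^bsub>TT\<^esub> ptens M N m n \<oplus>\<^bsub>TT\<^esub> q \<odot>\<^bsub>TT\<^esub> ptens M N m n"
      if mn: "m \<in> carrier M" "n \<in> carrier N" for m n
    proof -
      let ?A = "Poly_Mapping.keys p \<union> Poly_Mapping.keys q"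
      note e = tens_smult_ptens[of ?A, OF _ _ mn]
      have "Poly_Mapping.keys (p + q) \<subseteq> ?A" by (rule Poly_Mapping.keys_add)
      then show ?thesis using e[of p] e[of q] e[of "p + q"] act_summand_props[OF mn]
        by (simp add: lookup_add TT.finsum_addf Pi_def)
    qed
  qed (use cl sm(2) in \<open>auto simp: TT.a_ac\<close>)
  have z: "0 \<odot>\<^bsub>TT\<^esub> x = \<zero>\<^bsub>TT\<^esub>" if "x \<in> carrier TT" for x
    by (rule tens_additive_eqI[OF M N TT.abelian_group_axioms _ _ _ _ _ that])
      (use cl sm(2) tens_smult_raw(3)[of _ _ 0] in auto)
  have r0: "p \<odot>\<^bsub>TT\<^esub> \<zero>\<^bsub>TT\<^esub> = \<zero>\<^bsub>TT\<^esub>" for p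
    by (rule additive_zero_inv(1)[OF TT.abelian_group_axioms TT.abelian_group_axioms sm])
  have as0: "(Poly_Mapping.single \<mu> a * q) \<odot>\<^bsub>TT\<^esub> ptens M N m n = Poly_Mapping.single \<mu> a \<odot>\<^bsub>TT\<^esub> (q \<odot>\<^bsub>TT\<^esub> ptens M N m n)"
    if mn: "m \<in> carrier M" "n \<in> carrier N" for \<mu> a q m n
  proof (induction q rule: pm_induct)
    case zero
    then show ?case using z r0 ptens_closed[OF M N mn] by simp
  next
    case (single \<nu> b)
    note Mf = module_smult_facts[OF M] and Nf = module_smult_facts[OF N]
    have "act_summand (\<mu> + \<nu>) (a * b) m n = ptens M N ((const a * y_monom \<mu>) \<odot>\<^bsub>M\<^esub> ((const b * y_monom \<nu>) \<odot>\<^bsub>M\<^esub> m))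
        (x_monom \<mu> \<odot>\<^bsub>N\<^esub> (x_monom \<nu> \<odot>\<^bsub>N\<^esub> n))"
      unfolding act_summand_def tens_act_summand_add Nf(3)[OF mn(2), symmetric] Mf(3)[OF mn(1), symmetric]
      by (simp add: mult_single[of 0 a 0 b, simplified, symmetric] ac_simps)
    then show ?case using mn Mf(1) Nf(1) by (simp add: mult_single tens_smult_single act_summand_def)
  next
    case (add p q)
    then show ?case using ptens_closed[OF M N mn] cl by (simp add: distrib_left l sm(2))
  qed
  have as1: "(p * q) \<odot>\<^bsub>TT\<^esub> ptens M N m n = p \<odot>\<^bsub>TT\<^esub> (q \<odot>\<^bsub>TT\<^esub> ptens M N m n)"
    if mn: "m \<in> carrier M" "n \<in> carrier N" for p q m n
    by (induction p rule: pm_induct) (use ptens_closed[OF M N mn] as0[OF mn] cl in \<open>auto simp: z l distrib_right\<close>)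
  show ?thesis
  proof (rule moduleI[OF cring_PR TT.abelian_group_axioms])
    fix p q x y assume x: "x \<in> carrier TT"
    show "p \<odot>\<^bsub>TT\<^esub> x \<in> carrier TT" by (rule cl[OF x])
    show "(p \<oplus>\<^bsub>PR\<^esub> q) \<odot>\<^bsub>TT\<^esub> x = p \<odot>\<^bsub>TT\<^esub> x \<oplus>\<^bsub>TT\<^esub> q \<odot>\<^bsub>TT\<^esub> x" using l[OF x] by simp
    show "(p \<otimes>\<^bsub>PR\<^esub> q) \<odot>\<^bsub>TT\<^esub> x = p \<odot>\<^bsub>TT\<^esub> (q \<odot>\<^bsub>TT\<^esub> x)"
      by (rule tens_additive_eqI[OF M N TT.abelian_group_axioms _ _ _ _ _ x]) (use cl sm(2) as1 in auto)
    show "\<one>\<^bsub>PR\<^esub> \<odot>\<^bsub>TT\<^esub> x = x"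
    proof (rule tens_additive_eqI[OF M N TT.abelian_group_axioms _ _ _ _ _ x])
      show "\<one>\<^bsub>PR\<^esub> \<odot>\<^bsub>TT\<^esub> ptens M N m n = ptens M N m n" if "m \<in> carrier M" "n \<in> carrier N" for m n
        using tens_smult_single[OF that, of 0 1] that
        by (simp add: act_summand_def module_smult_facts[OF M] module_smult_facts[OF N])
    qed (use cl sm(2) in auto)
    assume "y \<in> carrier TT"
    then show "p \<odot>\<^bsub>TT\<^esub> (x \<oplus>\<^bsub>TT\<^esub> y) = p \<odot>\<^bsub>TT\<^esub> x \<oplus>\<^bsub>TT\<^esub> p \<odot>\<^bsub>TT\<^esub> y" using sm(2) x by blast
  qed
qed

text \<open>These rules replace the sum over monomials in later proofs that a map out of a tensor
  product is linear.\<close>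

lemma tens_smult_generators:
  assumes "m \<in> carrier M" "n \<in> carrier N"
  shows "const a \<odot>\<^bsub>TT\<^esub> ptens M N m n = ptens M N (const a \<odot>\<^bsub>M\<^esub> m) n"
    "mvar (Yv i) \<odot>\<^bsub>TT\<^esub> ptens M N m n = ptens M N (mvar (Yv i) \<odot>\<^bsub>M\<^esub> m) n"
    "mvar (Xv i) \<odot>\<^bsub>TT\<^esub> ptens M N m n = ptens M N m (mvar (Xv i) \<odot>\<^bsub>N\<^esub> n)"
proof -
  have mv: "mvar v \<odot>\<^bsub>TT\<^esub> ptens M N m n = act_summand (Poly_Mapping.single v (Suc 0)) 1 m n" for v
    unfolding mvar_def One_nat_def by (rule tens_smult_single[OF assms])
  show "const a \<odot>\<^bsub>TT\<^esub> ptens M N m n = ptens M N (const a \<odot>\<^bsub>M\<^esub> m) n"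
    "mvar (Yv i) \<odot>\<^bsub>TT\<^esub> ptens M N m n = ptens M N (mvar (Yv i) \<odot>\<^bsub>M\<^esub> m) n"
    "mvar (Xv i) \<odot>\<^bsub>TT\<^esub> ptens M N m n = ptens M N m (mvar (Xv i) \<odot>\<^bsub>N\<^esub> n)"
    using assms
    by (simp_all add: tens_smult_single mv act_summand_def module_smult_facts[OF M] module_smult_facts[OF N])
qed

end

subsection \<open>Grading and filtration\<close>

lemma gf_qpart_induct [consumes 2, case_names zero qpart add]:
  assumes M: "gfmodule M" and "m \<in> carrier M" "P \<zero>\<^bsub>M\<^esub>" "\<And>q x. x \<in> qpart M q \<Longrightarrow> P x"
    "\<And>x y. x \<in> carrier M \<Longrightarrow> y \<in> carrier M \<Longrightarrow> P x \<Longrightarrow> P y \<Longrightarrow> P (x \<oplus>\<^bsub>M\<^esub> y)"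
  shows "P m"
proof -
  interpret M: abelian_group M by (rule gfmodule_abelian_group[OF M])
  let ?S = "{q. hproj M q m \<noteq> \<zero>\<^bsub>M\<^esub>}"
  have "P (finsum M (\<lambda>q. hproj M q m) S)" if "finite S" for S using that
  proof induction
    case (insert q S)
    have "finsum M (\<lambda>q. hproj M q m) S \<in> carrier M"
      using hproj_carrier[OF M assms(2)] by (intro M.finsum_closed) auto
    then show ?case using insert assms(5) assms(4)[OF hproj_qpart[OF M assms(2)]] hproj_carrier[OF M assms(2)] by simp
  qed (use assms in simp)
  from this[OF hproj_finite[OF M assms(2)]] show ?thesis using hproj_sum[OF M assms(2) hproj_finite[OF M assms(2)]] by simp
qed

lemma hproj_smult:
  assumes M: "gfmodule M" and p: "homog d p" and m: "m \<in> carrier M"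
  shows "hproj M i (p \<odot>\<^bsub>M\<^esub> m) = p \<odot>\<^bsub>M\<^esub> hproj M (i - d) m" using M m
proof (induction m rule: gf_qpart_induct)
  interpret M: module PR M by (rule gfmodule_module[OF M])
  {
    case zero
    then show ?case using M.smult_r_null by (simp add: hproj_zero[OF M])
  next
    case (qpart q x)
    have "hproj M i (p \<odot>\<^bsub>M\<^esub> x) = (if i = q + d then p \<odot>\<^bsub>M\<^esub> x else \<zero>\<^bsub>M\<^esub>)"
      by (rule hproj_id[OF M gfmodule_smult_qpart[OF M p qpart]])
    moreover have "hproj M (i - d) x = (if i - d = q then x else \<zero>\<^bsub>M\<^esub>)" by (rule hproj_id[OF M qpart])
    ultimately show ?case using M.smult_r_null by auto
  next
    case (add x y)
    then show ?case using module_smult_facts[OF gfmodule_module[OF M]] hproj_add[OF M] hproj_carrier[OF M] by simp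
  }
qed

context
  fixes M :: "('n::finite bpoly, 'a) gfmod" and N :: "('n bpoly, 'b) gfmod"
  assumes M: "gfmodule M" and N: "gfmodule N"
begin

private abbreviation "T \<equiv> tens M N"

private lemma MN: "module PR M" "module PR N" by (rule gfmodule_module[OF M], rule gfmodule_module[OF N])

text \<open>The pieces of grading and filtration are generated in the multiplicatively written
  quotient group; here they are recognised as additive subgroups of the module.\<close>

lemma tens_generate_subgroup:
  assumes G: "G \<subseteq> carrier T"
  shows "additive_subgroup (generate (tens_free M N Mod tens_rel M N) G) T"
    and "additive_subgroup S T \<Longrightarrow> G \<subseteq> S \<Longrightarrow> generate (tens_free M N Mod tens_rel M N) G \<subseteq> S"
proof -
  let ?Q = "tens_free M N Mod tens_rel M N"
  interpret T: abelian_group T by (rule abelian_group_tens[OF MN])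
  interpret Q: group ?Q by (rule normal.factorgroup_is_group[OF tens_rel_normal[OF MN]])
  have ops: "carrier ?Q = carrier T" "x \<otimes>\<^bsub>?Q\<^esub> y = x \<oplus>\<^bsub>T\<^esub> y" "\<one>\<^bsub>?Q\<^esub> = \<zero>\<^bsub>T\<^esub>" for x y
    by (simp_all add: tens_def Let_def)
  have inv: "inv\<^bsub>?Q\<^esub> x = \<ominus>\<^bsub>T\<^esub> x" if "x \<in> carrier T" for x
    by (rule Q.inv_equality) (simp_all only: ops T.l_neg[OF that] that T.a_inv_closed)
  have sub: "subgroup S ?Q \<longleftrightarrow> additive_subgroup S T" for S
  proof
    assume S: "subgroup S ?Q"
    show "additive_subgroup S T"
    proof (rule additive_subgroupI[OF T.abelian_group_axioms])
      show ST: "S \<subseteq> carrier T" using subgroup.subset[OF S] unfolding ops .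
      show "\<zero>\<^bsub>T\<^esub> \<in> S" using subgroup.one_closed[OF S] unfolding ops .
      show "x \<oplus>\<^bsub>T\<^esub> y \<in> S" if "x \<in> S" "y \<in> S" for x y using subgroup.m_closed[OF S that] unfolding ops .
      show "\<ominus>\<^bsub>T\<^esub> x \<in> S" if "x \<in> S" for x
        using subgroup.m_inv_closed[OF S that] unfolding inv[OF subsetD[OF ST that]] .
    qed
  next
    assume "additive_subgroup S T"
    note S = additive_subgroupD[OF T.abelian_group_axioms this]
    show "subgroup S ?Q"
    proof (rule subgroup.intro)
      show "S \<subseteq> carrier ?Q" unfolding ops by (rule S)
      show "x \<otimes>\<^bsub>?Q\<^esub> y \<in> S" if "x \<in> S" "y \<in> S" for x y unfolding ops by (rule S(3)[OF that])
      show "\<one>\<^bsub>?Q\<^esub> \<in> S" unfolding ops by (rule S)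
      show "inv\<^bsub>?Q\<^esub> x \<in> S" if "x \<in> S" for x unfolding inv[OF subsetD[OF S(1) that]] by (rule S(4)[OF that])
    qed
  qed
  show "additive_subgroup (generate ?Q G) T" using Q.generate_is_subgroup[of G] G by (simp add: sub ops(1))
  show "additive_subgroup S T \<Longrightarrow> G \<subseteq> S \<Longrightarrow> generate ?Q G \<subseteq> S"
    using Q.generate_subgroup_incl[of G S] sub by blast
qed

definition qgens :: "int \<Rightarrow> (('a \<times> 'b) \<Rightarrow>\<^sub>0 int) set set" where
  "qgens q = {ptens M N m n | m n i. m \<in> qpart M i \<and> n \<in> qpart N (q - i)}"

definition fgens :: "int \<Rightarrow> (('a \<times> 'b) \<Rightarrow>\<^sub>0 int) set set" where
  "fgens k = {ptens M N m n | m n i. m \<in> fil M i \<and> n \<in> fil N (k - i)}"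

lemma tens_qpart: "qpart T q = generate (tens_free M N Mod tens_rel M N) (qgens q)"
  by (simp add: tens_def Let_def qgens_def ptens_def)

lemma tens_fil: "fil T q = generate (tens_free M N Mod tens_rel M N) (fgens q)"
  by (simp add: tens_def Let_def fgens_def ptens_def)

lemma qgens_carrier: "qgens q \<subseteq> carrier T"
  unfolding qgens_def using ptens_closed[OF MN] gfmodule_qpart_carrier[OF M] gfmodule_qpart_carrier[OF N] by blast

lemma fgens_carrier: "fgens q \<subseteq> carrier T"
  unfolding fgens_def using ptens_closed[OF MN] gfmodule_fil_carrier[OF M] gfmodule_fil_carrier[OF N] by blast

lemma tens_qpart_subgroup: "additive_subgroup (qpart T q) T"
  unfolding tens_qpart by (rule tens_generate_subgroup(1)[OF qgens_carrier])

lemma tens_fil_subgroup: "additive_subgroup (fil T q) T"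
  unfolding tens_fil by (rule tens_generate_subgroup(1)[OF fgens_carrier])

lemma ptens_qpart: "m \<in> qpart M i \<Longrightarrow> n \<in> qpart N j \<Longrightarrow> i + j = q \<Longrightarrow> ptens M N m n \<in> qpart T q"
  unfolding tens_qpart by (rule generate.incl) (unfold qgens_def, rule CollectI, rule exI[of _ m], rule exI[of _ n], rule exI[of _ i], auto)

lemma ptens_fil: "m \<in> fil M i \<Longrightarrow> n \<in> fil N j \<Longrightarrow> i + j = q \<Longrightarrow> ptens M N m n \<in> fil T q"
  unfolding tens_fil by (rule generate.incl) (unfold fgens_def, rule CollectI, rule exI[of _ m], rule exI[of _ n], rule exI[of _ i], auto)

text \<open>The preimage of \<open>S\<close> is a subgroup, hence contains the degree piece once it
  contains the pure tensors that generate it.\<close>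

lemma tens_qpart_map:
  assumes H: "abelian_group H" and f: "f \<in> carrier T \<rightarrow> carrier H"
    "\<And>x y. x \<in> carrier T \<Longrightarrow> y \<in> carrier T \<Longrightarrow> f (x \<oplus>\<^bsub>T\<^esub> y) = f x \<oplus>\<^bsub>H\<^esub> f y" and S: "additive_subgroup S H"
    and fS: "\<And>m n i. m \<in> qpart M i \<Longrightarrow> n \<in> qpart N (q - i) \<Longrightarrow> f (ptens M N m n) \<in> S"
    and x: "x \<in> qpart T q"
  shows "f x \<in> S"
proof -
  interpret T: abelian_group T by (rule abelian_group_tens[OF MN])
  note S' = additive_subgroupD[OF H S] and f0 = additive_zero_inv[OF T.abelian_group_axioms H f]
  have "additive_subgroup {x \<in> carrier T. f x \<in> S} T"
    by (rule additive_subgroupI[OF T.abelian_group_axioms]) (use f0 S' f in auto)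
  moreover have "qgens q \<subseteq> {x \<in> carrier T. f x \<in> S}" using qgens_carrier fS unfolding qgens_def by blast
  ultimately show ?thesis using tens_generate_subgroup(2)[OF qgens_carrier] x unfolding tens_qpart by blast
qed

lemma tens_fil_map:
  assumes H: "abelian_group H" and f: "f \<in> carrier T \<rightarrow> carrier H"
    "\<And>x y. x \<in> carrier T \<Longrightarrow> y \<in> carrier T \<Longrightarrow> f (x \<oplus>\<^bsub>T\<^esub> y) = f x \<oplus>\<^bsub>H\<^esub> f y" and S: "additive_subgroup S H"
    and fS: "\<And>m n i. m \<in> fil M i \<Longrightarrow> n \<in> fil N (q - i) \<Longrightarrow> f (ptens M N m n) \<in> S"
    and x: "x \<in> fil T q"
  shows "f x \<in> S"
proof -
  interpret T: abelian_group T by (rule abelian_group_tens[OF MN])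
  note S' = additive_subgroupD[OF H S] and f0 = additive_zero_inv[OF T.abelian_group_axioms H f]
  have "additive_subgroup {x \<in> carrier T. f x \<in> S} T"
    by (rule additive_subgroupI[OF T.abelian_group_axioms]) (use f0 S' f in auto)
  moreover have "fgens q \<subseteq> {x \<in> carrier T. f x \<in> S}" using fgens_carrier fS unfolding fgens_def by blast
  ultimately show ?thesis using tens_generate_subgroup(2)[OF fgens_carrier] x unfolding tens_fil by blast
qed

lemma additive_subgroup_finsum:
  assumes "abelian_group H" "additive_subgroup S H" "finite A" "\<And>i. i \<in> A \<Longrightarrow> f i \<in> S"
  shows "finsum H f A \<in> S"
proof -
  interpret H: abelian_group H by fact
  note S = additive_subgroupD[OF assms(1,2)]
  show ?thesis using assms(3,4) by induction (use S in \<open>auto simp: Pi_def subset_iff\<close>)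
qed

text \<open>The component of degree \<open>q\<close> of a pure tensor, summed over the splittings q
  = i + (q - i). Restricting i to the degrees that occur in \<open>m\<close> makes the sum
  finite.\<close>

definition proj_pair :: "int \<Rightarrow> 'a \<Rightarrow> 'b \<Rightarrow> (('a \<times> 'b) \<Rightarrow>\<^sub>0 int) set" where
  "proj_pair q m n = finsum T (\<lambda>i. ptens M N (hproj M i m) (hproj N (q - i) n)) {i. hproj M i m \<noteq> \<zero>\<^bsub>M\<^esub>}"

lemma proj_pair_superset:
  assumes "m \<in> carrier M" "n \<in> carrier N" "finite A" "{i. hproj M i m \<noteq> \<zero>\<^bsub>M\<^esub>} \<subseteq> A"
  shows "proj_pair q m n = finsum T (\<lambda>i. ptens M N (hproj M i m) (hproj N (q - i) n)) A"
proof -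
  interpret T: abelian_group T by (rule abelian_group_tens[OF MN])
  show ?thesis unfolding proj_pair_def by (rule T.add.finprod_mono_neutral_cong_left)
      (use assms ptens_zero(1)[OF MN] hproj_carrier[OF M] hproj_carrier[OF N] ptens_closed[OF MN] in auto)
qed

text \<open>Constants keep degrees. A variable raises them by 2, so moving it from left to right
  trades the splitting at i + 2 for the one at i, a reindexing of the sum.\<close>

lemma proj_pair_balanced: "balanced M N T (proj_pair q)"
proof (rule balancedI[OF MN])
  interpret T: abelian_group T by (rule abelian_group_tens[OF MN])
  interpret M: module PR M by (rule MN)
  interpret N: module PR N by (rule MN)
  note b = balancedD[OF ptens_balanced[OF MN]]
  note hM = hproj_carrier[OF M] and hN = hproj_carrier[OF N]
  note Mf = module_smult_facts[OF MN(1)] and Nf = module_smult_facts[OF MN(2)]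
  have ptc: "ptens M N (hproj M i m) (hproj N j n) \<in> carrier T" if "m \<in> carrier M" "n \<in> carrier N" for i j m n
    using that hM hN b(1) by blast
  show "proj_pair q m n \<in> carrier T" if "m \<in> carrier M" "n \<in> carrier N" for m n
    unfolding proj_pair_def by (rule T.finsum_closed) (use that ptc in auto)
  show "proj_pair q (m \<oplus>\<^bsub>M\<^esub> m') n = proj_pair q m n \<oplus>\<^bsub>T\<^esub> proj_pair q m' n"
    if "m \<in> carrier M" "m' \<in> carrier M" "n \<in> carrier N" for m m' n
  proof -
    let ?A = "{i. hproj M i m \<noteq> \<zero>\<^bsub>M\<^esub>} \<union> {i. hproj M i m' \<noteq> \<zero>\<^bsub>M\<^esub>}"
    have A: "finite ?A" "{i. hproj M i (m \<oplus>\<^bsub>M\<^esub> m') \<noteq> \<zero>\<^bsub>M\<^esub>} \<subseteq> ?A"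
      using hproj_finite[OF M] hproj_add[OF M] that by auto
    show ?thesis using that proj_pair_superset[of m n ?A q] proj_pair_superset[of m' n ?A q]
        proj_pair_superset[of "m \<oplus>\<^bsub>M\<^esub> m'" n ?A q] A ptc
      by (simp add: hproj_add[OF M] b(2) hM hN T.finsum_addf Pi_def)
  qed
  show "proj_pair q m (n \<oplus>\<^bsub>N\<^esub> n') = proj_pair q m n \<oplus>\<^bsub>T\<^esub> proj_pair q m n'"
    if "m \<in> carrier M" "n \<in> carrier N" "n' \<in> carrier N" for m n n' unfolding proj_pair_def using that ptc
    by (simp add: hproj_add[OF N] b(3) hM hN T.finsum_addf Pi_def)
  show "proj_pair q (const a \<odot>\<^bsub>M\<^esub> m) n = proj_pair q m (const a \<odot>\<^bsub>N\<^esub> n)" if "m \<in> carrier M" "n \<in> carrier N" for a m n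
  proof -
    let ?A = "{i. hproj M i m \<noteq> \<zero>\<^bsub>M\<^esub>}"
    have c: "ptens M N (const a \<odot>\<^bsub>M\<^esub> x) y = ptens M N x (const a \<odot>\<^bsub>N\<^esub> y)" if "x \<in> carrier M" "y \<in> carrier N" for x y
      using b(4)[OF that, of "const a"] by (simp add: mpoly_subst_const)
    have "{i. hproj M i (const a \<odot>\<^bsub>M\<^esub> m) \<noteq> \<zero>\<^bsub>M\<^esub>} \<subseteq> ?A"
      using that M.smult_r_null by (auto simp: hproj_smult[OF M homog_const])
    then have "proj_pair q (const a \<odot>\<^bsub>M\<^esub> m) n =
        finsum T (\<lambda>i. ptens M N (hproj M i (const a \<odot>\<^bsub>M\<^esub> m)) (hproj N (q - i) n)) ?A"
      by (intro proj_pair_superset) (use that Mf(1) hproj_finite[OF M] in auto)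
    also have "\<dots> = proj_pair q m (const a \<odot>\<^bsub>N\<^esub> n)" unfolding proj_pair_def
      by (rule T.finsum_cong') (use that ptc c hM hN Nf(1) b(1) in \<open>auto simp: hproj_smult[OF M homog_const] hproj_smult[OF N homog_const]\<close>)
    finally show ?thesis .
  qed
  show "proj_pair q (mvar (Xv v) \<odot>\<^bsub>M\<^esub> m) n = proj_pair q m (mvar (Yv v) \<odot>\<^bsub>N\<^esub> n)" if "m \<in> carrier M" "n \<in> carrier N" for v m n
  proof -
    let ?A = "{i. hproj M i m \<noteq> \<zero>\<^bsub>M\<^esub>}"
    have c: "ptens M N (mvar (Xv v) \<odot>\<^bsub>M\<^esub> x) y = ptens M N x (mvar (Yv v) \<odot>\<^bsub>N\<^esub> y)" if "x \<in> carrier M" "y \<in> carrier N" for x y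
      using b(4)[OF that, of "mvar v"] by (simp add: mpoly_subst_simps)
    have "{i. hproj M i (mvar (Xv v) \<odot>\<^bsub>M\<^esub> m) \<noteq> \<zero>\<^bsub>M\<^esub>} \<subseteq> (\<lambda>i. i + 2) ` ?A"
    proof
      fix i assume "i \<in> {i. hproj M i (mvar (Xv v) \<odot>\<^bsub>M\<^esub> m) \<noteq> \<zero>\<^bsub>M\<^esub>}"
      then show "i \<in> (\<lambda>i. i + 2) ` ?A"
        using that M.smult_r_null by (intro image_eqI[of _ _ "i - 2"]) (auto simp: hproj_smult[OF M homog_mvar])
    qed
    then have "proj_pair q (mvar (Xv v) \<odot>\<^bsub>M\<^esub> m) n =
        finsum T (\<lambda>i. ptens M N (hproj M i (mvar (Xv v) \<odot>\<^bsub>M\<^esub> m)) (hproj N (q - i) n)) ((\<lambda>i. i + 2) ` ?A)"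
      by (intro proj_pair_superset) (use that Mf(1) hproj_finite[OF M] in auto)
    also have "\<dots> = finsum T (\<lambda>i. ptens M N (hproj M (i + 2) (mvar (Xv v) \<odot>\<^bsub>M\<^esub> m)) (hproj N (q - (i + 2)) n)) ?A"
      by (rule T.add.finprod_reindex) (use that ptc Mf(1) in \<open>auto simp: inj_on_def\<close>)
    also have "\<dots> = proj_pair q m (mvar (Yv v) \<odot>\<^bsub>N\<^esub> n)" unfolding proj_pair_def
      by (rule T.finsum_cong')
        (use that ptc c hM hN Nf(1) b(1) in \<open>auto simp: hproj_smult[OF M homog_mvar] hproj_smult[OF N homog_mvar] algebra_simps\<close>)
    finally show ?thesis .
  qed
qed

definition tens_proj where "tens_proj q = tens_lift M N T (proj_pair q)"

text \<open>On a tensor of elements of degrees i and j only the splitting at i survives, so the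
  lifted projections are orthogonal and fix their degree pieces. They respect the filtration because
  the projections of each factor do.\<close>

lemma gfmodule_tens: "gfmodule T"
proof -
  interpret T: module PR T by (rule module_tens[OF MN])
  have ab: "abelian_group T" by (rule abelian_group_tens[OF MN])
  note lift = tens_lift[OF MN ab proj_pair_balanced, folded tens_proj_def]
  note b = balancedD[OF ptens_balanced[OF MN]]
  have pp: "proj_pair q' m n = (if q' = i + j then ptens M N m n else \<zero>\<^bsub>T\<^esub>)"
    if "m \<in> qpart M i" "n \<in> qpart N j" for m n i j q'
  proof -
    have m: "m \<in> carrier M" "n \<in> carrier N" using gfmodule_qpart_carrier[OF M that(1)] gfmodule_qpart_carrier[OF N that(2)] .
    have "proj_pair q' m n = finsum T (\<lambda>i. ptens M N (hproj M i m) (hproj N (q' - i) n)) {i}"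
      by (rule proj_pair_superset) (use m hproj_id[OF M that(1)] in \<open>auto split: if_splits\<close>)
    also have "\<dots> = ptens M N (hproj M i m) (hproj N (q' - i) n)"
      using T.M.finsum_insert[of "{}" i "\<lambda>i. ptens M N (hproj M i m) (hproj N (q' - i) n)"]
        b(1)[OF hproj_carrier[OF M m(1)] hproj_carrier[OF N m(2)]] by simp
    also have "\<dots> = ptens M N m (if q' - i = j then n else \<zero>\<^bsub>N\<^esub>)"
      unfolding hproj_id[OF M that(1)] hproj_id[OF N that(2)] by simp
    finally show ?thesis using ptens_zero(2)[OF MN m(1)] by auto
  qed
  have pq: "tens_proj q' x = (if q' = q then x else \<zero>\<^bsub>T\<^esub>)" if "x \<in> qpart T q" for x q q'
  proof -
    \<comment> \<open>Phrased as membership in the zero subgroup, so that it can be checked on the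
      generating pure tensors.\<close>
    have "tens_proj q' x \<ominus>\<^bsub>T\<^esub> (if q' = q then x else \<zero>\<^bsub>T\<^esub>) \<in> {\<zero>\<^bsub>T\<^esub>}"
    proof (rule tens_qpart_map[OF ab _ _ _ _ that])
      show "(\<lambda>x. tens_proj q' x \<ominus>\<^bsub>T\<^esub> (if q' = q then x else \<zero>\<^bsub>T\<^esub>)) \<in> carrier T \<rightarrow> carrier T"
        using lift(1) by (auto intro!: T.M.minus_closed)
      show "tens_proj q' (x \<oplus>\<^bsub>T\<^esub> y) \<ominus>\<^bsub>T\<^esub> (if q' = q then x \<oplus>\<^bsub>T\<^esub> y else \<zero>\<^bsub>T\<^esub>) =
        tens_proj q' x \<ominus>\<^bsub>T\<^esub> (if q' = q then x else \<zero>\<^bsub>T\<^esub>) \<oplus>\<^bsub>T\<^esub> (tens_proj q' y \<ominus>\<^bsub>T\<^esub> (if q' = q then y else \<zero>\<^bsub>T\<^esub>))"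
        if "x \<in> carrier T" "y \<in> carrier T" for x y
      proof -
        have "tens_proj q' x \<in> carrier T" "tens_proj q' y \<in> carrier T" using lift(1) that by auto
        then show ?thesis using that by (simp add: lift(2) T.M.group_simps)
      qed
      show "additive_subgroup {\<zero>\<^bsub>T\<^esub>} T" by (rule additive_subgroupI[OF ab]) (auto simp: T.M.minus_zero)
      show "tens_proj q' (ptens M N m n) \<ominus>\<^bsub>T\<^esub> (if q' = q then ptens M N m n else \<zero>\<^bsub>T\<^esub>) \<in> {\<zero>\<^bsub>T\<^esub>}"
        if "m \<in> qpart M i" "n \<in> qpart N (q - i)" for m n i
      proof -
        have "m \<in> carrier M" "n \<in> carrier N" using gfmodule_qpart_carrier[OF M that(1)] gfmodule_qpart_carrier[OF N that(2)] .
        then show ?thesis using lift(3) pp[OF that] b(1) by (simp add: T.M.group_simps)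
      qed
    qed
    moreover have "x \<in> carrier T" using additive_subgroupD(1)[OF ab tens_qpart_subgroup] that by blast
    moreover from this have "tens_proj q' x \<in> carrier T" using lift(1) by blast
    ultimately show ?thesis by (auto simp: T.M.group_simps)
  qed
  have pC: "tens_proj q x \<in> carrier T" if "x \<in> carrier T" for q x using lift(1) that by blast
  have pQ: "tens_proj q x \<in> qpart T q" if "x \<in> carrier T" for q x using that
  proof (induction x rule: tens_induct[OF MN, consumes 1, case_names 1 2 3])
    case 1
    then show ?case using additive_zero_inv(1)[OF ab ab lift(1,2)] additive_subgroupD(2)[OF ab tens_qpart_subgroup] by simp
  next
    case (2 m n)
    show ?case unfolding lift(3)[OF 2] proj_pair_def
      by (rule additive_subgroup_finsum[OF ab tens_qpart_subgroup hproj_finite[OF M 2(1)]])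
        (rule ptens_qpart[OF hproj_qpart[OF M 2(1)] hproj_qpart[OF N 2(2)]], simp)
  next
    case (3 x y)
    then show ?case using additive_subgroupD(3)[OF ab tens_qpart_subgroup] lift(2) by simp
  qed
  have dec: "\<exists>S. finite S \<and> (\<forall>q. q \<notin> S \<longrightarrow> tens_proj q x = \<zero>\<^bsub>T\<^esub>) \<and> x = finsum T (\<lambda>q. tens_proj q x) S" (is "?D x")
    if "x \<in> carrier T" for x
  proof -
    have D0: "?D \<zero>\<^bsub>T\<^esub>"
      using additive_zero_inv(1)[OF ab ab lift(1,2)] by (intro exI[of _ "{}"]) auto
    have Dadd: "?D (x \<oplus>\<^bsub>T\<^esub> y)" if xy: "x \<in> carrier T" "y \<in> carrier T" "?D x" "?D y" for x y
    proof -
      obtain S where S: "finite S" "\<And>q. q \<notin> S \<Longrightarrow> tens_proj q x = \<zero>\<^bsub>T\<^esub>" "x = finsum T (\<lambda>q. tens_proj q x) S"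
        using xy(3) by blast
      obtain S' where S': "finite S'" "\<And>q. q \<notin> S' \<Longrightarrow> tens_proj q y = \<zero>\<^bsub>T\<^esub>" "y = finsum T (\<lambda>q. tens_proj q y) S'"
        using xy(4) by blast
      have 1: "finsum T (\<lambda>q. tens_proj q x) S = finsum T (\<lambda>q. tens_proj q x) (S \<union> S')"
        by (rule T.M.add.finprod_mono_neutral_cong_left) (use S S' pC[OF xy(1)] in auto)
      have 2: "finsum T (\<lambda>q. tens_proj q y) S' = finsum T (\<lambda>q. tens_proj q y) (S \<union> S')"
        by (rule T.M.add.finprod_mono_neutral_cong_left) (use S S' pC[OF xy(2)] in auto)
      have "finsum T (\<lambda>q. tens_proj q (x \<oplus>\<^bsub>T\<^esub> y)) (S \<union> S') =
          finsum T (\<lambda>q. tens_proj q x) (S \<union> S') \<oplus>\<^bsub>T\<^esub> finsum T (\<lambda>q. tens_proj q y) (S \<union> S')"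
        using pC[OF xy(1)] pC[OF xy(2)] S(1) S'(1) by (simp add: lift(2)[OF xy(1,2)] T.M.finsum_addf Pi_def)
      also have "finsum T (\<lambda>q. tens_proj q x) (S \<union> S') = x" by (rule trans[OF 1[symmetric] S(3)[symmetric]])
      also have "finsum T (\<lambda>q. tens_proj q y) (S \<union> S') = y" by (rule trans[OF 2[symmetric] S'(3)[symmetric]])
      finally have eq: "x \<oplus>\<^bsub>T\<^esub> y = finsum T (\<lambda>q. tens_proj q (x \<oplus>\<^bsub>T\<^esub> y)) (S \<union> S')" by (rule sym)
      have "\<forall>q. q \<notin> S \<union> S' \<longrightarrow> tens_proj q (x \<oplus>\<^bsub>T\<^esub> y) = \<zero>\<^bsub>T\<^esub>"
        using S(2) S'(2) by (simp add: lift(2)[OF xy(1,2)])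
      then show ?thesis using S(1) S'(1) eq by (intro exI[of _ "S \<union> S'"] conjI) simp_all
    qed
    have Dq: "?D (ptens M N m n)" if "m \<in> qpart M i" "n \<in> qpart N j" for m n i j
    proof -
      have q: "ptens M N m n \<in> qpart T (i + j)" by (rule ptens_qpart[OF that]) simp
      have "ptens M N m n \<in> carrier T" using additive_subgroupD(1)[OF ab tens_qpart_subgroup] q by blast
      then show ?thesis using pq[OF q] by (intro exI[of _ "{i + j}"]) (auto simp: Pi_def)
    qed
    \<comment> \<open>Decomposability holds for tensors of homogeneous elements and is extended
      additively, first in the left entry and then in the right one.\<close>
    have D1: "?D (ptens M N m n)" if m: "m \<in> carrier M" and n: "n \<in> qpart N j" for m n j using M m
    proof (induction m rule: gf_qpart_induct)
      case zero
      then show ?case using D0 ptens_zero(1)[OF MN gfmodule_qpart_carrier[OF N n]] by simp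
    next
      case (qpart q x)
      then show ?case using Dq n by blast
    next
      case (add x y)
      note nC = gfmodule_qpart_carrier[OF N n]
      show ?case unfolding b(2)[OF add(1,2) nC] by (rule Dadd[OF b(1)[OF add(1) nC] b(1)[OF add(2) nC] add(3,4)])
    qed
    have D2: "?D (ptens M N m n)" if m: "m \<in> carrier M" and n: "n \<in> carrier N" for m n using N n
    proof (induction n rule: gf_qpart_induct)
      case zero
      then show ?case using D0 ptens_zero(2)[OF MN m] by simp
    next
      case (qpart q x)
      then show ?case using D1[OF m] by blast
    next
      case (add x y)
      show ?case unfolding b(3)[OF m add(1,2)] by (rule Dadd[OF b(1)[OF m add(1)] b(1)[OF m add(2)] add(3,4)])
    qed
    show ?thesis using that
    proof (induction x rule: tens_induct[OF MN, consumes 1, case_names 1 2 3])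
      case 1 show ?case by (rule D0)
    next
      case (2 m n) then show ?case by (rule D2)
    next
      case (3 x y) then show ?case by (rule Dadd)
    qed
  qed
  have hc: "hcomponents T x c \<longleftrightarrow> c = (\<lambda>q. tens_proj q x)" if "x \<in> carrier T" for x c
    by (rule hcomponents_by_projections[OF ab tens_qpart_subgroup pQ lift(2) _ _ dec that]) (use pq in auto)
  have sm: "p \<odot>\<^bsub>T\<^esub> ptens M N m n = finsum T (\<lambda>\<mu>. act_summand M N \<mu> (Poly_Mapping.lookup p \<mu>) m n) (Poly_Mapping.keys p)"
    if "m \<in> carrier M" "n \<in> carrier N" for p m n by (rule tens_smult_raw(3)[OF MN that])
  note smc = module.smult_closed[OF module_tens[OF MN], simplified]
  note smd = module.smult_r_distr[OF module_tens[OF MN], simplified]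
  show ?thesis unfolding gfmodule_def
  proof (intro conjI allI ballI impI)
    show "module PR T" by (rule module_tens[OF MN])
    show "additive_subgroup (qpart T q) T" for q by (rule tens_qpart_subgroup)
    show "\<exists>!c. hcomponents T x c" if "x \<in> carrier T" for x using hc[OF that] by auto
    show "p \<odot>\<^bsub>T\<^esub> x \<in> qpart T (q + d)" if hp: "homog d p" and x: "x \<in> qpart T q" for d q p x
    proof (rule tens_qpart_map[OF ab _ _ tens_qpart_subgroup _ x])
      show "p \<odot>\<^bsub>T\<^esub> ptens M N m n \<in> qpart T (q + d)" if mn: "m \<in> qpart M i" "n \<in> qpart N (q - i)" for m n i
      proof -
        have c: "m \<in> carrier M" "n \<in> carrier N" using gfmodule_qpart_carrier[OF M mn(1)] gfmodule_qpart_carrier[OF N mn(2)] .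
        show ?thesis unfolding sm[OF c]
        proof (rule additive_subgroup_finsum[OF ab tens_qpart_subgroup finite_keys])
          fix \<mu> assume "\<mu> \<in> Poly_Mapping.keys p"
          then have d: "qdeg \<mu> = d" using hp by (simp add: homog_iff)
          obtain dx dy where e: "homog dx (x_monom \<mu>)" "homog dy (y_monom \<mu>)" "qdeg \<mu> = dx + dy"
            by (rule homog_xy_monom)
          have "homog dy (const (Poly_Mapping.lookup p \<mu>) * y_monom \<mu>)" using homog_mult[OF homog_const e(2)] by simp
          then show "act_summand M N \<mu> (Poly_Mapping.lookup p \<mu>) m n \<in> qpart T (q + d)"
            unfolding act_summand_def[OF MN]
            by (rule ptens_qpart[OF gfmodule_smult_qpart[OF M _ mn(1)] gfmodule_smult_qpart[OF N e(1) mn(2)]])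
              (use d e(3) in simp)
        qed
      qed
    qed (use smc smd in auto)
    show "submodule (fil T k) PR T" for k
    proof (rule submodulePRI[OF module_tens[OF MN] tens_fil_subgroup])
      fix p x assume x: "x \<in> fil T k"
      show "p \<odot>\<^bsub>T\<^esub> x \<in> fil T k"
      proof (rule tens_fil_map[OF ab _ _ tens_fil_subgroup _ x])
        show "p \<odot>\<^bsub>T\<^esub> ptens M N m n \<in> fil T k" if mn: "m \<in> fil M i" "n \<in> fil N (k - i)" for m n i
        proof -
          have c: "m \<in> carrier M" "n \<in> carrier N" using gfmodule_fil_carrier[OF M mn(1)] gfmodule_fil_carrier[OF N mn(2)] .
          show ?thesis unfolding sm[OF c] act_summand_def[OF MN]
            by (rule additive_subgroup_finsum[OF ab tens_fil_subgroup finite_keys])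
              (rule ptens_fil[OF gf_fil_closed(5)[OF M mn(1)] gf_fil_closed(5)[OF N mn(2)]], simp)
        qed
      qed (use smc smd in auto)
    qed
    show "c q \<in> fil T k" if x: "x \<in> fil T k \<and> hcomponents T x c" for k x c q
    proof -
      have "x \<in> carrier T" using additive_subgroupD(1)[OF ab tens_fil_subgroup] x by blast
      then have c: "c q = tens_proj q x" using hc x by simp
      show ?thesis unfolding c
      proof (rule tens_fil_map[OF ab lift(1,2) tens_fil_subgroup _ x[THEN conjunct1]])
        show "tens_proj q (ptens M N m n) \<in> fil T k" if mn: "m \<in> fil M i" "n \<in> fil N (k - i)" for m n i
        proof -
          have c: "m \<in> carrier M" "n \<in> carrier N" using gfmodule_fil_carrier[OF M mn(1)] gfmodule_fil_carrier[OF N mn(2)] .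
          show ?thesis unfolding lift(3)[OF c] proj_pair_def
            by (rule additive_subgroup_finsum[OF ab tens_fil_subgroup hproj_finite[OF M c(1)]])
              (rule ptens_fil[OF hproj_fil[OF M mn(1)] hproj_fil[OF N mn(2)]], simp)
        qed
      qed
    qed
    show "fil T (k + 1) \<subseteq> fil T k" for k
    proof
      fix x assume x: "x \<in> fil T (k + 1)"
      show "x \<in> fil T k"
      proof (rule tens_fil_map[where f = "\<lambda>x. x", OF ab _ _ tens_fil_subgroup _ x])
        \<comment> \<open>The surplus unit of filtration is given up in the right factor.\<close>
        show "ptens M N m n \<in> fil T k" if "m \<in> fil M i" "n \<in> fil N (k + 1 - i)" for m n i
          using that gfmodule_fil_mono[OF N, of "k - i" "k + 1 - i"] by (intro ptens_fil[of m i n "k - i"]) auto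
      qed auto
    qed
  qed
qed

text \<open>Only the outer variables have to be checked, y on the left factor and x on the right
  one; compatibility in the middle is already contained in the existence of the additive map
  \<open>h\<close>.\<close>

lemma gfhom_tensI:
  assumes H: "gfmodule H" and h: "h \<in> carrier T \<rightarrow> carrier H"
    "\<And>x y. x \<in> carrier T \<Longrightarrow> y \<in> carrier T \<Longrightarrow> h (x \<oplus>\<^bsub>T\<^esub> y) = h x \<oplus>\<^bsub>H\<^esub> h y"
    and hp: "\<And>m n. m \<in> carrier M \<Longrightarrow> n \<in> carrier N \<Longrightarrow> h (ptens M N m n) = \<phi> m n"
    and c: "\<And>a m n. m \<in> carrier M \<Longrightarrow> n \<in> carrier N \<Longrightarrow> \<phi> (const a \<odot>\<^bsub>M\<^esub> m) n = const a \<odot>\<^bsub>H\<^esub> \<phi> m n"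
    and y: "\<And>i m n. m \<in> carrier M \<Longrightarrow> n \<in> carrier N \<Longrightarrow> \<phi> (mvar (Yv i) \<odot>\<^bsub>M\<^esub> m) n = mvar (Yv i) \<odot>\<^bsub>H\<^esub> \<phi> m n"
    and x: "\<And>i m n. m \<in> carrier M \<Longrightarrow> n \<in> carrier N \<Longrightarrow> \<phi> m (mvar (Xv i) \<odot>\<^bsub>N\<^esub> n) = mvar (Xv i) \<odot>\<^bsub>H\<^esub> \<phi> m n"
    and q: "\<And>m n i j. m \<in> qpart M i \<Longrightarrow> n \<in> qpart N j \<Longrightarrow> \<phi> m n \<in> qpart H (i + j)"
    and f: "\<And>m n i j. m \<in> fil M i \<Longrightarrow> n \<in> fil N j \<Longrightarrow> \<phi> m n \<in> fil H (i + j)"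
  shows "gfhom T H h"
proof -
  have Hm: "module PR H" by (rule gfmodule_module[OF H])
  have Ha: "abelian_group H" by (rule gfmodule_abelian_group[OF H])
  interpret Ta: abelian_group T by (rule abelian_group_tens[OF MN])
  note Tf = module_smult_facts[OF module_tens[OF MN]] and Hf = module_smult_facts[OF Hm]
  note Mf = module_smult_facts[OF MN(1)] and Nf = module_smult_facts[OF MN(2)]
  have hC: "h z \<in> carrier H" if "z \<in> carrier T" for z using h(1) that by blast
  have gen: "h (p \<odot>\<^bsub>T\<^esub> z) = p \<odot>\<^bsub>H\<^esub> h z" if "z \<in> carrier T"
    and e: "\<And>m n. m \<in> carrier M \<Longrightarrow> n \<in> carrier N \<Longrightarrow> h (p \<odot>\<^bsub>T\<^esub> ptens M N m n) = p \<odot>\<^bsub>H\<^esub> \<phi> m n" for p z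
    by (rule tens_additive_eqI[OF MN Ha _ _ _ _ _ that(1)])
      (use h e hp Tf Hf hC in auto)
  have lin: "\<forall>z\<in>carrier T. h (p \<odot>\<^bsub>T\<^esub> z) = p \<odot>\<^bsub>H\<^esub> h z" for p
  proof (induction p rule: mpoly_induct)
    case (const a)
    show ?case by (intro ballI gen) (simp_all add: tens_smult_generators[OF MN] hp Mf c)
  next
    case (add p q)
    then show ?case by (simp add: Tf Hf h hC)
  next
    case (var v p)
    have "\<forall>z\<in>carrier T. h (mvar v \<odot>\<^bsub>T\<^esub> z) = mvar v \<odot>\<^bsub>H\<^esub> h z"
      by (cases v; intro ballI gen) (simp_all add: tens_smult_generators[OF MN] hp Mf Nf x y)
    then show ?case using var by (simp add: Tf Hf h hC)
  qed
  show ?thesis unfolding gfhom_def image_subset_iff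
  proof (intro conjI ballI allI)
    show "h z \<in> qpart H k" if z: "z \<in> qpart T k" for z k
    proof (rule tens_qpart_map[OF Ha h gfmodule_qpart[OF H] _ z])
      show "h (ptens M N m n) \<in> qpart H k" if "m \<in> qpart M i" "n \<in> qpart N (k - i)" for m n i
        using q[OF that] hp[OF gfmodule_qpart_carrier[OF M that(1)] gfmodule_qpart_carrier[OF N that(2)]] by simp
    qed
    show "h z \<in> fil H k" if z: "z \<in> fil T k" for z k
    proof (rule tens_fil_map[OF Ha h gfmodule_fil_additive[OF H] _ z])
      show "h (ptens M N m n) \<in> fil H k" if "m \<in> fil M i" "n \<in> fil N (k - i)" for m n i
        using f[OF that] hp[OF gfmodule_fil_carrier[OF M that(1)] gfmodule_fil_carrier[OF N that(2)]] by simp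
    qed
  qed (use h lin in auto)
qed

end

lemma tens_map:
  fixes M :: "('n::finite bpoly, 'a) gfmod" and N :: "('n bpoly, 'b) gfmod"
    and M' :: "('n bpoly, 'c) gfmod" and N' :: "('n bpoly, 'd) gfmod"
  assumes M: "gfmodule M" "gfmodule N" and M': "gfmodule M'" "gfmodule N'"
    and f: "gfhom M M' f" and g: "gfhom N N' g"
  shows tens_map_gfhom: "gfhom (tens M N) (tens M' N') (tens_map M' N' f g)"
    and tens_map_ptens: "m \<in> carrier M \<Longrightarrow> n \<in> carrier N \<Longrightarrow> tens_map M' N' f g (ptens M N m n) = ptens M' N' (f m) (g n)"
proof -
  note mods = gfmodule_module[OF M(1)] gfmodule_module[OF M(2)]
  note mods' = gfmodule_module[OF M'(1)] gfmodule_module[OF M'(2)]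
  define k where "k = (\<lambda>(m, n). frag_of (f m, g n))"
  note f' = gfhomD[OF f] and g' = gfhomD[OF g]
  note b = balancedD[OF ptens_balanced[OF mods']]
  have kp: "tens_class M' N' (k (m, n)) = ptens M' N' (f m) (g n)" for m n by (simp add: k_def ptens_def)
  have kF: "k (m, n) \<in> carrier (tens_free M' N')" if "m \<in> carrier M" "n \<in> carrier N" for m n
    using that f'(1) g'(1) by (simp add: k_def tens_free_simps[OF mods'])
  have bal: "balanced M N (tens M' N') (\<lambda>m n. tens_class M' N' (k (m, n)))"
    unfolding kp balanced_def using b f' g' by simp
  have eq: "tens_map M' N' f g = (\<lambda>Z. \<Union>c\<in>Z. tens_class M' N' (frag_extend k c))"
    by (simp add: tens_map_def k_def fun_eq_iff)
  have kF': "\<forall>m\<in>carrier M. \<forall>n\<in>carrier N. k (m, n) \<in> carrier (tens_free M' N')" using kF by blast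
  note d = tens_descend[OF mods mods' kF' bal eq]
  show pt: "tens_map M' N' f g (ptens M N m n) = ptens M' N' (f m) (g n)" if "m \<in> carrier M" "n \<in> carrier N" for m n
    using d(3)[OF that] kp by simp
  show "gfhom (tens M N) (tens M' N') (tens_map M' N' f g)" by (rule gfhom_tensI[OF M gfmodule_tens[OF M'] d(1,2) pt])
      (use f' g' in \<open>auto simp: tens_smult_generators[OF mods'] intro!: ptens_qpart[OF M' _ _ refl] ptens_fil[OF M' _ _ refl]\<close>)
qed

section \<open>Strict complexes of bimodules and Gaussian elimination\<close>

section \<open>Complexes of bimodules\<close>

text \<open>The strict counterpart of \<open>is_Ch\<close>: the differentials are actual maps of
  bimodules whose squares vanish on elements, before any passage to classes of roofs.\<close>

definition bcomplex :: "('n, 'a) bcx \<Rightarrow> bool" where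
  "bcomplex Z \<longleftrightarrow> (\<forall>t a. gfmodule (bterm Z t a) \<and>
     gfhom (bterm Z t a) (bterm Z (t - 2) (a - 1)) (bdif Z t a) \<and>
     (\<forall>x\<in>carrier (bterm Z t a). bdif Z (t - 2) (a - 1) (bdif Z t a x) = \<zero>\<^bsub>bterm Z (t - 4) (a - 2)\<^esub>))"

lemma bcomplexD:
  assumes "bcomplex Z"
  shows "gfmodule (bterm Z t a)" "gfhom (bterm Z t a) (bterm Z (t - 2) (a - 1)) (bdif Z t a)"
    "x \<in> carrier (bterm Z t a) \<Longrightarrow> bdif Z (t - 2) (a - 1) (bdif Z t a x) = \<zero>\<^bsub>bterm Z (t - 4) (a - 2)\<^esub>"
  using assms by (auto simp: bcomplex_def)

subsection \<open>Homomorphisms of direct sums\<close>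

lemma gfhom_dsum_proj: "gfhom (gf_dsum T) (T i) (\<lambda>c. c i)" by (auto simp: gfhom_def gf_dsum_simps)

lemma gfhom_into_dsum:
  fixes T :: "'i \<Rightarrow> ('n bpoly, 'a) gfmod" and M :: "('n bpoly, 'b) gfmod"
  assumes M: "gfmodule M" and f: "\<And>i. gfhom M (T i) (f i)"
    and fin: "\<And>x. x \<in> carrier M \<Longrightarrow> finite {i. f i x \<noteq> \<zero>\<^bsub>T i\<^esub>}"
  shows "gfhom M (gf_dsum T) (\<lambda>x i. f i x)"
proof -
  note f' = gfhomD[OF f]
  have car: "(\<lambda>i. f i x) \<in> carrier (gf_dsum T)" if "x \<in> carrier M" for x
    using fin[OF that] f'(1)[OF that] by (auto simp: gf_dsum_simps dsupp_def)
  show ?thesis unfolding gfhom_def image_subset_iff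
    using car f' gfmodule_qpart_carrier[OF M] gfmodule_fil_carrier[OF M] by (auto simp: gf_dsum_simps(3-6))
qed

definition dincl :: "('i \<Rightarrow> ('r, 'a) gfmod) \<Rightarrow> 'i \<Rightarrow> 'a \<Rightarrow> 'i \<Rightarrow> 'a" where
  "dincl T i x j = (if j = i then x else \<zero>\<^bsub>T j\<^esub>)"

lemma gfhom_dincl:
  fixes T :: "'i \<Rightarrow> ('n bpoly, 'a) gfmod"
  assumes "\<And>i. gfmodule (T i)"
  shows "gfhom (T i) (gf_dsum T) (dincl T i)"
proof -
  have "gfhom (T i) (gf_dsum T) (\<lambda>x j. dincl T i x j)"
  proof (rule gfhom_into_dsum[OF assms])
    show "gfhom (T i) (T j) (\<lambda>x. dincl T i x j)" for j
      using gfhom_id[of "T i"] gfhom_zero[OF assms assms, of i j] by (cases "j = i") (auto simp: dincl_def)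
    show "finite {j. dincl T i x j \<noteq> \<zero>\<^bsub>T j\<^esub>}" for x
      by (rule finite_subset[of _ "{i}"]) (auto simp: dincl_def)
  qed
  then show ?thesis by simp
qed

subsection \<open>Composition\<close>

lemma tens_map_comp:
  fixes M :: "('n::finite bpoly, 'a) gfmod" and N :: "('n bpoly, 'b) gfmod"
    and M' :: "('n bpoly, 'c) gfmod" and N' :: "('n bpoly, 'd) gfmod"
    and M'' :: "('n bpoly, 'e) gfmod" and N'' :: "('n bpoly, 'f) gfmod"
  assumes M: "gfmodule M" "gfmodule N" and M': "gfmodule M'" "gfmodule N'" and M'': "gfmodule M''" "gfmodule N''"
    and f: "gfhom M M' f" "gfhom N N' g" and f': "gfhom M' M'' f'" "gfhom N' N'' g'"
    and x: "x \<in> carrier (tens M N)"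
  shows "tens_map M'' N'' f' g' (tens_map M' N' f g x) = tens_map M'' N'' (\<lambda>m. f' (f m)) (\<lambda>n. g' (g n)) x"
proof -
  note ff = gfhom_comp[OF f(1) f'(1)] gfhom_comp[OF f(2) f'(2)]
  note h1 = gfhomD[OF tens_map_gfhom[OF M M' f]] and h2 = gfhomD[OF tens_map_gfhom[OF M' M'' f']]
    and h3 = gfhomD[OF tens_map_gfhom[OF M M'' ff]]
  show ?thesis by (rule tens_additive_eqI[OF gfmodule_module[OF M(1)] gfmodule_module[OF M(2)]
      gfmodule_abelian_group[OF gfmodule_tens[OF M'']] _ _ _ _ _ x])
      (use h1 h2 h3 gfhomD(1)[OF f(1)] gfhomD(1)[OF f(2)] in
        \<open>auto simp: tens_map_ptens[OF M M' f] tens_map_ptens[OF M' M'' f'] tens_map_ptens[OF M M'' ff]\<close>)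
qed

lemma tens_map_zero:
  fixes M :: "('n::finite bpoly, 'a) gfmod" and N :: "('n bpoly, 'b) gfmod"
    and M' :: "('n bpoly, 'c) gfmod" and N' :: "('n bpoly, 'd) gfmod"
  assumes M: "gfmodule M" "gfmodule N" and M': "gfmodule M'" "gfmodule N'"
    and f: "gfhom M M' f" "gfhom N N' g"
    and z: "(\<forall>m\<in>carrier M. f m = \<zero>\<^bsub>M'\<^esub>) \<or> (\<forall>n\<in>carrier N. g n = \<zero>\<^bsub>N'\<^esub>)"
    and x: "x \<in> carrier (tens M N)"
  shows "tens_map M' N' f g x = \<zero>\<^bsub>tens M' N'\<^esub>"
proof -
  interpret T: abelian_group "tens M' N'" by (rule gfmodule_abelian_group[OF gfmodule_tens[OF M']])
  note h = gfhomD[OF tens_map_gfhom[OF M M' f]]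
  note pz = ptens_zero[OF gfmodule_module[OF M'(1)] gfmodule_module[OF M'(2)]]
  show ?thesis
    by (rule tens_additive_eqI[OF gfmodule_module[OF M(1)] gfmodule_module[OF M(2)] T.abelian_group_axioms _ _ _ _ _ x])
      (use h z gfhomD(1)[OF f(1)] gfhomD(1)[OF f(2)] pz in \<open>auto simp: tens_map_ptens[OF M M' f]\<close>)
qed

context
  fixes M :: "('n::finite, 'a) bcx" and N :: "('n, 'b) bcx"
  assumes M: "bcomplex M" and N: "bcomplex N"
begin

private abbreviation "SS \<equiv> bcx_summand M N"

text \<open>Both partial differentials are indexed by the summand they arrive in: \<open>dl\<close>
  comes from left degrees (i + 2, b + 1), while \<open>dr\<close> keeps the left degrees (i,
  b).\<close>

definition dl :: "int \<Rightarrow> int \<Rightarrow> int \<Rightarrow> int \<Rightarrow> (('a \<times> 'b) \<Rightarrow>\<^sub>0 int) set \<Rightarrow> (('a \<times> 'b) \<Rightarrow>\<^sub>0 int) set" where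
  "dl t a i b = tens_map (bterm M i b) (bterm N (t - 2 - i) (a - 1 - b)) (bdif M (i + 2) (b + 1)) (\<lambda>n. n)"

definition dr :: "int \<Rightarrow> int \<Rightarrow> int \<Rightarrow> int \<Rightarrow> (('a \<times> 'b) \<Rightarrow>\<^sub>0 int) set \<Rightarrow> (('a \<times> 'b) \<Rightarrow>\<^sub>0 int) set" where
  "dr t a i b = tens_map (bterm M i b) (bterm N (t - 2 - i) (a - 1 - b)) (\<lambda>m. m) (bdif N (t - i) (a - b))"

lemma bcx_comp_bdif:
  "bdif (M \<circ>\<^sub>b N) t a c (i, b) = dl t a i b (c (i + 2, b + 1)) \<oplus>\<^bsub>SS (t - 2) (a - 1) (i, b)\<^esub>
     (if even b then dr t a i b (c (i, b)) else \<ominus>\<^bsub>SS (t - 2) (a - 1) (i, b)\<^esub> dr t a i b (c (i, b)))"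
  by (simp add: bcx_comp_def Let_def dl_def dr_def)

lemma bcx_comp_bterm: "bterm (M \<circ>\<^sub>b N) t a = gf_dsum (SS t a)" by (simp add: bcx_comp_def)

lemma bcx_summand_simp: "SS t a (i, b) = tens (bterm M i b) (bterm N (t - i) (a - b))" by (simp add: bcx_summand_def)

lemma gfmodule_bcx_summand: "gfmodule (SS t a ib)"
  by (cases ib) (simp add: bcx_summand_def gfmodule_tens[OF bcomplexD(1)[OF M] bcomplexD(1)[OF N]])

lemma bdif_up: "gfhom (bterm M (i + 2) (b + 1)) (bterm M i b) (bdif M (i + 2) (b + 1))"
  using bcomplexD(2)[OF M, of "i + 2" "b + 1"] by simp

lemma bdif_right: "gfhom (bterm N (t - i) (a - b)) (bterm N (t - 2 - i) (a - 1 - b)) (bdif N (t - i) (a - b))"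
  using bcomplexD(2)[OF N, of "t - i" "a - b"] by (simp add: algebra_simps)

lemma gfhom_dl: "gfhom (SS t a (i + 2, b + 1)) (SS (t - 2) (a - 1) (i, b)) (dl t a i b)"
proof -
  have e: "t - (i + 2) = t - 2 - i" "a - (b + 1) = a - 1 - b" by simp_all
  show ?thesis unfolding bcx_summand_simp dl_def e
    by (rule tens_map_gfhom[OF bcomplexD(1)[OF M] bcomplexD(1)[OF N] bcomplexD(1)[OF M] bcomplexD(1)[OF N] bdif_up gfhom_id])
qed

lemma gfhom_dr: "gfhom (SS t a (i, b)) (SS (t - 2) (a - 1) (i, b)) (dr t a i b)" unfolding bcx_summand_simp dr_def
  by (rule tens_map_gfhom[OF bcomplexD(1)[OF M] bcomplexD(1)[OF N] bcomplexD(1)[OF M] bcomplexD(1)[OF N] gfhom_id bdif_right])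

lemma gfhom_signed:
  assumes "gfmodule M'" "gfmodule N'" "gfhom M' N' f"
  shows "gfhom M' N' (\<lambda>x. if P then f x else \<ominus>\<^bsub>N'\<^esub> f x)"
  using assms gfhom_minus[OF assms] by (cases P) auto

lemma gfhom_bcx_comp_bdif: "gfhom (gf_dsum (SS t a)) (gf_dsum (SS (t - 2) (a - 1))) (bdif (M \<circ>\<^sub>b N) t a)"
proof -
  let ?D = "gf_dsum (SS t a)" and ?S = "SS (t - 2) (a - 1)"
  have gD: "gfmodule ?D" by (rule gfmodule_gf_dsum) (rule gfmodule_bcx_summand)
  have "gfhom ?D (gf_dsum ?S) (\<lambda>c ib. bdif (M \<circ>\<^sub>b N) t a c ib)"
  proof (rule gfhom_into_dsum[OF gD])
    fix ib :: "int \<times> int"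
    obtain i b where ib: "ib = (i, b)" by (cases ib)
    have "gfhom ?D (?S (i, b)) (\<lambda>c. dl t a i b (c (i + 2, b + 1)))"
      "gfhom ?D (?S (i, b)) (\<lambda>c. dr t a i b (c (i, b)))"
      by (rule gfhom_comp[OF gfhom_dsum_proj[where T = "SS t a" and i = "(i + 2, b + 1)"] gfhom_dl[of t a i b]]
        gfhom_comp[OF gfhom_dsum_proj[where T = "SS t a" and i = "(i, b)"] gfhom_dr[of t a i b]])+
    then show "gfhom ?D (?S ib) (\<lambda>c. bdif (M \<circ>\<^sub>b N) t a c ib)" unfolding ib bcx_comp_bdif
      by (intro gfhom_add gD gfmodule_bcx_summand gfhom_signed)
  next
    fix c assume c: "c \<in> carrier ?D"
    have z: "bdif (M \<circ>\<^sub>b N) t a c (i, b) = \<zero>\<^bsub>?S (i, b)\<^esub>"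
      if "c (i, b) = \<zero>\<^bsub>SS t a (i, b)\<^esub>" "c (i + 2, b + 1) = \<zero>\<^bsub>SS t a (i + 2, b + 1)\<^esub>" for i b
    proof -
      interpret abelian_group "?S (i, b)" by (rule gfmodule_abelian_group[OF gfmodule_bcx_summand])
      show ?thesis unfolding bcx_comp_bdif that gfhomD0(1)[OF gfmodule_bcx_summand gfmodule_bcx_summand gfhom_dl]
        gfhomD0(1)[OF gfmodule_bcx_summand gfmodule_bcx_summand gfhom_dr] by (simp add: minus_zero)
    qed
    \<comment> \<open>The entry at (i, b) depends on the old entries at (i, b) and (i + 2, b + 1),
      so the support stays finite.\<close>
    have "{ib. bdif (M \<circ>\<^sub>b N) t a c ib \<noteq> \<zero>\<^bsub>?S ib\<^esub>} \<subseteq> dsupp (SS t a) c \<union> (\<lambda>(i, b). (i - 2, b - 1)) ` dsupp (SS t a) c"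
    proof
      fix ib assume ib: "ib \<in> {ib. bdif (M \<circ>\<^sub>b N) t a c ib \<noteq> \<zero>\<^bsub>?S ib\<^esub>}"
      obtain i b where e: "ib = (i, b)" by (cases ib)
      have "(i, b) \<in> dsupp (SS t a) c \<or> (i + 2, b + 1) \<in> dsupp (SS t a) c"
        using z[of i b] ib by (auto simp: dsupp_def e)
      then show "ib \<in> dsupp (SS t a) c \<union> (\<lambda>(i, b). (i - 2, b - 1)) ` dsupp (SS t a) c"
        by (auto simp: e intro!: image_eqI[of _ _ "(i + 2, b + 1)"])
    qed
    then show "finite {ib. bdif (M \<circ>\<^sub>b N) t a c ib \<noteq> \<zero>\<^bsub>?S ib\<^esub>}"
      using c by (auto simp: gf_dsum_simps intro: finite_subset)
  qed
  then show ?thesis by simp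
qed

text \<open>The two unmixed terms vanish with the squares in the factors. The mixed terms agree as
  maps and cancel by the Koszul sign, since the left differential changes the parity of
  \<open>b\<close>.\<close>

lemma bcomplex_comp: "bcomplex (M \<circ>\<^sub>b N)" unfolding bcomplex_def
proof (intro allI conjI ballI)
  fix t a
  note gS = gfmodule_bcx_summand and gM = bcomplexD(1)[OF M] and gN = bcomplexD(1)[OF N]
  show "gfmodule (bterm (M \<circ>\<^sub>b N) t a)" unfolding bcx_comp_bterm by (rule gfmodule_gf_dsum) (rule gfmodule_bcx_summand)
  show "gfhom (bterm (M \<circ>\<^sub>b N) t a) (bterm (M \<circ>\<^sub>b N) (t - 2) (a - 1)) (bdif (M \<circ>\<^sub>b N) t a)"
    unfolding bcx_comp_bterm by (rule gfhom_bcx_comp_bdif)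
  fix c assume "c \<in> carrier (bterm (M \<circ>\<^sub>b N) t a)"
  then have c: "c ib \<in> carrier (SS t a ib)" for ib unfolding bcx_comp_bterm gf_dsum_simps(1) by blast
  show "bdif (M \<circ>\<^sub>b N) (t - 2) (a - 1) (bdif (M \<circ>\<^sub>b N) t a c) = \<zero>\<^bsub>bterm (M \<circ>\<^sub>b N) (t - 4) (a - 2)\<^esub>"
  proof (rule ext)
    fix ib :: "int \<times> int"
    obtain i b where ib: "ib = (i, b)" by (cases ib)
    let ?S2 = "SS (t - 2) (a - 1)" and ?S4 = "SS (t - 4) (a - 2)"
    interpret S4: abelian_group "?S4 (i, b)" by (rule gfmodule_abelian_group[OF gS])
    have e: "t - 2 - 2 = t - 4" "a - 1 - 1 = a - 2" by simp_all
    have hl: "gfhom (?S2 (i + 2, b + 1)) (?S4 (i, b)) (dl (t - 2) (a - 1) i b)"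
      and hr: "gfhom (?S2 (i, b)) (?S4 (i, b)) (dr (t - 2) (a - 1) i b)"
      using gfhom_dl[of "t - 2" "a - 1" i b] gfhom_dr[of "t - 2" "a - 1" i b] unfolding e .
    note hl1 = gfhom_dl[of t a "i + 2" "b + 1"] and hr1 = gfhom_dr[of t a "i + 2" "b + 1"]
      and hl0 = gfhom_dl[of t a i b] and hr0 = gfhom_dr[of t a i b]
    let ?l1 = "dl t a (i + 2) (b + 1) (c (i + 2 + 2, b + 1 + 1))" and ?r1 = "dr t a (i + 2) (b + 1) (c (i + 2, b + 1))"
    let ?l0 = "dl t a i b (c (i + 2, b + 1))" and ?r0 = "dr t a i b (c (i, b))"
    let ?L = "dl (t - 2) (a - 1) i b" and ?R = "dr (t - 2) (a - 1) i b"
    have cl: "?l1 \<in> carrier (?S2 (i + 2, b + 1))" "?r1 \<in> carrier (?S2 (i + 2, b + 1))"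
      "?l0 \<in> carrier (?S2 (i, b))" "?r0 \<in> carrier (?S2 (i, b))"
      using gfhomD(1)[OF hl1 c] gfhomD(1)[OF hr1 c] gfhomD(1)[OF hl0 c] gfhomD(1)[OF hr0 c] .
    have ar: "t - 2 - 2 - i = t - i - 4" "a - 1 - 1 - b = a - b - 2" "t - 2 - (i + 2) = t - i - 4" "a - 1 - (b + 1) = a - b - 2"
      "t - 2 - i = t - i - 2" "a - 1 - b = a - b - 1" "t - (i + 2) = t - i - 2" "a - (b + 1) = a - b - 1"
      "t - (i + 2 + 2) = t - i - 4" "a - (b + 1 + 1) = a - b - 2" "t - 4 - i = t - i - 4" "a - 2 - b = a - b - 2" by simp_all
    have ar2: "i + 2 + 2 - 2 = i + 2" "b + 1 + 1 - 1 = b + 1" "i + 2 + 2 - 4 = i" "b + 1 + 1 - 2 = b" by simp_all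
    have bd0: "bdif M (i + 2) (b + 1) (bdif M (i + 2 + 2) (b + 1 + 1) m) = \<zero>\<^bsub>bterm M i b\<^esub>"
      if "m \<in> carrier (bterm M (i + 2 + 2) (b + 1 + 1))" for m using bcomplexD(3)[OF M that] unfolding ar2 .
    have bd1: "bdif N (t - i - 2) (a - b - 1) (bdif N (t - i) (a - b) n) = \<zero>\<^bsub>bterm N (t - i - 4) (a - b - 2)\<^esub>"
      if "n \<in> carrier (bterm N (t - i) (a - b))" for n using bcomplexD(3)[OF N that] by simp
    have hN1: "gfhom (bterm N (t - i) (a - b)) (bterm N (t - i - 2) (a - b - 1)) (bdif N (t - i) (a - b))"
      by (rule bcomplexD(2)[OF N])
    have hN2: "gfhom (bterm N (t - i - 2) (a - b - 1)) (bterm N (t - i - 4) (a - b - 2)) (bdif N (t - i - 2) (a - b - 1))"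
      using bcomplexD(2)[OF N, of "t - i - 2" "a - b - 1"] by simp
    have Ll: "?L ?l1 = \<zero>\<^bsub>?S4 (i, b)\<^esub>"
    proof -
      have x: "c (i + 2 + 2, b + 1 + 1) \<in> carrier (tens (bterm M (i + 2 + 2) (b + 1 + 1)) (bterm N (t - i - 4) (a - b - 2)))"
        using c[of "(i + 2 + 2, b + 1 + 1)"] unfolding bcx_summand_simp ar .
      show ?thesis unfolding dl_def ar
        apply (subst tens_map_comp[OF gM gN gM gN gM gN bdif_up gfhom_id bdif_up gfhom_id x])
        unfolding bcx_summand_simp ar
        by (rule tens_map_zero[OF gM gN gM gN gfhom_comp[OF bdif_up bdif_up] gfhom_id disjI1[OF ballI[OF bd0]] x])
    qed
    have Rr: "?R ?r0 = \<zero>\<^bsub>?S4 (i, b)\<^esub>"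
    proof -
      have x: "c (i, b) \<in> carrier (tens (bterm M i b) (bterm N (t - i) (a - b)))"
        using c[of "(i, b)"] unfolding bcx_summand_simp .
      show ?thesis unfolding dr_def ar
        apply (subst tens_map_comp[OF gM gN gM gN gM gN gfhom_id hN1 gfhom_id hN2 x]) unfolding bcx_summand_simp ar
        by (rule tens_map_zero[OF gM gN gM gN gfhom_id gfhom_comp[OF hN1 hN2] disjI2[OF ballI[OF bd1]] x])
    qed
    have LR: "?L ?r1 = ?R ?l0"
    proof -
      have x: "c (i + 2, b + 1) \<in> carrier (tens (bterm M (i + 2) (b + 1)) (bterm N (t - i - 2) (a - b - 1)))"
        using c[of "(i + 2, b + 1)"] unfolding bcx_summand_simp ar .
      show ?thesis unfolding dl_def dr_def ar
        apply (subst tens_map_comp[OF gM gN gM gN gM gN gfhom_id hN2 bdif_up gfhom_id x])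
        apply (subst tens_map_comp[OF gM gN gM gN gM gN bdif_up gfhom_id gfhom_id hN2 x])
        ..
    qed
    have RC: "?R ?l0 \<in> carrier (?S4 (i, b))" by (rule gfhomD(1)[OF hr cl(3)])
    interpret S2: abelian_group "?S2 (i, b)" by (rule gfmodule_abelian_group[OF gS])
    interpret S2': abelian_group "?S2 (i + 2, b + 1)" by (rule gfmodule_abelian_group[OF gS])
    note Ladd = gfhomD(2)[OF hl] and Radd = gfhomD(2)[OF hr]
      and Lneg = gfhomD0(2)[OF gS gS hl] and Rneg = gfhomD0(2)[OF gS gS hr]
    define l1 where "l1 = ?l1"
    define r1 where "r1 = ?r1"
    define l0 where "l0 = ?l0"
    define r0 where "r0 = ?r0"
    note defs = l1_def r1_def l0_def r0_def
    have "bdif (M \<circ>\<^sub>b N) (t - 2) (a - 1) (bdif (M \<circ>\<^sub>b N) t a c) (i, b) = \<zero>\<^bsub>?S4 (i, b)\<^esub>"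
      unfolding bcx_comp_bdif e defs[symmetric] using cl[folded defs] RC[folded defs] by (cases "even b")
        (simp_all add: Ladd Radd Lneg Rneg Ll[folded defs] Rr[folded defs] LR[folded defs] S4.group_simps)
    then show "bdif (M \<circ>\<^sub>b N) (t - 2) (a - 1) (bdif (M \<circ>\<^sub>b N) t a c) ib = \<zero>\<^bsub>bterm (M \<circ>\<^sub>b N) (t - 4) (a - 2)\<^esub> ib"
      unfolding ib bcx_comp_bterm gf_dsum_simps .
  qed
qed

end

subsection \<open>Homotopy equivalences of complexes of bimodules\<close>

text \<open>Meets the cardinality bound on objects uniformly: every infinite universe contains a
  countably infinite set.\<close>

lemma dobj_countable:
  assumes inf: "infinite (UNIV :: 'u set)" and A: "fcomplex A" and c: "\<And>k. countable (carrier (cpart A k))"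
  shows "dobj TYPE('u) A"
proof -
  obtain f :: "nat \<Rightarrow> 'u" where f: "inj f" using infinite_countable_subset[OF inf] by blast
  have "inj_on (f \<circ> to_nat_on (carrier (cpart A k))) (carrier (cpart A k))" for k
    by (rule comp_inj_on[OF inj_on_to_nat_on[OF c]]) (use f inj_on_subset in blast)
  then show ?thesis unfolding dobj_def using A by blast
qed

lemma bcx_complex_simps:
  "cpart (bcx_complex Z t) k = bterm Z t (k + t div 2)"
  "cdif (bcx_complex Z t) k x = \<zero>\<^bsub>bterm Z t (k - 1 + t div 2)\<^esub>" by (simp_all add: bcx_complex_def)

lemma fcomplex_bcx_complex: "bcomplex Z \<Longrightarrow> fcomplex (bcx_complex Z t)"
  unfolding fcomplex_def bcx_complex_simps
  using gfhom_zero[OF bcomplexD(1) bcomplexD(1)] bcomplexD(1) by (auto simp: bcx_complex_def)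

lemma chmap_bcx:
  assumes Z: "bcomplex Z" and Y: "bcomplex Y"
    and f: "\<And>k. gfhom (bterm Z t (k + t div 2)) (bterm Y t' (k + t' div 2)) (f k)"
  shows "chmap (bcx_complex Z t) (bcx_complex Y t') f" unfolding chmap_def bcx_complex_simps
  using f gfhomD0(1)[OF bcomplexD(1)[OF Z] bcomplexD(1)[OF Y] f] by auto

text \<open>Functoriality of \<open>dmap\<close> turns strict equations into equations of morphisms,
  after which comparison on carriers suffices. As f g is the identity on the nose, only the homotopy
  on \<open>Z\<close> has to be supplied.\<close>

lemma bcx_homotopy_equivalence:
  fixes Z :: "('n, 'a) bcx" and Y :: "('n, 'b) bcx"
  assumes inf: "infinite (UNIV :: 'u set)" and Z: "bcomplex Z" and Y: "bcomplex Y"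
    and cZ: "\<And>t a. countable (carrier (bterm Z t a))" and cY: "\<And>t a. countable (carrier (bterm Y t a))"
    and bZ: "finite {t. \<exists>a. carrier (bterm Z t a) \<noteq> {\<zero>\<^bsub>bterm Z t a\<^esub>}}"
    and bY: "finite {t. \<exists>a. carrier (bterm Y t a) \<noteq> {\<zero>\<^bsub>bterm Y t a\<^esub>}}"
    and f: "\<And>t a. gfhom (bterm Z t a) (bterm Y t a) (f t a)"
    and fd: "\<And>t a x. x \<in> carrier (bterm Z t a) \<Longrightarrow> bdif Y t a (f t a x) = f (t - 2) (a - 1) (bdif Z t a x)"
    and g: "\<And>t a. gfhom (bterm Y t a) (bterm Z t a) (g t a)"
    and gd: "\<And>t a x. x \<in> carrier (bterm Y t a) \<Longrightarrow> bdif Z t a (g t a x) = g (t - 2) (a - 1) (bdif Y t a x)"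
    and h: "\<And>t a. gfhom (bterm Z t a) (bterm Z (t + 2) (a + 1)) (h t a)"
    and gf: "\<And>t a x. x \<in> carrier (bterm Z t a) \<Longrightarrow> g t a (f t a x) = x \<oplus>\<^bsub>bterm Z t a\<^esub>
       (bdif Z (t + 2) (a + 1) (h t a x) \<oplus>\<^bsub>bterm Z t a\<^esub> h (t - 2) (a - 1) (bdif Z t a x))"
    and fg: "\<And>t a x. x \<in> carrier (bterm Y t a) \<Longrightarrow> f t a (g t a x) = x"
  shows "Ch_equiv (to_Ch TYPE('u) Z) (to_Ch TYPE('u) Y)"
proof -
  \<comment> \<open>Two half units change \<open>t div 2\<close> by exactly one, at integral and
    half-integral t-degree alike; at fixed inner degree the a-degree therefore drops by one, as
    \<open>bdif\<close> requires.\<close>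
  have div: "(t - 2) div 2 = t div 2 - 1" "(t + 2) div 2 = t div 2 + 1" "(t - 4) div 2 = t div 2 - 2" for t :: int
    by simp_all
  have cpm: "cpart (bcx_complex W (t - 2)) k = bterm W (t - 2) (k + t div 2 - 1)"
    "cpart (bcx_complex W (t + 2)) k = bterm W (t + 2) (k + t div 2 + 1)"
    "cpart (bcx_complex W (t - 4)) k = bterm W (t - 4) (k + t div 2 - 2)" for W :: "('n, 'c) bcx" and t k
    by (simp_all add: bcx_complex_simps div algebra_simps)
  have objZ: "dobj TYPE('u) (bcx_complex Z t)" for t
    by (rule dobj_countable[OF inf fcomplex_bcx_complex[OF Z]]) (simp add: bcx_complex_simps cZ)
  have objY: "dobj TYPE('u) (bcx_complex Y t)" for t
    by (rule dobj_countable[OF inf fcomplex_bcx_complex[OF Y]]) (simp add: bcx_complex_simps cY)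
  note fcZ = fcomplex_bcx_complex[OF Z] and fcY = fcomplex_bcx_complex[OF Y]
  note comp = dcomp_dmap[OF inf] and cong = dmap_cong and add = dadd_dmap[OF inf]
  have dW: "chmap (bcx_complex W t) (bcx_complex W (t - 2)) (\<lambda>k. bdif W t (k + t div 2))"
    if W: "bcomplex W" for W :: "('n, 'c) bcx" and t
  proof (rule chmap_bcx[OF W W])
    show "gfhom (bterm W t (k + t div 2)) (bterm W (t - 2) (k + (t - 2) div 2)) (bdif W t (k + t div 2))" for k
      using bcomplexD(2)[OF W, of t "k + t div 2"] by (simp add: div algebra_simps)
  qed
  have dW2: "chmap (bcx_complex W (t + 2)) (bcx_complex W t) (\<lambda>k. bdif W (t + 2) (k + (t + 2) div 2))"
    if W: "bcomplex W" for W :: "('n, 'c) bcx" and t using dW[OF W, of "t + 2"] by simp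
  have dW4: "chmap (bcx_complex W (t - 2)) (bcx_complex W (t - 4)) (\<lambda>k. bdif W (t - 2) (k + (t - 2) div 2))"
    if W: "bcomplex W" for W :: "('n, 'c) bcx" and t using dW[OF W, of "t - 2"] by simp
  have fm: "chmap (bcx_complex Z t) (bcx_complex Y t) (\<lambda>k. f t (k + t div 2))" for t
    by (rule chmap_bcx[OF Z Y f])
  have gm: "chmap (bcx_complex Y t) (bcx_complex Z t) (\<lambda>k. g t (k + t div 2))" for t
    by (rule chmap_bcx[OF Y Z g])
  have hm: "chmap (bcx_complex Z t) (bcx_complex Z (t + 2)) (\<lambda>k. h t (k + t div 2))" for t
  proof (rule chmap_bcx[OF Z Z])
    show "gfhom (bterm Z t (k + t div 2)) (bterm Z (t + 2) (k + (t + 2) div 2)) (h t (k + t div 2))" for k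
      using h[of t "k + t div 2"] by (simp add: div algebra_simps)
  qed
  have hm2: "chmap (bcx_complex Z (t - 2)) (bcx_complex Z t) (\<lambda>k. h (t - 2) (k + (t - 2) div 2))" for t
    using hm[of "t - 2"] by simp
  have isCh: "is_Ch (to_Ch TYPE('u) W)" if W: "bcomplex W" and ob: "\<And>t. dobj TYPE('u) (bcx_complex W t)"
    and fin: "finite {t. \<exists>a. carrier (bterm W t a) \<noteq> {\<zero>\<^bsub>bterm W t a\<^esub>}}" for W :: "('n, 'c) bcx"
    unfolding is_Ch_def to_Ch_def dch.simps
  proof (intro conjI allI)
    note fc = fcomplex_bcx_complex[OF W]
    fix t
    show "dobj TYPE('u) (bcx_complex W t)" by (rule ob)
    show "(dmap (bcx_complex W t) (bcx_complex W (t - 2)) (\<lambda>k. bdif W t (k + t div 2)) :: ('n, 'u, 'c, 'c) dmor)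
        \<in> dhom (bcx_complex W t) (bcx_complex W (t - 2))" by (rule dmap_in_dhom[OF ob fc dW[OF W]])
    have "dcomp (bcx_complex W t) (bcx_complex W (t - 2)) (bcx_complex W (t - 4))
       (dmap (bcx_complex W (t - 2)) (bcx_complex W (t - 4)) (\<lambda>k. bdif W (t - 2) (k + (t - 2) div 2)))
       (dmap (bcx_complex W t) (bcx_complex W (t - 2)) (\<lambda>k. bdif W t (k + t div 2))) =
       (dmap (bcx_complex W t) (bcx_complex W (t - 4))
         (\<lambda>k. bdif W (t - 2) (k + (t - 2) div 2) \<circ> bdif W t (k + t div 2)) :: ('n, 'u, 'c, 'c) dmor)"
      by (rule comp[OF fc ob fc dW[OF W] dW4[OF W]])
    also have "\<dots> = dzero (bcx_complex W t) (bcx_complex W (t - 4))" unfolding dzero_def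
      by (rule cong[OF fc fc chmap_comp[OF dW[OF W] dW4[OF W]]])
        (use bcomplexD(3)[OF W] in \<open>simp add: cpm bcx_complex_simps div algebra_simps\<close>)
    finally show "dcomp (bcx_complex W t) (bcx_complex W (t - 2)) (bcx_complex W (t - 4))
       (dmap (bcx_complex W (t - 2)) (bcx_complex W (t - 2 - 2)) (\<lambda>k. bdif W (t - 2) (k + (t - 2) div 2)))
       (dmap (bcx_complex W t) (bcx_complex W (t - 2)) (\<lambda>k. bdif W t (k + t div 2))) =
       (dzero (bcx_complex W t) (bcx_complex W (t - 4)) :: ('n, 'u, 'c, 'c) dmor)" by simp
  next
    show "finite {t. \<exists>k. carrier (cpart (bcx_complex W t) k) \<noteq> {\<zero>\<^bsub>cpart (bcx_complex W t) k\<^esub>}}"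
      by (rule finite_subset[OF _ fin]) (auto simp: bcx_complex_simps)
  qed
  let ?Z = "to_Ch TYPE('u) Z" and ?Y = "to_Ch TYPE('u) Y"
  define F :: "int \<Rightarrow> ('n, 'u, 'a, 'b) dmor" where
    "F = (\<lambda>t. dmap (bcx_complex Z t) (bcx_complex Y t) (\<lambda>k. f t (k + t div 2)))"
  define G :: "int \<Rightarrow> ('n, 'u, 'b, 'a) dmor" where
    "G = (\<lambda>t. dmap (bcx_complex Y t) (bcx_complex Z t) (\<lambda>k. g t (k + t div 2)))"
  define H :: "int \<Rightarrow> ('n, 'u, 'a, 'a) dmor" where
    "H = (\<lambda>t. dmap (bcx_complex Z t) (bcx_complex Z (t + 2)) (\<lambda>k. h t (k + t div 2)))"
  have simps: "dterm ?Z = bcx_complex Z" "dterm ?Y = bcx_complex Y"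
    "ddif ?Z t = dmap (bcx_complex Z t) (bcx_complex Z (t - 2)) (\<lambda>k. bdif Z t (k + t div 2))"
    "ddif ?Y t = dmap (bcx_complex Y t) (bcx_complex Y (t - 2)) (\<lambda>k. bdif Y t (k + t div 2))"
    "ddif ?Z (t + 2) = dmap (bcx_complex Z (t + 2)) (bcx_complex Z t) (\<lambda>k. bdif Z (t + 2) (k + (t + 2) div 2))"
    "ddif ?Y (t + 2) = dmap (bcx_complex Y (t + 2)) (bcx_complex Y t) (\<lambda>k. bdif Y (t + 2) (k + (t + 2) div 2))"
    "H (t - 2) = dmap (bcx_complex Z (t - 2)) (bcx_complex Z t) (\<lambda>k. h (t - 2) (k + (t - 2) div 2))" for t
    by (simp_all add: to_Ch_def H_def)
  have FM: "Ch_map ?Z ?Y F" unfolding Ch_map_def simps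
  proof (intro allI conjI)
    fix t
    show "F t \<in> dhom (bcx_complex Z t) (bcx_complex Y t)" unfolding F_def by (rule dmap_in_dhom[OF objZ fcY fm])
    show "dcomp (bcx_complex Z t) (bcx_complex Y t) (bcx_complex Y (t - 2))
          (dmap (bcx_complex Y t) (bcx_complex Y (t - 2)) (\<lambda>k. bdif Y t (k + t div 2))) (F t) =
         dcomp (bcx_complex Z t) (bcx_complex Z (t - 2)) (bcx_complex Y (t - 2)) (F (t - 2))
          (dmap (bcx_complex Z t) (bcx_complex Z (t - 2)) (\<lambda>k. bdif Z t (k + t div 2)))"
      unfolding F_def comp[OF fcZ objY fcY fm dW[OF Y]] comp[OF fcZ objZ fcY dW[OF Z] fm]
      by (rule cong[OF fcZ fcY chmap_comp[OF fm dW[OF Y]]])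
        (use fd in \<open>simp add: cpm bcx_complex_simps div algebra_simps\<close>)
  qed
  have GM: "Ch_map ?Y ?Z G" unfolding Ch_map_def simps
  proof (intro allI conjI)
    fix t
    show "G t \<in> dhom (bcx_complex Y t) (bcx_complex Z t)" unfolding G_def by (rule dmap_in_dhom[OF objY fcZ gm])
    show "dcomp (bcx_complex Y t) (bcx_complex Z t) (bcx_complex Z (t - 2))
          (dmap (bcx_complex Z t) (bcx_complex Z (t - 2)) (\<lambda>k. bdif Z t (k + t div 2))) (G t) =
         dcomp (bcx_complex Y t) (bcx_complex Y (t - 2)) (bcx_complex Z (t - 2)) (G (t - 2))
          (dmap (bcx_complex Y t) (bcx_complex Y (t - 2)) (\<lambda>k. bdif Y t (k + t div 2)))"
      unfolding G_def comp[OF fcY objZ fcZ gm dW[OF Z]] comp[OF fcY objY fcZ dW[OF Y] gm]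
      by (rule cong[OF fcY fcZ chmap_comp[OF gm dW[OF Z]]])
        (use gd in \<open>simp add: cpm bcx_complex_simps div algebra_simps\<close>)
  qed
  have GF: "Ch_homotopic ?Z ?Z (\<lambda>t. dcomp (dterm ?Z t) (dterm ?Y t) (dterm ?Z t) (G t) (F t)) (\<lambda>t. did (dterm ?Z t))"
    unfolding Ch_homotopic_def
  proof (intro exI[of _ H] allI conjI)
    fix t
    show "H t \<in> dhom (dterm ?Z t) (dterm ?Z (t + 2))" unfolding H_def simps by (rule dmap_in_dhom[OF objZ fcZ hm])
    note dh = chmap_comp[OF hm dW2[OF Z]] and hd = chmap_comp[OF dW[OF Z] hm2]
    note dhhd = chmap_add[OF fcZ fcZ dh hd]
    have H2: "H (t - 2) = dmap (bcx_complex Z (t - 2)) (bcx_complex Z t) (\<lambda>k. h (t - 2) (k + (t - 2) div 2))"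
      by (rule simps)
    show "dcomp (dterm ?Z t) (dterm ?Y t) (dterm ?Z t) (G t) (F t) =
       dadd (dterm ?Z t) (dterm ?Z t) (did (dterm ?Z t))
         (dadd (dterm ?Z t) (dterm ?Z t) (dcomp (dterm ?Z t) (dterm ?Z (t + 2)) (dterm ?Z t) (ddif ?Z (t + 2)) (H t))
           (dcomp (dterm ?Z t) (dterm ?Z (t - 2)) (dterm ?Z t) (H (t - 2)) (ddif ?Z t)))"
      unfolding simps did_def F_def G_def H2 H_def diff_add_cancel add_diff_cancel_right' comp[OF fcZ objY fcZ fm gm] comp[OF fcZ objZ fcZ hm dW2[OF Z]]
        comp[OF fcZ objZ fcZ dW[OF Z] hm2] add[OF fcZ fcZ dh hd] add[OF fcZ fcZ chmap_id dhhd]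
      by (rule cong[OF fcZ fcZ chmap_comp[OF fm gm]])
        (use gf in \<open>simp add: cpm bcx_complex_simps div algebra_simps\<close>)
  qed
  \<comment> \<open>Here the zero morphisms form the homotopy; its two terms vanish because
    \<open>bdif\<close> preserves zero.\<close>
  have FG: "Ch_homotopic ?Y ?Y (\<lambda>t. dcomp (dterm ?Y t) (dterm ?Z t) (dterm ?Y t) (F t) (G t)) (\<lambda>t. did (dterm ?Y t))"
    unfolding Ch_homotopic_def
  proof (intro exI[of _ "\<lambda>t. dzero (bcx_complex Y t) (bcx_complex Y (t + 2))"] allI conjI)
    fix t
    have zm: "chmap (bcx_complex Y t) (bcx_complex Y (t + 2)) (\<lambda>k x. \<zero>\<^bsub>cpart (bcx_complex Y (t + 2)) k\<^esub>)" for t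
      by (rule chmap_zero[OF fcY fcY])
    have zm2: "chmap (bcx_complex Y (t - 2)) (bcx_complex Y t) (\<lambda>k x. \<zero>\<^bsub>cpart (bcx_complex Y t) k\<^esub>)" for t
      by (rule chmap_zero[OF fcY fcY])
    show "(dzero (bcx_complex Y t) (bcx_complex Y (t + 2)) :: ('n, 'u, 'b, 'b) dmor) \<in> dhom (dterm ?Y t) (dterm ?Y (t + 2))"
      unfolding dzero_def simps by (rule dmap_in_dhom[OF objY fcY zm])
    note dh = chmap_comp[OF zm dW2[OF Y]] and hd = chmap_comp[OF dW[OF Y] zm2]
    note dhhd = chmap_add[OF fcY fcY dh hd]
    have z2: "dzero (bcx_complex Y (t - 2)) (bcx_complex Y (t - 2 + 2)) =
        (dmap (bcx_complex Y (t - 2)) (bcx_complex Y t) (\<lambda>k x. \<zero>\<^bsub>cpart (bcx_complex Y t) k\<^esub>) :: ('n, 'u, 'b, 'b) dmor)" by (simp add: dzero_def)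
    show "dcomp (dterm ?Y t) (dterm ?Z t) (dterm ?Y t) (F t) (G t) =
       dadd (dterm ?Y t) (dterm ?Y t) (did (dterm ?Y t))
         (dadd (dterm ?Y t) (dterm ?Y t) (dcomp (dterm ?Y t) (dterm ?Y (t + 2)) (dterm ?Y t) (ddif ?Y (t + 2))
             (dzero (bcx_complex Y t) (bcx_complex Y (t + 2))))
           (dcomp (dterm ?Y t) (dterm ?Y (t - 2)) (dterm ?Y t) (dzero (bcx_complex Y (t - 2)) (bcx_complex Y (t - 2 + 2))) (ddif ?Y t)))"
      unfolding simps did_def F_def G_def z2 dzero_def diff_add_cancel add_diff_cancel_right' comp[OF fcY objZ fcY gm fm] comp[OF fcY objY fcY zm dW2[OF Y]]
        comp[OF fcY objY fcY dW[OF Y] zm2] add[OF fcY fcY dh hd] add[OF fcY fcY chmap_id dhhd]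
    proof (rule cong[OF fcY fcY chmap_comp[OF gm fm]])
      fix k x assume x: "x \<in> carrier (cpart (bcx_complex Y t) k)"
      let ?M = "bterm Y t (k + t div 2)"
      interpret M: abelian_group ?M by (rule gfmodule_abelian_group[OF bcomplexD(1)[OF Y]])
      have h: "gfhom (bterm Y (t + 2) (k + t div 2 + 1)) ?M (bdif Y (t + 2) (k + t div 2 + 1))"
        using bcomplexD(2)[OF Y, of "t + 2" "k + t div 2 + 1"] by simp
      have "bdif Y (t + 2) (k + t div 2 + 1) \<zero>\<^bsub>bterm Y (t + 2) (k + t div 2 + 1)\<^esub> = \<zero>\<^bsub>?M\<^esub>"
        by (rule gfhomD0(1)[OF bcomplexD(1)[OF Y] bcomplexD(1)[OF Y] h])
      then show "((\<lambda>x. f t (k + t div 2) x) \<circ> g t (k + t div 2)) x = x \<oplus>\<^bsub>cpart (bcx_complex Y t) k\<^esub>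
         ((bdif Y (t + 2) (k + (t + 2) div 2) \<circ> (\<lambda>x. \<zero>\<^bsub>cpart (bcx_complex Y (t + 2)) k\<^esub>)) x \<oplus>\<^bsub>cpart (bcx_complex Y t) k\<^esub>
          ((\<lambda>x. \<zero>\<^bsub>cpart (bcx_complex Y t) k\<^esub>) \<circ> bdif Y t (k + t div 2)) x)"
        using x fg by (simp add: cpm bcx_complex_simps div add.assoc)
    qed
  qed
  show ?thesis unfolding Ch_equiv_def using isCh[OF Z objZ bZ] isCh[OF Y objY bY] FM GM GF FG by blast
qed

text \<open>A finitely supported family is recovered from the graph of its nonzero entries, a finite
  subset of a countable set.\<close>

lemma countable_dsum:
  fixes T :: "'i::countable \<Rightarrow> ('r, 'a) gfmod"
  assumes "\<And>i. countable (carrier (T i))"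
  shows "countable (carrier (gf_dsum T))"
proof -
  define enc where "enc = (\<lambda>c. (\<lambda>i. (i, c i)) ` dsupp T c)"
  have mem: "(i, x) \<in> enc c \<longleftrightarrow> x = c i \<and> c i \<noteq> \<zero>\<^bsub>T i\<^esub>" for c i x
    by (auto simp: enc_def dsupp_def)
  have "inj_on enc (carrier (gf_dsum T))"
  proof (rule inj_onI)
    fix c c' assume "enc c = enc c'"
    then have "x = c i \<and> c i \<noteq> \<zero>\<^bsub>T i\<^esub> \<longleftrightarrow> x = c' i \<and> c' i \<noteq> \<zero>\<^bsub>T i\<^esub>" for i x
      using mem[of i x c] mem[of i x c'] by simp
    then show "c = c'" by (metis ext)
  qed
  moreover have "enc ` carrier (gf_dsum T) \<subseteq> {A. finite A \<and> A \<subseteq> (\<Union>i. {i} \<times> carrier (T i))}"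
    by (auto simp: gf_dsum_simps enc_def)
  moreover have "countable {A. finite A \<and> A \<subseteq> (\<Union>i. {i} \<times> carrier (T i))}"
    by (intro countable_Collect_finite_subset countable_UN countable_SIGMA) (auto simp: assms)
  ultimately show ?thesis by (meson countable_image_inj_on countable_subset)
qed

lemma bterm_single: "bterm (single_bcx M) t a = (if t = 0 \<and> a = 0 then M else gf_triv \<zero>\<^bsub>M\<^esub>)"
  by (simp add: single_bcx_def Let_def)

lemma bdif_single: "bdif (single_bcx M) t a x = \<zero>\<^bsub>M\<^esub>"
  by (simp add: single_bcx_def Let_def gf_triv_def)

lemma gf_triv_simps [simp]: "carrier (gf_triv z) = {z}" "\<zero>\<^bsub>gf_triv z\<^esub> = z"
  by (simp_all add: gf_triv_def)

lemma zero_bterm_single: "\<zero>\<^bsub>bterm (single_bcx M) t a\<^esub> = \<zero>\<^bsub>M\<^esub>"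
  by (simp add: bterm_single)

lemma bcomplex_single:
  fixes M :: "('n bpoly, 'a) gfmod"
  assumes "gfmodule M"
  shows "bcomplex (single_bcx M)"
proof -
  have g: "gfmodule (bterm (single_bcx M) t a)" for t a
    using assms by (auto simp: bterm_single intro: gfmodule_gf_triv)
  have "bdif (single_bcx M) t a = (\<lambda>_. \<zero>\<^bsub>bterm (single_bcx M) (t - 2) (a - 1)\<^esub>)" for t a
    by (simp add: fun_eq_iff bdif_single zero_bterm_single)
  then have "gfhom (bterm (single_bcx M) t a) (bterm (single_bcx M) (t - 2) (a - 1)) (bdif (single_bcx M) t a)" for t a
    using gfhom_zero[OF g g, of t a "t - 2" "a - 1"] by simp
  then show ?thesis unfolding bcomplex_def using g by (simp add: bdif_single zero_bterm_single)
qed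

text \<open>
  Gaussian elimination for \<open>T\<^sub>2 \<rightarrow> T\<^sub>0 \<oplus> L\<^sub>0 \<rightarrow> M\<^sub>2\<close> with differentials \<open>(D\<^sub>1, A)\<close> and \<open>D\<^sub>2 + \<Xi>\<close>: the
  maps \<open>r\<close> and \<open>j\<close> split off \<open>T\<^sub>2\<close> and \<open>M\<^sub>2\<close> from \<open>L\<^sub>0\<close>, and what remains is \<open>T\<^sub>0 \<cong> I\<close>. The homotopy is
  \<open>-r\<close> and \<open>-j\<close>, and the equivalence is \<open>(x, u) \<mapsto> e (x - D\<^sub>1 r u)\<close> with inverse \<open>z \<mapsto> (e' z, - j D\<^sub>2 e' z)\<close>.
\<close>

lemma four_term_equivalence:
  fixes Z :: "('n, 'i::countable \<Rightarrow> 'a) bcx" and S :: "int \<Rightarrow> int \<Rightarrow> 'i \<Rightarrow> ('n bpoly, 'a) gfmod"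
    and I :: "('n bpoly, 'b) gfmod"
  assumes inf: "infinite (UNIV :: 'u set)" and Z: "bcomplex Z" and bt: "\<And>t a. bterm Z t a = gf_dsum (S t a)"
    and gS: "\<And>t a i. gfmodule (S t a i)" and cS: "\<And>t a i. countable (carrier (S t a i))"
    and I: "gfmodule I" and cI: "countable (carrier I)"
    and triv: "\<And>t a i. (t, a, i) \<notin> {(2, 1, k2), (0, 0, k0), (0, 0, l0), (-2, -1, m2)} \<Longrightarrow>
      carrier (S t a i) = {\<zero>\<^bsub>S t a i\<^esub>}"
    and ne: "k0 \<noteq> l0"
    and D1: "gfhom (S 2 1 k2) (S 0 0 k0) D1" and A: "gfhom (S 2 1 k2) (S 0 0 l0) A"
    and D2: "gfhom (S 0 0 k0) (S (-2) (-1) m2) D2" and \<Xi>: "gfhom (S 0 0 l0) (S (-2) (-1) m2) \<Xi>"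
    and r: "gfhom (S 0 0 l0) (S 2 1 k2) r" and j: "gfhom (S (-2) (-1) m2) (S 0 0 l0) j"
    and e: "gfhom (S 0 0 k0) I e" and e': "gfhom I (S 0 0 k0) e'"
    and d2: "\<And>c. c \<in> carrier (bterm Z 2 1) \<Longrightarrow> bdif Z 2 1 c k0 = D1 (c k2)"
      "\<And>c. c \<in> carrier (bterm Z 2 1) \<Longrightarrow> bdif Z 2 1 c l0 = A (c k2)"
    and d0: "\<And>c. c \<in> carrier (bterm Z 0 0) \<Longrightarrow> bdif Z 0 0 c m2 = D2 (c k0) \<oplus>\<^bsub>S (-2) (-1) m2\<^esub> \<Xi> (c l0)"
    and rA: "\<And>x. x \<in> carrier (S 2 1 k2) \<Longrightarrow> r (A x) = x"
    and Xj: "\<And>x. x \<in> carrier (S (-2) (-1) m2) \<Longrightarrow> \<Xi> (j x) = x"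
    and rj: "\<And>x. x \<in> carrier (S (-2) (-1) m2) \<Longrightarrow> r (j x) = \<zero>\<^bsub>S 2 1 k2\<^esub>"
    and key: "\<And>u. u \<in> carrier (S 0 0 l0) \<Longrightarrow>
      A (r u) \<oplus>\<^bsub>S 0 0 l0\<^esub> j (\<Xi> u) \<oplus>\<^bsub>S 0 0 l0\<^esub> j (D2 (D1 (r u))) = u"
    and ee': "\<And>z. z \<in> carrier I \<Longrightarrow> e (e' z) = z" and e'e: "\<And>x. x \<in> carrier (S 0 0 k0) \<Longrightarrow> e' (e x) = x"
  shows "Ch_equiv (to_Ch TYPE('u) Z) (to_Ch TYPE('u) (single_bcx I))"
proof -
  let ?T2 = "S 2 1 k2" and ?T0 = "S 0 0 k0" and ?L0 = "S 0 0 l0" and ?M2 = "S (-2) (-1) m2"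
  let ?Y = "single_bcx I"
  have Y: "bcomplex ?Y" by (rule bcomplex_single[OF I])
  note gZ = bcomplexD(1)[OF Z] and gY = bcomplexD(1)[OF Y] and dZ = bcomplexD(2)[OF Z]
  interpret T2: abelian_group "?T2" by (rule gfmodule_abelian_group[OF gS])
  interpret T0: abelian_group "?T0" by (rule gfmodule_abelian_group[OF gS])
  interpret L0: abelian_group "?L0" by (rule gfmodule_abelian_group[OF gS])
  interpret M2: abelian_group "?M2" by (rule gfmodule_abelian_group[OF gS])
  interpret I: abelian_group I by (rule gfmodule_abelian_group[OF I])
  note cl = gfhomD(1)[OF D1] gfhomD(1)[OF A] gfhomD(1)[OF D2] gfhomD(1)[OF \<Xi>] gfhomD(1)[OF r] gfhomD(1)[OF j]
    gfhomD(1)[OF e] gfhomD(1)[OF e']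
  note ad = gfhomD(2)[OF D1] gfhomD(2)[OF A] gfhomD(2)[OF D2] gfhomD(2)[OF \<Xi>] gfhomD(2)[OF r] gfhomD(2)[OF j]
    gfhomD(2)[OF e] gfhomD(2)[OF e']
  note ng = gfhomD0[OF gS gS D1] gfhomD0[OF gS gS A] gfhomD0[OF gS gS D2] gfhomD0[OF gS gS \<Xi>] gfhomD0[OF gS gS r]
    gfhomD0[OF gS gS j] gfhomD0[OF gS I e] gfhomD0[OF I gS e']
  have cmp: "c i \<in> carrier (S t a i)" if "c \<in> carrier (bterm Z t a)" for c t a i
    using that unfolding bt gf_dsum_simps(1) by blast
  \<comment> \<open>All other summands are zero modules, so an element is determined by its
    coordinates in the four listed ones.\<close>
  have eqZ: "c = c'" if c: "c \<in> carrier (bterm Z t a)" "c' \<in> carrier (bterm Z t a)"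
    and eq: "\<And>i. (t, a, i) \<in> {(2, 1, k2), (0, 0, k0), (0, 0, l0), (-2, -1, m2)} \<Longrightarrow> c i = c' i" for t a c c'
  proof (rule ext)
    fix i
    show "c i = c' i"
    proof (cases "(t, a, i) \<in> {(2, 1, k2), (0, 0, k0), (0, 0, l0), (-2, -1, m2)}")
      case False
      then show ?thesis using cmp[OF c(1), of i] cmp[OF c(2), of i] triv by auto
    qed (rule eq)
  qed
  have zZ: "\<zero>\<^bsub>bterm Z t a\<^esub> i = \<zero>\<^bsub>S t a i\<^esub>" for t a i by (simp add: bt gf_dsum_simps)
  have aZ: "(c \<oplus>\<^bsub>bterm Z t a\<^esub> c') i = c i \<oplus>\<^bsub>S t a i\<^esub> c' i" for t a c c' i by (simp add: bt gf_dsum_simps)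
  define f where "f = (\<lambda>(t::int) (a::int). if t = 0 \<and> a = 0 then (\<lambda>c. e (c k0 \<ominus>\<^bsub>?T0\<^esub> D1 (r (c l0)))) else (\<lambda>_. \<zero>\<^bsub>I\<^esub>))"
  define g where "g = (\<lambda>(t::int) (a::int). if t = 0 \<and> a = 0 then (\<lambda>z. dincl (S 0 0) k0 (e' z) \<oplus>\<^bsub>bterm Z 0 0\<^esub>
      dincl (S 0 0) l0 (\<ominus>\<^bsub>?L0\<^esub> j (D2 (e' z)))) else (\<lambda>_. \<zero>\<^bsub>bterm Z t a\<^esub>))"
  define h where "h = (\<lambda>(t::int) (a::int). if t = 0 \<and> a = 0 then (\<lambda>c. dincl (S 2 1) k2 (\<ominus>\<^bsub>?T2\<^esub> r (c l0)))
      else if t = -2 \<and> a = -1 then (\<lambda>c. dincl (S 0 0) l0 (\<ominus>\<^bsub>?L0\<^esub> j (c m2)))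
      else (\<lambda>_. \<zero>\<^bsub>bterm Z (t + 2) (a + 1)\<^esub>))"
  have proj: "gfhom (bterm Z t a) (S t a i) (\<lambda>c. c i)" for t a i unfolding bt by (rule gfhom_dsum_proj)
  have inc: "gfhom (S t a i) (bterm Z t a) (dincl (S t a) i)" for t a i unfolding bt by (rule gfhom_dincl[OF gS])
  have zY: "\<zero>\<^bsub>bterm ?Y t a\<^esub> = \<zero>\<^bsub>I\<^esub>" for t a by (rule zero_bterm_single)
  have fh: "gfhom (bterm Z t a) (bterm ?Y t a) (f t a)" for t a
  proof (cases "t = 0 \<and> a = 0")
    case True
    have "gfhom (bterm Z 0 0) (S 0 0 k0) (\<lambda>c. c k0 \<ominus>\<^bsub>?T0\<^esub> D1 (r (c l0)))"
      unfolding a_minus_def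
      by (rule gfhom_add[OF gZ gS proj gfhom_minus[OF gZ gS gfhom_comp[OF gfhom_comp[OF proj r] D1]]])
    from gfhom_comp[OF this e] show ?thesis using True by (simp add: f_def bterm_single)
  next
    case False
    then have "f t a = (\<lambda>_. \<zero>\<^bsub>bterm ?Y t a\<^esub>)" by (auto simp: f_def zY)
    then show ?thesis using gfhom_zero[OF gZ gY] by simp
  qed
  have gh: "gfhom (bterm ?Y t a) (bterm Z t a) (g t a)" for t a
  proof (cases "t = 0 \<and> a = 0")
    case True
    have "gfhom I (bterm Z 0 0) (\<lambda>z. dincl (S 0 0) k0 (e' z) \<oplus>\<^bsub>bterm Z 0 0\<^esub> dincl (S 0 0) l0 (\<ominus>\<^bsub>?L0\<^esub> j (D2 (e' z))))"
      by (rule gfhom_add[OF I gZ gfhom_comp[OF e' inc] gfhom_comp[OF gfhom_minus[OF I gS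
          gfhom_comp[OF gfhom_comp[OF e' D2] j]] inc]])
    then show ?thesis using True by (simp add: g_def bterm_single)
  next
    case False
    then have "g t a = (\<lambda>_. \<zero>\<^bsub>bterm Z t a\<^esub>)" by (auto simp: g_def)
    then show ?thesis using gfhom_zero[OF gY gZ] by simp
  qed
  have hh: "gfhom (bterm Z t a) (bterm Z (t + 2) (a + 1)) (h t a)" for t a
  proof -
    have 1: "gfhom (bterm Z 0 0) (bterm Z 2 1) (\<lambda>c. dincl (S 2 1) k2 (\<ominus>\<^bsub>?T2\<^esub> r (c l0)))"
      by (rule gfhom_comp[OF gfhom_minus[OF gZ gS gfhom_comp[OF proj r]] inc])
    have 2: "gfhom (bterm Z (-2) (-1)) (bterm Z 0 0) (\<lambda>c. dincl (S 0 0) l0 (\<ominus>\<^bsub>?L0\<^esub> j (c m2)))"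
      by (rule gfhom_comp[OF gfhom_minus[OF gZ gS gfhom_comp[OF proj j]] inc])
    show ?thesis
    proof (cases "t = 0 \<and> a = 0 \<or> t = -2 \<and> a = -1")
      case True
      then show ?thesis using 1 2 by (auto simp: h_def)
    next
      case False
      then have "h t a = (\<lambda>_. \<zero>\<^bsub>bterm Z (t + 2) (a + 1)\<^esub>)" by (auto simp: h_def)
      then show ?thesis using gfhom_zero[OF gZ gZ] by simp
    qed
  qed
  have g00: "g 0 0 z k0 = e' z" "g 0 0 z l0 = \<ominus>\<^bsub>?L0\<^esub> j (D2 (e' z))" if "z \<in> carrier I" for z
    using that cl ne by (simp_all add: g_def aZ dincl_def)
  have tY: "carrier (bterm ?Y t a) = {\<zero>\<^bsub>I\<^esub>}" if "\<not> (t = 0 \<and> a = 0)" for t a using that by (auto simp: bterm_single)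
  show ?thesis
  proof (rule bcx_homotopy_equivalence[OF inf Z Y _ _ _ _ fh _ gh _ hh])
    show "countable (carrier (bterm Z t a))" for t a unfolding bt by (rule countable_dsum) (rule cS)
    show "countable (carrier (bterm ?Y t a))" for t a using cI by (simp add: bterm_single)
    have "carrier (bterm Z t a) = {\<zero>\<^bsub>bterm Z t a\<^esub>}" if t: "t \<notin> {2, 0, -2}" for t a
    proof -
      have "c = \<zero>\<^bsub>bterm Z t a\<^esub>" if "c \<in> carrier (bterm Z t a)" for c
        by (rule eqZ[OF that abelian_monoid.zero_closed[OF abelian_group.axioms(1)[OF gfmodule_abelian_group[OF gZ]]]])
          (use t in auto)
      then show ?thesis
        using abelian_monoid.zero_closed[OF abelian_group.axioms(1)[OF gfmodule_abelian_group[OF gZ]]] by blast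
    qed
    then show "finite {t. \<exists>a. carrier (bterm Z t a) \<noteq> {\<zero>\<^bsub>bterm Z t a\<^esub>}}"
      by - (rule finite_subset[of _ "{2, 0, -2}"], auto)
    show "finite {t. \<exists>a. carrier (bterm ?Y t a) \<noteq> {\<zero>\<^bsub>bterm ?Y t a\<^esub>}}"
      by (rule finite_subset[of _ "{0}"]) (auto simp: bterm_single split: if_splits)
    show "bdif ?Y t a (f t a c) = f (t - 2) (a - 1) (bdif Z t a c)" if c: "c \<in> carrier (bterm Z t a)" for t a c
    proof (cases "t = 2 \<and> a = 1")
      case True
      then have "c \<in> carrier (bterm Z 2 1)" using c by simp
      note this cmp[OF this, of k2]
      then show ?thesis using True cl rA by (simp add: f_def bdif_single d2 ng T0.r_neg a_minus_def)
    next
      case False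
      then show ?thesis by (auto simp: f_def bdif_single)
    qed
    show "bdif Z t a (g t a z) = g (t - 2) (a - 1) (bdif ?Y t a z)" if z: "z \<in> carrier (bterm ?Y t a)" for t a z
    proof (rule eqZ)
      have bz: "bdif ?Y t a z = \<zero>\<^bsub>bterm ?Y (t - 2) (a - 1)\<^esub>" by (simp add: bdif_single zY)
      have gz: "g (t - 2) (a - 1) (bdif ?Y t a z) = \<zero>\<^bsub>bterm Z (t - 2) (a - 1)\<^esub>"
        unfolding bz by (rule gfhomD0(1)[OF gY gZ gh])
      have gC: "g t a z \<in> carrier (bterm Z t a)" by (rule gfhomD(1)[OF gh z])
      show "bdif Z t a (g t a z) \<in> carrier (bterm Z (t - 2) (a - 1))" by (rule gfhomD(1)[OF dZ gC])
      show "g (t - 2) (a - 1) (bdif ?Y t a z) \<in> carrier (bterm Z (t - 2) (a - 1))"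
        unfolding bz by (rule gfhomD(1)[OF gh abelian_monoid.zero_closed[OF abelian_group.axioms(1)[OF gfmodule_abelian_group[OF gY]]]])
      fix i assume i: "(t - 2, a - 1, i) \<in> {(2, 1, k2), (0, 0, k0), (0, 0, l0), (-2, -1, m2)}"
      show "bdif Z t a (g t a z) i = g (t - 2) (a - 1) (bdif ?Y t a z) i"
      proof (cases "t = 0 \<and> a = 0")
        case True
        then have zI: "z \<in> carrier I" and im: "i = m2" using z i by (auto simp: bterm_single)
        have gC0: "g 0 0 z \<in> carrier (bterm Z 0 0)" using gC True by simp
        show ?thesis unfolding gz zZ using True im zI cl by (simp add: d0[OF gC0] g00[OF zI] ng Xj M2.group_simps)
      next
        case False
        have "g t a z = \<zero>\<^bsub>bterm Z t a\<^esub>" using False by (auto simp: g_def)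
        then have "bdif Z t a (g t a z) = \<zero>\<^bsub>bterm Z (t - 2) (a - 1)\<^esub>" using gfhomD0(1)[OF gZ gZ dZ] by simp
        then show ?thesis unfolding gz by simp
      qed
    qed
    show "f t a (g t a z) = z" if z: "z \<in> carrier (bterm ?Y t a)" for t a z
    proof (cases "t = 0 \<and> a = 0")
      case True
      then have zI: "z \<in> carrier I" using z by (simp add: bterm_single)
      show ?thesis using True zI cl by (simp add: f_def g00[OF zI] ng rj T0.group_simps T2.group_simps ee')
    next
      case False
      then show ?thesis using z tY[OF False] by (auto simp: f_def)
    qed
    show "g t a (f t a c) = c \<oplus>\<^bsub>bterm Z t a\<^esub> (bdif Z (t + 2) (a + 1) (h t a c) \<oplus>\<^bsub>bterm Z t a\<^esub> h (t - 2) (a - 1) (bdif Z t a c))"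
      if c: "c \<in> carrier (bterm Z t a)" for t a c
    proof (rule eqZ)
      interpret Zt: abelian_group "bterm Z t a" by (rule gfmodule_abelian_group[OF gZ])
      have hC: "h t a c \<in> carrier (bterm Z (t + 2) (a + 1))" by (rule gfhomD(1)[OF hh c])
      have dhC: "bdif Z (t + 2) (a + 1) (h t a c) \<in> carrier (bterm Z t a)" using gfhomD(1)[OF dZ hC] by simp
      have dC: "bdif Z t a c \<in> carrier (bterm Z (t - 2) (a - 1))" by (rule gfhomD(1)[OF dZ c])
      have hdC: "h (t - 2) (a - 1) (bdif Z t a c) \<in> carrier (bterm Z t a)" using gfhomD(1)[OF hh dC] by simp
      show "g t a (f t a c) \<in> carrier (bterm Z t a)" by (rule gfhomD(1)[OF gh gfhomD(1)[OF fh c]])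
      show "c \<oplus>\<^bsub>bterm Z t a\<^esub> (bdif Z (t + 2) (a + 1) (h t a c) \<oplus>\<^bsub>bterm Z t a\<^esub> h (t - 2) (a - 1) (bdif Z t a c))
          \<in> carrier (bterm Z t a)" using c dhC hdC by simp
      fix i assume i: "(t, a, i) \<in> {(2, 1, k2), (0, 0, k0), (0, 0, l0), (-2, -1, m2)}"
      note ci = cmp[OF c]
      consider "t = 2" "a = 1" "i = k2" | "t = 0" "a = 0" "i = k0" | "t = 0" "a = 0" "i = l0" | "t = -2" "a = -1" "i = m2"
        using i by auto
      then show "g t a (f t a c) i = (c \<oplus>\<^bsub>bterm Z t a\<^esub>
          (bdif Z (t + 2) (a + 1) (h t a c) \<oplus>\<^bsub>bterm Z t a\<^esub> h (t - 2) (a - 1) (bdif Z t a c))) i"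
      proof cases
        case 1
        have c21: "c \<in> carrier (bterm Z 2 1)" using c 1 by simp
        have k: "c k2 \<in> carrier ?T2" using ci[of k2] 1 by simp
        \<comment> \<open>At the left end \<open>h\<close> is zero, so of the homotopy only - r A
          remains, which cancels the identity; g f is zero there.\<close>
        have "bdif Z 4 2 \<zero>\<^bsub>bterm Z 4 2\<^esub> = \<zero>\<^bsub>bterm Z 2 1\<^esub>" using gfhomD0(1)[OF gZ gZ dZ, of 4 2] by simp
        then show ?thesis using 1 k cl by (simp add: aZ zZ g_def h_def dincl_def d2[OF c21] rA T2.group_simps)
      next
        case 2
        have c00: "c \<in> carrier (bterm Z 0 0)" using c 2 by simp
        have k: "c k0 \<in> carrier ?T0" "c l0 \<in> carrier ?L0" using cmp[OF c00] by auto
        have h21: "h 0 0 c \<in> carrier (bterm Z 2 1)" using hC 2 by simp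
        have fI: "f 0 0 c \<in> carrier I" using k cl by (simp add: f_def)
        have hz: "h (- 2) (- 1) x k0 = \<zero>\<^bsub>?T0\<^esub>" for x using ne by (simp add: h_def dincl_def)
        have "bdif Z 2 1 (h 0 0 c) k0 = \<ominus>\<^bsub>?T0\<^esub> D1 (r (c l0))"
          unfolding d2(1)[OF h21] using k cl by (simp add: h_def dincl_def ng)
        moreover have "g 0 0 (f 0 0 c) k0 = c k0 \<ominus>\<^bsub>?T0\<^esub> D1 (r (c l0))"
          unfolding g00(1)[OF fI] using k cl by (simp add: f_def e'e)
        ultimately show ?thesis using 2 k cl by (simp add: aZ hz T0.group_simps)
      next
        case 3
        have c00: "c \<in> carrier (bterm Z 0 0)" using c 3 by simp
        have k: "c k0 \<in> carrier ?T0" "c l0 \<in> carrier ?L0" using cmp[OF c00] by auto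
        have h21: "h 0 0 c \<in> carrier (bterm Z 2 1)" using hC 3 by simp
        have fI: "f 0 0 c \<in> carrier I" using k cl by (simp add: f_def)
        let ?u = "c l0" and ?x = "c k0"
        have cl2: "A (r ?u) \<in> carrier ?L0" "j (\<Xi> ?u) \<in> carrier ?L0" "j (D2 (D1 (r ?u))) \<in> carrier ?L0"
          "j (D2 ?x) \<in> carrier ?L0" "D2 ?x \<in> carrier ?M2" "\<Xi> ?u \<in> carrier ?M2"
          "D2 (D1 (r ?u)) \<in> carrier ?M2" "D1 (r ?u) \<in> carrier ?T0" using k cl by auto
        have 4: "bdif Z 2 1 (h 0 0 c) l0 = \<ominus>\<^bsub>?L0\<^esub> A (r ?u)"
          unfolding d2(2)[OF h21] using k cl by (simp add: h_def dincl_def ng)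
        have 5: "h (- 2) (- 1) (bdif Z 0 0 c) l0 = \<ominus>\<^bsub>?L0\<^esub> (j (D2 ?x) \<oplus>\<^bsub>?L0\<^esub> j (\<Xi> ?u))"
          using cl2 by (simp add: h_def dincl_def d0[OF c00] ad)
        have 6: "g 0 0 (f 0 0 c) l0 = \<ominus>\<^bsub>?L0\<^esub> (j (D2 ?x) \<ominus>\<^bsub>?L0\<^esub> j (D2 (D1 (r ?u))))"
        proof -
          have y: "?x \<ominus>\<^bsub>?T0\<^esub> D1 (r ?u) \<in> carrier ?T0" using k cl2 by simp
          have f0: "f 0 0 c = e (?x \<ominus>\<^bsub>?T0\<^esub> D1 (r ?u))" by (simp add: f_def)
          show ?thesis unfolding g00(2)[OF fI] unfolding f0 e'e[OF y] using k cl2 by (simp add: ng)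
        qed
        \<comment> \<open>The left side is the \<open>l0\<close> coordinate of g f. By
          \<open>key\<close> the first bracket on the right is \<open>c l0\<close>, and the
          remaining terms are the two halves of the homotopy; the correction in \<open>key\<close>
          matches the term that g f produces from - \<open>D1 r\<close>.\<close>
        have "\<ominus>\<^bsub>?L0\<^esub> (j (D2 ?x) \<ominus>\<^bsub>?L0\<^esub> j (D2 (D1 (r ?u)))) =
            (A (r ?u) \<oplus>\<^bsub>?L0\<^esub> j (\<Xi> ?u) \<oplus>\<^bsub>?L0\<^esub> j (D2 (D1 (r ?u)))) \<oplus>\<^bsub>?L0\<^esub>
            (\<ominus>\<^bsub>?L0\<^esub> A (r ?u) \<oplus>\<^bsub>?L0\<^esub> \<ominus>\<^bsub>?L0\<^esub> (j (D2 ?x) \<oplus>\<^bsub>?L0\<^esub> j (\<Xi> ?u)))"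
          using cl2 by (simp add: L0.group_simps)
        then show ?thesis using 3 4 5 6 by (simp add: aZ key[OF k(2)])
      next
        case 4
        have c22: "c \<in> carrier (bterm Z (-2) (-1))" using c 4 by simp
        have k: "c m2 \<in> carrier ?M2" using cmp[OF c22] .
        have h00: "h (-2) (-1) c \<in> carrier (bterm Z 0 0)" using hC 4 by simp
        have "bdif Z 0 0 (h (-2) (-1) c) m2 = \<ominus>\<^bsub>?M2\<^esub> c m2"
          unfolding d0[OF h00] using k cl ne by (simp add: h_def dincl_def ng Xj)
        moreover have "h (-4) (-2) x = \<zero>\<^bsub>bterm Z (-2) (-1)\<^esub>" for x by (simp add: h_def)
        ultimately show ?thesis using 4 k by (simp add: aZ zZ g_def M2.group_simps)
      qed
    qed
  qed
qed

section \<open>Cyclic bimodules and maps out of their tensor products\<close>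

section \<open>Cyclic bimodules\<close>

lemma ideal_PR_iff:
  "ideal J (PR :: 'v mpoly ring) \<longleftrightarrow> 0 \<in> J \<and> (\<forall>p\<in>J. \<forall>q\<in>J. p + q \<in> J) \<and> (\<forall>p\<in>J. \<forall>q. q * p \<in> J)"
proof
  assume J: "ideal J (PR :: 'v mpoly ring)"
  interpret ideal J PR by (rule J)
  show "0 \<in> J \<and> (\<forall>p\<in>J. \<forall>q\<in>J. p + q \<in> J) \<and> (\<forall>p\<in>J. \<forall>q. q * p \<in> J)"
    using additive_subgroup.zero_closed[OF additive_subgroup_axioms]
      additive_subgroup.a_closed[OF additive_subgroup_axioms] I_l_closed by simp
next
  assume J: "0 \<in> J \<and> (\<forall>p\<in>J. \<forall>q\<in>J. p + q \<in> J) \<and> (\<forall>p\<in>J. \<forall>q. q * p \<in> J)"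
  interpret cring "PR :: 'v mpoly ring" by (rule cring_PR)
  have "- p \<in> J" if "p \<in> J" for p using J that mult_minus1[of p] by metis
  then have "additive_subgroup J (PR :: 'v mpoly ring)"
    using J by (intro additive_subgroupI[OF abelian_group_axioms]) auto
  then show "ideal J (PR :: 'v mpoly ring)"
    using J by (intro idealI ring_axioms additive_subgroup.a_subgroup) (simp_all add: mult.commute)
qed

lemma ideal_PR:
  assumes "ideal J (PR :: 'v mpoly ring)"
  shows "0 \<in> J" "p \<in> J \<Longrightarrow> q \<in> J \<Longrightarrow> p + q \<in> J" "p \<in> J \<Longrightarrow> q * p \<in> J" "p \<in> J \<Longrightarrow> p * q \<in> J"
    "p \<in> J \<Longrightarrow> - p \<in> J" "p \<in> J \<Longrightarrow> q \<in> J \<Longrightarrow> p - q \<in> J"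
proof -
  note J = assms[unfolded ideal_PR_iff]
  show "0 \<in> J" and a: "p \<in> J \<Longrightarrow> q \<in> J \<Longrightarrow> p + q \<in> J" and m: "p \<in> J \<Longrightarrow> q * p \<in> J"
    for p q using J by auto
  show "p \<in> J \<Longrightarrow> p * q \<in> J" using m[of p q] by (simp add: mult.commute)
  show "p \<in> J \<Longrightarrow> - p \<in> J" for p using m[of p "-1"] by simp
  then show "p \<in> J \<Longrightarrow> q \<in> J \<Longrightarrow> p - q \<in> J" using a[of p "- q"] by simp
qed

abbreviation cls :: "'v mpoly set \<Rightarrow> 'v mpoly \<Rightarrow> 'v mpoly set" where
  "cls J p \<equiv> J +>\<^bsub>PR\<^esub> p"

lemma mem_cls: "q \<in> cls J p \<longleftrightarrow> q - p \<in> J"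
proof -
  have "q \<in> cls J p \<longleftrightarrow> (\<exists>h\<in>J. q = h + p)" by (simp add: a_r_coset_def')
  also have "\<dots> \<longleftrightarrow> q - p \<in> J" by (metis diff_add_cancel add_diff_cancel)
  finally show ?thesis .
qed

lemma cls_eq_iff:
  assumes "ideal J PR"
  shows "cls J p = cls J q \<longleftrightarrow> p - q \<in> J"
proof
  assume "cls J p = cls J q"
  then have "p \<in> cls J q" using mem_cls[of p J p] ideal_PR(1)[OF assms] by simp
  then show "p - q \<in> J" by (simp add: mem_cls)
next
  assume pq: "p - q \<in> J"
  have "x - p \<in> J \<longleftrightarrow> x - q \<in> J" for x
    using ideal_PR(2)[OF assms _ pq, of "x - p"] ideal_PR(6)[OF assms _ pq, of "x - q"] by (auto simp: algebra_simps)
  then show "cls J p = cls J q" by (auto simp: mem_cls)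
qed

text \<open>Homogeneity expressed through components, the form in which it makes the degree
  projections of a quotient well defined.\<close>

definition hideal :: "'v mpoly set \<Rightarrow> bool" where
  "hideal J \<longleftrightarrow> ideal J PR \<and> (\<forall>p\<in>J. \<forall>d. hcomp d p \<in> J)"

lemma hidealD:
  assumes "hideal J"
  shows "ideal J PR" "p \<in> J \<Longrightarrow> hcomp d p \<in> J" using assms by (auto simp: hideal_def)

text \<open>Functions on a quotient are defined through this arbitrary representative and then shown
  to depend on the class alone.\<close>

definition rep :: "'v mpoly set \<Rightarrow> 'v mpoly" where
  "rep Z = (SOME p. p \<in> Z)"

lemma rep_cls:
  assumes "ideal J PR"
  shows "rep (cls J p) - p \<in> J"
proof -
  have "p \<in> cls J p" using ideal_PR(1)[OF assms] by (simp add: mem_cls)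
  then have "rep (cls J p) \<in> cls J p" unfolding rep_def by (rule someI)
  then show ?thesis by (simp add: mem_cls)
qed

lemma quot_gf_simps:
  assumes J: "ideal J (PR :: 'n bpoly ring)"
  shows "carrier (quot_gf J F) = range (cls J)" "\<zero>\<^bsub>quot_gf J F\<^esub> = cls J 0"
    "cls J p \<oplus>\<^bsub>quot_gf J F\<^esub> cls J q = cls J (p + q)" "p \<odot>\<^bsub>quot_gf J F\<^esub> cls J q = cls J (p * q)"
    "qpart (quot_gf J F) d = cls J ` {p. homog d p}" "fil (quot_gf J F) = F"
proof -
  interpret ideal J PR by (rule J)
  show "carrier (quot_gf J F) = range (cls J)" by (auto simp: quot_gf_def Let_def FactRing_def A_RCOSETS_def')
  have "cls J 0 = J" by (auto simp: mem_cls)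
  then show "\<zero>\<^bsub>quot_gf J F\<^esub> = cls J 0" by (simp add: quot_gf_def Let_def FactRing_def)
  show "cls J p \<oplus>\<^bsub>quot_gf J F\<^esub> cls J q = cls J (p + q)"
    using a_rcos_sum[of p q] by (simp add: quot_gf_def Let_def FactRing_def)
  show "p \<odot>\<^bsub>quot_gf J F\<^esub> cls J q = cls J (p * q)"
    using rcoset_mult_add[of p q] by (simp add: quot_gf_def Let_def FactRing_def)
  show "qpart (quot_gf J F) d = cls J ` {p. homog d p}" "fil (quot_gf J F) = F" by (auto simp: quot_gf_def Let_def)
qed

lemma module_quot_gf:
  assumes J: "ideal J (PR :: 'n bpoly ring)"
  shows "module PR (quot_gf J F)"
proof -
  note s = quot_gf_simps[OF J, of F]
  have ag: "abelian_group (quot_gf J F)"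
  proof (rule abelian_groupI)
    show "\<exists>y\<in>carrier (quot_gf J F). y \<oplus>\<^bsub>quot_gf J F\<^esub> x = \<zero>\<^bsub>quot_gf J F\<^esub>" if x: "x \<in> carrier (quot_gf J F)" for x
    proof -
      obtain p where "x = cls J p" using x s(1) by auto
      then show ?thesis using s by (intro bexI[of _ "cls J (- p)"]) auto
    qed
  qed (auto simp: s add_ac)
  show ?thesis by (intro module.intro cring_PR ag module_axioms.intro) (auto simp: s algebra_simps)
qed

text \<open>Components are computed on a representative. Another choice differs by an element of
  \<open>J\<close>, whose components lie in \<open>J\<close> again; homogeneity of
  \<open>K k\<close> gives compatibility with the filtration in the same way.\<close>

lemma gfmodule_quot_gf:
  fixes J :: "'n bpoly set"
  assumes J: "hideal J" and K: "\<And>k. hideal (K k)" and mono: "\<And>k. K (k + 1) \<subseteq> K k"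
  shows "gfmodule (quot_gf J (\<lambda>k. cls J ` K k))"
proof -
  let ?M = "quot_gf J (\<lambda>k. cls J ` K k)"
  note Ji = hidealD(1)[OF J] and s = quot_gf_simps[OF hidealD(1)[OF J], of "\<lambda>k. cls J ` K k"]
  note m = module_quot_gf[OF Ji, of "\<lambda>k. cls J ` K k"]
  interpret m: module PR ?M by (rule m)
  have neg: "\<ominus>\<^bsub>?M\<^esub> cls J p = cls J (- p)" for p
    using m.M.minus_equality[of "cls J (- p)" "cls J p"] by (simp add: s)
  have sub: "additive_subgroup (cls J ` S) ?M" if "0 \<in> S" "\<And>p q. p \<in> S \<Longrightarrow> q \<in> S \<Longrightarrow> p + q \<in> S" "\<And>p. p \<in> S \<Longrightarrow> - p \<in> S" for S
    using that by (intro additive_subgroupI[OF m.abelian_group_axioms]) (auto simp: s neg)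
  have fil: "submodule (cls J ` K k) PR ?M" for k
    using ideal_PR[OF hidealD(1)[OF K]] by (intro submodulePRI[OF m sub]) (auto simp: s)
  have qp: "additive_subgroup (qpart ?M q) ?M" for q unfolding s(5) by (rule sub) (auto intro: homog_add homog_uminus)
  define P where "P = (\<lambda>q Z. cls J (hcomp q (rep Z)))"
  have P: "P q (cls J p) = cls J (hcomp q p)" for q p unfolding P_def cls_eq_iff[OF Ji]
    using hidealD(2)[OF J rep_cls[OF Ji, of p], of q] hcomp_add[of q "rep (cls J p) - p" p] by simp
  show ?thesis unfolding gfmodule_def
  proof (intro conjI allI impI ballI m qp)
    show "fil ?M (k + 1) \<subseteq> fil ?M k" for k using mono unfolding s(6) by blast
    show "submodule (fil ?M k) PR ?M" for k unfolding s(6) by (rule fil)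
    show "p \<odot>\<^bsub>?M\<^esub> x \<in> qpart ?M (q + d)" if "homog d p" "x \<in> qpart ?M q" for d p q x
      using that(2) homog_mult[OF that(1)] by (auto simp: s add.commute[of q])
    have hc: "hcomponents ?M x c \<longleftrightarrow> c = (\<lambda>q. P q x)" if "x \<in> carrier ?M" for x c
    proof (rule hcomponents_by_projections[OF m.abelian_group_axioms qp _ _ _ _ _ that])
      show "P q y \<in> qpart ?M q" if "y \<in> carrier ?M" for q y
        using that by (auto simp: s P intro!: imageI homog_hcomp)
      show "P q (y \<oplus>\<^bsub>?M\<^esub> z) = P q y \<oplus>\<^bsub>?M\<^esub> P q z" if "y \<in> carrier ?M" "z \<in> carrier ?M" for q y z
        using that by (auto simp: s P hcomp_add)
      show "P q y = y" if "y \<in> qpart ?M q" for q y using that by (auto simp: s P hcomp_homog)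
      show "P q' y = \<zero>\<^bsub>?M\<^esub>" if "y \<in> qpart ?M q" "q' \<noteq> q" for q q' y using that by (auto simp: s P hcomp_homog)
      fix y assume "y \<in> carrier ?M"
      then obtain p where y: "y = cls J p" by (auto simp: s)
      let ?S = "qdeg ` Poly_Mapping.keys p"
      have "finsum ?M (\<lambda>q. P q y) S = cls J (\<Sum>q\<in>S. hcomp q p)" if "finite S" for S
        using that by induction (auto simp: s y P)
      from this[of ?S] have 1: "finsum ?M (\<lambda>q. P q y) ?S = y" by (simp add: y hcomp_sum)
      have 2: "P q y = \<zero>\<^bsub>?M\<^esub>" if "q \<notin> ?S" for q using that by (simp add: s y P hcomp_eq_0)
      show "\<exists>S. finite S \<and> (\<forall>q. q \<notin> S \<longrightarrow> P q y = \<zero>\<^bsub>?M\<^esub>) \<and> y = finsum ?M (\<lambda>q. P q y) S"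
        by (rule exI[of _ ?S], intro conjI allI impI 2 1[symmetric]) simp
    qed
    show "\<exists>!c. hcomponents ?M x c" if "x \<in> carrier ?M" for x using hc[OF that] by simp
    show "c q \<in> fil ?M k" if xk: "x \<in> fil ?M k \<and> hcomponents ?M x c" for k x c q
    proof -
      obtain p where p: "x = cls J p" "p \<in> K k" using xk by (auto simp: s)
      then have "c = (\<lambda>q. P q x)" using hc xk s(1) by blast
      then show ?thesis using p hidealD(2)[OF K p(2)] by (auto simp: P s)
    qed
  qed
qed

lemma step_fil_eq:
  assumes "ideal J PR"
  shows "step_fil J c = (\<lambda>k. cls J ` (if k \<le> 0 then UNIV else if k \<le> 2 then range ((*) c) else {0}))"
proof -
  have "cls J 0 = J" by (auto simp: mem_cls)
  then show ?thesis by (auto simp: step_fil_def fun_eq_iff)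
qed

text \<open>The three steps are the images of the unit ideal, of the principal ideal of
  \<open>c\<close> and of zero, all homogeneous because \<open>c\<close> is.\<close>

lemma gfmodule_step:
  fixes J :: "'n bpoly set"
  assumes J: "hideal J" and c: "homog d c"
  shows "gfmodule (quot_gf J (step_fil J c))"
proof -
  have "hcomp e (c * p) \<in> range ((*) c)" for e p by (simp add: hcomp_mult[OF c])
  moreover have "c * p + c * q \<in> range ((*) c)" "r * (c * p) \<in> range ((*) c)" for p q r
    by (simp_all add: distrib_left[symmetric] mult.left_commute[of r])
  moreover have "(0::'n bpoly) \<in> range ((*) c)" by (rule range_eqI[of _ _ 0]) simp
  ultimately have "hideal (range ((*) c))" "hideal (UNIV :: 'n bpoly set)" "hideal {0 :: 'n bpoly}"
    by (auto simp: hideal_def ideal_PR_iff)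
  then have "hideal (if k \<le> 0 then UNIV else if k \<le> 2 then range ((*) c) else {0})" for k :: int by simp
  then show ?thesis unfolding step_fil_eq[OF hidealD(1)[OF J]]
    by (rule gfmodule_quot_gf[OF J]) (use \<open>0 \<in> range ((*) c)\<close> in auto)
qed

lemma step_fil_cases:
  assumes "ideal J PR" "x \<in> step_fil J c k"
  obtains p where "x = cls J p" "k \<le> 0" | p where "x = cls J (c * p)" "0 < k" "k \<le> 2" | "x = cls J 0" "2 < k"
  using assms(2) unfolding step_fil_eq[OF assms(1)] by (auto split: if_splits)

subsection \<open>Homomorphisms from cyclic bimodules\<close>

lemma gfhom_eq_cyclic:
  fixes J :: "'n bpoly set"
  assumes J: "ideal J PR" and f: "gfhom (quot_gf J F) N f" and g: "gfhom (quot_gf J F) N g"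
    and eq: "f (cls J 1) = g (cls J 1)" and x: "x \<in> carrier (quot_gf J F)"
  shows "f x = g x"
proof -
  note s = quot_gf_simps[OF J, of F]
  obtain p where "x = p \<odot>\<^bsub>quot_gf J F\<^esub> cls J 1" using x by (auto simp: s)
  then show ?thesis using gfhomD(3)[OF f, of "cls J 1" p] gfhomD(3)[OF g, of "cls J 1" p] eq by (simp add: s)
qed

text \<open>A map out of a cyclic bimodule is a choice of image \<open>n\<close> for the generator.
  Besides degree 0 and annihilation by \<open>J\<close>, the step filtration asks for filtration 0
  of n and filtration 2 of c n, 2 half units being one full step.\<close>

lemma gfhom_cyclic:
  fixes J :: "'n bpoly set"
  assumes J: "ideal J PR" and N: "gfmodule N" and n: "n \<in> qpart N 0" "n \<in> fil N 0"
    and ann: "\<And>p. p \<in> J \<Longrightarrow> p \<odot>\<^bsub>N\<^esub> n = \<zero>\<^bsub>N\<^esub>" and c: "c \<odot>\<^bsub>N\<^esub> n \<in> fil N 2"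
  shows "gfhom (quot_gf J (step_fil J c)) N (\<lambda>Z. rep Z \<odot>\<^bsub>N\<^esub> n)"
    "rep (cls J p) \<odot>\<^bsub>N\<^esub> n = p \<odot>\<^bsub>N\<^esub> n"
proof -
  note s = quot_gf_simps[OF J, of "step_fil J c"]
  interpret N: abelian_group N by (rule gfmodule_abelian_group[OF N])
  have nC: "n \<in> carrier N" by (rule gfmodule_qpart_carrier[OF N n(1)])
  note f = module_smult_facts[OF gfmodule_module[OF N]]
  show r: "rep (cls J p) \<odot>\<^bsub>N\<^esub> n = p \<odot>\<^bsub>N\<^esub> n" for p
  proof -
    have "((rep (cls J p) - p) + p) \<odot>\<^bsub>N\<^esub> n = p \<odot>\<^bsub>N\<^esub> n"
      unfolding f(2)[OF nC] using ann[OF rep_cls[OF J]] f(1)[OF nC] by simp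
    then show ?thesis by simp
  qed
  show "gfhom (quot_gf J (step_fil J c)) N (\<lambda>Z. rep Z \<odot>\<^bsub>N\<^esub> n)"
    unfolding gfhom_def image_subset_iff
  proof (intro conjI ballI allI)
    show "rep x \<odot>\<^bsub>N\<^esub> n \<in> qpart N q" if "x \<in> qpart (quot_gf J (step_fil J c)) q" for x q
      using that gfmodule_smult_qpart[OF N _ n(1), of q] by (auto simp: s r)
    show "rep x \<odot>\<^bsub>N\<^esub> n \<in> fil N k" if x: "x \<in> fil (quot_gf J (step_fil J c)) k" for x k
    proof -
      have "x \<in> step_fil J c k" using x by (simp add: s)
      then show ?thesis
      proof (cases rule: step_fil_cases[OF J, consumes 1, case_names 1 2 3])
        case (1 p)
        then show ?thesis using gf_fil_closed(5)[OF N n(2)] gfmodule_fil_mono[OF N 1(2)] by (auto simp: r)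
      next
        case (2 p)
        then show ?thesis using gf_fil_closed(5)[OF N c, of p] gfmodule_fil_mono[OF N 2(3)] f(3)[OF nC, of p c]
          by (auto simp: r mult.commute)
      next
        case 3
        then show ?thesis using gf_fil_closed(1)[OF N] f(5)[OF nC] by (simp add: r)
      qed
    qed
  qed (auto simp: s r f nC)
qed

text \<open>The map is described on polynomial representatives by \<psi>, whose value acts on one
  element \<open>n\<close>. If n has degree b, then \<psi> must lower degrees by b. The filtration
  indices 2, 2 and 4 belong to generators of F^1 in one or in both factors. The trace, the map j and
  the unit map on I \<otimes> I all have this form.\<close>

lemma gfhom_tens_cyclic:
  fixes J K :: "'n::finite bpoly set" and H :: "('n bpoly, 'a) gfmod" and \<psi> :: "'n bpoly \<Rightarrow> 'n bpoly \<Rightarrow> 'n bpoly"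
  assumes J: "hideal J" "homog d c" and K: "hideal K" "homog d' c'" and H: "gfmodule H"
    and n: "n \<in> qpart H b"
    and a: "\<And>p p' q. \<psi> (p + p') q = \<psi> p q + \<psi> p' q" "\<And>p q q'. \<psi> p (q + q') = \<psi> p q + \<psi> p q'"
    and const: "\<And>a p q. \<psi> (const a * p) q = const a * \<psi> p q" "\<And>a p q. \<psi> p (const a * q) = const a * \<psi> p q"
    and xy: "\<And>i p q. \<psi> (mvar (Xv i) * p) q = \<psi> p (mvar (Yv i) * q)"
    and y: "\<And>i p q. \<psi> (mvar (Yv i) * p) q = mvar (Yv i) * \<psi> p q"
    and x: "\<And>i p q. \<psi> p (mvar (Xv i) * q) = mvar (Xv i) * \<psi> p q"
    and hom: "\<And>i j p q. homog i p \<Longrightarrow> homog j q \<Longrightarrow> homog (i + j - b) (\<psi> p q)"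
    and ann: "\<And>p q. p \<in> J \<or> q \<in> K \<Longrightarrow> \<psi> p q \<odot>\<^bsub>H\<^esub> n = \<zero>\<^bsub>H\<^esub>"
    and f0: "n \<in> fil H 0"
    and f1: "\<And>p q. \<psi> (c * p) q \<odot>\<^bsub>H\<^esub> n \<in> fil H 2" "\<And>p q. \<psi> p (c' * q) \<odot>\<^bsub>H\<^esub> n \<in> fil H 2"
    and f2: "\<And>p q. \<psi> (c * p) (c' * q) \<odot>\<^bsub>H\<^esub> n \<in> fil H 4"
  obtains h where "gfhom (tens (quot_gf J (step_fil J c)) (quot_gf K (step_fil K c'))) H h"
    "\<And>p q. h (ptens (quot_gf J (step_fil J c)) (quot_gf K (step_fil K c')) (cls J p) (cls K q)) = \<psi> p q \<odot>\<^bsub>H\<^esub> n"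
proof -
  let ?M = "quot_gf J (step_fil J c)" and ?N = "quot_gf K (step_fil K c')"
  note Ji = hidealD(1)[OF J(1)] and Ki = hidealD(1)[OF K(1)]
  note sM = quot_gf_simps[OF Ji, of "step_fil J c"] and sN = quot_gf_simps[OF Ki, of "step_fil K c'"]
  have gM: "gfmodule ?M" and gN: "gfmodule ?N" by (rule gfmodule_step[OF J], rule gfmodule_step[OF K])
  note mM = gfmodule_module[OF gM] and mN = gfmodule_module[OF gN]
  interpret H: abelian_group H by (rule gfmodule_abelian_group[OF H])
  have nC: "n \<in> carrier H" by (rule gfmodule_qpart_carrier[OF H n])
  note hf = module_smult_facts[OF gfmodule_module[OF H] nC]
  define \<phi> where "\<phi> = (\<lambda>Z W. \<psi> (rep Z) (rep W) \<odot>\<^bsub>H\<^esub> n)"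
  have \<phi>: "\<phi> (cls J p) (cls K q) = \<psi> p q \<odot>\<^bsub>H\<^esub> n" for p q
  proof -
    \<comment> \<open>Representatives are exchanged one at a time; each correction term has an
      argument in \<open>J\<close> or \<open>K\<close> and kills \<open>n\<close>.\<close>
    have "\<psi> (rep (cls J p)) (rep (cls K q)) = \<psi> (rep (cls J p) - p) (rep (cls K q)) + \<psi> p (rep (cls K q) - q) + \<psi> p q"
      using a(1)[of "rep (cls J p) - p" p "rep (cls K q)"] a(2)[of p "rep (cls K q) - q" q] by (simp add: add.assoc)
    then show ?thesis unfolding \<phi>_def using ann[of "rep (cls J p) - p"] ann[of p "rep (cls K q) - q"]
        rep_cls[OF Ji] rep_cls[OF Ki] by (simp add: hf)
  qed
  have bal: "balanced ?M ?N H \<phi>" by (rule balancedI[OF mM mN]) (auto simp: sM sN \<phi> hf a xy const)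
  obtain h where h: "h \<in> carrier (tens ?M ?N) \<rightarrow> carrier H"
    "\<forall>x\<in>carrier (tens ?M ?N). \<forall>y\<in>carrier (tens ?M ?N). h (x \<oplus>\<^bsub>tens ?M ?N\<^esub> y) = h x \<oplus>\<^bsub>H\<^esub> h y"
    "\<forall>m\<in>carrier ?M. \<forall>n\<in>carrier ?N. h (ptens ?M ?N m n) = \<phi> m n"
    using tens_universal[OF mM mN H.abelian_group_axioms bal] by blast
  have z: "\<psi> 0 q \<odot>\<^bsub>H\<^esub> n = \<zero>\<^bsub>H\<^esub>" "\<psi> p 0 \<odot>\<^bsub>H\<^esub> n = \<zero>\<^bsub>H\<^esub>" for p q
    using ann ideal_PR(1)[OF Ji] ideal_PR(1)[OF Ki] by auto
  have "gfhom (tens ?M ?N) H h"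
  proof (rule gfhom_tensI[OF gM gN H h(1)])
    show "\<phi> m k \<in> qpart H (i + j)" if "m \<in> qpart ?M i" "k \<in> qpart ?N j" for m k i j
      using that gfmodule_smult_qpart[OF H hom n] by (fastforce simp: sM sN \<phi>)
    show "\<phi> m k \<in> fil H (i + j)" if m: "m \<in> fil ?M i" and k: "k \<in> fil ?N j" for m k i j
    proof -
      have m': "m \<in> step_fil J c i" and k': "k \<in> step_fil K c' j" using m k by (simp_all add: sM sN)
      have up: "x \<in> fil H (i + j)" if "x \<in> fil H l" "i + j \<le> l" for x l
        using gfmodule_fil_mono[OF H that(2)] that(1) by blast
      note gz = gf_fil_closed(1)[OF H] and g0 = gf_fil_closed(5)[OF H f0]
      from m' show ?thesis
      proof (cases rule: step_fil_cases[OF Ji, consumes 1, case_names 1 2 3])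
        case m: (1 p)
        from k' show ?thesis
          by (cases rule: step_fil_cases[OF Ki, consumes 1, case_names 1 2 3]) (use m up[OF g0] up[OF f1(2)] z(2) gz in \<open>auto simp: \<phi>\<close>)
      next
        case m: (2 p)
        from k' show ?thesis
          by (cases rule: step_fil_cases[OF Ki, consumes 1, case_names 1 2 3]) (use m up[OF f1(1)] up[OF f2] z(2) gz in \<open>auto simp: \<phi>\<close>)
      next
        case 3
        from k' show ?thesis
          by (cases rule: step_fil_cases[OF Ki, consumes 1, case_names 1 2 3]) (use 3 z gz in \<open>auto simp: \<phi>\<close>)
      qed
    qed
  qed (use h in \<open>auto simp: sM sN \<phi> const y x hf\<close>)
  moreover have "h (ptens ?M ?N (cls J p) (cls K q)) = \<psi> p q \<odot>\<^bsub>H\<^esub> n" for p q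
    using h(3) \<phi> by (simp add: sM sN)
  ultimately show thesis by (rule that)
qed

subsection \<open>Generators of tensor products\<close>

lemma tens_cyclic_actions:
  fixes J K :: "'n::finite bpoly set" and F G :: "int \<Rightarrow> 'n bpoly set set"
  assumes J: "ideal J PR" and K: "ideal K PR"
  defines "M \<equiv> quot_gf J F" and "N \<equiv> quot_gf K G"
  defines "pt \<equiv> \<lambda>p q. ptens M N (cls J p) (cls K q)"
  shows "pt p q \<in> carrier (tens M N)"
    "pt (p + p') q = pt p q \<oplus>\<^bsub>tens M N\<^esub> pt p' q" "pt p (q + q') = pt p q \<oplus>\<^bsub>tens M N\<^esub> pt p q'"
    "const a \<odot>\<^bsub>tens M N\<^esub> pt p q = pt (const a * p) q"
    "mvar (Yv i) \<odot>\<^bsub>tens M N\<^esub> pt p q = pt (mvar (Yv i) * p) q"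
    "mvar (Xv i) \<odot>\<^bsub>tens M N\<^esub> pt p q = pt p (mvar (Xv i) * q)"
    "pt (mvar (Xv i) * p) q = pt p (mvar (Yv i) * q)"
    "pt (const a * p) q = pt p (const a * q)"
    "p - p' \<in> J \<Longrightarrow> pt p q = pt p' q" "q - q' \<in> K \<Longrightarrow> pt p q = pt p q'"
proof -
  note m = module_quot_gf[OF J, of F, folded M_def] module_quot_gf[OF K, of G, folded N_def]
  note s = quot_gf_simps[OF J, of F, folded M_def] quot_gf_simps[OF K, of G, folded N_def]
  note b = balancedD[OF ptens_balanced[OF m]] and g = tens_smult_generators[OF m]
  have c: "cls J p \<in> carrier M" "cls K p \<in> carrier N" for p by (simp_all add: s)
  show "pt p q \<in> carrier (tens M N)"
    "pt (p + p') q = pt p q \<oplus>\<^bsub>tens M N\<^esub> pt p' q" "pt p (q + q') = pt p q \<oplus>\<^bsub>tens M N\<^esub> pt p q'"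
    "const a \<odot>\<^bsub>tens M N\<^esub> pt p q = pt (const a * p) q"
    "mvar (Yv i) \<odot>\<^bsub>tens M N\<^esub> pt p q = pt (mvar (Yv i) * p) q"
    "mvar (Xv i) \<odot>\<^bsub>tens M N\<^esub> pt p q = pt p (mvar (Xv i) * q)"
    "pt (mvar (Xv i) * p) q = pt p (mvar (Yv i) * q)" using b(1)[OF c] b(2)[OF c(1) c(1) c(2)] b(3)[OF c(1) c(2) c(2)]
      b(4)[OF c, of "mvar i"] g[OF c] by (simp_all add: pt_def s mpoly_subst_simps)
  show "pt (const a * p) q = pt p (const a * q)"
    using b(4)[OF c, of "const a"] by (simp add: pt_def s mpoly_subst_const)
  show "p - p' \<in> J \<Longrightarrow> pt p q = pt p' q" "q - q' \<in> K \<Longrightarrow> pt p q = pt p q'"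
    using cls_eq_iff[OF J] cls_eq_iff[OF K] by (metis pt_def)+
qed

text \<open>The elements \<open>y_plus\<close>, \<open>y_minus\<close>, \<open>x_plus\<close> and
  \<open>x_minus\<close> are polynomials in one set of variables; by these rules they act on a
  tensor product or cross the tensor sign.\<close>

lemma tens_cyclic_poly_actions:
  fixes J K :: "'n::finite bpoly set" and F G :: "int \<Rightarrow> 'n bpoly set set"
  assumes J: "ideal J PR" and K: "ideal K PR"
  defines "M \<equiv> quot_gf J F" and "N \<equiv> quot_gf K G"
  defines "pt \<equiv> \<lambda>p q. ptens M N (cls J p) (cls K q)"
  shows "yvars r \<odot>\<^bsub>tens M N\<^esub> pt p q = pt (yvars r * p) q"
    "xvars r \<odot>\<^bsub>tens M N\<^esub> pt p q = pt p (xvars r * q)"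
    "pt (xvars r * p) q = pt p (yvars r * q)"
proof -
  have pt: "ptens M N (cls J p) (cls K q) = pt p q" for p q by (simp add: pt_def)
  note a = tens_cyclic_actions[OF J K, where F = F and G = G, folded M_def N_def, unfolded pt]
  have "module PR (tens M N)"
    unfolding M_def N_def by (rule module_tens[OF module_quot_gf[OF J] module_quot_gf[OF K]])
  note f = module_smult_facts[OF this a(1)]
  have c: "yvars (const b) = const b" "xvars (const b) = const b" for b by (simp_all add: mpoly_subst_const)
  show "yvars r \<odot>\<^bsub>tens M N\<^esub> pt p q = pt (yvars r * p) q"
  proof (induction r arbitrary: p q rule: mpoly_induct)
    case (var v r)
    show ?case unfolding mpoly_subst_simps f(3) var a(5) mult.assoc ..
  qed (simp_all add: c f a mpoly_subst_simps distrib_right)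
  show "xvars r \<odot>\<^bsub>tens M N\<^esub> pt p q = pt p (xvars r * q)"
  proof (induction r arbitrary: p q rule: mpoly_induct)
    case (const b)
    then show ?case using a(4,8) by (simp add: c)
  next
    case (var v r)
    then show ?case by (simp add: mpoly_subst_simps f(3) a(6) mult.assoc)
  qed (simp_all add: f a(3) mpoly_subst_simps distrib_right)
  show "pt (xvars r * p) q = pt p (yvars r * q)"
  proof (induction r arbitrary: p q rule: mpoly_induct)
    case (const b)
    then show ?case using a(8) by (simp add: c)
  next
    case (var v r)
    then show ?case by (simp add: mpoly_subst_simps a(7) mult.assoc mult.left_commute)
  qed (simp_all add: a(2,3) mpoly_subst_simps distrib_right)
qed

section \<open>The algebra of M \<otimes> M: relations, generators and the trace\<close>

section \<open>The two-strand bimodules\<close>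

text \<open>The numeral type \<open>2\<close> consists of the integers modulo two, in which the
  strand index \<open>2\<close> is \<open>0\<close>.\<close>

lemma exhaust_2: "i = 1 \<or> i = (2 :: 2)"
proof (induction i)
  case (of_int z)
  then have "z = 0 \<or> z = 1" by auto
  then show ?case by auto
qed

lemma Idl_PR_pair: "Idl\<^bsub>PR\<^esub> {a, b :: 'v mpoly} = {u * a + v * b | u v. True}"
proof -
  interpret cring "PR :: 'v mpoly ring" by (rule cring_PR)
  let ?I = "{u * a + v * b | u v. True}"
  have I: "ideal ?I (PR :: 'v mpoly ring)" unfolding ideal_PR_iff
  proof (intro conjI ballI allI)
    show "0 \<in> ?I" by (rule CollectI, rule exI[of _ 0], rule exI[of _ 0]) simp
    show "p + q \<in> ?I" if pq: "p \<in> ?I" "q \<in> ?I" for p q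
    proof -
      obtain u v u' v' where "p = u * a + v * b" "q = u' * a + v' * b" using pq by blast
      then have "p + q = (u + u') * a + (v + v') * b" by (simp add: algebra_simps)
      then show ?thesis by blast
    qed
    show "q * p \<in> ?I" if p: "p \<in> ?I" for p q
    proof -
      obtain u v where "p = u * a + v * b" using p by blast
      then have "q * p = (q * u) * a + (q * v) * b" by (simp add: algebra_simps)
      then show ?thesis by blast
    qed
  qed
  have ab: "{a, b} \<subseteq> ?I"
  proof -
    have "a = 1 * a + 0 * b" "b = 0 * a + 1 * b" by simp_all
    then show ?thesis by blast
  qed
  have G: "ideal (Idl\<^bsub>PR\<^esub> {a, b}) (PR :: 'v mpoly ring)" by (rule genideal_ideal) simp
  have "a \<in> Idl\<^bsub>PR\<^esub> {a, b}" "b \<in> Idl\<^bsub>PR\<^esub> {a, b}" using genideal_self[of "{a, b}"] by auto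
  then have "?I \<subseteq> Idl\<^bsub>PR\<^esub> {a, b}" using ideal_PR[OF G] by auto
  then show ?thesis using genideal_minimal[OF I ab] by blast
qed

lemma hideal_pair:
  fixes a b :: "'v mpoly"
  assumes "homog d a" "homog e b"
  shows "hideal (Idl\<^bsub>PR\<^esub> {a, b})"
proof -
  interpret cring "PR :: 'v mpoly ring" by (rule cring_PR)
  have "ideal (Idl\<^bsub>PR\<^esub> {a, b}) (PR :: 'v mpoly ring)" by (rule genideal_ideal) simp
  moreover have "hcomp i p \<in> Idl\<^bsub>PR\<^esub> {a, b}" if p: "p \<in> Idl\<^bsub>PR\<^esub> {a, b}" for p i
  proof -
    obtain u v where "p = a * u + b * v" using p unfolding Idl_PR_pair by (auto simp: mult.commute)
    then have "hcomp i p = hcomp (i - d) u * a + hcomp (i - e) v * b"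
      by (simp add: hcomp_add hcomp_mult[OF assms(1)] hcomp_mult[OF assms(2)] mult.commute)
    then show ?thesis unfolding Idl_PR_pair by blast
  qed
  ultimately show ?thesis by (simp add: hideal_def)
qed

lemma homog_xy_minus:
  "homog 2 (y_plus - x_plus)" "homog 2 (y_minus + x_minus)" "homog 2 (y_minus - x_minus)"
  "homog 4 ((y_minus + x_minus) * (y_minus - x_minus))" "homog 2 (mvar v - mvar w)"
proof -
  show 1: "homog 2 (y_plus - x_plus)" "homog 2 (y_minus + x_minus)" "homog 2 (y_minus - x_minus)"
    "homog 2 (mvar v - mvar w)"
    unfolding y_plus_def x_plus_def y_minus_def x_minus_def by (intro homog_diff homog_add homog_mvar)+
  show "homog 4 ((y_minus + x_minus) * (y_minus - x_minus))" using homog_mult[OF 1(2,3)] by simp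
qed

lemma hideal_I: "hideal ideal_I" and hideal_M: "hideal ideal_M"
  unfolding ideal_I_def ideal_M_def by (rule hideal_pair homog_xy_minus)+

text \<open>\<open>ideal_M\<close> lies in \<open>ideal_I\<close> because its quadratic generator is
  a multiple of y_- - x_- and its linear one is the sum of the generators of \<open>ideal_I\<close>;
  this makes I a quotient of M.\<close>

lemma ideal_generators:
  "mvar (Yv i) - mvar (Xv i) \<in> ideal_I" "y_plus - x_plus \<in> ideal_M"
  "(y_minus + x_minus) * (y_minus - x_minus) \<in> ideal_M" "ideal_M \<subseteq> ideal_I"
  "y_minus - x_minus \<in> ideal_I"
proof -
  interpret cring "PR :: 2 bpoly ring" by (rule cring_PR)
  have gI: "mvar (Yv 1) - mvar (Xv 1) \<in> ideal_I" "mvar (Yv 2) - mvar (Xv 2) \<in> ideal_I"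
    and gM: "y_plus - x_plus \<in> ideal_M" "(y_minus + x_minus) * (y_minus - x_minus) \<in> ideal_M"
    using genideal_self[of "{mvar (Yv 1) - mvar (Xv 1), mvar (Yv 2) - mvar (Xv 2)}"]
      genideal_self[of "{y_plus - x_plus, (y_minus + x_minus) * (y_minus - x_minus)}"]
    by (auto simp: ideal_I_def ideal_M_def)
  show "y_plus - x_plus \<in> ideal_M" "(y_minus + x_minus) * (y_minus - x_minus) \<in> ideal_M" by fact+
  show "mvar (Yv i) - mvar (Xv i) \<in> ideal_I" using exhaust_2[of i] gI by auto
  note I = ideal_PR[OF hidealD(1)[OF hideal_I]]
  have eq: "y_plus - x_plus = (mvar (Yv 2) - mvar (Xv 2)) + (mvar (Yv 1) - mvar (Xv 1))"
    "y_minus - x_minus = (mvar (Yv 2) - mvar (Xv 2)) - (mvar (Yv 1) - mvar (Xv 1))"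
    by (simp_all add: y_plus_def x_plus_def y_minus_def x_minus_def)
  have 1: "y_plus - x_plus \<in> ideal_I" and 2: "y_minus - x_minus \<in> ideal_I"
    unfolding eq by (rule I(2)[OF gI(2,1)], rule I(6)[OF gI(2,1)])
  show "y_minus - x_minus \<in> ideal_I" by fact
  show "ideal_M \<subseteq> ideal_I" unfolding ideal_M_def
    by (rule genideal_minimal[OF hidealD(1)[OF hideal_I]]) (use 1 I(3)[OF 2] in auto)
qed

lemma const_minus1: "const (-1) = (-1 :: 'v mpoly)" by (metis single_one single_uminus)

lemma xy_pm_vars:
  "y_plus = yvars (mvar 2 + mvar 1)" "x_plus = xvars (mvar 2 + mvar 1)"
  "y_minus = yvars (mvar 2 + const (-1) * mvar 1)" "x_minus = xvars (mvar 2 + const (-1) * mvar 1)"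
proof -
  show "y_plus = yvars (mvar 2 + mvar 1)" "x_plus = xvars (mvar 2 + mvar 1)"
    "y_minus = yvars (mvar 2 + const (-1) * mvar 1)" "x_minus = xvars (mvar 2 + const (-1) * mvar 1)"
    unfolding y_plus_def x_plus_def y_minus_def x_minus_def mpoly_subst_simps mpoly_subst_const
    by (simp_all add: const_minus1)
qed

lemma const_half: "const (1/2 :: rat) * (p + p) = (p :: 'v mpoly)"
proof -
  have "const (1/2 :: rat) * (p + p) = (const (1/2) + const (1/2)) * p" by (simp add: algebra_simps)
  also have "const (1/2 :: rat) + const (1/2) = (1 :: 'v mpoly)" by (simp add: single_add[symmetric])
  finally show ?thesis by simp
qed

lemma xv_half:
  "mvar (Xv 2) = const (1/2) * (x_plus + x_minus)" "mvar (Xv 1) = const (1/2) * (x_plus - x_minus)"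
  using const_half[of "mvar (Xv 2) :: 2 bpoly"] const_half[of "mvar (Xv 1) :: 2 bpoly"]
  by (simp_all add: x_plus_def x_minus_def algebra_simps)

context
  fixes J K :: "2 bpoly set" and F G :: "int \<Rightarrow> 2 bpoly set set"
  assumes J: "ideal J PR" "ideal_M \<subseteq> J" and K: "ideal K PR" "ideal_M \<subseteq> K"
begin

private abbreviation "MJ \<equiv> quot_gf J F"
private abbreviation "NK \<equiv> quot_gf K G"
private abbreviation "TJK \<equiv> tens MJ NK"
private abbreviation "cpt p q \<equiv> ptens MJ NK (cls J p) (cls K q)"

private lemmas cact = tens_cyclic_actions[OF J(1) K(1), where F = F and G = G]

lemma tens_xy_actions:
  "y_plus \<odot>\<^bsub>TJK\<^esub> cpt p q = cpt (y_plus * p) q" "x_plus \<odot>\<^bsub>TJK\<^esub> cpt p q = cpt p (x_plus * q)"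
  "y_minus \<odot>\<^bsub>TJK\<^esub> cpt p q = cpt (y_minus * p) q" "x_minus \<odot>\<^bsub>TJK\<^esub> cpt p q = cpt p (x_minus * q)"
  "cpt (x_plus * p) q = cpt p (y_plus * q)" "cpt (x_minus * p) q = cpt p (y_minus * q)"
  unfolding xy_pm_vars by (rule tens_cyclic_poly_actions[OF J(1) K(1)])+

text \<open>In M one has x_+ = y_+ and x_-^2 = y_-^2. The relations hold in each factor because both
  ideals contain \<open>ideal_M\<close>, and so tie the middle variables to the outer ones on either
  side.\<close>

lemma pt_reduce:
  "cpt (x_plus * p) q = cpt (y_plus * p) q" "cpt p (x_plus * q) = cpt p (y_plus * q)"
  "cpt (x_minus * (x_minus * p)) q = cpt (y_minus * (y_minus * p)) q" "cpt p (x_minus * (x_minus * q)) = cpt p (y_minus * (y_minus * q))"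
proof -
  have 1: "(x_plus - y_plus) * p \<in> ideal_M" "(x_minus * x_minus - y_minus * y_minus) * p \<in> ideal_M" for p
  proof -
    have "(x_plus - y_plus) * p = - ((y_plus - x_plus) * p)"
      "(x_minus * x_minus - y_minus * y_minus) * p = - ((y_minus + x_minus) * (y_minus - x_minus) * p)"
      by (simp_all add: algebra_simps)
    then show "(x_plus - y_plus) * p \<in> ideal_M" "(x_minus * x_minus - y_minus * y_minus) * p \<in> ideal_M"
      using ideal_generators(2,3) ideal_PR(4,5)[OF hidealD(1)[OF hideal_M]] by simp_all
  qed
  show "cpt (x_plus * p) q = cpt (y_plus * p) q" by (rule cact(9)) (use 1(1)[of p] J in \<open>auto simp: algebra_simps\<close>)
  show "cpt p (x_plus * q) = cpt p (y_plus * q)" by (rule cact(10)) (use 1(1)[of q] K in \<open>auto simp: algebra_simps\<close>)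
  show "cpt (x_minus * (x_minus * p)) q = cpt (y_minus * (y_minus * p)) q"
    by (rule cact(9)) (use 1(2)[of p] J in \<open>auto simp: algebra_simps\<close>)
  show "cpt p (x_minus * (x_minus * q)) = cpt p (y_minus * (y_minus * q))"
    by (rule cact(10)) (use 1(2)[of q] K in \<open>auto simp: algebra_simps\<close>)
qed

lemma tens_cyclic_module: "module PR TJK" by (rule module_tens[OF module_quot_gf[OF J(1)] module_quot_gf[OF K(1)]])

text \<open>The relations of M pass through the middle: y_+ equals the middle sum and hence x_+, and
  y_-^2 equals \<epsilon>^2 and hence x_-^2. This is what makes assignments landing in multiples of
  1 \<otimes> 1 well defined modulo \<open>ideal_M\<close>.\<close>

lemma ideal_M_annihilates:
  assumes "p \<in> ideal_M"
  shows "p \<odot>\<^bsub>TJK\<^esub> cpt 1 1 = \<zero>\<^bsub>TJK\<^esub>"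
proof -
  interpret T: module PR TJK by (rule tens_cyclic_module)
  note f = module_smult_facts[OF tens_cyclic_module cact(1)]
  have diff: "(p - q) \<odot>\<^bsub>TJK\<^esub> cpt 1 1 = p \<odot>\<^bsub>TJK\<^esub> cpt 1 1 \<ominus>\<^bsub>TJK\<^esub> q \<odot>\<^bsub>TJK\<^esub> cpt 1 1" for p q
    using f(2)[of p "- q" 1 1] f(7)[of q 1 1] by (simp add: a_minus_def)
  have 1: "(y_plus - x_plus) \<odot>\<^bsub>TJK\<^esub> cpt 1 1 = \<zero>\<^bsub>TJK\<^esub>"
  proof -
    have "y_plus \<odot>\<^bsub>TJK\<^esub> cpt 1 1 = x_plus \<odot>\<^bsub>TJK\<^esub> cpt 1 1"
      unfolding tens_xy_actions(1,2) using pt_reduce(1,2)[of 1 1] tens_xy_actions(5)[of 1 1] by simp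
    then show ?thesis unfolding diff a_minus_def using T.M.r_neg[OF f(1)] by simp
  qed
  have 2: "((y_minus + x_minus) * (y_minus - x_minus)) \<odot>\<^bsub>TJK\<^esub> cpt 1 1 = \<zero>\<^bsub>TJK\<^esub>"
  proof -
    have e: "(y_minus + x_minus) * (y_minus - x_minus) = y_minus * y_minus - x_minus * x_minus"
      by (simp add: algebra_simps)
    have "(y_minus * y_minus) \<odot>\<^bsub>TJK\<^esub> cpt 1 1 = (x_minus * x_minus) \<odot>\<^bsub>TJK\<^esub> cpt 1 1"
      unfolding f(3) tens_xy_actions(3,4)
      using pt_reduce(3,4)[of 1 1] tens_xy_actions(6)[of "x_minus * 1" 1] tens_xy_actions(6)[of 1 "y_minus * 1"] by simp
    then show ?thesis unfolding e diff a_minus_def using T.M.r_neg[OF f(1)] by simp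
  qed
  obtain u v where "p = u * (y_plus - x_plus) + v * ((y_minus + x_minus) * (y_minus - x_minus))"
    using assms unfolding ideal_M_def Idl_PR_pair by blast
  then show ?thesis using 1 2 T.smult_r_null by (simp add: f)
qed

text \<open>Over the outer variables the middle ones satisfy a quadratic relation: their sum is y_+
  and \<epsilon>^2 = y_-^2. So 1 \<otimes> 1 and \<epsilon> (1 \<otimes> 1), written
  \<open>cpt x_minus 1\<close>, generate, and two values determine a morphism.\<close>

lemma tens_generators:
  assumes H: "abelian_group H" and f: "gfhom TJK H f" and g: "gfhom TJK H g"
    and 1: "f (cpt 1 1) = g (cpt 1 1)" and w: "f (cpt x_minus 1) = g (cpt x_minus 1)"
    and z: "z \<in> carrier TJK"
  shows "f z = g z"
proof -
  note fl = gfhomD[OF f] and gl = gfhomD[OF g]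
  define U where "U = {z \<in> carrier TJK. f z = g z}"
  note fc = module_smult_facts[OF tens_cyclic_module]
  have Ua: "x \<oplus>\<^bsub>TJK\<^esub> y \<in> U" if "x \<in> U" "y \<in> U" for x y
    using that fl(2) gl(2) abelian_monoid.a_closed[OF abelian_group.axioms(1)[OF module.axioms(2)[OF tens_cyclic_module]]] by (auto simp: U_def)
  have Us: "p \<odot>\<^bsub>TJK\<^esub> x \<in> U" if "x \<in> U" for p x using that fc(1) fl(3) gl(3) by (auto simp: U_def)
  \<comment> \<open>A middle variable is half of the sum or difference of \<open>x_plus\<close> and
    \<open>x_minus\<close>; this uses that 2 is invertible.\<close>
  have half: "cpt (mvar (Xv i) * p) q \<in> U" if U: "cpt (x_plus * p) q \<in> U" "cpt (x_minus * p) q \<in> U" for i p q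
  proof -
    have "cpt (mvar (Xv 2) * p) q = const (1/2) \<odot>\<^bsub>TJK\<^esub> (cpt (x_plus * p) q \<oplus>\<^bsub>TJK\<^esub> cpt (x_minus * p) q)"
      unfolding xv_half cact(2)[symmetric] cact(4) by (simp add: algebra_simps)
    moreover have "cpt (mvar (Xv 1) * p) q = const (1/2) \<odot>\<^bsub>TJK\<^esub> (cpt (x_plus * p) q \<oplus>\<^bsub>TJK\<^esub> const (-1) \<odot>\<^bsub>TJK\<^esub> cpt (x_minus * p) q)"
      unfolding xv_half cact(4) cact(2)[symmetric] by (simp add: algebra_simps const_minus1)
    ultimately show ?thesis using exhaust_2[of i] Ua Us U by metis
  qed
  \<comment> \<open>Multiplication by a middle variable stays in the span of the two generators,
    because the middle sum is y_+ and the square of the middle difference is y_-^2.\<close>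
  have step: "cpt (mvar (Xv i)) q \<in> U \<and> cpt (x_minus * mvar (Xv i)) q \<in> U" if "cpt 1 q \<in> U" "cpt x_minus q \<in> U" for i q
  proof
    have y: "cpt (y_plus * 1) q \<in> U" "cpt (y_plus * x_minus) q \<in> U" "cpt (y_minus * (y_minus * 1)) q \<in> U"
      unfolding tens_xy_actions(1,3)[symmetric] using that Us by auto
    show "cpt (mvar (Xv i)) q \<in> U" using half[of 1 q i] y(1) that(2) pt_reduce(1)[of 1 q] by simp
    show "cpt (x_minus * mvar (Xv i)) q \<in> U"
      using half[of x_minus q i] y pt_reduce(1)[of x_minus q] pt_reduce(3)[of 1 q] by (simp add: mult.commute)
  qed
  have left: "cpt p q \<in> U" if "cpt 1 q \<in> U" "cpt x_minus q \<in> U" for p q using that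
  proof (induction p arbitrary: q rule: mpoly_induct)
    case (const a)
    then show ?case using Us[of "cpt 1 q" "const a"] unfolding cact(4) by simp
  next
    case (add p p')
    then show ?case unfolding cact(2) using Ua by blast
  next
    case (var v p)
    show ?case
    proof (cases v)
      case (Xv i)
      have "cpt 1 (mvar (Yv i) * q) = cpt (mvar (Xv i)) q" "cpt x_minus (mvar (Yv i) * q) = cpt (x_minus * mvar (Xv i)) q"
        using cact(7)[of i 1 q] cact(7)[of i x_minus q] by (simp_all add: mult.commute)
      then have "cpt p (mvar (Yv i) * q) \<in> U" using var(1) step[OF var(2,3), of i] by simp
      then show ?thesis unfolding Xv cact(7) .
    next
      case (Yv i)
      show ?thesis unfolding Yv cact(5)[symmetric] using var Us by blast
    qed
  qed
  have right: "cpt 1 q \<in> U \<and> cpt x_minus q \<in> U" for q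
  proof (induction q rule: mpoly_induct)
    case (const a)
    have "cpt 1 1 \<in> U" "cpt x_minus 1 \<in> U" using 1 w cact(1) by (simp_all add: U_def)
    then show ?case using Us[of "cpt 1 1" "const a"] Us[of "cpt x_minus 1" "const a"] unfolding cact(4) cact(8) by simp
  next
    case (add p p')
    then show ?case unfolding cact(3) using Ua by blast
  next
    case (var v q)
    show ?case
    proof (cases v)
      case (Xv i)
      show ?thesis unfolding Xv cact(6)[symmetric] using var Us by blast
    next
      case (Yv i)
      show ?thesis unfolding Yv cact(7)[symmetric] using var left by blast
    qed
  qed
  have ptU: "cpt p q \<in> U" for p q using left right by blast
  show ?thesis by (rule tens_additive_eqI[OF module_quot_gf[OF J(1)] module_quot_gf[OF K(1)] H _ _ fl(2) gl(2) _ z])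
      (use fl(1) gl(1) ptU in \<open>auto simp: quot_gf_simps[OF J(1)] quot_gf_simps[OF K(1)] U_def\<close>)
qed

text \<open>A factor \<open>I\<close> moves \<open>x\<^sub>-\<close> out of the tensor product, so one generator suffices.\<close>

lemma tens_generator_I:
  assumes JK: "J = ideal_I \<or> K = ideal_I" and H: "abelian_group H" and f: "gfhom TJK H f" and g: "gfhom TJK H g"
    and 1: "f (cpt 1 1) = g (cpt 1 1)" and z: "z \<in> carrier TJK"
  shows "f z = g z"
proof (rule tens_generators[OF H f g 1 _ z])
  have d: "x_minus - y_minus \<in> ideal_I" "y_minus - x_minus \<in> ideal_I"
    using ideal_generators(5) ideal_PR(5)[OF hidealD(1)[OF hideal_I], of "y_minus - x_minus"] by simp_all
  have "\<exists>c. cpt x_minus 1 = c \<odot>\<^bsub>TJK\<^esub> cpt 1 1" using JK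
  proof
    assume "J = ideal_I"
    then have "cpt x_minus 1 = y_minus \<odot>\<^bsub>TJK\<^esub> cpt 1 1" unfolding tens_xy_actions using cact(9)[of x_minus y_minus 1] d by simp
    then show ?thesis by blast
  next
    assume "K = ideal_I"
    then have "cpt 1 y_minus = x_minus \<odot>\<^bsub>TJK\<^esub> cpt 1 1" unfolding tens_xy_actions using cact(10)[of y_minus x_minus 1] d by simp
    then show ?thesis using tens_xy_actions(6)[of 1 1] by auto
  qed
  then show "f (cpt x_minus 1) = g (cpt x_minus 1)" using gfhomD(3)[OF f cact(1)] gfhomD(3)[OF g cact(1)] 1 by metis
qed

end

subsection \<open>The coefficient of the middle variable\<close>

text \<open>The abstract predicate \<open>H\<close> covers homogeneity both of polynomials and of
  elements of \<open>quad\<close>.\<close>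

lemma meval_homog:
  fixes c :: "rat \<Rightarrow> 'b::comm_ring_1" and f :: "'v \<Rightarrow> 'b"
  assumes c: "rat_algebra c"
    and H: "\<And>d. H d 0" "\<And>d x y. H d x \<Longrightarrow> H d y \<Longrightarrow> H d (x + y)"
      "\<And>d e x y. H d x \<Longrightarrow> H e y \<Longrightarrow> H (d + e) (x * y)" "\<And>a. H (0 :: int) (c a)" "\<And>v. H 2 (f v)"
    and p: "homog d p"
  shows "H d (meval c f p)"
proof -
  have m: "H (qdeg \<mu>) (mexp f \<mu>)" for \<mu>
  proof (induction \<mu> rule: nat_pm_induct)
    case zero
    then show ?case using H(4)[of 1] rat_algebraD(2)[OF c] by simp
  next
    case (plus v \<mu>)
    then show ?case using H(3)[OF H(5) plus, of v] by (simp add: mexp_add qdeg_add)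
  qed
  have s: "H d (c (Poly_Mapping.lookup p \<mu>) * mexp f \<mu>)" if "\<mu> \<in> Poly_Mapping.keys p" for \<mu>
    using H(3)[OF H(4)[of "Poly_Mapping.lookup p \<mu>"] m[of \<mu>]] p that by (simp add: homog_iff)
  have "H d (\<Sum>\<mu>\<in>S. c (Poly_Mapping.lookup p \<mu>) * mexp f \<mu>)" if "finite S" "S \<subseteq> Poly_Mapping.keys p" for S
    using that by induction (use H(1,2) s in auto)
  then show ?thesis by (simp add: meval_def)
qed

lemma mpoly_subst_homog:
  assumes "\<And>v. homog 2 (f v)" "homog d p"
  shows "homog d (mpoly_subst f p)" unfolding mpoly_subst_meval
  by (rule meval_homog[OF rat_algebra_single _ _ _ _ _ assms(2)]) (auto intro: homog_add homog_mult homog_const assms(1))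

text \<open>
  The ring \<open>\<rat>[x, y][\<epsilon>] / (\<epsilon>\<^sup>2 - y\<^sub>-\<^sup>2)\<close>; \<open>\<epsilon>\<close> is the difference of the middle variables in \<open>M \<otimes> M\<close>.
\<close>

datatype quad = Quad (qre: "2 bpoly") (qep: "2 bpoly")

instantiation quad :: comm_ring_1
begin

definition "0 = Quad 0 0"
definition "1 = Quad 1 0"
definition "z + w = Quad (qre z + qre w) (qep z + qep w)"
definition "- z = Quad (- qre z) (- qep z)"
definition "z - w = Quad (qre z - qre w) (qep z - qep w)"
definition "z * w = Quad (qre z * qre w + y_minus * y_minus * (qep z * qep w)) (qre z * qep w + qep z * qre w)"

instance by standard (simp_all add: zero_quad_def one_quad_def plus_quad_def uminus_quad_def minus_quad_def
      times_quad_def algebra_simps)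

end

lemma quad_simps [simp]:
  "qre 0 = 0" "qep 0 = 0" "qre 1 = 1" "qep 1 = 0" "qre (z + w) = qre z + qre w" "qep (z + w) = qep z + qep w"
  "qre (z - w) = qre z - qre w" "qep (z - w) = qep z - qep w"
  "qre (z * w) = qre z * qre w + y_minus * y_minus * (qep z * qep w)" "qep (z * w) = qre z * qep w + qep z * qre w"
  by (simp_all add: zero_quad_def one_quad_def plus_quad_def minus_quad_def times_quad_def)

lemma quad_eqI: "qre z = qre w \<Longrightarrow> qep z = qep w \<Longrightarrow> z = w" by (cases z; cases w) simp

definition qconst :: "rat \<Rightarrow> quad" where
  "qconst a = Quad (const a) 0"

lemma rat_algebra_qconst: "rat_algebra qconst"
  by (auto simp: rat_algebra_def qconst_def single_add mult_single intro!: quad_eqI)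

text \<open>The middle variables recovered from their sum y_+ and their difference \<epsilon>: (y_+
  - \<epsilon>)/2 and (y_+ + \<epsilon>)/2.\<close>

definition mid :: "2 \<Rightarrow> quad" where
  "mid i = Quad (const (1/2) * y_plus) (const (if i = 1 then - 1/2 else 1/2))"

text \<open>\<open>evl\<close> places polynomials of the left factor, and \<open>evr\<close> those
  of the right factor, into the common ring: variables facing the middle become \<open>mid\<close>,
  the others stay outer.\<close>

definition evl :: "2 bpoly \<Rightarrow> quad" where
  "evl = meval qconst (\<lambda>v. case v of Xv i \<Rightarrow> mid i | Yv i \<Rightarrow> Quad (mvar (Yv i)) 0)"

definition evr :: "2 bpoly \<Rightarrow> quad" where
  "evr = meval qconst (\<lambda>v. case v of Xv i \<Rightarrow> Quad (mvar (Xv i)) 0 | Yv i \<Rightarrow> mid i)"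

lemma ev_simps [simp]:
  "evl (p + q) = evl p + evl q" "evl (p - q) = evl p - evl q" "evl (p * q) = evl p * evl q" "evl 1 = 1" "evl 0 = 0"
  "evr (p + q) = evr p + evr q" "evr (p - q) = evr p - evr q" "evr (p * q) = evr p * evr q" "evr 1 = 1" "evr 0 = 0"
  "evl (const a) = Quad (const a) 0" "evr (const a) = Quad (const a) 0"
  "evl (mvar (Xv i)) = mid i" "evl (mvar (Yv i)) = Quad (mvar (Yv i)) 0"
  "evr (mvar (Xv i)) = Quad (mvar (Xv i)) 0" "evr (mvar (Yv i)) = mid i" unfolding evl_def evr_def
  by (simp_all add: meval_add meval_diff meval_mult meval_1 meval_0 meval_single meval_mvar rat_algebra_qconst)
    (simp_all add: qconst_def)

lemma mid_pm: "mid 2 + mid 1 = Quad y_plus 0" "mid 2 - mid 1 = Quad 0 1"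
proof -
  have h: "const (1/2 :: rat) * p + const (1/2) * p = p" for p :: "2 bpoly"
    by (simp add: distrib_right[symmetric] single_add[symmetric])
  have "const (1/2 :: rat) + const (- 1/2) = (0 :: 2 bpoly)" "const (1/2 :: rat) - const (- 1/2) = (1 :: 2 bpoly)"
    by (simp_all add: single_add[symmetric] single_diff[symmetric])
  then show "mid 2 + mid 1 = Quad y_plus 0" "mid 2 - mid 1 = Quad 0 1" by (auto intro!: quad_eqI simp: mid_def h)
qed

lemma ev_pm [simp]:
  "evl x_plus = Quad y_plus 0" "evl x_minus = Quad 0 1" "evl y_plus = Quad y_plus 0" "evl y_minus = Quad y_minus 0"
  "evr y_plus = Quad y_plus 0" "evr y_minus = Quad 0 1" "evr x_plus = Quad x_plus 0" "evr x_minus = Quad x_minus 0"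
  using mid_pm by (auto simp: x_plus_def x_minus_def y_plus_def y_minus_def simp del: quad_simps intro!: quad_eqI)
    (auto simp: plus_quad_def minus_quad_def)

text \<open>The ring \<open>quad\<close> normalises the middle variables by the y-side, so the
  relations of the left factor vanish on the nose. Those of the right factor turn into relations
  between outer variables, which is why \<open>evr\<close> lands in \<open>ideal_M\<close> only
  coefficientwise.\<close>

lemma evl_ideal_M:
  assumes "p \<in> ideal_M"
  shows "evl p = 0"
proof -
  obtain u v where p: "p = u * (y_plus - x_plus) + v * ((y_minus + x_minus) * (y_minus - x_minus))"
    using assms unfolding ideal_M_def Idl_PR_pair by blast
  show ?thesis unfolding p by (auto intro!: quad_eqI simp: algebra_simps)
qed

lemma evr_ideal_M:
  assumes "p \<in> ideal_M"
  shows "qre (evr p) \<in> ideal_M" "qep (evr p) \<in> ideal_M"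
proof -
  note I = ideal_PR[OF hidealD(1)[OF hideal_M]]
  obtain u v where p: "p = u * (y_plus - x_plus) + v * ((y_minus + x_minus) * (y_minus - x_minus))"
    using assms unfolding ideal_M_def Idl_PR_pair by blast
  have e: "evr p = evr u * Quad (y_plus - x_plus) 0 + evr v * Quad ((y_minus + x_minus) * (y_minus - x_minus)) 0"
    unfolding p by (auto intro!: quad_eqI simp: algebra_simps)
  show "qre (evr p) \<in> ideal_M" "qep (evr p) \<in> ideal_M"
    unfolding e using I(2)[OF I(3)[OF ideal_generators(2)] I(3)[OF ideal_generators(3)]] by simp_all
qed

text \<open>\<epsilon> has q-degree 2, whence the drop in the degree of its coefficient.\<close>

definition qhomog :: "int \<Rightarrow> quad \<Rightarrow> bool" where
  "qhomog d z \<longleftrightarrow> homog d (qre z) \<and> homog (d - 2) (qep z)"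

lemma homog_y: "homog 2 y_plus" "homog 2 y_minus"
  unfolding y_plus_def y_minus_def by (rule homog_add homog_diff, rule homog_mvar, rule homog_mvar)+

lemma qhomog_mult:
  assumes "qhomog d z" "qhomog e w"
  shows "qhomog (d + e) (z * w)"
proof -
  have z: "homog d (qre z)" "homog (d - 2) (qep z)" and w: "homog e (qre w)" "homog (e - 2) (qep w)"
    using assms by (auto simp: qhomog_def)
  have "homog (2 + 2 + ((d - 2) + (e - 2))) (y_minus * y_minus * (qep z * qep w))" by (intro homog_mult homog_y z w)
  then have "homog (d + e) (y_minus * y_minus * (qep z * qep w))" by simp
  moreover have "homog (d + e - 2) (qre z * qep w)" "homog (d + e - 2) (qep z * qre w)"
    using homog_mult[OF z(1) w(2)] homog_mult[OF z(2) w(1)] by (simp_all add: algebra_simps)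
  ultimately show ?thesis using homog_mult[OF z(1) w(1)] by (simp add: qhomog_def homog_add)
qed

lemma ev_homog:
  assumes "homog d p"
  shows "qhomog d (evl p)" "qhomog d (evr p)"
proof -
  have m: "qhomog 2 (mid i)" for i
    using homog_mult[OF homog_const homog_y(1), of "1/2"] by (simp add: qhomog_def mid_def homog_const)
  have v: "qhomog 2 (Quad (mvar v) 0)" for v by (simp add: qhomog_def homog_mvar)
  have z: "qhomog e 0" "qhomog e z \<Longrightarrow> qhomog e w \<Longrightarrow> qhomog e (z + w)" "qhomog 0 (qconst a)" for e z w a
    by (simp_all add: qhomog_def homog_add homog_const qconst_def)
  show "qhomog d (evl p)" unfolding evl_def
    by (rule meval_homog[OF rat_algebra_qconst z(1,2) qhomog_mult z(3) _ assms]) (auto simp: m v split: bvar.splits)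
  show "qhomog d (evr p)" unfolding evr_def
    by (rule meval_homog[OF rat_algebra_qconst z(1,2) qhomog_mult z(3) _ assms]) (auto simp: m v split: bvar.splits)
qed

text \<open>The coefficient of \<epsilon>. Exchanging the middle variables negates \<epsilon>, so
  this is half of the divided difference; the normalisation makes the trace of \<epsilon> equal to
  1.\<close>

definition trace :: "2 bpoly \<Rightarrow> 2 bpoly \<Rightarrow> 2 bpoly" where
  "trace p q = qep (evl p * evr q)"

text \<open>With \<epsilon>^2 = y_-^2 one has (y_- + \<epsilon>)(\<epsilon> - x_-) = (y_- -
  x_-)(\<epsilon> + y_-) and (y_- - \<epsilon>)(\<epsilon> + x_-) = (y_- - x_-)(\<epsilon> - y_-).
  The factor y_- - x_- is free of \<epsilon> and comes out of the trace, for either order of the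
  blobs.\<close>

lemma trace_step:
  "trace ((y_minus + x_minus) * p) ((y_minus - x_minus) * q) = (y_minus - x_minus) * qep (Quad y_minus 1 * (evl p * evr q))"
  "trace ((y_minus - x_minus) * p) ((y_minus + x_minus) * q) = (y_minus - x_minus) * qep (Quad (- y_minus) 1 * (evl p * evr q))"
  by (simp_all add: trace_def algebra_simps)

lemma trace_ideal_M: "p \<in> ideal_M \<or> q \<in> ideal_M \<Longrightarrow> trace p q \<in> ideal_M"
  using evl_ideal_M[of p] evr_ideal_M[of q] ideal_PR[OF hidealD(1)[OF hideal_M]] by (auto simp: trace_def)

lemma trace_homog: "homog i p \<Longrightarrow> homog j q \<Longrightarrow> homog (i + j - 2) (trace p q)"
  using qhomog_mult[OF ev_homog(1) ev_homog(2)] by (simp add: trace_def qhomog_def)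

lemma trace_linear:
  "trace (p + p') q = trace p q + trace p' q" "trace p (q + q') = trace p q + trace p q'"
  "trace (const a * p) q = const a * trace p q" "trace p (const a * q) = const a * trace p q"
  "trace (mvar (Xv i) * p) q = trace p (mvar (Yv i) * q)"
  "trace (mvar (Yv i) * p) q = mvar (Yv i) * trace p q" "trace p (mvar (Xv i) * q) = mvar (Xv i) * trace p q"
  by (simp_all add: trace_def algebra_simps)

text \<open>Together with \<open>subst_x\<close> it identifies I with the polynomials in one set of
  variables: it kills \<open>ideal_I\<close> exactly, so an element of a factor I can be rewritten
  in the outer variables.\<close>

definition subst_y :: "2 bpoly \<Rightarrow> 2 bpoly" where
  "subst_y = mpoly_subst (\<lambda>v. case v of Xv i \<Rightarrow> mvar (Yv i) | Yv i \<Rightarrow> mvar (Yv i))"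

definition subst_x :: "2 bpoly \<Rightarrow> 2 bpoly" where
  "subst_x = mpoly_subst (\<lambda>v. case v of Xv i \<Rightarrow> mvar (Xv i) | Yv i \<Rightarrow> mvar (Xv i))"

lemma subst_simps:
  "subst_y (p + q) = subst_y p + subst_y q" "subst_y (p * q) = subst_y p * subst_y q" "subst_y (const a) = const a"
  "subst_y (mvar (Xv i)) = mvar (Yv i)" "subst_y (mvar (Yv i)) = mvar (Yv i)"
  "subst_x (p + q) = subst_x p + subst_x q" "subst_x (p * q) = subst_x p * subst_x q" "subst_x (const a) = const a"
  "subst_x (mvar (Xv i)) = mvar (Xv i)" "subst_x (mvar (Yv i)) = mvar (Xv i)" "subst_x 0 = 0" "subst_y 0 = 0"
  "subst_x 1 = 1" "subst_y 1 = 1" using mpoly_subst_const[of _ 0] mpoly_subst_const[of _ 1]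
  by (simp_all add: subst_y_def subst_x_def mpoly_subst_simps mpoly_subst_const single_one)

lemma subst_homog: "homog d p \<Longrightarrow> homog d (subst_x p)" "homog d p \<Longrightarrow> homog d (subst_y p)"
  unfolding subst_x_def subst_y_def by (rule mpoly_subst_homog; simp add: homog_mvar split: bvar.splits)+

lemma subst_ideal_I:
  assumes "p \<in> ideal_I"
  shows "subst_x p = 0" "subst_y p = 0"
proof -
  have d: "subst_x (mvar (Yv i) - mvar (Xv i)) = 0" "subst_y (mvar (Yv i) - mvar (Xv i)) = 0" for i
    by (simp_all add: subst_x_def subst_y_def mpoly_subst_meval meval_diff[OF rat_algebra_single] meval_mvar[OF rat_algebra_single])
  obtain u v where p: "p = u * (mvar (Yv 1) - mvar (Xv 1)) + v * (mvar (Yv 2) - mvar (Xv 2))"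
    using assms unfolding ideal_I_def Idl_PR_pair by blast
  show "subst_x p = 0" "subst_y p = 0" unfolding p subst_simps d by simp_all
qed

subsection \<open>Homomorphisms between tensor products\<close>

lemma s_q_mod_simps [simp]:
  "carrier (s_mod k M) = carrier M" "\<zero>\<^bsub>s_mod k M\<^esub> = \<zero>\<^bsub>M\<^esub>" "x \<oplus>\<^bsub>s_mod k M\<^esub> y = x \<oplus>\<^bsub>M\<^esub> y"
  "p \<odot>\<^bsub>s_mod k M\<^esub> x = p \<odot>\<^bsub>M\<^esub> x" "qpart (s_mod k M) = qpart M" "fil (s_mod k M) i = fil M (i - k)"
  "carrier (q_mod k M) = carrier M" "\<zero>\<^bsub>q_mod k M\<^esub> = \<zero>\<^bsub>M\<^esub>" "x \<oplus>\<^bsub>q_mod k M\<^esub> y = x \<oplus>\<^bsub>M\<^esub> y"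
  "p \<odot>\<^bsub>q_mod k M\<^esub> x = p \<odot>\<^bsub>M\<^esub> x" "qpart (q_mod k M) q = qpart M (q - k)" "fil (q_mod k M) = fil M"
  by (simp_all add: s_mod_def q_mod_def)

context
  fixes J K :: "2 bpoly set" and c c' :: "2 bpoly" and d d' :: int
  assumes J: "hideal J" "ideal_M \<subseteq> J" "homog d c" and K: "hideal K" "ideal_M \<subseteq> K" "homog d' c'"
begin

private abbreviation "MS \<equiv> quot_gf J (step_fil J c)"
private abbreviation "NS \<equiv> quot_gf K (step_fil K c')"
private abbreviation "TS \<equiv> tens MS NS"
private abbreviation "spt p q \<equiv> ptens MS NS (cls J p) (cls K q)"

private lemma JK: "ideal J PR" "ideal K PR" using hidealD(1) J(1) K(1) by auto

private lemmas sact = tens_cyclic_actions[OF JK, where F = "step_fil J c" and G = "step_fil K c'"]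

lemma gfmodule_tens_step: "gfmodule TS" by (rule gfmodule_tens[OF gfmodule_step[OF J(1,3)] gfmodule_step[OF K(1,3)]])

private lemmas fcl = gf_fil_closed[OF gfmodule_tens_step]

lemma pt_degrees:
  "spt 1 1 \<in> qpart TS 0" "spt p q \<in> fil TS 0" "spt (c * p) q \<in> fil TS 2" "spt p (c' * q) \<in> fil TS 2"
  "p \<in> J \<or> q \<in> K \<Longrightarrow> spt p q = \<zero>\<^bsub>TS\<^esub>"
proof -
  note g = gfmodule_step[OF J(1,3)] gfmodule_step[OF K(1,3)]
  have s: "cls J p \<in> step_fil J c 0" "cls K p \<in> step_fil K c' 0" "cls J (c * p) \<in> step_fil J c 2"
    "cls K (c' * p) \<in> step_fil K c' 2" for p by (auto simp: step_fil_def)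
  show "spt 1 1 \<in> qpart TS 0" by (rule ptens_qpart[OF g, of _ 0 _ 0]) (auto simp: quot_gf_simps JK homog_one)
  show "spt p q \<in> fil TS 0" by (rule ptens_fil[OF g, of _ 0 _ 0]) (auto simp: quot_gf_simps JK s)
  show "spt (c * p) q \<in> fil TS 2" by (rule ptens_fil[OF g, of _ 2 _ 0]) (auto simp: quot_gf_simps JK s)
  show "spt p (c' * q) \<in> fil TS 2" by (rule ptens_fil[OF g, of _ 0 _ 2]) (auto simp: quot_gf_simps JK s)
  have z: "\<zero>\<^bsub>MS\<^esub> = cls J 0" "\<zero>\<^bsub>NS\<^esub> = cls K 0" using quot_gf_simps(2) JK by auto
  note pz = ptens_zero[OF gfmodule_module[OF g(1)] gfmodule_module[OF g(2)]]
  show "p \<in> J \<or> q \<in> K \<Longrightarrow> spt p q = \<zero>\<^bsub>TS\<^esub>"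
    using pz(1)[of "cls K q"] pz(2)[of "cls J p"] sact(9)[of p 0 q] sact(10)[of q 0 p]
    unfolding z by (auto simp: quot_gf_simps JK)
qed

lemma pt_diff: "spt (p - p') q = spt p q \<ominus>\<^bsub>TS\<^esub> spt p' q" "spt p (q - q') = spt p q \<ominus>\<^bsub>TS\<^esub> spt p q'"
proof -
  interpret T: abelian_group TS by (rule gfmodule_abelian_group[OF gfmodule_tens_step])
  show "spt (p - p') q = spt p q \<ominus>\<^bsub>TS\<^esub> spt p' q"
    using sact(2)[of "p - p'" p' q] sact(1) by (simp add: T.group_simps)
  show "spt p (q - q') = spt p q \<ominus>\<^bsub>TS\<^esub> spt p q'"
    using sact(3)[of p "q - q'" q'] sact(1) by (simp add: T.group_simps)
qed

text \<open>In each formula the middle variables of the two terms on the right cancel.\<close>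

lemma xy_minus_pt:
  "(y_minus - x_minus) \<odot>\<^bsub>TS\<^esub> spt 1 1 = spt (y_minus - x_minus) 1 \<oplus>\<^bsub>TS\<^esub> spt 1 (y_minus - x_minus)"
  "(y_minus + x_minus) \<odot>\<^bsub>TS\<^esub> spt 1 1 = spt (y_minus + x_minus) 1 \<ominus>\<^bsub>TS\<^esub> spt 1 (y_minus - x_minus)"
  "(y_minus + x_minus) \<odot>\<^bsub>TS\<^esub> spt 1 1 = spt (y_minus - x_minus) 1 \<oplus>\<^bsub>TS\<^esub> spt 1 (y_minus + x_minus)"
proof -
  interpret T: abelian_group TS by (rule gfmodule_abelian_group[OF gfmodule_tens_step])
  note f = module_smult_facts[OF gfmodule_module[OF gfmodule_tens_step] sact(1)]
  note xy = tens_xy_actions(3,4,6)[OF JK(1) J(2) JK(2) K(2), of "step_fil J c" "step_fil K c'" 1 1, simplified]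
  have d: "(y_minus - x_minus) \<odot>\<^bsub>TS\<^esub> spt 1 1 = y_minus \<odot>\<^bsub>TS\<^esub> spt 1 1 \<ominus>\<^bsub>TS\<^esub> x_minus \<odot>\<^bsub>TS\<^esub> spt 1 1"
    using f(2)[of "y_minus" "- x_minus" 1 1] f(7)[of x_minus 1 1] by (simp add: a_minus_def)
  show "(y_minus - x_minus) \<odot>\<^bsub>TS\<^esub> spt 1 1 = spt (y_minus - x_minus) 1 \<oplus>\<^bsub>TS\<^esub> spt 1 (y_minus - x_minus)"
    unfolding d pt_diff xy using sact(1) by (simp add: T.group_simps)
  show "(y_minus + x_minus) \<odot>\<^bsub>TS\<^esub> spt 1 1 = spt (y_minus + x_minus) 1 \<ominus>\<^bsub>TS\<^esub> spt 1 (y_minus - x_minus)"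
    "(y_minus + x_minus) \<odot>\<^bsub>TS\<^esub> spt 1 1 = spt (y_minus - x_minus) 1 \<oplus>\<^bsub>TS\<^esub> spt 1 (y_minus + x_minus)"
    unfolding f(2) pt_diff sact(2,3) xy using sact(1) by (simp_all add: T.group_simps)
qed

text \<open>The trace lowers the q-degree by 2 and the filtration by one step, that is 2 half units,
  which the shifts of the target record. Pure tensors have filtration 0 in \<open>TS\<close>, so the
  filtration condition with content is the one from F^2 to F^1.\<close>

lemma trace_map:
  assumes c: "(e, e') = (y_minus + x_minus, y_minus - x_minus) \<or> (e, e') = (y_minus - x_minus, y_minus + x_minus)"
    and f: "(y_minus - x_minus) \<odot>\<^bsub>TS\<^esub> spt 1 1 \<in> fil TS 2"
  obtains r where "gfhom (tens (quot_gf ideal_M (step_fil ideal_M e)) (quot_gf ideal_M (step_fil ideal_M e')))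
      (s_mod 2 (q_mod 2 TS)) r"
    "\<And>p q. r (ptens (quot_gf ideal_M (step_fil ideal_M e)) (quot_gf ideal_M (step_fil ideal_M e'))
      (cls ideal_M p) (cls ideal_M q)) = trace p q \<odot>\<^bsub>TS\<^esub> spt 1 1"
proof (rule gfhom_tens_cyclic[where H = "s_mod 2 (q_mod 2 TS)" and n = "spt 1 1" and b = 2 and \<psi> = trace and c = e and c' = e'])
  show "homog 2 e" "homog 2 e'" using c homog_xy_minus by auto
  show "gfmodule (s_mod 2 (q_mod 2 TS))" by (intro gfmodule_s_mod gfmodule_q_mod gfmodule_tens_step)
  show "spt 1 1 \<in> fil (s_mod 2 (q_mod 2 TS)) 0"
    using gfmodule_fil_mono[OF gfmodule_tens_step, of "-2" 0] pt_degrees(2) by auto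
  \<comment> \<open>In both cases of \<open>trace_step\<close> the factor y_- - x_- comes out and
    meets 1 \<otimes> 1, where \<open>f\<close> applies; index 4 of the shifted module is index 2 of
    \<open>TS\<close>.\<close>
  show "trace (e * p) (e' * q) \<odot>\<^bsub>s_mod 2 (q_mod 2 TS)\<^esub> spt 1 1 \<in> fil (s_mod 2 (q_mod 2 TS)) 4" for p q
  proof -
    have "\<exists>u. trace (e * p) (e' * q) = (y_minus - x_minus) * u" using c trace_step[of p q] by blast
    then obtain u where "trace (e * p) (e' * q) = u * (y_minus - x_minus)" by (metis mult.commute)
    then show ?thesis using fcl(5)[OF f, of u] module_smult_facts(3)[OF gfmodule_module[OF gfmodule_tens_step] sact(1)] by simp
  qed
  show "trace p q \<odot>\<^bsub>s_mod 2 (q_mod 2 TS)\<^esub> spt 1 1 = \<zero>\<^bsub>s_mod 2 (q_mod 2 TS)\<^esub>" if "p \<in> ideal_M \<or> q \<in> ideal_M" for p q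
    using ideal_M_annihilates[OF JK(1) J(2) JK(2) K(2) trace_ideal_M[OF that]] by simp
qed (use fcl(5)[OF pt_degrees(2)] pt_degrees in \<open>simp_all add: hideal_M trace_linear trace_homog\<close>)

end

subsection \<open>The maps \<open>\<chi>\<^sub>+\<close> and \<open>\<chi>\<^sub>-\<close>\<close>

lemma quot_mult_cls:
  assumes J: "ideal J PR" and J': "ideal J' PR" and c: "\<And>q. q \<in> J \<Longrightarrow> c * q \<in> J'"
  shows "quot_mult J' c (cls J p) = cls J' (c * p)"
proof -
  have "cls J' (c * q) = cls J' (c * p)" if "q \<in> cls J p" for q
    using that c[of "q - p"] by (simp add: cls_eq_iff[OF J'] mem_cls algebra_simps)
  moreover have "p \<in> cls J p" using ideal_PR(1)[OF J] by (simp add: mem_cls)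
  ultimately show ?thesis unfolding quot_mult_def by blast
qed

text \<open>Each y_i - x_i is half of y_+ - x_+ plus or minus y_- - x_-. After multiplication by y_-
  + x_- both parts are multiples of generators of \<open>ideal_M\<close>, so \<open>chi_plus\<close>
  is well defined.\<close>

lemma y_plus_x_mult_ideal_I:
  assumes "p \<in> ideal_I"
  shows "(y_minus + x_minus) * p \<in> ideal_M"
proof -
  note I = ideal_PR[OF hidealD(1)[OF hideal_M]]
  have v: "(mvar (Yv 1) - mvar (Xv 1)) = const (1/2) * ((y_plus - x_plus) - (y_minus - x_minus))"
    "(mvar (Yv 2) - mvar (Xv 2)) = const (1/2) * ((y_plus - x_plus) + (y_minus - x_minus))"
    unfolding y_plus_def x_plus_def y_minus_def x_minus_def
    using const_half[of "mvar (Yv 1) - mvar (Xv 1) :: 2 bpoly"] const_half[of "mvar (Yv 2) - mvar (Xv 2) :: 2 bpoly"] by (simp_all add: algebra_simps)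
  obtain a b where p: "p = a * (mvar (Yv 1) - mvar (Xv 1)) + b * (mvar (Yv 2) - mvar (Xv 2))"
    using assms unfolding ideal_I_def Idl_PR_pair by blast
  have "(y_minus + x_minus) * p = (a + b) * const (1/2) * (y_minus + x_minus) * (y_plus - x_plus)
      + (b - a) * const (1/2) * ((y_minus + x_minus) * (y_minus - x_minus))"
    unfolding p v by (simp add: algebra_simps)
  then show ?thesis using I(2)[OF I(3)[OF ideal_generators(2)] I(3)[OF ideal_generators(3)]] by simp
qed

lemma chi_cls:
  "chi_plus (cls ideal_I p) = cls ideal_M ((y_minus + x_minus) * p)" "chi_minus (cls ideal_M p) = cls ideal_I p"
  unfolding chi_plus_def chi_minus_def
  using quot_mult_cls[OF hidealD(1)[OF hideal_I] hidealD(1)[OF hideal_M] y_plus_x_mult_ideal_I]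
    quot_mult_cls[OF hidealD(1)[OF hideal_M] hidealD(1)[OF hideal_I], of 1 p] ideal_generators(4) by auto

lemma gfmodule_two_strand: "gfmodule bimod_I" "gfmodule black_blob" "gfmodule gray_blob"
  unfolding bimod_I_def black_blob_def gray_blob_def
  by (rule gfmodule_step[OF hideal_I homog_0] gfmodule_step[OF hideal_M homog_xy_minus(3)]
      gfmodule_step[OF hideal_M homog_xy_minus(2)])+

text \<open>The generator of I goes to the generator of F^1 of G, of q-degree 2 and filtration index
  2; the shifts by -2 bring both to 0. For \<open>chi_minus\<close>, the generator y_- - x_- of F^1
  of B is zero in I.\<close>

lemma gfhom_chi:
  "gfhom bimod_I (s_mod (-2) (q_mod (-2) gray_blob)) chi_plus" "gfhom black_blob bimod_I chi_minus"
proof -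
  note iI = hidealD(1)[OF hideal_I] and iM = hidealD(1)[OF hideal_M]
  note sI = quot_gf_simps[OF iI] and sM = quot_gf_simps[OF iM]
  let ?N = "s_mod (-2) (q_mod (-2) gray_blob)" and ?n = "cls ideal_M (y_minus + x_minus)"
  have N: "gfmodule ?N" by (intro gfmodule_s_mod gfmodule_q_mod gfmodule_two_strand)
  have fi: "?n \<in> fil gray_blob 2" "cls ideal_I 1 \<in> fil bimod_I 0" "cls ideal_M 0 \<in> fil gray_blob 4"
    "cls ideal_I 0 \<in> fil bimod_I 2" using step_fil_eq[OF iM, of "y_minus + x_minus"] step_fil_eq[OF iI, of 0]
    by (auto simp: gray_blob_def bimod_I_def sI sM intro!: imageI range_eqI[of _ _ 1])
  have d: "cls ideal_I (y_minus - x_minus) = cls ideal_I 0" using ideal_generators(5) by (simp add: cls_eq_iff[OF iI])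
  have pre: "?n \<in> qpart ?N 0" "?n \<in> fil ?N 0" "\<And>p. p \<in> ideal_I \<Longrightarrow> p \<odot>\<^bsub>?N\<^esub> ?n = \<zero>\<^bsub>?N\<^esub>"
    "0 \<odot>\<^bsub>?N\<^esub> ?n \<in> fil ?N 2"
    using fi homog_xy_minus(2) y_plus_x_mult_ideal_I by (auto simp: gray_blob_def sM cls_eq_iff[OF iM] mult.commute)
  have hp: "gfhom bimod_I ?N (\<lambda>Z. rep Z \<odot>\<^bsub>?N\<^esub> ?n)"
    unfolding bimod_I_def by (rule gfhom_cyclic(1)[OF iI N pre])
  have 1: "rep (cls ideal_I p) \<odot>\<^bsub>?N\<^esub> ?n = p \<odot>\<^bsub>?N\<^esub> ?n" for p
    by (rule gfhom_cyclic(2)[OF iI N pre])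
  have "rep Z \<odot>\<^bsub>?N\<^esub> ?n = chi_plus Z" if "Z \<in> carrier bimod_I" for Z
    using that 1 by (auto simp: bimod_I_def sI chi_cls gray_blob_def sM mult.commute)
  then show "gfhom bimod_I ?N chi_plus" by (rule gfhom_cong[OF gfmodule_two_strand(1) hp])
  have pre: "cls ideal_I 1 \<in> qpart bimod_I 0" "cls ideal_I 1 \<in> fil bimod_I 0"
    "\<And>p. p \<in> ideal_M \<Longrightarrow> p \<odot>\<^bsub>bimod_I\<^esub> cls ideal_I 1 = \<zero>\<^bsub>bimod_I\<^esub>"
    "(y_minus - x_minus) \<odot>\<^bsub>bimod_I\<^esub> cls ideal_I 1 \<in> fil bimod_I 2"
  proof -
    show "(y_minus - x_minus) \<odot>\<^bsub>bimod_I\<^esub> cls ideal_I 1 \<in> fil bimod_I 2"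
      using fi(4) by (simp add: bimod_I_def sI d)
  qed (use fi homog_one ideal_generators(4) in \<open>auto simp: bimod_I_def sI cls_eq_iff[OF iI]\<close>)
  have hm: "gfhom black_blob bimod_I (\<lambda>Z. rep Z \<odot>\<^bsub>bimod_I\<^esub> cls ideal_I 1)"
    unfolding black_blob_def by (rule gfhom_cyclic(1)[OF iM gfmodule_two_strand(1) pre])
  have 2: "rep (cls ideal_M p) \<odot>\<^bsub>bimod_I\<^esub> cls ideal_I 1 = p \<odot>\<^bsub>bimod_I\<^esub> cls ideal_I 1" for p
    by (rule gfhom_cyclic(2)[OF iM gfmodule_two_strand(1) pre])
  have "rep Z \<odot>\<^bsub>bimod_I\<^esub> cls ideal_I 1 = chi_minus Z" if "Z \<in> carrier black_blob" for Z
    using that 2 by (auto simp: bimod_I_def sI chi_cls black_blob_def sM)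
  then show "gfhom black_blob bimod_I chi_minus" by (rule gfhom_cong[OF gfmodule_two_strand(2) hm])
qed

subsection \<open>Shifts of tensor products\<close>

lemma shift_shift:
  "q_mod b (s_mod a M) = s_mod a (q_mod b M)" "s_mod a (s_mod b M) = s_mod (a + b) M"
  "q_mod a (q_mod b M) = q_mod (a + b) M" "s_mod 0 M = M" "q_mod 0 M = M"
  by (simp_all add: q_mod_def s_mod_def algebra_simps)

lemma tens_shift_aux:
  "tens_rel (s_mod k M) N = tens_rel M N" "tens_rel M (s_mod k N) = tens_rel M N"
  "tens_rel (q_mod k M) N = tens_rel M N" "tens_rel M (q_mod k N) = tens_rel M N"
  "tens_free (s_mod k M) N = tens_free M N" "tens_free M (s_mod k N) = tens_free M N"
  "tens_free (q_mod k M) N = tens_free M N" "tens_free M (q_mod k N) = tens_free M N"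
  by (simp_all add: tens_rel_def tens_free_def)

lemma tens_class_shift:
  "tens_class (s_mod k M) N = tens_class M N" "tens_class M (s_mod k N) = tens_class M N"
  "tens_class (q_mod k M) N = tens_class M N" "tens_class M (q_mod k N) = tens_class M N"
  by (simp_all add: tens_class_def tens_shift_aux fun_eq_iff)

lemma tens_act_shift:
  "tens_act (s_mod k M) N = tens_act M N" "tens_act M (s_mod k N) = tens_act M N"
  "tens_act (q_mod k M) N = tens_act M N" "tens_act M (q_mod k N) = tens_act M N"
  by (simp_all add: tens_act_def fun_eq_iff)

lemma tens_map_shift:
  "tens_map (s_mod k M) N = tens_map M N" "tens_map M (s_mod k N) = tens_map M N"
  "tens_map (q_mod k M) N = tens_map M N" "tens_map M (q_mod k N) = tens_map M N"
  by (simp_all add: tens_map_def tens_class_shift fun_eq_iff)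

lemma shift_index:
  fixes P :: "int \<Rightarrow> 'a set" and Q :: "int \<Rightarrow> 'b set"
  shows "(\<exists>i. m \<in> P (i - k) \<and> n \<in> Q (l - i)) \<longleftrightarrow> (\<exists>i. m \<in> P i \<and> n \<in> Q (l - k - i))"
    "(\<exists>i. m \<in> P i \<and> n \<in> Q (l - i - k)) \<longleftrightarrow> (\<exists>i. m \<in> P i \<and> n \<in> Q (l - k - i))"
proof -
  show "(\<exists>i. m \<in> P (i - k) \<and> n \<in> Q (l - i)) \<longleftrightarrow> (\<exists>i. m \<in> P i \<and> n \<in> Q (l - k - i))"
  proof
    assume "\<exists>i. m \<in> P (i - k) \<and> n \<in> Q (l - i)"
    then obtain i where "m \<in> P (i - k) \<and> n \<in> Q (l - i)" by blast
    then show "\<exists>i. m \<in> P i \<and> n \<in> Q (l - k - i)" by (intro exI[of _ "i - k"]) simp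
  next
    assume "\<exists>i. m \<in> P i \<and> n \<in> Q (l - k - i)"
    then obtain i where "m \<in> P i \<and> n \<in> Q (l - k - i)" by blast
    then show "\<exists>i. m \<in> P (i - k) \<and> n \<in> Q (l - i)" by (intro exI[of _ "i + k"]) (simp add: algebra_simps)
  qed
qed (simp add: algebra_simps)

text \<open>An equality of records: the relations involve only the module structures, and grading
  and filtration are generated over splittings of an index, so a shift of either factor reindexes
  the splittings.\<close>

lemma tens_shift:
  "tens (s_mod k M) N = s_mod k (tens M N)" "tens M (s_mod k N) = s_mod k (tens M N)"
  "tens (q_mod k M) N = q_mod k (tens M N)" "tens M (q_mod k N) = q_mod k (tens M N)"
proof -
  note s = tens_shift_aux tens_class_shift tens_act_shift
  show "tens (s_mod k M) N = s_mod k (tens M N)" "tens M (s_mod k N) = s_mod k (tens M N)"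
    by (simp_all add: tens_def Let_def s s_mod_def[of k "\<lparr>carrier = _, monoid.mult = _, one = _, zero = _, add = _, module.smult = _, qpart = _, fil = _\<rparr>"] shift_index fun_eq_iff)
  show "tens (q_mod k M) N = q_mod k (tens M N)" "tens M (q_mod k N) = q_mod k (tens M N)"
    by (simp_all add: tens_def Let_def s q_mod_def[of k "\<lparr>carrier = _, monoid.mult = _, one = _, zero = _, add = _, module.smult = _, qpart = _, fil = _\<rparr>"] shift_index fun_eq_iff)
qed

lemma gfhom_shift:
  "gfhom (s_mod a (q_mod b M)) N f \<longleftrightarrow> gfhom M (s_mod (-a) (q_mod (-b) N)) f"
  "gfhom (s_mod a (q_mod b M)) (s_mod a (q_mod b N)) f \<longleftrightarrow> gfhom M N f"
proof -
  have all: "(\<forall>k. P (k - a) k) \<longleftrightarrow> (\<forall>k. P k (k + a))" "(\<forall>k. P (k - a) (k - a)) \<longleftrightarrow> (\<forall>k. P k k)"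
    for P :: "int \<Rightarrow> int \<Rightarrow> bool" and a by (metis add_diff_cancel diff_add_cancel)+
  show "gfhom (s_mod a (q_mod b M)) N f \<longleftrightarrow> gfhom M (s_mod (-a) (q_mod (-b) N)) f"
    using all(1)[of "\<lambda>i j. f ` qpart M i \<subseteq> qpart N j" b] all(1)[of "\<lambda>i j. f ` fil M i \<subseteq> fil N j" a]
    unfolding gfhom_def by simp
  show "gfhom (s_mod a (q_mod b M)) (s_mod a (q_mod b N)) f \<longleftrightarrow> gfhom M N f"
    using all(2)[of "\<lambda>i j. f ` qpart M i \<subseteq> qpart N j" b] all(2)[of "\<lambda>i j. f ` fil M i \<subseteq> fil N j" a]
    unfolding gfhom_def by simp
qed

subsection \<open>Countability\<close>

lemma countable_poly_mapping:
  assumes "countable S"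
  shows "countable {p :: 'a \<Rightarrow>\<^sub>0 'b::{zero, countable}. Poly_Mapping.keys p \<subseteq> S}"
proof -
  define enc where "enc = (\<lambda>p :: 'a \<Rightarrow>\<^sub>0 'b. (\<lambda>k. (k, Poly_Mapping.lookup p k)) ` Poly_Mapping.keys p)"
  have mem: "(k, a) \<in> enc p \<longleftrightarrow> a = Poly_Mapping.lookup p k \<and> a \<noteq> 0" for p k a
    by (auto simp: enc_def in_keys_iff)
  have inj: "inj enc"
  proof (rule injI, rule poly_mapping_eqI)
    fix p q k assume "enc p = enc q"
    then have "a = Poly_Mapping.lookup p k \<and> a \<noteq> 0 \<longleftrightarrow> a = Poly_Mapping.lookup q k \<and> a \<noteq> 0" for a
      using mem[of k a p] mem[of k a q] by simp
    then show "Poly_Mapping.lookup p k = Poly_Mapping.lookup q k" by metis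
  qed
  have "enc ` {p. Poly_Mapping.keys p \<subseteq> S} \<subseteq> {A. finite A \<and> A \<subseteq> S \<times> UNIV}"
    by (auto simp: enc_def)
  moreover have "countable {A. finite A \<and> A \<subseteq> S \<times> (UNIV :: 'b set)}"
    by (intro countable_Collect_finite_subset countable_SIGMA) (use assms in auto)
  ultimately show ?thesis by (meson countable_image_inj_on countable_subset inj inj_on_subset subset_UNIV)
qed

instance bvar :: (countable) countable by countable_datatype

lemma countable_mpoly: "countable (UNIV :: ('v :: countable) mpoly set)"
proof -
  have "countable (UNIV :: ('v \<Rightarrow>\<^sub>0 nat) set)" using countable_poly_mapping[of "UNIV :: 'v set"] by simp
  from countable_poly_mapping[OF this] show ?thesis by simp
qed

lemma countable_quot_gf: "ideal J PR \<Longrightarrow> countable (carrier (quot_gf J F :: (2 bpoly, 2 bpoly set) gfmod))"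
  using quot_gf_simps(1)[of J F] countable_image[OF countable_mpoly] by simp

lemma countable_tens:
  fixes M :: "('n::finite bpoly, 'a) gfmod" and N :: "('n bpoly, 'b) gfmod"
  assumes "module PR M" "module PR N" "countable (carrier M)" "countable (carrier N)"
  shows "countable (carrier (tens M N))"
proof -
  have "carrier (tens_free M N) = {c. Poly_Mapping.keys c \<subseteq> carrier M \<times> carrier N}"
    by (simp add: tens_free_def set_eq_iff)
  then show ?thesis using countable_image[OF countable_poly_mapping[of "carrier M \<times> carrier N"]] assms(3,4)
    unfolding tens_carrier[OF assms(1,2)] by simp
qed

section \<open>Contraction of the two composites of Rouquier complexes\<close>

section \<open>The Rouquier complexes\<close>

lemma bcomplex_bracket:
  fixes M N :: "('n bpoly, 'a) gfmod"
  assumes M: "gfmodule M" and N: "gfmodule N" and f: "gfhom M N f"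
  shows "bcomplex (bracket p M N f)"
proof -
  let ?Z = "bracket p M N f"
  have T: "bterm ?Z t a = (if t = 2 * p \<and> a = p then M else if t = 2 * (p - 1) \<and> a = p - 1 then N else gf_triv \<zero>\<^bsub>M\<^esub>)" for t a
    by (simp add: bracket_def Let_def)
  have d: "bdif ?Z t a = (if t = 2 * p \<and> a = p then f else (\<lambda>_. \<zero>\<^bsub>bterm ?Z (t - 2) (a - 1)\<^esub>))" for t a
    unfolding T by (simp add: bracket_def Let_def)
  have g: "gfmodule (bterm ?Z t a)" for t a using M N by (auto simp: T intro: gfmodule_gf_triv)
  show ?thesis unfolding bcomplex_def
  proof (intro allI conjI ballI g)
    fix t a
    show "gfhom (bterm ?Z t a) (bterm ?Z (t - 2) (a - 1)) (bdif ?Z t a)"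
    proof (cases "t = 2 * p \<and> a = p")
      case True
      then show ?thesis using f by (simp add: T d)
    next
      case False
      then have e: "bdif ?Z t a = (\<lambda>_. \<zero>\<^bsub>bterm ?Z (t - 2) (a - 1)\<^esub>)" by (auto simp: d)
      show ?thesis unfolding e by (rule gfhom_zero[OF g g])
    qed
    fix x
    show "bdif ?Z (t - 2) (a - 1) (bdif ?Z t a x) = \<zero>\<^bsub>bterm ?Z (t - 4) (a - 2)\<^esub>"
    proof (cases "t - 2 = 2 * p \<and> a - 1 = p")
      case True
      then have "bdif ?Z t a x = \<zero>\<^bsub>M\<^esub>" by (auto simp: d T)
      then show ?thesis using True gfhomD0(1)[OF M N f] by (auto simp: d T)
    next
      case False
      then show ?thesis by (auto simp: d)
    qed
  qed
qed

lemma bcomplex_shift: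
  assumes "bcomplex Z"
  shows "bcomplex (t_shift k Z)" "bcomplex (a_shift k Z)" "bcomplex (s_shift k Z)" "bcomplex (q_shift k Z)"
proof -
  note D = bcomplexD[OF assms]
  have e: "t - 2 - k = (t - k) - 2" "t - 4 - k = (t - k) - 4" "a - 1 - k = (a - k) - 1" "a - 2 - k = (a - k) - 2" for t a :: int
    by simp_all
  show "bcomplex (t_shift k Z)" "bcomplex (a_shift k Z)"
    unfolding bcomplex_def t_shift_def a_shift_def bcx.simps e using D by auto
  show "bcomplex (s_shift k Z)" "bcomplex (q_shift k Z)" unfolding bcomplex_def s_shift_def q_shift_def
    using D by (auto intro: gfmodule_s_mod gfmodule_q_mod
        simp: gfhom_shift(2)[of k 0, unfolded shift_shift] gfhom_shift(2)[of 0 k, unfolded shift_shift])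
qed

lemma bcomplex_sigma: "bcomplex sigma_pos" "bcomplex sigma_neg" unfolding sigma_pos_def sigma_neg_def
  by (intro bcomplex_shift bcomplex_bracket gfmodule_s_mod gfmodule_q_mod gfmodule_two_strand gfhom_chi)+

text \<open>The shifts multiplied out. On the gray blob q^2 cancels q^{-2}, and half a step minus a
  full step leaves filtration shift -1 in half units. Positions 1 and -1 are the t-degrees 1/2 and
  -1/2.\<close>

lemma bterm_sigma:
  "bterm sigma_pos t a = (if t = 1 \<and> a = 1 then s_mod 1 (q_mod 2 bimod_I)
     else if t = -1 \<and> a = 0 then s_mod (-1) gray_blob else s_mod 1 (q_mod 2 (gf_triv \<zero>\<^bsub>bimod_I\<^esub>)))"
  "bterm sigma_neg t a = (if t = 1 \<and> a = 0 then s_mod (-1) (q_mod (-2) black_blob)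
     else if t = -1 \<and> a = -1 then s_mod (-1) (q_mod (-2) bimod_I) else s_mod (-1) (q_mod (-2) (gf_triv \<zero>\<^bsub>black_blob\<^esub>)))"
  by (auto simp: sigma_pos_def sigma_neg_def t_shift_def s_shift_def a_shift_def q_shift_def bracket_def Let_def shift_shift)

lemma bdif_sigma: "bdif sigma_pos 1 1 = chi_plus" "bdif sigma_neg 1 0 = chi_minus"
  by (simp_all add: sigma_pos_def sigma_neg_def t_shift_def s_shift_def a_shift_def q_shift_def bracket_def Let_def)

lemma carrier_sigma_trivial:
  "(t, a) \<notin> {(1, 1), (-1, 0)} \<Longrightarrow> carrier (bterm sigma_pos t a) = {\<zero>\<^bsub>bterm sigma_pos t a\<^esub>}"
  "(t, a) \<notin> {(1, 0), (-1, -1)} \<Longrightarrow> carrier (bterm sigma_neg t a) = {\<zero>\<^bsub>bterm sigma_neg t a\<^esub>}"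
  by (auto simp: bterm_sigma)

lemma countable_sigma: "countable (carrier (bterm sigma_pos t a))" "countable (carrier (bterm sigma_neg t a))"
  using countable_quot_gf hidealD(1)[OF hideal_I] hidealD(1)[OF hideal_M]
  by (auto simp: bterm_sigma bimod_I_def black_blob_def gray_blob_def)

lemma tens_trivial:
  fixes M :: "('n::finite bpoly, 'a) gfmod" and N :: "('n bpoly, 'b) gfmod"
  assumes M: "gfmodule M" "gfmodule N" and z: "carrier M = {\<zero>\<^bsub>M\<^esub>} \<or> carrier N = {\<zero>\<^bsub>N\<^esub>}"
  shows "carrier (tens M N) = {\<zero>\<^bsub>tens M N\<^esub>}"
proof -
  note mods = gfmodule_module[OF M(1)] gfmodule_module[OF M(2)]
  interpret T: abelian_group "tens M N" by (rule abelian_group_tens[OF mods])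
  have "x = \<zero>\<^bsub>tens M N\<^esub>" if "x \<in> carrier (tens M N)" for x using that
    by (induction x rule: tens_induct[OF mods, consumes 1, case_names 1 2 3]) (use z ptens_zero[OF mods] in auto)
  then show ?thesis by auto
qed

context
  fixes M :: "('n::finite, 'a) bcx" and N :: "('n, 'b) bcx"
  assumes M: "bcomplex M" and N: "bcomplex N"
begin

private abbreviation "Summ \<equiv> bcx_summand M N"

text \<open>Most summands of the composites are zero; where one of the two possible sources is, the
  differential reduces to one partial differential with its sign.\<close>

lemma bcx_comp_bdif_single:
  assumes c: "c \<in> carrier (bterm (M \<circ>\<^sub>b N) t a)"
  shows "carrier (Summ t a (i, b)) = {\<zero>\<^bsub>Summ t a (i, b)\<^esub>} \<Longrightarrow> bdif (M \<circ>\<^sub>b N) t a c (i, b) = dl M N t a i b (c (i + 2, b + 1))"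
    "carrier (Summ t a (i + 2, b + 1)) = {\<zero>\<^bsub>Summ t a (i + 2, b + 1)\<^esub>} \<Longrightarrow> bdif (M \<circ>\<^sub>b N) t a c (i, b) =
      (if even b then dr M N t a i b (c (i, b)) else \<ominus>\<^bsub>Summ (t - 2) (a - 1) (i, b)\<^esub> dr M N t a i b (c (i, b)))"
proof -
  note g = gfmodule_bcx_summand[OF M N]
  note hl = gfhom_dl[OF M N, of t a i b] and hr = gfhom_dr[OF M N, of t a i b]
  interpret S: abelian_group "Summ (t - 2) (a - 1) (i, b)" by (rule gfmodule_abelian_group[OF g])
  have cm: "c k \<in> carrier (Summ t a k)" for k using c unfolding bcx_comp_bterm[OF M N] gf_dsum_simps(1) by blast
  have z: "\<ominus>\<^bsub>Summ (t - 2) (a - 1) (i, b)\<^esub> \<zero>\<^bsub>Summ (t - 2) (a - 1) (i, b)\<^esub> = \<zero>\<^bsub>Summ (t - 2) (a - 1) (i, b)\<^esub>"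
    by (rule S.minus_zero)
  show "bdif (M \<circ>\<^sub>b N) t a c (i, b) = dl M N t a i b (c (i + 2, b + 1))" if "carrier (Summ t a (i, b)) = {\<zero>\<^bsub>Summ t a (i, b)\<^esub>}"
    using cm[of "(i, b)"] that gfhomD0(1)[OF g g hr] gfhomD(1)[OF hl cm] by (simp add: bcx_comp_bdif[OF M N] z)
  show "bdif (M \<circ>\<^sub>b N) t a c (i, b) =
      (if even b then dr M N t a i b (c (i, b)) else \<ominus>\<^bsub>Summ (t - 2) (a - 1) (i, b)\<^esub> dr M N t a i b (c (i, b)))"
    if "carrier (Summ t a (i + 2, b + 1)) = {\<zero>\<^bsub>Summ t a (i + 2, b + 1)\<^esub>}"
    using cm[of "(i + 2, b + 1)"] that gfhomD0(1)[OF g g hl] gfhomD(1)[OF hr cm] by (simp add: bcx_comp_bdif[OF M N])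
qed

end

subsection \<open>Maps between tensor products of the bimodules\<close>

lemma ptens_shift:
  "ptens (s_mod k M) N = ptens M N" "ptens M (s_mod k N) = ptens M N"
  "ptens (q_mod k M) N = ptens M N" "ptens M (q_mod k N) = ptens M N"
  by (simp_all add: ptens_def tens_class_shift fun_eq_iff)

lemma cls_carrier:
  "cls ideal_I p \<in> carrier bimod_I" "cls ideal_M p \<in> carrier black_blob" "cls ideal_M p \<in> carrier gray_blob"
  using hidealD(1)[OF hideal_I] hidealD(1)[OF hideal_M]
  by (auto simp: bimod_I_def black_blob_def gray_blob_def quot_gf_simps)

lemma tens_chi:
  fixes N :: "(2 bpoly, 'a) gfmod"
  assumes N: "gfmodule N"
  shows "gfhom (tens bimod_I N) (s_mod (-2) (q_mod (-2) (tens gray_blob N))) (tens_map gray_blob N chi_plus (\<lambda>n. n))"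
    "gfhom (tens N bimod_I) (s_mod (-2) (q_mod (-2) (tens N gray_blob))) (tens_map N gray_blob (\<lambda>n. n) chi_plus)"
    "gfhom (tens black_blob N) (tens bimod_I N) (tens_map bimod_I N chi_minus (\<lambda>n. n))"
    "gfhom (tens N black_blob) (tens N bimod_I) (tens_map N bimod_I (\<lambda>n. n) chi_minus)"
    "n \<in> carrier N \<Longrightarrow> tens_map gray_blob N chi_plus (\<lambda>n. n) (ptens bimod_I N (cls ideal_I p) n)
       = ptens gray_blob N (cls ideal_M ((y_minus + x_minus) * p)) n"
    "n \<in> carrier N \<Longrightarrow> tens_map N gray_blob (\<lambda>n. n) chi_plus (ptens N bimod_I n (cls ideal_I p))
       = ptens N gray_blob n (cls ideal_M ((y_minus + x_minus) * p))"
    "n \<in> carrier N \<Longrightarrow> tens_map bimod_I N chi_minus (\<lambda>n. n) (ptens black_blob N (cls ideal_M p) n)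
       = ptens bimod_I N (cls ideal_I p) n"
    "n \<in> carrier N \<Longrightarrow> tens_map N bimod_I (\<lambda>n. n) chi_minus (ptens N black_blob n (cls ideal_M p))
       = ptens N bimod_I n (cls ideal_I p)"
proof -
  note I = gfmodule_two_strand(1) and B = gfmodule_two_strand(2) and G = gfmodule_s_mod[OF gfmodule_q_mod[OF gfmodule_two_strand(3)]]
  note p = gfhom_chi(1) and m = gfhom_chi(2)
  note i = gfhom_id[of N]
  show "gfhom (tens bimod_I N) (s_mod (-2) (q_mod (-2) (tens gray_blob N))) (tens_map gray_blob N chi_plus (\<lambda>n. n))"
    "gfhom (tens N bimod_I) (s_mod (-2) (q_mod (-2) (tens N gray_blob))) (tens_map N gray_blob (\<lambda>n. n) chi_plus)"
    "gfhom (tens black_blob N) (tens bimod_I N) (tens_map bimod_I N chi_minus (\<lambda>n. n))"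
    "gfhom (tens N black_blob) (tens N bimod_I) (tens_map N bimod_I (\<lambda>n. n) chi_minus)"
    using tens_map_gfhom[OF I N G N p i] tens_map_gfhom[OF N I N G i p] tens_map_gfhom[OF B N I N m i]
      tens_map_gfhom[OF N B N I i m] by (simp_all add: tens_shift tens_map_shift)
  show "n \<in> carrier N \<Longrightarrow> tens_map gray_blob N chi_plus (\<lambda>n. n) (ptens bimod_I N (cls ideal_I p) n)
       = ptens gray_blob N (cls ideal_M ((y_minus + x_minus) * p)) n"
    "n \<in> carrier N \<Longrightarrow> tens_map N gray_blob (\<lambda>n. n) chi_plus (ptens N bimod_I n (cls ideal_I p))
       = ptens N gray_blob n (cls ideal_M ((y_minus + x_minus) * p))"
    "n \<in> carrier N \<Longrightarrow> tens_map bimod_I N chi_minus (\<lambda>n. n) (ptens black_blob N (cls ideal_M p) n)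
       = ptens bimod_I N (cls ideal_I p) n"
    "n \<in> carrier N \<Longrightarrow> tens_map N bimod_I (\<lambda>n. n) chi_minus (ptens N black_blob n (cls ideal_M p))
       = ptens N bimod_I n (cls ideal_I p)"
    using tens_map_ptens[OF I N G N p i, of "cls ideal_I p" n] tens_map_ptens[OF N I N G i p, of n "cls ideal_I p"]
      tens_map_ptens[OF B N I N m i, of "cls ideal_M p" n] tens_map_ptens[OF N B N I i m, of n "cls ideal_M p"]
    by (simp_all add: tens_map_shift ptens_shift cls_carrier chi_cls)
qed

text \<open>The map \<open>e\<close> multiplies after rewriting the left entry in y-variables, and
  \<open>e'\<close> sends 1 to 1 \<otimes> 1. Both modules have one generator, on which the two
  composites are checked.\<close>

lemma unit_I:
  obtains e e' where "gfhom (tens bimod_I bimod_I) bimod_I e" "gfhom bimod_I (tens bimod_I bimod_I) e'"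
    "\<And>z. z \<in> carrier bimod_I \<Longrightarrow> e (e' z) = z" "\<And>z. z \<in> carrier (tens bimod_I bimod_I) \<Longrightarrow> e' (e z) = z"
proof -
  note iI = hidealD(1)[OF hideal_I]
  let ?T = "tens bimod_I bimod_I" and ?pt = "\<lambda>p q. ptens bimod_I bimod_I (cls ideal_I p) (cls ideal_I q)"
  note sI = quot_gf_simps[OF iI, of "step_fil ideal_I 0", folded bimod_I_def]
  have I: "gfmodule bimod_I" and T: "gfmodule ?T" by (simp_all add: gfmodule_two_strand gfmodule_tens)
  interpret T: module PR ?T by (rule gfmodule_module[OF T])
  note d = pt_degrees[OF hideal_I ideal_generators(4) homog_0 hideal_I ideal_generators(4) homog_0, folded bimod_I_def]
  note act = tens_cyclic_actions[OF iI iI, where F = "step_fil ideal_I 0" and G = "step_fil ideal_I 0", folded bimod_I_def]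
  note f = module_smult_facts[OF gfmodule_module[OF T] act(1)] and fc = gf_fil_closed[OF T]
  have fI: "cls ideal_I p \<in> fil bimod_I 0" for p by (auto simp: sI step_fil_def)
  have i1: "cls ideal_I (subst_y p * q) = cls ideal_I 0" if "p \<in> ideal_I \<or> q \<in> ideal_I" for p q
    using that subst_ideal_I ideal_PR(1,3)[OF iI] by (auto simp: cls_eq_iff[OF iI])
  obtain e where e: "gfhom ?T bimod_I e" "\<And>p q. e (?pt p q) = (subst_y p * q) \<odot>\<^bsub>bimod_I\<^esub> cls ideal_I 1"
  proof (rule gfhom_tens_cyclic[OF hideal_I homog_0 hideal_I homog_0 I, of "cls ideal_I 1" 0 "\<lambda>p q. subst_y p * q", folded bimod_I_def])
    show "homog (i + j - 0) (subst_y p * q)" if "homog i p" "homog j q" for i j p q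
      using homog_mult[OF subst_homog(2)[OF that(1)] that(2)] by simp
  qed (use i1 fI gf_fil_closed(1)[OF I] in \<open>auto simp: subst_simps algebra_simps sI intro: imageI homog_one\<close>)
  have ann: "p \<odot>\<^bsub>?T\<^esub> ?pt 1 1 = \<zero>\<^bsub>?T\<^esub>" if p: "p \<in> ideal_I" for p
  proof -
    have v: "(mvar (Yv i) - mvar (Xv i)) \<odot>\<^bsub>?T\<^esub> ?pt 1 1 = \<zero>\<^bsub>?T\<^esub>" for i
    proof -
      have e: "mvar (Xv i) - mvar (Yv i) \<in> ideal_I" using ideal_PR(5)[OF iI ideal_generators(1)[of i]] by simp
      \<comment> \<open>y_i (1 \<otimes> 1) = y_i \<otimes> 1 = x_i \<otimes> 1 = 1 \<otimes> y_i =
        1 \<otimes> x_i = x_i (1 \<otimes> 1): the relation of I is used in each factor, and the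
        middle variable crosses in between.\<close>
      have "mvar (Yv i) \<odot>\<^bsub>?T\<^esub> ?pt 1 1 = mvar (Xv i) \<odot>\<^bsub>?T\<^esub> ?pt 1 1"
        using act(9)[OF e, of 1] act(10)[OF ideal_generators(1)[of i], of 1] act(7)[of i 1 1] act(5)[of i 1 1] act(6)[of i 1 1]
        by simp
      then show ?thesis
        using f(2)[of "mvar (Yv i)" "- mvar (Xv i)" 1 1] f(7)[of "mvar (Xv i)" 1 1] T.M.r_neg[OF f(1)] by simp
    qed
    obtain u w where "p = u * (mvar (Yv 1) - mvar (Xv 1)) + w * (mvar (Yv 2) - mvar (Xv 2))"
      using p unfolding ideal_I_def Idl_PR_pair by blast
    then show ?thesis using T.smult_r_null by (simp add: f v)
  qed
  have z0: "0 \<odot>\<^bsub>?T\<^esub> ?pt 1 1 \<in> fil ?T 2" using fc(1) f(5) by simp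
  define e' where "e' = (\<lambda>Z. rep Z \<odot>\<^bsub>?T\<^esub> ?pt 1 1)"
  have e': "gfhom bimod_I ?T e'" "\<And>p. e' (cls ideal_I p) = p \<odot>\<^bsub>?T\<^esub> ?pt 1 1"
    using gfhom_cyclic[OF iI T d(1,2) ann z0, folded bimod_I_def] by (auto simp: e'_def)
  have "e (e' z) = z" if "z \<in> carrier bimod_I" for z
    by (rule gfhom_eq_cyclic[OF iI, of "step_fil ideal_I 0", folded bimod_I_def, OF gfhom_comp[OF e'(1) e(1)] gfhom_id _ that])
      (simp add: e' e f subst_simps sI)
  moreover have "e' (e z) = z" if "z \<in> carrier ?T" for z
    by (rule tens_generator_I[OF iI ideal_generators(4) iI ideal_generators(4), where F = "step_fil ideal_I 0" and G = "step_fil ideal_I 0",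
        folded bimod_I_def, OF _ T.M.abelian_group_axioms gfhom_comp[OF e(1) e'(1)] gfhom_id _ that])
      (simp_all add: e' e f subst_simps sI)
  ultimately show thesis using that e(1) e'(1) by blast
qed

text \<open>The complex is I \<otimes> B -> (I \<otimes> I) \<oplus> (G \<otimes> B) -> G \<otimes>
  I, with summands labelled by the degrees of the left factor, (1, 1) for I and (-1, 0) for G. The
  left I has odd a-degree, so the Koszul sign falls on the arrow from I \<otimes> B to I \<otimes> I
  and on no other.\<close>

lemma sigma_pos_neg:
  assumes "infinite (UNIV :: 'u set)"
  shows "Ch_equiv (to_Ch TYPE('u) (sigma_pos \<circ>\<^sub>b sigma_neg)) (to_Ch TYPE('u) (single_bcx bimod_I))"
proof -
  let ?S = "bcx_summand sigma_pos sigma_neg"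
  let ?T2 = "tens bimod_I black_blob" and ?T0 = "tens bimod_I bimod_I"
    and ?L = "tens gray_blob black_blob" and ?M = "tens gray_blob bimod_I"
  let ?sh = "\<lambda>W. s_mod (-2) (q_mod (-2) W)"
  let ?p2 = "\<lambda>p q. ptens bimod_I black_blob (cls ideal_I p) (cls ideal_M q)"
    and ?p0 = "\<lambda>p q. ptens bimod_I bimod_I (cls ideal_I p) (cls ideal_I q)"
    and ?pL = "\<lambda>p q. ptens gray_blob black_blob (cls ideal_M p) (cls ideal_M q)"
    and ?pM = "\<lambda>p q. ptens gray_blob bimod_I (cls ideal_M p) (cls ideal_I q)"
  note pn = bcomplex_sigma
  note iI = hidealD(1)[OF hideal_I] and iM = hidealD(1)[OF hideal_M] and MI = ideal_generators(4)
  note MM = subset_refl[of ideal_M]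
  note hM = homog_xy_minus(2) and hB = homog_xy_minus(3)
  note I = gfmodule_two_strand(1) and B = gfmodule_two_strand(2) and G = gfmodule_two_strand(3)
  note fold = bimod_I_def[symmetric] black_blob_def[symmetric] gray_blob_def[symmetric]
  have gm: "gfmodule ?T2" "gfmodule ?T0" "gfmodule ?L" "gfmodule ?M" "gfmodule (?sh ?L)" "gfmodule (?sh ?M)"
    by (simp_all add: gfmodule_tens I B G gfmodule_s_mod gfmodule_q_mod)
  interpret T2: module PR ?T2 by (rule gfmodule_module[OF gm(1)])
  interpret L: module PR ?L by (rule gfmodule_module[OF gm(3)])
  \<comment> \<open>The prefactors of the two complexes cancel on \<open>?T2\<close> and
    \<open>?T0\<close>; on \<open>?L\<close> and \<open>?M\<close> the shift \<open>s_q^{-1}\<close>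
    of the gray blob remains.\<close>
  have S: "?S 2 1 (1, 1) = ?T2" "?S 0 0 (1, 1) = ?T0" "?S 0 0 (-1, 0) = ?sh ?L" "?S (-2) (-1) (-1, 0) = ?sh ?M"
    by (simp_all add: bcx_summand_def bterm_sigma tens_shift shift_shift)
  note act2 = tens_cyclic_actions[OF iI iM, where F = "step_fil ideal_I 0" and G = "step_fil ideal_M (y_minus - x_minus)", unfolded fold]
    and actL = tens_cyclic_actions[OF iM iM, where F = "step_fil ideal_M (y_minus + x_minus)" and G = "step_fil ideal_M (y_minus - x_minus)", unfolded fold]
  note degL = pt_degrees[OF hideal_M MM hM hideal_M MM hB, unfolded fold]
    and deg2 = pt_degrees[OF hideal_I MI homog_0 hideal_M MM hB, unfolded fold]
  note xyL = xy_minus_pt[OF hideal_M MM hM hideal_M MM hB, unfolded fold]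
    and xy2 = xy_minus_pt[OF hideal_I MI homog_0 hideal_M MM hB, unfolded fold]
  note fL = module_smult_facts[OF L.module_axioms actL(1)] and f2 = module_smult_facts[OF T2.module_axioms act2(1)]
  \<comment> \<open>The part of y_- - x_- on the factor I vanishes, and the part on B is the
    generator of F^1 there.\<close>
  have "(y_minus - x_minus) \<odot>\<^bsub>?T2\<^esub> ?p2 1 1 \<in> fil ?T2 2"
    unfolding xy2(1) using deg2(5)[of "y_minus - x_minus" 1] deg2(4)[of 1 1] ideal_generators(5) act2(1) by simp
  from trace_map[OF hideal_I MI homog_0 hideal_M MM hB, of "y_minus + x_minus" "y_minus - x_minus", unfolded fold, OF _ this]
  obtain r where r: "gfhom ?L (s_mod 2 (q_mod 2 ?T2)) r" "\<And>p q. r (?pL p q) = trace p q \<odot>\<^bsub>?T2\<^esub> ?p2 1 1" by blast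
  have yL: "(y_minus + x_minus) \<odot>\<^bsub>?L\<^esub> ?pL 1 1 \<in> fil ?L 2"
    unfolding xyL(2) using gf_fil_closed(4)[OF gm(3) degL(3)[of 1 1] degL(4)[of 1 1]] by simp
  \<comment> \<open>The entry in I is rewritten in the outer x-variables by \<open>subst_x\<close>,
    so that a pure tensor becomes an outer multiple of 1 \<otimes> 1.\<close>
  obtain j where j: "gfhom ?M ?L j" "\<And>p q. j (?pM p q) = (p * subst_x q) \<odot>\<^bsub>?L\<^esub> ?pL 1 1"
  proof (rule gfhom_tens_cyclic[OF hideal_M hM hideal_I homog_0 gm(3), of "?pL 1 1" 0 "\<lambda>p q. p * subst_x q", unfolded fold])
    show "homog (i + j - 0) (p * subst_x q)" if "homog i p" "homog j q" for i j p q
      using homog_mult[OF that(1) subst_homog(1)[OF that(2)]] by simp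
    show "(p * subst_x q) \<odot>\<^bsub>?L\<^esub> ?pL 1 1 = \<zero>\<^bsub>?L\<^esub>" if "p \<in> ideal_M \<or> q \<in> ideal_I" for p q
    proof -
      have "p * subst_x q \<in> ideal_M" using that subst_ideal_I(1) ideal_PR(1,4)[OF iM] by auto
      from ideal_M_annihilates[where F = "step_fil ideal_M (y_minus + x_minus)" and G = "step_fil ideal_M (y_minus - x_minus)", OF iM MM iM MM this]
      show ?thesis unfolding fold .
    qed
    show "((y_minus + x_minus) * p * subst_x q) \<odot>\<^bsub>?L\<^esub> ?pL 1 1 \<in> fil ?L 2" for p q
      using gf_fil_closed(5)[OF gm(3) yL, of "p * subst_x q"] fL(3)[of "p * subst_x q" "y_minus + x_minus" 1 1]
      by (simp only: mult_ac)
  qed (use degL gf_fil_closed(1)[OF gm(3)] in \<open>auto simp: subst_simps algebra_simps fL(5)\<close>)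
  obtain e e' where e: "gfhom ?T0 bimod_I e" "gfhom bimod_I ?T0 e'"
    "\<And>z. z \<in> carrier bimod_I \<Longrightarrow> e (e' z) = z" "\<And>z. z \<in> carrier ?T0 \<Longrightarrow> e' (e z) = z"
    using unit_I by blast
  define C where "C = tens_map bimod_I bimod_I (\<lambda>n. n) chi_minus"
  \<comment> \<open>The Koszul sign of the odd left degree 1.\<close>
  define D1 where "D1 = (\<lambda>x. \<ominus>\<^bsub>?T0\<^esub> C x)"
  define A where "A = tens_map gray_blob black_blob chi_plus (\<lambda>n. n)"
  define D2 where "D2 = tens_map gray_blob bimod_I chi_plus (\<lambda>n. n)"
  define \<Xi> where "\<Xi> = tens_map gray_blob bimod_I (\<lambda>n. n) chi_minus"
  have hom: "gfhom ?T2 ?T0 C" "gfhom ?T2 (?sh ?L) A" "gfhom ?T0 (?sh ?M) D2" "gfhom ?L ?M \<Xi>"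
    unfolding C_def A_def D2_def \<Xi>_def
    by (rule tens_chi(4)[OF I], rule tens_chi(1)[OF B], rule tens_chi(1)[OF I], rule tens_chi(4)[OF G])
  have val: "C (?p2 p q) = ?p0 p q" "A (?p2 p q) = ?pL ((y_minus + x_minus) * p) q"
    "D2 (?p0 p q) = ?pM ((y_minus + x_minus) * p) q" "\<Xi> (?pL p q) = ?pM p q" for p q
    unfolding C_def A_def D2_def \<Xi>_def
    by (simp_all only: tens_chi(5)[OF B cls_carrier(2)] tens_chi(5)[OF I cls_carrier(1)]
        tens_chi(8)[OF I cls_carrier(1)] tens_chi(8)[OF G cls_carrier(3)])
  have D1: "gfhom ?T2 ?T0 D1" unfolding D1_def by (rule gfhom_minus[OF gm(1,2) hom(1)])
  have \<Xi>: "gfhom (?sh ?L) (?sh ?M) \<Xi>" and j': "gfhom (?sh ?M) (?sh ?L) j" and r': "gfhom (?sh ?L) ?T2 r"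
    using hom(4) j(1) r(1) by (simp_all add: gfhom_shift(2)) (simp add: gfhom_shift(1))
  \<comment> \<open>The coefficients of \<epsilon> in 1, \<epsilon> and y_- + \<epsilon>.\<close>
  have rv: "r (?pL 1 1) = \<zero>\<^bsub>?T2\<^esub>" "r (?pL x_minus 1) = ?p2 1 1" "r (?pL (y_minus + x_minus) 1) = ?p2 1 1"
    by (simp_all add: r(2) trace_def f2(4,5))
  note genI = tens_generator_I[where F = "step_fil ideal_I 0" and G = "step_fil ideal_M (y_minus - x_minus)", OF iI MI iM MM, unfolded fold]
    and genM = tens_generator_I[where F = "step_fil ideal_M (y_minus + x_minus)" and G = "step_fil ideal_I 0", OF iM MM iI MI, unfolded fold]
    and genL = tens_generators[where F = "step_fil ideal_M (y_minus + x_minus)" and G = "step_fil ideal_M (y_minus - x_minus)", OF iM MM iM MM, unfolded fold]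
  have rA: "r (A x) = x" if "x \<in> carrier ?T2" for x
    by (rule genI[OF _ T2.abelian_group_axioms gfhom_comp[OF hom(2) r'] gfhom_id _ that]) (simp_all add: val rv)
  have Xj: "\<Xi> (j x) = x" if "x \<in> carrier ?M" for x
    by (rule genM[OF _ gfmodule_abelian_group[OF gm(4)] gfhom_comp[OF j(1) hom(4)] gfhom_id _ that])
      (simp_all add: val j(2) subst_simps fL(4))
  have rj: "r (j x) = \<zero>\<^bsub>?T2\<^esub>" if "x \<in> carrier ?M" for x
  proof -
    let ?H = "s_mod 2 (q_mod 2 ?T2)"
    have H: "gfmodule ?H" by (intro gfmodule_s_mod gfmodule_q_mod gm)
    have "r (j x) = \<zero>\<^bsub>?H\<^esub>"
      by (rule genM[OF _ gfmodule_abelian_group[OF H] gfhom_comp[OF j(1) r(1)] gfhom_zero[OF gm(4) H] _ that])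
        (simp_all add: j(2) subst_simps fL(4) rv)
    then show ?thesis by simp
  qed
  have key: "A (r u) \<oplus>\<^bsub>?L\<^esub> j (\<Xi> u) \<oplus>\<^bsub>?L\<^esub> j (D2 (D1 (r u))) = u" if "u \<in> carrier ?L" for u
  proof -
    have 1: "gfhom (?sh ?L) (?sh ?L) (\<lambda>u. A (r u) \<oplus>\<^bsub>?sh ?L\<^esub> j (\<Xi> u) \<oplus>\<^bsub>?sh ?L\<^esub> j (D2 (D1 (r u))))"
      by (rule gfhom_add[OF gm(5,5) gfhom_add[OF gm(5,5) gfhom_comp[OF r' hom(2)] gfhom_comp[OF \<Xi> j']]
            gfhom_comp[OF gfhom_comp[OF gfhom_comp[OF r' D1] hom(3)] j']])
    have z: "A \<zero>\<^bsub>?T2\<^esub> = \<zero>\<^bsub>?L\<^esub>" "D1 \<zero>\<^bsub>?T2\<^esub> = \<zero>\<^bsub>?T0\<^esub>" "D2 \<zero>\<^bsub>?T0\<^esub> = \<zero>\<^bsub>?M\<^esub>" "j \<zero>\<^bsub>?M\<^esub> = \<zero>\<^bsub>?L\<^esub>"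
      using gfhomD0(1)[OF gm(1,5) hom(2)] gfhomD0(1)[OF gm(1,2) D1] gfhomD0(1)[OF gm(2,6) hom(3)] gfhomD0(1)[OF gm(4,3) j(1)]
      by simp_all
    have p0C: "?p0 1 1 \<in> carrier ?T0" by (rule ptens_closed[OF gfmodule_module[OF I] gfmodule_module[OF I] cls_carrier(1,1)])
    have pMC: "?pM p q \<in> carrier ?M" for p q by (rule ptens_closed[OF gfmodule_module[OF G] gfmodule_module[OF I] cls_carrier(3,1)])
    have sM: "\<ominus>\<^bsub>?sh ?M\<^esub> x = \<ominus>\<^bsub>?M\<^esub> x" for x by (simp add: a_inv_def s_mod_def q_mod_def)
    \<comment> \<open>The sign comes from \<open>D1\<close>, and the factor y_- + x_- from \<chi>_+
      after the middle variable of G \<otimes> I has become outer.\<close>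
    have jd: "j (D2 (D1 (?p2 1 1))) = \<ominus>\<^bsub>?L\<^esub> ((y_minus + x_minus) \<odot>\<^bsub>?L\<^esub> ?pL 1 1)"
      using gfhomD0(2)[OF gm(2,6) hom(3) p0C] gfhomD0(2)[OF gm(4,3) j(1) pMC, of "y_minus + x_minus" 1]
      by (simp add: D1_def val sM j(2) subst_simps)
    have w: "?pL x_minus 1 = ?pL 1 y_minus"
      using tens_xy_actions(6)[OF iM MM iM MM, of "step_fil ideal_M (y_minus + x_minus)" "step_fil ideal_M (y_minus - x_minus)" 1 1, unfolded fold]
      by simp
    have dxy: "?pL 1 (y_minus - x_minus) = ?pL 1 y_minus \<ominus>\<^bsub>?L\<^esub> x_minus \<odot>\<^bsub>?L\<^esub> ?pL 1 1"
      using pt_diff(2)[OF hideal_M MM hM hideal_M MM hB, of 1 y_minus x_minus, unfolded fold]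
        tens_xy_actions(4)[OF iM MM iM MM, of "step_fil ideal_M (y_minus + x_minus)" "step_fil ideal_M (y_minus - x_minus)" 1 1, unfolded fold]
      by simp
    show ?thesis
    proof (rule genL[OF L.abelian_group_axioms 1[unfolded gfhom_shift(2), simplified] gfhom_id _ _ that])
      show "A (r (?pL 1 1)) \<oplus>\<^bsub>?L\<^esub> j (\<Xi> (?pL 1 1)) \<oplus>\<^bsub>?L\<^esub> j (D2 (D1 (r (?pL 1 1)))) = ?pL 1 1"
        using actL(1)[of 1 1] by (simp add: rv z val j(2) subst_simps fL(4))
      \<comment> \<open>On \<epsilon> (1 \<otimes> 1) the three terms are y_- + \<epsilon>, x_- and
        -(y_- + x_-), with sum \<epsilon>.\<close>
      show "A (r (?pL x_minus 1)) \<oplus>\<^bsub>?L\<^esub> j (\<Xi> (?pL x_minus 1)) \<oplus>\<^bsub>?L\<^esub> j (D2 (D1 (r (?pL x_minus 1)))) = ?pL x_minus 1"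
        unfolding rv val jd j(2) xyL(2) dxy unfolding w using actL(1) fL(1) by (simp add: subst_simps L.group_simps)
    qed
  qed
  \<comment> \<open>A summand can be nonzero only if both factors sit in one of their two positions;
    the four combinations are those listed.\<close>
  have triv: "carrier (?S t a i) = {\<zero>\<^bsub>?S t a i\<^esub>}"
    if "(t, a, i) \<notin> {(2, 1, (1, 1)), (0, 0, (1, 1)), (0, 0, (-1, 0)), (-2, -1, (-1, 0))}" for t a i
  proof -
    obtain k b where i: "i = (k, b)" by (cases i)
    have "(k, b) \<notin> {(1, 1), (-1, 0)} \<or> (t - k, a - b) \<notin> {(1, 0), (-1, -1)}" using that by (auto simp: i)
    then show ?thesis unfolding i bcx_summand_simp[OF pn]
      by (intro tens_trivial[OF bcomplexD(1)[OF pn(1)] bcomplexD(1)[OF pn(2)]]) (metis carrier_sigma_trivial)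
  qed
  have cS: "countable (carrier (?S t a i))" for t a i
    by (cases i) (simp add: bcx_summand_simp[OF pn] countable_tens gfmodule_module bcomplexD(1)[OF pn(1)] bcomplexD(1)[OF pn(2)] countable_sigma)
  note bd = bcx_comp_bdif_single[OF pn] and dlr = dl_def[OF pn] dr_def[OF pn]
  show ?thesis
  proof (rule four_term_equivalence[where ?k2.0 = "(1, 1)" and ?k0.0 = "(1, 1)" and ?l0.0 = "(-1, 0)" and ?m2.0 = "(-1, 0)"
          and S = ?S and ?D1.0 = D1 and A = A and ?D2.0 = D2 and \<Xi> = \<Xi> and r = r and j = j and e = e and e' = e',
        unfolded S, OF assms bcomplex_comp[OF pn] bcx_comp_bterm[OF pn] gfmodule_bcx_summand[OF pn] cS I _ triv])
    show "countable (carrier bimod_I)" using countable_quot_gf[OF iI] by (simp add: bimod_I_def)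
    \<comment> \<open>Into (1, 1) the source (3, 2) is zero, which leaves \<open>dr\<close> with the
      sign of odd b; into (-1, 0) the source (-1, 0) is zero, which leaves
      \<open>dl\<close>.\<close>
    show "bdif (sigma_pos \<circ>\<^sub>b sigma_neg) 2 1 c (1, 1) = D1 (c (1, 1))" "bdif (sigma_pos \<circ>\<^sub>b sigma_neg) 2 1 c (-1, 0) = A (c (1, 1))"
      if "c \<in> carrier (bterm (sigma_pos \<circ>\<^sub>b sigma_neg) 2 1)" for c
      using bd(2)[OF that, of 1 1] bd(1)[OF that, of "-1" 0] triv[of 2 1 "(3, 2)"] triv[of 2 1 "(-1, 0)"]
      by (simp_all add: S D1_def C_def A_def dlr bdif_sigma bterm_sigma tens_map_shift)
    \<comment> \<open>Here both sources contribute: \<open>dl\<close> gives \<open>D2\<close>, and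
      \<open>dr\<close> gives \<Xi> without a sign, because b = 0.\<close>
    show "bdif (sigma_pos \<circ>\<^sub>b sigma_neg) 0 0 c (-1, 0) = D2 (c (1, 1)) \<oplus>\<^bsub>?sh ?M\<^esub> \<Xi> (c (-1, 0))"
      if "c \<in> carrier (bterm (sigma_pos \<circ>\<^sub>b sigma_neg) 0 0)" for c
      using bcx_comp_bdif[OF pn, of 0 0 c "-1" 0]
      by (simp add: S D2_def \<Xi>_def dlr bdif_sigma bterm_sigma tens_map_shift)
  qed (use D1 hom \<Xi> r' j' e rA Xj rj key in \<open>simp_all\<close>)
qed

text \<open>The mirror image B \<otimes> I -> (I \<otimes> I) \<oplus> (B \<otimes> G) -> I
  \<otimes> G. The left degrees are now (1, 0) for B and (-1, -1) for I, so the odd sign moves to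
  the arrow out of I \<otimes> I.\<close>

lemma sigma_neg_pos:
  assumes "infinite (UNIV :: 'u set)"
  shows "Ch_equiv (to_Ch TYPE('u) (sigma_neg \<circ>\<^sub>b sigma_pos)) (to_Ch TYPE('u) (single_bcx bimod_I))"
proof -
  let ?S = "bcx_summand sigma_neg sigma_pos"
  let ?T2 = "tens black_blob bimod_I" and ?T0 = "tens bimod_I bimod_I"
    and ?L = "tens black_blob gray_blob" and ?M = "tens bimod_I gray_blob"
  let ?sh = "\<lambda>W. s_mod (-2) (q_mod (-2) W)"
  let ?p2 = "\<lambda>p q. ptens black_blob bimod_I (cls ideal_M p) (cls ideal_I q)"
    and ?p0 = "\<lambda>p q. ptens bimod_I bimod_I (cls ideal_I p) (cls ideal_I q)"
    and ?pL = "\<lambda>p q. ptens black_blob gray_blob (cls ideal_M p) (cls ideal_M q)"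
    and ?pM = "\<lambda>p q. ptens bimod_I gray_blob (cls ideal_I p) (cls ideal_M q)"
  note pn = bcomplex_sigma(2,1)
  note iI = hidealD(1)[OF hideal_I] and iM = hidealD(1)[OF hideal_M] and MI = ideal_generators(4)
  note MM = subset_refl[of ideal_M]
  note hM = homog_xy_minus(2) and hB = homog_xy_minus(3)
  note I = gfmodule_two_strand(1) and B = gfmodule_two_strand(2) and G = gfmodule_two_strand(3)
  note fold = bimod_I_def[symmetric] black_blob_def[symmetric] gray_blob_def[symmetric]
  have gm: "gfmodule ?T2" "gfmodule ?T0" "gfmodule ?L" "gfmodule ?M" "gfmodule (?sh ?L)" "gfmodule (?sh ?M)"
    by (simp_all add: gfmodule_tens I B G gfmodule_s_mod gfmodule_q_mod)
  interpret T2: module PR ?T2 by (rule gfmodule_module[OF gm(1)])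
  interpret L: module PR ?L by (rule gfmodule_module[OF gm(3)])
  have S: "?S 2 1 (1, 0) = ?T2" "?S 0 0 (-1, -1) = ?T0" "?S 0 0 (1, 0) = ?sh ?L" "?S (-2) (-1) (-1, -1) = ?sh ?M"
    by (simp_all add: bcx_summand_def bterm_sigma tens_shift shift_shift)
  note act2 = tens_cyclic_actions[OF iM iI, where F = "step_fil ideal_M (y_minus - x_minus)" and G = "step_fil ideal_I 0", unfolded fold]
    and actL = tens_cyclic_actions[OF iM iM, where F = "step_fil ideal_M (y_minus - x_minus)" and G = "step_fil ideal_M (y_minus + x_minus)", unfolded fold]
  note degL = pt_degrees[OF hideal_M MM hB hideal_M MM hM, unfolded fold]
    and deg2 = pt_degrees[OF hideal_M MM hB hideal_I MI homog_0, unfolded fold]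
  note xyL = xy_minus_pt[OF hideal_M MM hB hideal_M MM hM, unfolded fold]
    and xy2 = xy_minus_pt[OF hideal_M MM hB hideal_I MI homog_0, unfolded fold]
  note fL = module_smult_facts[OF L.module_axioms actL(1)] and f2 = module_smult_facts[OF T2.module_axioms act2(1)]
  \<comment> \<open>Now the right factor is I, so the right part of y_- - x_- vanishes and the left
    one is the generator of F^1 of B.\<close>
  have "(y_minus - x_minus) \<odot>\<^bsub>?T2\<^esub> ?p2 1 1 \<in> fil ?T2 2"
    unfolding xy2(1) using deg2(5)[of 1 "y_minus - x_minus"] deg2(3)[of 1 1] ideal_generators(5) act2(1) by simp
  from trace_map[OF hideal_M MM hB hideal_I MI homog_0, of "y_minus - x_minus" "y_minus + x_minus", unfolded fold, OF _ this]
  obtain r where r: "gfhom ?L (s_mod 2 (q_mod 2 ?T2)) r" "\<And>p q. r (?pL p q) = trace p q \<odot>\<^bsub>?T2\<^esub> ?p2 1 1" by blast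
  have yL: "(y_minus + x_minus) \<odot>\<^bsub>?L\<^esub> ?pL 1 1 \<in> fil ?L 2"
    unfolding xyL(3) using gf_fil_closed(2)[OF gm(3) degL(3)[of 1 1] degL(4)[of 1 1]] by simp
  \<comment> \<open>Here I is the left factor, and its entry is rewritten in the outer
    y-variables.\<close>
  obtain j where j: "gfhom ?M ?L j" "\<And>p q. j (?pM p q) = (subst_y p * q) \<odot>\<^bsub>?L\<^esub> ?pL 1 1"
  proof (rule gfhom_tens_cyclic[OF hideal_I homog_0 hideal_M hM gm(3), of "?pL 1 1" 0 "\<lambda>p q. subst_y p * q", unfolded fold])
    show "homog (i + j - 0) (subst_y p * q)" if "homog i p" "homog j q" for i j p q
      using homog_mult[OF subst_homog(2)[OF that(1)] that(2)] by simp
    show "(subst_y p * q) \<odot>\<^bsub>?L\<^esub> ?pL 1 1 = \<zero>\<^bsub>?L\<^esub>" if "p \<in> ideal_I \<or> q \<in> ideal_M" for p q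
    proof -
      have "subst_y p * q \<in> ideal_M" using that subst_ideal_I(2) ideal_PR(1,3)[OF iM] by auto
      from ideal_M_annihilates[where F = "step_fil ideal_M (y_minus - x_minus)" and G = "step_fil ideal_M (y_minus + x_minus)", OF iM MM iM MM this]
      show ?thesis unfolding fold .
    qed
    show "(subst_y p * ((y_minus + x_minus) * q)) \<odot>\<^bsub>?L\<^esub> ?pL 1 1 \<in> fil ?L 2" for p q
      using gf_fil_closed(5)[OF gm(3) yL, of "subst_y p * q"] fL(3)[of "subst_y p * q" "y_minus + x_minus" 1 1]
      by (simp only: mult_ac)
  qed (use degL gf_fil_closed(1)[OF gm(3)] in \<open>auto simp: subst_simps algebra_simps fL(5)\<close>)
  obtain e e' where e: "gfhom ?T0 bimod_I e" "gfhom bimod_I ?T0 e'"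
    "\<And>z. z \<in> carrier bimod_I \<Longrightarrow> e (e' z) = z" "\<And>z. z \<in> carrier ?T0 \<Longrightarrow> e' (e z) = z"
    using unit_I by blast
  define C where "C = tens_map bimod_I bimod_I chi_minus (\<lambda>n. n)"
  define A where "A = tens_map black_blob gray_blob (\<lambda>n. n) chi_plus"
  define E where "E = tens_map bimod_I gray_blob (\<lambda>n. n) chi_plus"
  \<comment> \<open>The Koszul sign of the odd left degree -1.\<close>
  define D2 where "D2 = (\<lambda>x. \<ominus>\<^bsub>?sh ?M\<^esub> E x)"
  define \<Xi> where "\<Xi> = tens_map bimod_I gray_blob chi_minus (\<lambda>n. n)"
  have hom: "gfhom ?T2 ?T0 C" "gfhom ?T2 (?sh ?L) A" "gfhom ?T0 (?sh ?M) E" "gfhom ?L ?M \<Xi>"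
    unfolding C_def A_def E_def \<Xi>_def
    by (rule tens_chi(3)[OF I], rule tens_chi(2)[OF B], rule tens_chi(2)[OF I], rule tens_chi(3)[OF G])
  have val: "C (?p2 p q) = ?p0 p q" "A (?p2 p q) = ?pL p ((y_minus + x_minus) * q)"
    "E (?p0 p q) = ?pM p ((y_minus + x_minus) * q)" "\<Xi> (?pL p q) = ?pM p q" for p q
    unfolding C_def A_def E_def \<Xi>_def
    by (simp_all only: tens_chi(6)[OF B cls_carrier(2)] tens_chi(6)[OF I cls_carrier(1)]
        tens_chi(7)[OF I cls_carrier(1)] tens_chi(7)[OF G cls_carrier(3)])
  have D2: "gfhom ?T0 (?sh ?M) D2" unfolding D2_def by (rule gfhom_minus[OF gm(2,6) hom(3)])
  have \<Xi>: "gfhom (?sh ?L) (?sh ?M) \<Xi>" and j': "gfhom (?sh ?M) (?sh ?L) j" and r': "gfhom (?sh ?L) ?T2 r"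
    using hom(4) j(1) r(1) by (simp_all add: gfhom_shift(2)) (simp add: gfhom_shift(1))
  have rv: "r (?pL 1 1) = \<zero>\<^bsub>?T2\<^esub>" "r (?pL x_minus 1) = ?p2 1 1" "r (?pL 1 (y_minus + x_minus)) = ?p2 1 1"
    by (simp_all add: r(2) trace_def f2(4,5))
  note genI = tens_generator_I[where F = "step_fil ideal_M (y_minus - x_minus)" and G = "step_fil ideal_I 0", OF iM MM iI MI, unfolded fold]
    and genM = tens_generator_I[where F = "step_fil ideal_I 0" and G = "step_fil ideal_M (y_minus + x_minus)", OF iI MI iM MM, unfolded fold]
    and genL = tens_generators[where F = "step_fil ideal_M (y_minus - x_minus)" and G = "step_fil ideal_M (y_minus + x_minus)", OF iM MM iM MM, unfolded fold]
  have rA: "r (A x) = x" if "x \<in> carrier ?T2" for x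
    by (rule genI[OF _ T2.abelian_group_axioms gfhom_comp[OF hom(2) r'] gfhom_id _ that]) (simp_all add: val rv)
  have Xj: "\<Xi> (j x) = x" if "x \<in> carrier ?M" for x
    by (rule genM[OF _ gfmodule_abelian_group[OF gm(4)] gfhom_comp[OF j(1) hom(4)] gfhom_id _ that])
      (simp_all add: val j(2) subst_simps fL(4))
  have rj: "r (j x) = \<zero>\<^bsub>?T2\<^esub>" if "x \<in> carrier ?M" for x
  proof -
    let ?H = "s_mod 2 (q_mod 2 ?T2)"
    have H: "gfmodule ?H" by (intro gfmodule_s_mod gfmodule_q_mod gm)
    have "r (j x) = \<zero>\<^bsub>?H\<^esub>"
      by (rule genM[OF _ gfmodule_abelian_group[OF H] gfhom_comp[OF j(1) r(1)] gfhom_zero[OF gm(4) H] _ that])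
        (simp_all add: j(2) subst_simps fL(4) rv)
    then show ?thesis by simp
  qed
  have key: "A (r u) \<oplus>\<^bsub>?L\<^esub> j (\<Xi> u) \<oplus>\<^bsub>?L\<^esub> j (D2 (C (r u))) = u" if "u \<in> carrier ?L" for u
  proof -
    have 1: "gfhom (?sh ?L) (?sh ?L) (\<lambda>u. A (r u) \<oplus>\<^bsub>?sh ?L\<^esub> j (\<Xi> u) \<oplus>\<^bsub>?sh ?L\<^esub> j (D2 (C (r u))))"
      by (rule gfhom_add[OF gm(5,5) gfhom_add[OF gm(5,5) gfhom_comp[OF r' hom(2)] gfhom_comp[OF \<Xi> j']]
            gfhom_comp[OF gfhom_comp[OF gfhom_comp[OF r' hom(1)] D2] j']])
    have z: "A \<zero>\<^bsub>?T2\<^esub> = \<zero>\<^bsub>?L\<^esub>" "C \<zero>\<^bsub>?T2\<^esub> = \<zero>\<^bsub>?T0\<^esub>" "D2 \<zero>\<^bsub>?T0\<^esub> = \<zero>\<^bsub>?M\<^esub>" "j \<zero>\<^bsub>?M\<^esub> = \<zero>\<^bsub>?L\<^esub>"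
      using gfhomD0(1)[OF gm(1,5) hom(2)] gfhomD0(1)[OF gm(1,2) hom(1)] gfhomD0(1)[OF gm(2,6) D2] gfhomD0(1)[OF gm(4,3) j(1)]
      by simp_all
    have pMC: "?pM p q \<in> carrier ?M" for p q by (rule ptens_closed[OF gfmodule_module[OF I] gfmodule_module[OF G] cls_carrier(1,3)])
    have sM: "\<ominus>\<^bsub>?sh ?M\<^esub> x = \<ominus>\<^bsub>?M\<^esub> x" for x by (simp add: a_inv_def s_mod_def q_mod_def)
    have jd: "j (D2 (C (?p2 1 1))) = \<ominus>\<^bsub>?L\<^esub> ((y_minus + x_minus) \<odot>\<^bsub>?L\<^esub> ?pL 1 1)"
      using gfhomD0(2)[OF gm(4,3) j(1) pMC, of 1 "y_minus + x_minus"] by (simp add: D2_def val sM j(2) subst_simps)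
    have dxy: "?pL (y_minus - x_minus) 1 = y_minus \<odot>\<^bsub>?L\<^esub> ?pL 1 1 \<ominus>\<^bsub>?L\<^esub> ?pL x_minus 1"
      using pt_diff(1)[OF hideal_M MM hB hideal_M MM hM, of y_minus x_minus 1, unfolded fold]
        tens_xy_actions(3)[OF iM MM iM MM, of "step_fil ideal_M (y_minus - x_minus)" "step_fil ideal_M (y_minus + x_minus)" 1 1, unfolded fold]
      by simp
    have sx: "subst_y x_minus * 1 = y_minus"
      by (simp add: x_minus_def y_minus_def subst_simps(4) subst_y_def mpoly_subst_meval
          meval_diff[OF rat_algebra_single] meval_mvar[OF rat_algebra_single])
    show ?thesis
    proof (rule genL[OF L.abelian_group_axioms 1[unfolded gfhom_shift(2), simplified] gfhom_id _ _ that])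
      show "A (r (?pL 1 1)) \<oplus>\<^bsub>?L\<^esub> j (\<Xi> (?pL 1 1)) \<oplus>\<^bsub>?L\<^esub> j (D2 (C (r (?pL 1 1)))) = ?pL 1 1"
        using actL(1)[of 1 1] by (simp add: rv z val j(2) subst_simps fL(4))
      \<comment> \<open>The terms are \<epsilon> + x_-, y_- and -(y_- + x_-); the y_- arises because
        \<epsilon> acts on the left factor I of I \<otimes> G as y_-.\<close>
      show "A (r (?pL x_minus 1)) \<oplus>\<^bsub>?L\<^esub> j (\<Xi> (?pL x_minus 1)) \<oplus>\<^bsub>?L\<^esub> j (D2 (C (r (?pL x_minus 1)))) = ?pL x_minus 1"
        unfolding rv jd unfolding val j(2) xyL(3) dxy sx using actL(1) fL(1) by (simp add: subst_simps L.group_simps)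
    qed
  qed
  have triv: "carrier (?S t a i) = {\<zero>\<^bsub>?S t a i\<^esub>}"
    if "(t, a, i) \<notin> {(2, 1, (1, 0)), (0, 0, (-1, -1)), (0, 0, (1, 0)), (-2, -1, (-1, -1))}" for t a i
  proof -
    obtain k b where i: "i = (k, b)" by (cases i)
    have "(k, b) \<notin> {(1, 0), (-1, -1)} \<or> (t - k, a - b) \<notin> {(1, 1), (-1, 0)}" using that by (auto simp: i)
    then show ?thesis unfolding i bcx_summand_simp[OF pn]
      by (intro tens_trivial[OF bcomplexD(1)[OF pn(1)] bcomplexD(1)[OF pn(2)]]) (metis carrier_sigma_trivial)
  qed
  have cS: "countable (carrier (?S t a i))" for t a i
    by (cases i) (simp add: bcx_summand_simp[OF pn] countable_tens gfmodule_module bcomplexD(1)[OF pn(1)] bcomplexD(1)[OF pn(2)] countable_sigma)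
  note bd = bcx_comp_bdif_single[OF pn] and dlr = dl_def[OF pn] dr_def[OF pn]
  show ?thesis
  proof (rule four_term_equivalence[where ?k2.0 = "(1, 0)" and ?k0.0 = "(-1, -1)" and ?l0.0 = "(1, 0)" and ?m2.0 = "(-1, -1)"
          and S = ?S and ?D1.0 = C and A = A and ?D2.0 = D2 and \<Xi> = \<Xi> and r = r and j = j and e = e and e' = e',
        unfolded S, OF assms bcomplex_comp[OF pn] bcx_comp_bterm[OF pn] gfmodule_bcx_summand[OF pn] cS I _ triv])
    show "countable (carrier bimod_I)" using countable_quot_gf[OF iI] by (simp add: bimod_I_def)
    show "bdif (sigma_neg \<circ>\<^sub>b sigma_pos) 2 1 c (-1, -1) = C (c (1, 0))" "bdif (sigma_neg \<circ>\<^sub>b sigma_pos) 2 1 c (1, 0) = A (c (1, 0))"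
      if "c \<in> carrier (bterm (sigma_neg \<circ>\<^sub>b sigma_pos) 2 1)" for c
      using bd(1)[OF that, of "-1" "-1"] bd(2)[OF that, of 1 0] triv[of 2 1 "(3, 1)"] triv[of 2 1 "(-1, -1)"]
      by (simp_all add: S C_def A_def dlr bdif_sigma bterm_sigma tens_map_shift)
    show "bdif (sigma_neg \<circ>\<^sub>b sigma_pos) 0 0 c (-1, -1) = D2 (c (-1, -1)) \<oplus>\<^bsub>?sh ?M\<^esub> \<Xi> (c (1, 0))"
      if c: "c \<in> carrier (bterm (sigma_neg \<circ>\<^sub>b sigma_pos) 0 0)" for c
    proof -
      interpret M: abelian_group "?sh ?M" by (rule gfmodule_abelian_group[OF gm(6)])
      have "c k \<in> carrier (?S 0 0 k)" for k using c unfolding bcx_comp_bterm[OF pn] gf_dsum_simps(1) by blast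
      from this[of "(-1, -1)"] this[of "(1, 0)"] have k: "c (-1, -1) \<in> carrier ?T0" "c (1, 0) \<in> carrier (?sh ?L)"
        unfolding S .
      \<comment> \<open>The left differential contributes \<Xi> and comes first, so the summands are
        exchanged to fit the elimination lemma.\<close>
      have "bdif (sigma_neg \<circ>\<^sub>b sigma_pos) 0 0 c (-1, -1) = \<Xi> (c (1, 0)) \<oplus>\<^bsub>?sh ?M\<^esub> D2 (c (-1, -1))"
        using bcx_comp_bdif[OF pn, of 0 0 c "-1" "-1"]
        by (simp add: S D2_def E_def \<Xi>_def dlr bdif_sigma bterm_sigma tens_map_shift)
      then show ?thesis using M.a_comm[OF gfhomD(1)[OF \<Xi> k(2)] gfhomD(1)[OF D2 k(1)]] by simp
    qed
  qed (use D2 hom \<Xi> r' j' e rA Xj rj key in \<open>simp_all\<close>)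
qed

theorem theorem4p1:
  assumes "infinite (UNIV :: 'u set)"
  shows "Ch_equiv (to_Ch TYPE('u) (sigma_pos \<circ>\<^sub>b sigma_neg)) (to_Ch TYPE('u) (single_bcx bimod_I)) \<and>
         Ch_equiv (to_Ch TYPE('u) (sigma_neg \<circ>\<^sub>b sigma_pos)) (to_Ch TYPE('u) (single_bcx bimod_I))"
  using sigma_pos_neg[OF assms] sigma_neg_pos[OF assms] by blast

end
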